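(* Let $H$ be a cocommutative weak Hopf algebra in $\mathcal C$ and let $(A,\rho_A)$ be a right $H$-comodule algebra with subalgebra of coinvariants $A_H$. Then there exists a bijective correspondence between the equivalence classes of $H$-cleft extensions $A_H\hookrightarrow B$ and the equivalence classes of crossed systems for $H$ over $A_H$.
   Context: Setting. $\mathcal C$ is a strict symmetric monoidal category with tensor product $\otimes$, unit object $K$, symmetry $c$, and with equalizers (hence idempotents split). In tensor products, identities are denoted by their objects ($P\otimes f=id_P\otimes f$). Algebras $(A,\eta_A,\mu_A)$ and coalgebras $(D,\varepsilon_D,\delta_D)$ are (co)associative and (co)unital; $D$ is cocommutative if $c_{D,D}\circ\delta_D=\delta_D$. $\mu_{A\otimes B}=(\mu_A\otimes\mu_B)\circ(A\otimes c_{B,A}\otimes B)$, $\delta_{D\otimes E}=(D\otimes c_{D,E}\otimes E)\circ(\delta_D\otimes\delta_E)$, $\varepsilon_{D\otimes E}=\varepsilon_D\otimes\varepsilon_E$. For a coalgebra $B$, an algebra $A$ and $\alpha,\beta:B\to A$, the convolution product is $\alpha\wedge\beta=\mu_A\circ(\alpha\otimes\beta)\circ\delta_B$. Weak Hopf algebra. An object $H$ with an algebra and a coalgebra structure such that: $\delta_H\circ\mu_H=(\mu_H\otimes\mu_H)\circ\delta_{H\otimes H}$; $\varepsilon_H\circ\mu_H\circ(\mu_H\otimes H)=(\varepsilon_H\otimes\varepsilon_H)\circ(\mu_H\otimes\mu_H)\circ(H\otimes\delta_H\otimes H)=(\varepsilon_H\otimes\varepsilon_H)\circ(\mu_H\otimes\mu_H)\circ(H\otimes(c_{H,H}\circ\delta_H)\otimes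 H)$; $(\delta_H\otimes H)\circ\delta_H\circ\eta_H=(H\otimes\mu_H\otimes H)\circ(\delta_H\otimes\delta_H)\circ(\eta_H\otimes\eta_H)=(H\otimes(\mu_H\circ c_{H,H})\otimes H)\circ(\delta_H\otimes\delta_H)\circ(\eta_H\otimes\eta_H)$; and there is an antipode $\lambda_H:H\to H$ with $id_H\wedge\lambda_H=\Pi_H^L$, $\lambda_H\wedge id_H=\Pi_H^R$, $\lambda_H\wedge id_H\wedge\lambda_H=\lambda_H$, where $\Pi_H^L=((\varepsilon_H\circ\mu_H)\otimes H)\circ(H\otimes c_{H,H})\circ((\delta_H\circ\eta_H)\otimes H)$ and $\Pi_H^R=(H\otimes(\varepsilon_H\circ\mu_H))\circ(c_{H,H}\otimes H)\circ(H\otimes(\delta_H\circ\eta_H))$. Comodule algebras. A right $H$-comodule algebra is an algebra $A$ with a right $H$-comodule structure $\rho_A:A\to A\otimes H$ such that $\rho_A\circ\mu_A=\mu_{A\otimes H}\circ(\rho_A\otimes\rho_A)$ and $(A\otimes\Pi_H^L)\circ\rho_A\circ\eta_A=\rho_A\circ\eta_A$. Its subalgebra of coinvariants $i_A:A_H\to A$ is the equalizer of $\rho_A$ and $\zeta_A=(A\otimes\Pi_H^L)\circ\rho_A$, with the algebra structure making $i_A$ an algebra morphism. Put $e_A=(A\otimes(\varepsilon_H\circ\mu_H))\circ(c_{H,A}\otimes H)\circ(H\otimes(\rho_A\circ\eta_A)):H\to A$. Cleft extensions. An integral is a morphism of right $H$-comodules $f:H\to A$ ($H$ with coaction $\delta_H$).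 It is convolution invertible if there is $f^{-1}:H\to A$ with $f^{-1}\wedge f=e_A$, $f\wedge f^{-1}=(A\otimes(\varepsilon_H\circ\mu_H))\circ((\rho_A\circ\eta_A)\otimes H)$, $f^{-1}\wedge f\wedge f^{-1}=f^{-1}$. $A_H\hookrightarrow A$ is an $H$-cleft extension if there is a convolution invertible integral $f:H\to A$ such that $f\wedge f^{-1}$ factorizes through $i_A$. An $H$-cleft extension $A_H\hookrightarrow B$ is a right $H$-comodule algebra $B$ with $B_H=A_H$ (i.e. with an algebra morphism $i_B:A_H\to B$ that is an equalizer of $\rho_B$ and $\zeta_B$) which is $H$-cleft in this sense. $A_H\hookrightarrow B$ and $A_H\hookrightarrow B'$ are equivalent if there is a morphism $T:B\to B'$ of algebras and of right $H$-comodules with $T\circ i_B=i_{B'}$. Crossed systems. A weak left $H$-module algebra is an algebra $D$ with $\varphi_D:H\otimes D\to D$ such that $\varphi_D\circ(\eta_H\otimes D)=id_D$; $\varphi_D\circ(H\otimes\mu_D)=\mu_D\circ(\varphi_D\otimes\varphi_D)\circ(H\otimes c_{H,D}\otimes D)\circ(\delta_H\otimes D\otimes D)$; $\varphi_D\circ(\mu_H\otimes\eta_D)=\varphi_D\circ(H\otimes(\varphi_D\circ(H\otimes\eta_D)))$; $\varphi_D\circ(\Pi_H^L\otimes\eta_D)=\varphi_D\circ(H\otimes\eta_D)$. Put $u_1=\varphi_D\circ(H\otimes\eta_D)$, $u_2=\varphi_D\circ(H\otimes u_1)$. For $n=1,2$, $Reg_{\varphi_D}(H^{\otimes n},D)$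 is the set of $\sigma:H^{\otimes n}\to D$ for which there is $\sigma^{-1}:H^{\otimes n}\to D$ with $\sigma\wedge\sigma^{-1}=\sigma^{-1}\wedge\sigma=u_n$, $\sigma\wedge\sigma^{-1}\wedge\sigma=\sigma$, $\sigma^{-1}\wedge\sigma\wedge\sigma^{-1}=\sigma^{-1}$. Let $\Omega_H^L=((\varepsilon_H\circ\mu_H)\otimes H\otimes H)\circ\delta_{H\otimes H}$. A crossed system for $H$ over $D$ is a pair $(\varphi_D,\sigma)$ with $(D,\varphi_D)$ a weak left $H$-module algebra and $\sigma\in Reg_{\varphi_D}(H\otimes H,D)$ such that (g1) $\mu_D\circ(D\otimes\varphi_D)\circ(\sigma\otimes\mu_H\otimes D)\circ(\delta_{H\otimes H}\otimes D)=\mu_D\circ((\varphi_D\circ(H\otimes\varphi_D))\otimes D)\circ(H\otimes H\otimes c_{D,D})\circ(H\otimes H\otimes\sigma\otimes D)\circ(\delta_{H\otimes H}\otimes D)$; (g2) $(\varphi_D\circ(H\otimes\sigma)\circ(\Omega_H^L\otimes H))\wedge(\sigma\circ(H\otimes\mu_H))=((\sigma\otimes\varepsilon_H)\circ(H\otimes\Omega_H^L))\wedge(\sigma\circ(\mu_H\otimes H))$; (g3) $\sigma\circ(H\otimes\eta_H)=\sigma\circ(\eta_H\otimes H)=u_1$. Crossed systems $(\varphi_D,\sigma)$ and $(\phi_D,\tau)$ are equivalent if $\varphi_D\circ(H\otimes\eta_D)=\phi_D\circ(H\otimes\eta_D)$ and there is $h\in Reg_{\varphi_D}(H,D)\cap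 Reg_{\phi_D}(H,D)$ with $h\circ\eta_H=\eta_D$, $\varphi_D=\mu_D\circ(\mu_D\otimes D)\circ(h\otimes\phi_D\otimes h^{-1})\circ(\delta_H\otimes c_{H,D})\circ(\delta_H\otimes D)$ and $\sigma=\mu_D\circ(\mu_D\otimes h^{-1})\circ(\mu_D\otimes\tau\otimes\mu_H)\circ(h\otimes\phi_D\otimes\delta_{H\otimes H})\circ(\delta_H\otimes h\otimes H\otimes H)\circ\delta_{H\otimes H}$. *)

theory Defs
  imports Main
begin

section \<open>Strict symmetric monoidal categories with equalizers\<close>

record ('o, 'm) monoidal_data =
  Ob :: "'o set"
  Ar :: "'m set"
  source :: "'m \<Rightarrow> 'o"
  target :: "'m \<Rightarrow> 'o"
  ident :: "'o \<Rightarrow> 'm" ("\<langle>_\<rangle>\<index>")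
  compose :: "'m \<Rightarrow> 'm \<Rightarrow> 'm" (infixl "\<cdot>\<index>" 65)
  tensor_ob :: "'o \<Rightarrow> 'o \<Rightarrow> 'o" (infixr "\<odot>\<index>" 70)
  tensor :: "'m \<Rightarrow> 'm \<Rightarrow> 'm" (infixr "\<otimes>\<index>" 70)
  unit_ob :: 'o ("\<one>\<index>")
  symmetry :: "'o \<Rightarrow> 'o \<Rightarrow> 'm" ("\<gamma>\<index>")

definition Hom :: "('o, 'm) monoidal_data \<Rightarrow> 'o \<Rightarrow> 'o \<Rightarrow> 'm set"
  where "Hom C a b = {f \<in> Ar C. source C f = a \<and> target C f = b}"

text \<open>Composition is written in applicative order, and only its values on composable arrows are
  constrained.  Strictness means that the associativity and unit laws for the tensor product are
  equations, both on objects and on arrows.\<close>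

locale strict_symmetric_monoidal_category =
  fixes C :: "('o, 'm) monoidal_data" (structure)
  assumes source_closed: "f \<in> Ar C \<Longrightarrow> source C f \<in> Ob C"
    and target_closed: "f \<in> Ar C \<Longrightarrow> target C f \<in> Ob C"
    and ident_Hom: "a \<in> Ob C \<Longrightarrow> \<langle>a\<rangle> \<in> Hom C a a"
    and compose_Hom: "\<lbrakk>f \<in> Hom C a b; g \<in> Hom C b d\<rbrakk> \<Longrightarrow> g \<cdot> f \<in> Hom C a d"
    and compose_assoc: "\<lbrakk>f \<in> Hom C a b; g \<in> Hom C b d; h \<in> Hom C d e\<rbrakk>
          \<Longrightarrow> (h \<cdot> g) \<cdot> f = h \<cdot> (g \<cdot> f)"
    and ident_left: "f \<in> Hom C a b \<Longrightarrow> \<langle>b\<rangle> \<cdot> f = f"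
    and ident_right: "f \<in> Hom C a b \<Longrightarrow> f \<cdot> \<langle>a\<rangle> = f"
    and unit_closed: "\<one> \<in> Ob C"
    and tensor_ob_closed: "\<lbrakk>a \<in> Ob C; b \<in> Ob C\<rbrakk> \<Longrightarrow> a \<odot> b \<in> Ob C"
    and tensor_ob_assoc: "\<lbrakk>a \<in> Ob C; b \<in> Ob C; d \<in> Ob C\<rbrakk>
          \<Longrightarrow> (a \<odot> b) \<odot> d = a \<odot> (b \<odot> d)"
    and tensor_ob_unit_left: "a \<in> Ob C \<Longrightarrow> \<one> \<odot> a = a"
    and tensor_ob_unit_right: "a \<in> Ob C \<Longrightarrow> a \<odot> \<one> = a"
    and tensor_Hom: "\<lbrakk>f \<in> Hom C a b; g \<in> Hom C a' b'\<rbrakk>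
          \<Longrightarrow> f \<otimes> g \<in> Hom C (a \<odot> a') (b \<odot> b')"
    and tensor_ident: "\<lbrakk>a \<in> Ob C; b \<in> Ob C\<rbrakk> \<Longrightarrow> \<langle>a\<rangle> \<otimes> \<langle>b\<rangle> = \<langle>a \<odot> b\<rangle>"
    and tensor_compose: "\<lbrakk>f \<in> Hom C a b; g \<in> Hom C b d; f' \<in> Hom C a' b'; g' \<in> Hom C b' d'\<rbrakk>
          \<Longrightarrow> (g \<cdot> f) \<otimes> (g' \<cdot> f') = (g \<otimes> g') \<cdot> (f \<otimes> f')"
    and tensor_assoc: "\<lbrakk>f \<in> Ar C; g \<in> Ar C; h \<in> Ar C\<rbrakk>
          \<Longrightarrow> (f \<otimes> g) \<otimes> h = f \<otimes> (g \<otimes> h)"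
    and tensor_unit_left: "f \<in> Ar C \<Longrightarrow> \<langle>\<one>\<rangle> \<otimes> f = f"
    and tensor_unit_right: "f \<in> Ar C \<Longrightarrow> f \<otimes> \<langle>\<one>\<rangle> = f"
    and symmetry_Hom: "\<lbrakk>a \<in> Ob C; b \<in> Ob C\<rbrakk> \<Longrightarrow> \<gamma> a b \<in> Hom C (a \<odot> b) (b \<odot> a)"
    and symmetry_natural: "\<lbrakk>f \<in> Hom C a a'; g \<in> Hom C b b'\<rbrakk>
          \<Longrightarrow> \<gamma> a' b' \<cdot> (f \<otimes> g) = (g \<otimes> f) \<cdot> \<gamma> a b"
    and symmetry_involutive: "\<lbrakk>a \<in> Ob C; b \<in> Ob C\<rbrakk> \<Longrightarrow> \<gamma> b a \<cdot> \<gamma> a b = \<langle>a \<odot> b\<rangle>"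
    and symmetry_hexagon: "\<lbrakk>a \<in> Ob C; b \<in> Ob C; d \<in> Ob C\<rbrakk>
          \<Longrightarrow> \<gamma> a (b \<odot> d) = (\<langle>b\<rangle> \<otimes> \<gamma> a d) \<cdot> (\<gamma> a b \<otimes> \<langle>d\<rangle>)"

definition (in strict_symmetric_monoidal_category) is_equalizer :: "'m \<Rightarrow> 'm \<Rightarrow> 'o \<Rightarrow> 'm \<Rightarrow> bool"
  where "is_equalizer f g e i \<longleftrightarrow>
    (\<exists>a b. f \<in> Hom C a b \<and> g \<in> Hom C a b \<and> i \<in> Hom C e a \<and> f \<cdot> i = g \<cdot> i \<and>
      (\<forall>x. \<forall>k \<in> Hom C x a. f \<cdot> k = g \<cdot> k \<longrightarrow> (\<exists>!l. l \<in> Hom C x e \<and> i \<cdot> l = k)))"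

locale strict_symmetric_monoidal_category_with_equalizers = strict_symmetric_monoidal_category +
  assumes has_equalizers: "\<lbrakk>f \<in> Hom C a b; g \<in> Hom C a b\<rbrakk> \<Longrightarrow> \<exists>e i. is_equalizer f g e i"


section \<open>Algebras, coalgebras and weak Hopf algebras\<close>

record ('o, 'm) algebra =
  obj :: 'o
  \<eta> :: 'm
  \<mu> :: 'm

record ('o, 'm) weak_hopf = "('o, 'm) algebra" +
  \<epsilon> :: 'm
  \<delta> :: 'm
  antipode :: 'm

record ('o, 'm) comodule_algebra = "('o, 'm) algebra" +
  \<rho> :: 'm

text \<open>A comodule algebra \<open>B\<close> together with an arrow \<open>incl\<close> into it.\<close>

record ('o, 'm) algebra_extension = "('o, 'm) comodule_algebra" +
  incl :: 'm

context strict_symmetric_monoidal_category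
begin

definition is_algebra :: "('o, 'm, 'z) algebra_scheme \<Rightarrow> bool"
  where "is_algebra A \<longleftrightarrow>
    obj A \<in> Ob C \<and> \<eta> A \<in> Hom C \<one> (obj A) \<and> \<mu> A \<in> Hom C (obj A \<odot> obj A) (obj A) \<and>
    \<mu> A \<cdot> (\<langle>obj A\<rangle> \<otimes> \<eta> A) = \<langle>obj A\<rangle> \<and>
    \<mu> A \<cdot> (\<eta> A \<otimes> \<langle>obj A\<rangle>) = \<langle>obj A\<rangle> \<and>
    \<mu> A \<cdot> (\<langle>obj A\<rangle> \<otimes> \<mu> A) = \<mu> A \<cdot> (\<mu> A \<otimes> \<langle>obj A\<rangle>)"

definition is_algebra_morphism ::
    "('o, 'm, 'y) algebra_scheme \<Rightarrow> ('o, 'm, 'z) algebra_scheme \<Rightarrow> 'm \<Rightarrow> bool"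
  where "is_algebra_morphism A B f \<longleftrightarrow>
    f \<in> Hom C (obj A) (obj B) \<and> f \<cdot> \<eta> A = \<eta> B \<and> f \<cdot> \<mu> A = \<mu> B \<cdot> (f \<otimes> f)"

definition tensor_\<mu> :: "('o, 'm, 'y) algebra_scheme \<Rightarrow> ('o, 'm, 'z) algebra_scheme \<Rightarrow> 'm"
  where "tensor_\<mu> A B = (\<mu> A \<otimes> \<mu> B) \<cdot> (\<langle>obj A\<rangle> \<otimes> \<gamma> (obj B) (obj A) \<otimes> \<langle>obj B\<rangle>)"

definition is_coalgebra :: "'o \<Rightarrow> 'm \<Rightarrow> 'm \<Rightarrow> bool"
  where "is_coalgebra D e d \<longleftrightarrow>
    D \<in> Ob C \<and> e \<in> Hom C D \<one> \<and> d \<in> Hom C D (D \<odot> D) \<and>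
    (\<langle>D\<rangle> \<otimes> e) \<cdot> d = \<langle>D\<rangle> \<and> (e \<otimes> \<langle>D\<rangle>) \<cdot> d = \<langle>D\<rangle> \<and>
    (\<langle>D\<rangle> \<otimes> d) \<cdot> d = (d \<otimes> \<langle>D\<rangle>) \<cdot> d"

definition tensor_\<delta> :: "'o \<Rightarrow> 'm \<Rightarrow> 'o \<Rightarrow> 'm \<Rightarrow> 'm"
  where "tensor_\<delta> D d E e = (\<langle>D\<rangle> \<otimes> \<gamma> D E \<otimes> \<langle>E\<rangle>) \<cdot> (d \<otimes> e)"

text \<open>\<open>conv d A\<close> is the convolution product of arrows into the algebra \<open>A\<close> from
  a coalgebra with comultiplication \<open>d\<close>.\<close>

definition conv :: "'m \<Rightarrow> ('o, 'm, 'z) algebra_scheme \<Rightarrow> 'm \<Rightarrow> 'm \<Rightarrow> 'm"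
  where "conv d A \<alpha> \<beta> = \<mu> A \<cdot> (\<alpha> \<otimes> \<beta>) \<cdot> d"

text \<open>Comultiplications of \<open>H \<otimes> H\<close> and of \<open>H \<otimes> H \<otimes> H\<close>.\<close>

definition \<delta>2 :: "('o, 'm) weak_hopf \<Rightarrow> 'm"
  where "\<delta>2 H = tensor_\<delta> (obj H) (\<delta> H) (obj H) (\<delta> H)"

definition \<delta>3 :: "('o, 'm) weak_hopf \<Rightarrow> 'm"
  where "\<delta>3 H = tensor_\<delta> (obj H \<odot> obj H) (\<delta>2 H) (obj H) (\<delta> H)"

definition \<Pi>L :: "('o, 'm) weak_hopf \<Rightarrow> 'm"
  where "\<Pi>L H =
    ((\<epsilon> H \<cdot> \<mu> H) \<otimes> \<langle>obj H\<rangle>) \<cdot> (\<langle>obj H\<rangle> \<otimes> \<gamma> (obj H) (obj H)) \<cdot> ((\<delta> H \<cdot> \<eta> H) \<otimes> \<langle>obj H\<rangle>)"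

definition \<Pi>R :: "('o, 'm) weak_hopf \<Rightarrow> 'm"
  where "\<Pi>R H =
    (\<langle>obj H\<rangle> \<otimes> (\<epsilon> H \<cdot> \<mu> H)) \<cdot> (\<gamma> (obj H) (obj H) \<otimes> \<langle>obj H\<rangle>) \<cdot> (\<langle>obj H\<rangle> \<otimes> (\<delta> H \<cdot> \<eta> H))"

definition weak_hopf_algebra :: "('o, 'm) weak_hopf \<Rightarrow> bool"
  where "weak_hopf_algebra H \<longleftrightarrow>
    is_algebra H \<and> is_coalgebra (obj H) (\<epsilon> H) (\<delta> H) \<and>
    \<delta> H \<cdot> \<mu> H = (\<mu> H \<otimes> \<mu> H) \<cdot> \<delta>2 H \<and>
    \<epsilon> H \<cdot> \<mu> H \<cdot> (\<mu> H \<otimes> \<langle>obj H\<rangle>)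
      = (\<epsilon> H \<otimes> \<epsilon> H) \<cdot> (\<mu> H \<otimes> \<mu> H) \<cdot> (\<langle>obj H\<rangle> \<otimes> \<delta> H \<otimes> \<langle>obj H\<rangle>) \<and>
    \<epsilon> H \<cdot> \<mu> H \<cdot> (\<mu> H \<otimes> \<langle>obj H\<rangle>)
      = (\<epsilon> H \<otimes> \<epsilon> H) \<cdot> (\<mu> H \<otimes> \<mu> H) \<cdot>
        (\<langle>obj H\<rangle> \<otimes> (\<gamma> (obj H) (obj H) \<cdot> \<delta> H) \<otimes> \<langle>obj H\<rangle>) \<and>
    (\<delta> H \<otimes> \<langle>obj H\<rangle>) \<cdot> \<delta> H \<cdot> \<eta> H
      = (\<langle>obj H\<rangle> \<otimes> \<mu> H \<otimes> \<langle>obj H\<rangle>) \<cdot> (\<delta> H \<otimes> \<delta> H) \<cdot> (\<eta> H \<otimes> \<eta> H) \<and>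
    (\<delta> H \<otimes> \<langle>obj H\<rangle>) \<cdot> \<delta> H \<cdot> \<eta> H
      = (\<langle>obj H\<rangle> \<otimes> (\<mu> H \<cdot> \<gamma> (obj H) (obj H)) \<otimes> \<langle>obj H\<rangle>) \<cdot> (\<delta> H \<otimes> \<delta> H) \<cdot> (\<eta> H \<otimes> \<eta> H) \<and>
    antipode H \<in> Hom C (obj H) (obj H) \<and>
    conv (\<delta> H) H \<langle>obj H\<rangle> (antipode H) = \<Pi>L H \<and>
    conv (\<delta> H) H (antipode H) \<langle>obj H\<rangle> = \<Pi>R H \<and>
    conv (\<delta> H) H (conv (\<delta> H) H (antipode H) \<langle>obj H\<rangle>) (antipode H) = antipode H"

definition cocommutative :: "('o, 'm) weak_hopf \<Rightarrow> bool"
  where "cocommutative H \<longleftrightarrow> \<gamma> (obj H) (obj H) \<cdot> \<delta> H = \<delta> H"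


section \<open>Comodule algebras and cleft extensions\<close>

definition right_comodule :: "('o, 'm) weak_hopf \<Rightarrow> 'o \<Rightarrow> 'm \<Rightarrow> bool"
  where "right_comodule H M r \<longleftrightarrow>
    M \<in> Ob C \<and> r \<in> Hom C M (M \<odot> obj H) \<and>
    (\<langle>M\<rangle> \<otimes> \<epsilon> H) \<cdot> r = \<langle>M\<rangle> \<and>
    (r \<otimes> \<langle>obj H\<rangle>) \<cdot> r = (\<langle>M\<rangle> \<otimes> \<delta> H) \<cdot> r"

definition is_comodule_morphism :: "('o, 'm) weak_hopf \<Rightarrow> 'o \<Rightarrow> 'm \<Rightarrow> 'o \<Rightarrow> 'm \<Rightarrow> 'm \<Rightarrow> bool"
  where "is_comodule_morphism H M r N s f \<longleftrightarrow>
    f \<in> Hom C M N \<and> s \<cdot> f = (f \<otimes> \<langle>obj H\<rangle>) \<cdot> r"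

definition right_comodule_algebra ::
    "('o, 'm) weak_hopf \<Rightarrow> ('o, 'm, 'z) comodule_algebra_scheme \<Rightarrow> bool"
  where "right_comodule_algebra H A \<longleftrightarrow>
    is_algebra A \<and> right_comodule H (obj A) (\<rho> A) \<and>
    \<rho> A \<cdot> \<mu> A = tensor_\<mu> A H \<cdot> (\<rho> A \<otimes> \<rho> A) \<and>
    (\<langle>obj A\<rangle> \<otimes> \<Pi>L H) \<cdot> \<rho> A \<cdot> \<eta> A = \<rho> A \<cdot> \<eta> A"

definition \<zeta> :: "('o, 'm) weak_hopf \<Rightarrow> ('o, 'm, 'z) comodule_algebra_scheme \<Rightarrow> 'm"
  where "\<zeta> H A = (\<langle>obj A\<rangle> \<otimes> \<Pi>L H) \<cdot> \<rho> A"

definition coinvariant_subalgebra ::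
    "('o, 'm) weak_hopf \<Rightarrow> ('o, 'm, 'z) comodule_algebra_scheme \<Rightarrow> ('o, 'm) algebra \<Rightarrow> 'm \<Rightarrow> bool"
  where "coinvariant_subalgebra H A D i \<longleftrightarrow>
    is_algebra D \<and> is_algebra_morphism D A i \<and> is_equalizer (\<rho> A) (\<zeta> H A) (obj D) i"

definition e_map :: "('o, 'm) weak_hopf \<Rightarrow> ('o, 'm, 'z) comodule_algebra_scheme \<Rightarrow> 'm"
  where "e_map H A =
    (\<langle>obj A\<rangle> \<otimes> (\<epsilon> H \<cdot> \<mu> H)) \<cdot> (\<gamma> (obj H) (obj A) \<otimes> \<langle>obj H\<rangle>) \<cdot> (\<langle>obj H\<rangle> \<otimes> (\<rho> A \<cdot> \<eta> A))"

definition is_integral ::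
    "('o, 'm) weak_hopf \<Rightarrow> ('o, 'm, 'z) comodule_algebra_scheme \<Rightarrow> 'm \<Rightarrow> bool"
  where "is_integral H A f \<longleftrightarrow> is_comodule_morphism H (obj H) (\<delta> H) (obj A) (\<rho> A) f"

definition is_convolution_inverse ::
    "('o, 'm) weak_hopf \<Rightarrow> ('o, 'm, 'z) comodule_algebra_scheme \<Rightarrow> 'm \<Rightarrow> 'm \<Rightarrow> bool"
  where "is_convolution_inverse H A f f' \<longleftrightarrow>
    f' \<in> Hom C (obj H) (obj A) \<and>
    conv (\<delta> H) A f' f = e_map H A \<and>
    conv (\<delta> H) A f f' = (\<langle>obj A\<rangle> \<otimes> (\<epsilon> H \<cdot> \<mu> H)) \<cdot> ((\<rho> A \<cdot> \<eta> A) \<otimes> \<langle>obj H\<rangle>) \<and>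
    conv (\<delta> H) A (conv (\<delta> H) A f' f) f' = f'"

definition cleft_extension ::
    "('o, 'm) weak_hopf \<Rightarrow> ('o, 'm) algebra \<Rightarrow> ('o, 'm) algebra_extension \<Rightarrow> bool"
  where "cleft_extension H D B \<longleftrightarrow>
    right_comodule_algebra H B \<and> coinvariant_subalgebra H B D (incl B) \<and>
    (\<exists>f f'. is_integral H B f \<and> is_convolution_inverse H B f f' \<and>
      (\<exists>g \<in> Hom C (obj H) (obj D). conv (\<delta> H) B f f' = incl B \<cdot> g))"

definition cleft_extensions ::
    "('o, 'm) weak_hopf \<Rightarrow> ('o, 'm) algebra \<Rightarrow> ('o, 'm) algebra_extension set"
  where "cleft_extensions H D = {B. cleft_extension H D B}"

definition cleft_equivalence ::
    "('o, 'm) weak_hopf \<Rightarrow> ('o, 'm) algebra \<Rightarrow>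
     (('o, 'm) algebra_extension \<times> ('o, 'm) algebra_extension) set"
  where "cleft_equivalence H D =
    {(B, B'). B \<in> cleft_extensions H D \<and> B' \<in> cleft_extensions H D \<and>
      (\<exists>T. is_algebra_morphism B B' T \<and> is_comodule_morphism H (obj B) (\<rho> B) (obj B') (\<rho> B') T \<and>
        T \<cdot> incl B = incl B')}"


section \<open>Crossed systems\<close>

definition weak_module_algebra :: "('o, 'm) weak_hopf \<Rightarrow> ('o, 'm) algebra \<Rightarrow> 'm \<Rightarrow> bool"
  where "weak_module_algebra H D \<phi> \<longleftrightarrow>
    is_algebra D \<and> \<phi> \<in> Hom C (obj H \<odot> obj D) (obj D) \<and>
    \<phi> \<cdot> (\<eta> H \<otimes> \<langle>obj D\<rangle>) = \<langle>obj D\<rangle> \<and>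
    \<phi> \<cdot> (\<langle>obj H\<rangle> \<otimes> \<mu> D)
      = \<mu> D \<cdot> (\<phi> \<otimes> \<phi>) \<cdot> (\<langle>obj H\<rangle> \<otimes> \<gamma> (obj H) (obj D) \<otimes> \<langle>obj D\<rangle>) \<cdot>
        (\<delta> H \<otimes> \<langle>obj D\<rangle> \<otimes> \<langle>obj D\<rangle>) \<and>
    \<phi> \<cdot> (\<mu> H \<otimes> \<eta> D) = \<phi> \<cdot> (\<langle>obj H\<rangle> \<otimes> (\<phi> \<cdot> (\<langle>obj H\<rangle> \<otimes> \<eta> D))) \<and>
    \<phi> \<cdot> (\<Pi>L H \<otimes> \<eta> D) = \<phi> \<cdot> (\<langle>obj H\<rangle> \<otimes> \<eta> D)"

definition u1 :: "('o, 'm) weak_hopf \<Rightarrow> ('o, 'm) algebra \<Rightarrow> 'm \<Rightarrow> 'm"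
  where "u1 H D \<phi> = \<phi> \<cdot> (\<langle>obj H\<rangle> \<otimes> \<eta> D)"

definition u2 :: "('o, 'm) weak_hopf \<Rightarrow> ('o, 'm) algebra \<Rightarrow> 'm \<Rightarrow> 'm"
  where "u2 H D \<phi> = \<phi> \<cdot> (\<langle>obj H\<rangle> \<otimes> u1 H D \<phi>)"

text \<open>\<open>is_regular_inverse X d D u s s'\<close> states that \<open>s'\<close> is a convolution inverse of \<open>s\<close> relative
  to \<open>u\<close>, for arrows from the coalgebra \<open>X\<close> with comultiplication \<open>d\<close>; such an \<open>s'\<close> is unique.\<close>

definition is_regular_inverse ::
    "'o \<Rightarrow> 'm \<Rightarrow> ('o, 'm) algebra \<Rightarrow> 'm \<Rightarrow> 'm \<Rightarrow> 'm \<Rightarrow> bool"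
  where "is_regular_inverse X d D u s s' \<longleftrightarrow>
    s' \<in> Hom C X (obj D) \<and>
    conv d D s s' = u \<and> conv d D s' s = u \<and>
    conv d D (conv d D s s') s = s \<and> conv d D (conv d D s' s) s' = s'"

definition Reg1 :: "('o, 'm) weak_hopf \<Rightarrow> ('o, 'm) algebra \<Rightarrow> 'm \<Rightarrow> 'm set"
  where "Reg1 H D \<phi> =
    {h \<in> Hom C (obj H) (obj D). \<exists>h'. is_regular_inverse (obj H) (\<delta> H) D (u1 H D \<phi>) h h'}"

definition Reg2 :: "('o, 'm) weak_hopf \<Rightarrow> ('o, 'm) algebra \<Rightarrow> 'm \<Rightarrow> 'm set"
  where "Reg2 H D \<phi> =
    {s \<in> Hom C (obj H \<odot> obj H) (obj D).
      \<exists>s'. is_regular_inverse (obj H \<odot> obj H) (\<delta>2 H) D (u2 H D \<phi>) s s'}"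

definition \<Omega>L :: "('o, 'm) weak_hopf \<Rightarrow> 'm"
  where "\<Omega>L H = ((\<epsilon> H \<cdot> \<mu> H) \<otimes> \<langle>obj H\<rangle> \<otimes> \<langle>obj H\<rangle>) \<cdot> \<delta>2 H"

definition crossed_system :: "('o, 'm) weak_hopf \<Rightarrow> ('o, 'm) algebra \<Rightarrow> 'm \<Rightarrow> 'm \<Rightarrow> bool"
  where "crossed_system H D \<phi> \<sigma> \<longleftrightarrow>
    weak_module_algebra H D \<phi> \<and> \<sigma> \<in> Reg2 H D \<phi> \<and>
    \<mu> D \<cdot> (\<langle>obj D\<rangle> \<otimes> \<phi>) \<cdot> (\<sigma> \<otimes> \<mu> H \<otimes> \<langle>obj D\<rangle>) \<cdot> (\<delta>2 H \<otimes> \<langle>obj D\<rangle>)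
      = \<mu> D \<cdot> ((\<phi> \<cdot> (\<langle>obj H\<rangle> \<otimes> \<phi>)) \<otimes> \<langle>obj D\<rangle>) \<cdot>
        (\<langle>obj H\<rangle> \<otimes> \<langle>obj H\<rangle> \<otimes> \<gamma> (obj D) (obj D)) \<cdot>
        (\<langle>obj H\<rangle> \<otimes> \<langle>obj H\<rangle> \<otimes> \<sigma> \<otimes> \<langle>obj D\<rangle>) \<cdot> (\<delta>2 H \<otimes> \<langle>obj D\<rangle>) \<and>
    conv (\<delta>3 H) D (\<phi> \<cdot> (\<langle>obj H\<rangle> \<otimes> \<sigma>) \<cdot> (\<Omega>L H \<otimes> \<langle>obj H\<rangle>)) (\<sigma> \<cdot> (\<langle>obj H\<rangle> \<otimes> \<mu> H))
      = conv (\<delta>3 H) D ((\<sigma> \<otimes> \<epsilon> H) \<cdot> (\<langle>obj H\<rangle> \<otimes> \<Omega>L H)) (\<sigma> \<cdot> (\<mu> H \<otimes> \<langle>obj H\<rangle>)) \<and>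
    \<sigma> \<cdot> (\<langle>obj H\<rangle> \<otimes> \<eta> H) = u1 H D \<phi> \<and> \<sigma> \<cdot> (\<eta> H \<otimes> \<langle>obj H\<rangle>) = u1 H D \<phi>"

definition crossed_systems :: "('o, 'm) weak_hopf \<Rightarrow> ('o, 'm) algebra \<Rightarrow> ('m \<times> 'm) set"
  where "crossed_systems H D = {(\<phi>, \<sigma>). crossed_system H D \<phi> \<sigma>}"

definition crossed_equivalence ::
    "('o, 'm) weak_hopf \<Rightarrow> ('o, 'm) algebra \<Rightarrow> (('m \<times> 'm) \<times> ('m \<times> 'm)) set"
  where "crossed_equivalence H D =
    {((\<phi>, \<sigma>), (\<psi>, \<tau>)).
      (\<phi>, \<sigma>) \<in> crossed_systems H D \<and> (\<psi>, \<tau>) \<in> crossed_systems H D \<and>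
      \<phi> \<cdot> (\<langle>obj H\<rangle> \<otimes> \<eta> D) = \<psi> \<cdot> (\<langle>obj H\<rangle> \<otimes> \<eta> D) \<and>
      (\<exists>h \<in> Reg1 H D \<phi> \<inter> Reg1 H D \<psi>. \<exists>h'.
        is_regular_inverse (obj H) (\<delta> H) D (u1 H D \<phi>) h h' \<and>
        h \<cdot> \<eta> H = \<eta> D \<and>
        \<phi> = \<mu> D \<cdot> (\<mu> D \<otimes> \<langle>obj D\<rangle>) \<cdot> (h \<otimes> \<psi> \<otimes> h') \<cdot>
              (\<delta> H \<otimes> \<gamma> (obj H) (obj D)) \<cdot> (\<delta> H \<otimes> \<langle>obj D\<rangle>) \<and>
        \<sigma> = \<mu> D \<cdot> (\<mu> D \<otimes> h') \<cdot> (\<mu> D \<otimes> \<tau> \<otimes> \<mu> H) \<cdot> (h \<otimes> \<psi> \<otimes> \<delta>2 H) \<cdot>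
              (\<delta> H \<otimes> h \<otimes> \<langle>obj H\<rangle> \<otimes> \<langle>obj H\<rangle>) \<cdot> \<delta>2 H)}"

end

end

theory Submission
  imports Defs
begin

text \<open>
  A cocommutative weak Hopf algebra behaves like the linearization of a groupoid, and over a groupoid
  the theorem is elementary: a cleft extension is a family of components \<open>B\<^sub>a\<close>, indexed by the arrows
  \<open>a\<close> and each containing an invertible element \<open>f(a)\<close>, and \<open>f\<close> is described by the action
  \<open>\<phi>\<^sub>a(p) = f(a) p f(a)\<^sup>-\<^sup>1\<close> and by the factor set \<open>\<sigma>(a, b) = f(a) f(b) f(a b)\<^sup>-\<^sup>1\<close>.  The proof below
  makes this picture literal.

  Fix a cocommutative coalgebra \<open>X\<close> and read an arrow \<open>p : X \<otimes> Y \<rightarrow> S\<close> as an element of \<open>S\<close> that depends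
  on a point of \<open>X\<close> and linearly on \<open>Y\<close>.  Two elements are paired by duplicating the point with the
  comultiplication of \<open>X\<close>.  An element \<open>a\<close> of \<open>H\<close> is grouplike if \<open>\<delta> a = a \<otimes> a\<close>; the coordinates of
  \<open>H \<otimes> \<dots> \<otimes> H\<close>, regarded as elements over that coalgebra, are grouplike and generic.  Hence an equation
  between arrows out of \<open>H \<otimes> H \<otimes> Y\<close> may be checked on \<open>a \<otimes> b \<otimes> p\<close> with \<open>a\<close> and \<open>b\<close> grouplike
  (\<open>generic_ext2\<close> and its relatives), where convolution products become products of values.  Counit
  values are scalars, \<open>\<epsilon>(a b)\<close> stands for composability of \<open>a\<close> and \<open>b\<close>, and \<open>\<Pi>\<^sup>L a\<close>, \<open>\<Pi>\<^sup>R a\<close>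
  and \<open>\<lambda> a\<close> stand for target, source and inverse.  The unit of \<open>H\<close> is not grouplike.  A statement
  about it is obtained from one about \<open>\<Pi>\<^sup>L z\<close> with \<open>z\<close> generic, by substituting \<open>z = 1\<close> in the
  resulting equation of arrows.

  Every cleaving can be normalized to \<open>f 1 = 1\<close> (\<open>exists_normal\<close>).  The elements that define \<open>\<phi>\<close> and
  \<open>\<sigma>\<close> then have degree \<open>\<Pi>\<^sup>L a\<close> and \<open>\<Pi>\<^sup>L (a b)\<close>, so they are coinvariant and lift to \<open>A\<^sub>H\<close>.  The laws of a
  crossed system hold because both sides of each are the same word in \<open>B\<close> after cancellation
  (\<open>presentation.crossed_system\<close>).  Conversely, a crossed system yields the crossed product, the image of
  an idempotent on \<open>A\<^sub>H \<otimes> H\<close>, with a cleaving that returns the given system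
  (\<open>crossed_product.product_presentation\<close>).

  It remains to see that the relation ``\<open>B\<close> has a normalized cleaving with crossed system \<open>s\<close>'' passes to
  a bijection of equivalence classes.  If \<open>B\<close> and \<open>B'\<close> have cleavings \<open>f\<close> and \<open>g\<close> with the same
  system, then \<open>d f(a) \<mapsto> d g(a)\<close> is an equivalence, since \<open>b = b\<^sub>0 f\<^sup>-\<^sup>1(b\<^sub>1) f(b\<^sub>2)\<close> for all \<open>b\<close>
  (\<open>two_presentations.exists_equivalence\<close>).  If \<open>f\<close> and \<open>g\<close> are two cleavings of \<open>B\<close>, then
  \<open>h(a) = f(a) g\<^sup>-\<^sup>1(a)\<close> is an equivalence of their systems (\<open>two_cleavings.equivalent_systems\<close>), and
  conversely such an \<open>h\<close> turns \<open>g\<close> into the cleaving \<open>h(a) g(a)\<close> (\<open>recleaving.presentation\<close>).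
\<close>

section \<open>Arrows of a strict symmetric monoidal category\<close>

context strict_symmetric_monoidal_category
begin

lemma Hom_iff: "f \<in> Hom C a b \<longleftrightarrow> f \<in> Ar C \<and> source C f = a \<and> target C f = b"
  by (simp add: Hom_def)

lemma in_Hom: "f \<in> Ar C \<Longrightarrow> f \<in> Hom C (source C f) (target C f)"
  by (simp add: Hom_def)

declare source_closed [simp] target_closed [simp] unit_closed [simp] tensor_ob_closed [simp]
  tensor_ob_assoc [simp] tensor_ob_unit_left [simp] tensor_ob_unit_right [simp]
  tensor_assoc [simp] tensor_unit_left [simp] tensor_unit_right [simp] tensor_ident [simp]
  symmetry_involutive [simp]

lemma ident_simps [simp]:
  assumes "a \<in> Ob C"
  shows "\<langle>a\<rangle> \<in> Ar C" "source C \<langle>a\<rangle> = a" "target C \<langle>a\<rangle> = a"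
  using ident_Hom [OF assms] by (auto simp: Hom_def)

lemma compose_simps [simp]:
  assumes "f \<in> Ar C" "g \<in> Ar C" "source C g = target C f"
  shows "g \<cdot> f \<in> Ar C" "source C (g \<cdot> f) = source C f" "target C (g \<cdot> f) = target C g"
  using compose_Hom [of f "source C f" "target C f" g "target C g"] assms by (auto simp: Hom_def)

lemma tensor_simps [simp]:
  assumes "f \<in> Ar C" "g \<in> Ar C"
  shows "f \<otimes> g \<in> Ar C" "source C (f \<otimes> g) = source C f \<odot> source C g"
    "target C (f \<otimes> g) = target C f \<odot> target C g"
  using tensor_Hom [OF in_Hom in_Hom, of f g] assms by (auto simp: Hom_def)

lemma symmetry_simps [simp]:
  assumes "a \<in> Ob C" "b \<in> Ob C"
  shows "\<gamma> a b \<in> Ar C" "source C (\<gamma> a b) = a \<odot> b" "target C (\<gamma> a b) = b \<odot> a"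
  using symmetry_Hom [OF assms] by (auto simp: Hom_def)

lemma compose_assoc' [simp]:
  assumes "f \<in> Ar C" "g \<in> Ar C" "h \<in> Ar C" "source C g = target C f" "source C h = target C g"
  shows "(h \<cdot> g) \<cdot> f = h \<cdot> (g \<cdot> f)"
  using assms by (intro compose_assoc) (auto simp: Hom_def)

lemma compose_tail:
  assumes "g \<cdot> f = k" "f \<in> Ar C" "g \<in> Ar C" "source C g = target C f"
    and "x \<in> Ar C" "source C f = target C x"
  shows "g \<cdot> (f \<cdot> x) = k \<cdot> x"
  using assms compose_assoc' [of x f g] by simp

lemma ident_left' [simp]: "\<lbrakk>f \<in> Ar C; target C f = b\<rbrakk> \<Longrightarrow> \<langle>b\<rangle> \<cdot> f = f"
  by (rule ident_left) (auto simp: Hom_def)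

lemma ident_right' [simp]: "\<lbrakk>f \<in> Ar C; source C f = a\<rbrakk> \<Longrightarrow> f \<cdot> \<langle>a\<rangle> = f"
  by (rule ident_right) (auto simp: Hom_def)

lemma interchange:
  assumes "f \<in> Ar C" "g \<in> Ar C" "f' \<in> Ar C" "g' \<in> Ar C"
    "source C g = target C f" "source C g' = target C f'"
  shows "(g \<otimes> g') \<cdot> (f \<otimes> f') = (g \<cdot> f) \<otimes> (g' \<cdot> f')"
  using assms by (intro tensor_compose [symmetric]) (auto simp: Hom_def)

lemma ident_merge:
  "\<lbrakk>a \<in> Ob C; b \<in> Ob C; f \<in> Ar C\<rbrakk> \<Longrightarrow> \<langle>a\<rangle> \<otimes> \<langle>b\<rangle> \<otimes> f = \<langle>a \<odot> b\<rangle> \<otimes> f"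
  by (simp flip: tensor_assoc)

lemma symmetry_natural':
  assumes "f \<in> Ar C" "g \<in> Ar C" "target C f = a'" "target C g = b'"
  shows "\<gamma> a' b' \<cdot> (f \<otimes> g) = (g \<otimes> f) \<cdot> \<gamma> (source C f) (source C g)"
  using assms by (intro symmetry_natural) (auto simp: Hom_def)

lemma symmetry_unit_right [simp]:
  assumes a: "a \<in> Ob C"
  shows "\<gamma> a \<one> = \<langle>a\<rangle>"
proof -
  have "\<gamma> a \<one> = \<gamma> a \<one> \<cdot> \<gamma> a \<one>"
    using symmetry_hexagon [of a \<one> \<one>] a by simp
  then have "\<gamma> \<one> a \<cdot> \<gamma> a \<one> = \<gamma> \<one> a \<cdot> (\<gamma> a \<one> \<cdot> \<gamma> a \<one>)"
    by simp
  also have "\<dots> = (\<gamma> \<one> a \<cdot> \<gamma> a \<one>) \<cdot> \<gamma> a \<one>"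
    using a by (simp del: symmetry_involutive)
  finally show ?thesis
    using a by simp
qed

lemma symmetry_unit_left [simp]:
  assumes a: "a \<in> Ob C"
  shows "\<gamma> \<one> a = \<langle>a\<rangle>"
  using symmetry_involutive [OF a unit_closed] a by simp

lemma symmetry_hexagon':
  assumes "a \<in> Ob C" "b \<in> Ob C" "d \<in> Ob C"
  shows "\<gamma> (a \<odot> b) d = (\<gamma> a d \<otimes> \<langle>b\<rangle>) \<cdot> (\<langle>a\<rangle> \<otimes> \<gamma> b d)"
proof -
  let ?l = "(\<gamma> a d \<otimes> \<langle>b\<rangle>) \<cdot> (\<langle>a\<rangle> \<otimes> \<gamma> b d)"
  have 1: "\<gamma> d (a \<odot> b) = (\<langle>a\<rangle> \<otimes> \<gamma> d b) \<cdot> (\<gamma> d a \<otimes> \<langle>b\<rangle>)"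
    using assms by (rule_tac symmetry_hexagon) auto
  have "?l \<cdot> \<gamma> d (a \<odot> b)
      = (\<gamma> a d \<otimes> \<langle>b\<rangle>) \<cdot> (((\<langle>a\<rangle> \<otimes> \<gamma> b d) \<cdot> (\<langle>a\<rangle> \<otimes> \<gamma> d b)) \<cdot> (\<gamma> d a \<otimes> \<langle>b\<rangle>))"
    unfolding 1 using assms by simp
  also have "\<dots> = (\<gamma> a d \<otimes> \<langle>b\<rangle>) \<cdot> (\<gamma> d a \<otimes> \<langle>b\<rangle>)"
    using assms by (simp add: interchange del: compose_assoc')
  also have "\<dots> = \<langle>d \<odot> a \<odot> b\<rangle>"
    using assms by (simp add: interchange)
  finally have 2: "?l \<cdot> \<gamma> d (a \<odot> b) = \<langle>d \<odot> a \<odot> b\<rangle>" .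
  have "?l = ?l \<cdot> (\<gamma> d (a \<odot> b) \<cdot> \<gamma> (a \<odot> b) d)"
    using assms by simp
  also have "\<dots> = (?l \<cdot> \<gamma> d (a \<odot> b)) \<cdot> \<gamma> (a \<odot> b) d"
    using assms by (simp del: symmetry_involutive)
  also have "\<dots> = \<gamma> (a \<odot> b) d"
    unfolding 2 using assms by simp
  finally show ?thesis ..
qed

end

section \<open>Tensor products of coalgebras\<close>

context strict_symmetric_monoidal_category
begin

lemma coalgebra_simps:
  assumes "is_coalgebra D e d"
  shows "D \<in> Ob C" "e \<in> Ar C" "source C e = D" "target C e = \<one>"
    "d \<in> Ar C" "source C d = D" "target C d = D \<odot> D"
    "(\<langle>D\<rangle> \<otimes> e) \<cdot> d = \<langle>D\<rangle>" "(e \<otimes> \<langle>D\<rangle>) \<cdot> d = \<langle>D\<rangle>"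
  using assms by (auto simp: is_coalgebra_def Hom_def)

lemma coassociative: "is_coalgebra D e d \<Longrightarrow> (\<langle>D\<rangle> \<otimes> d) \<cdot> d = (d \<otimes> \<langle>D\<rangle>) \<cdot> d"
  by (auto simp: is_coalgebra_def)

lemma tensor_\<delta>_simps:
  assumes "is_coalgebra a e d" "is_coalgebra b e' d'"
  shows "tensor_\<delta> a d b d' \<in> Ar C" "source C (tensor_\<delta> a d b d') = a \<odot> b"
    "target C (tensor_\<delta> a d b d') = a \<odot> b \<odot> a \<odot> b"
  using assms by (simp_all add: tensor_\<delta>_def coalgebra_simps)

text \<open>The two ways of discarding half of each copy; both are needed to see that the
  projections of a tensor product are morphisms of coalgebras.\<close>

lemma tensor_\<delta>_discard:
  assumes D: "is_coalgebra a e d" and E: "is_coalgebra b e' d'"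
  shows "(\<langle>a\<rangle> \<otimes> e' \<otimes> \<langle>a\<rangle> \<otimes> e') \<cdot> tensor_\<delta> a d b d' = d \<otimes> e'" (is ?A)
    and "(e \<otimes> \<langle>b\<rangle> \<otimes> e \<otimes> \<langle>b\<rangle>) \<cdot> tensor_\<delta> a d b d' = e \<otimes> d'" (is ?B)
    and "(\<langle>a\<rangle> \<otimes> e' \<otimes> e \<otimes> \<langle>b\<rangle>) \<cdot> tensor_\<delta> a d b d' = \<langle>a \<odot> b\<rangle>" (is ?C)
proof -
  note [simp] = coalgebra_simps [OF D] coalgebra_simps [OF E]
  have e'd': "(e' \<otimes> e') \<cdot> d' = e'"
  proof -
    have "(e' \<cdot> (\<langle>b\<rangle> \<otimes> e')) \<cdot> d' = e'"
      by simp
    then show ?thesis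
      using interchange [of "\<langle>b\<rangle>" e' e' "\<langle>\<one>\<rangle>"] by (simp del: compose_assoc')
  qed
  have ed: "(e \<otimes> e) \<cdot> d = e"
  proof -
    have "(e \<cdot> (\<langle>a\<rangle> \<otimes> e)) \<cdot> d = e"
      by simp
    then show ?thesis
      using interchange [of "\<langle>a\<rangle>" e e "\<langle>\<one>\<rangle>"] by (simp del: compose_assoc')
  qed
  have 1: "(e' \<otimes> \<langle>a\<rangle>) \<cdot> \<gamma> a b = \<langle>a\<rangle> \<otimes> e'"
    using symmetry_natural' [of "\<langle>a\<rangle>" e' a \<one>] by simp
  have 2: "(\<langle>b\<rangle> \<otimes> e) \<cdot> \<gamma> a b = e \<otimes> \<langle>b\<rangle>"
    using symmetry_natural' [of e "\<langle>b\<rangle>" \<one> b] by simp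
  have 3: "(e' \<otimes> e) \<cdot> \<gamma> a b = e \<otimes> e'"
    using symmetry_natural' [of e e' \<one> \<one>] by simp
  have A: "(\<langle>a\<rangle> \<otimes> f \<otimes> h) \<cdot> tensor_\<delta> a d b d' = (\<langle>a\<rangle> \<otimes> (f \<cdot> \<gamma> a b) \<otimes> h) \<cdot> (d \<otimes> d')"
    if "f \<in> Ar C" "h \<in> Ar C" "source C f = b \<odot> a" "source C h = b" for f h
    using that by (simp add: tensor_\<delta>_def interchange flip: compose_assoc')
  have B: "(e \<otimes> f \<otimes> h) \<cdot> tensor_\<delta> a d b d' = (e \<otimes> (f \<cdot> \<gamma> a b) \<otimes> h) \<cdot> (d \<otimes> d')"
    if "f \<in> Ar C" "h \<in> Ar C" "source C f = b \<odot> a" "source C h = b" for f h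
    using that by (simp add: tensor_\<delta>_def interchange flip: compose_assoc')
  show ?A
    using A [of "e' \<otimes> \<langle>a\<rangle>" e'] interchange [of d "\<langle>a \<odot> a\<rangle>" d' "e' \<otimes> e'"]
      tensor_assoc [of "\<langle>a\<rangle>" "\<langle>a\<rangle>" "e' \<otimes> e'"] by (simp add: 1 e'd')
  show ?B
    using B [of "\<langle>b\<rangle> \<otimes> e" "\<langle>b\<rangle>"] interchange [of d "e \<otimes> e" d' "\<langle>b \<odot> b\<rangle>"] by (simp add: 2 ed)
  show ?C
    using A [of "e' \<otimes> e" "\<langle>b\<rangle>"] interchange [of d "\<langle>a\<rangle> \<otimes> e" d' "e' \<otimes> \<langle>b\<rangle>"] by (simp add: 3)
qed

lemma tensor_coalgebra:
  assumes D: "is_coalgebra a e d" and E: "is_coalgebra b e' d'"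
  shows "is_coalgebra (a \<odot> b) (e \<otimes> e') (tensor_\<delta> a d b d')"
proof -
  note [simp] = coalgebra_simps [OF D] coalgebra_simps [OF E]
  let ?c = "\<gamma> a b" and ?\<Delta> = "tensor_\<delta> a d b d'"
  have n1: "(\<langle>b\<rangle> \<otimes> d) \<cdot> ?c = (?c \<otimes> \<langle>a\<rangle>) \<cdot> ((\<langle>a\<rangle> \<otimes> ?c) \<cdot> (d \<otimes> \<langle>b\<rangle>))"
    using symmetry_natural' [of d "\<langle>b\<rangle>" "a \<odot> a" b] by (simp add: symmetry_hexagon')
  have n2: "(d' \<otimes> \<langle>a\<rangle>) \<cdot> ?c = (\<langle>b\<rangle> \<otimes> ?c) \<cdot> ((?c \<otimes> \<langle>b\<rangle>) \<cdot> (\<langle>a\<rangle> \<otimes> d'))"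
    using symmetry_natural' [of "\<langle>a\<rangle>" d' a "b \<odot> b"] by (simp add: symmetry_hexagon [of a b b])
  let ?W = "(\<langle>a\<rangle> \<otimes> ?c \<otimes> ?c \<otimes> \<langle>b\<rangle>) \<cdot> (\<langle>a \<odot> a\<rangle> \<otimes> ?c \<otimes> \<langle>b \<odot> b\<rangle>)"
  have w1: "(\<langle>a \<odot> b \<odot> a\<rangle> \<otimes> ?c \<otimes> \<langle>b\<rangle>) \<cdot> (\<langle>a\<rangle> \<otimes> ((?c \<otimes> \<langle>a\<rangle>) \<cdot> (\<langle>a\<rangle> \<otimes> ?c)) \<otimes> \<langle>b \<odot> b\<rangle>) = ?W"
  proof -
    have "\<langle>a\<rangle> \<otimes> ((?c \<otimes> \<langle>a\<rangle>) \<cdot> (\<langle>a\<rangle> \<otimes> ?c)) \<otimes> \<langle>b \<odot> b\<rangle>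
        = (\<langle>a\<rangle> \<otimes> ?c \<otimes> \<langle>a \<odot> b \<odot> b\<rangle>) \<cdot> (\<langle>a \<odot> a\<rangle> \<otimes> ?c \<otimes> \<langle>b \<odot> b\<rangle>)"
      using interchange [of "\<langle>a\<rangle> \<otimes> ?c" "?c \<otimes> \<langle>a\<rangle>" "\<langle>b \<odot> b\<rangle>" "\<langle>b \<odot> b\<rangle>"]
        interchange [of "\<langle>a\<rangle>" "\<langle>a\<rangle>" "\<langle>a\<rangle> \<otimes> ?c \<otimes> \<langle>b \<odot> b\<rangle>" "?c \<otimes> \<langle>a \<odot> b \<odot> b\<rangle>"]
        tensor_assoc [of "\<langle>a\<rangle>" "\<langle>a\<rangle>" "?c \<otimes> \<langle>b \<odot> b\<rangle>"]
      by simp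
    moreover have "(\<langle>a \<odot> b \<odot> a\<rangle> \<otimes> ?c \<otimes> \<langle>b\<rangle>) \<cdot> (\<langle>a\<rangle> \<otimes> ?c \<otimes> \<langle>a \<odot> b \<odot> b\<rangle>)
        = \<langle>a\<rangle> \<otimes> ?c \<otimes> ?c \<otimes> \<langle>b\<rangle>"
      using interchange [of "\<langle>a\<rangle> \<otimes> ?c" "\<langle>a \<odot> b \<odot> a\<rangle>" "\<langle>a \<odot> b \<odot> b\<rangle>" "?c \<otimes> \<langle>b\<rangle>"] by simp
    ultimately show ?thesis by (simp flip: compose_assoc')
  qed
  have w2: "(\<langle>a\<rangle> \<otimes> ?c \<otimes> \<langle>b \<odot> a \<odot> b\<rangle>) \<cdot> (\<langle>a \<odot> a\<rangle> \<otimes> ((\<langle>b\<rangle> \<otimes> ?c) \<cdot> (?c \<otimes> \<langle>b\<rangle>)) \<otimes> \<langle>b\<rangle>) = ?W"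
  proof -
    have "\<langle>a \<odot> a\<rangle> \<otimes> ((\<langle>b\<rangle> \<otimes> ?c) \<cdot> (?c \<otimes> \<langle>b\<rangle>)) \<otimes> \<langle>b\<rangle>
        = (\<langle>a \<odot> a \<odot> b\<rangle> \<otimes> ?c \<otimes> \<langle>b\<rangle>) \<cdot> (\<langle>a \<odot> a\<rangle> \<otimes> ?c \<otimes> \<langle>b \<odot> b\<rangle>)"
      using interchange [of "?c \<otimes> \<langle>b\<rangle>" "\<langle>b\<rangle> \<otimes> ?c" "\<langle>b\<rangle>" "\<langle>b\<rangle>"]
        interchange [of "\<langle>a \<odot> a\<rangle>" "\<langle>a \<odot> a\<rangle>" "?c \<otimes> \<langle>b \<odot> b\<rangle>" "\<langle>b\<rangle> \<otimes> ?c \<otimes> \<langle>b\<rangle>"]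
        tensor_assoc [of "\<langle>a \<odot> a\<rangle>" "\<langle>b\<rangle>" "?c \<otimes> \<langle>b\<rangle>"]
      by simp
    moreover have "(\<langle>a\<rangle> \<otimes> ?c \<otimes> \<langle>b \<odot> a \<odot> b\<rangle>) \<cdot> (\<langle>a \<odot> a \<odot> b\<rangle> \<otimes> ?c \<otimes> \<langle>b\<rangle>)
        = \<langle>a\<rangle> \<otimes> ?c \<otimes> ?c \<otimes> \<langle>b\<rangle>"
      using interchange [of "\<langle>a \<odot> a \<odot> b\<rangle>" "\<langle>a\<rangle> \<otimes> ?c" "?c \<otimes> \<langle>b\<rangle>" "\<langle>b \<odot> a \<odot> b\<rangle>"] by simp
    ultimately show ?thesis by (simp flip: compose_assoc')
  qed
  have L: "(\<langle>a \<odot> b\<rangle> \<otimes> ?\<Delta>) \<cdot> ?\<Delta> = ?W \<cdot> (((\<langle>a\<rangle> \<otimes> d) \<cdot> d) \<otimes> ((\<langle>b\<rangle> \<otimes> d') \<cdot> d'))"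
  proof -
    have "\<langle>a \<odot> b\<rangle> \<otimes> ?\<Delta> = (\<langle>a \<odot> b \<odot> a\<rangle> \<otimes> ?c \<otimes> \<langle>b\<rangle>) \<cdot> (\<langle>a \<odot> b\<rangle> \<otimes> d \<otimes> d')"
      using interchange [of "\<langle>a \<odot> b\<rangle>" "\<langle>a \<odot> b\<rangle>" "d \<otimes> d'" "\<langle>a\<rangle> \<otimes> ?c \<otimes> \<langle>b\<rangle>"]
        tensor_assoc [of "\<langle>a \<odot> b\<rangle>" "\<langle>a\<rangle>" "?c \<otimes> \<langle>b\<rangle>"] by (simp add: tensor_\<delta>_def)
    moreover have 2: "(\<langle>a \<odot> b\<rangle> \<otimes> d \<otimes> d') \<cdot> (\<langle>a\<rangle> \<otimes> ?c \<otimes> \<langle>b\<rangle>)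
        = \<langle>a\<rangle> \<otimes> ((?c \<otimes> \<langle>a\<rangle>) \<cdot> ((\<langle>a\<rangle> \<otimes> ?c) \<cdot> (d \<otimes> \<langle>b\<rangle>))) \<otimes> d'"
      using interchange [of "\<langle>a\<rangle>" "\<langle>a\<rangle>" "?c \<otimes> \<langle>b\<rangle>" "\<langle>b\<rangle> \<otimes> d \<otimes> d'"]
        interchange [of ?c "\<langle>b\<rangle> \<otimes> d" "\<langle>b\<rangle>" d'] tensor_assoc [of "\<langle>a\<rangle>" "\<langle>b\<rangle>" "d \<otimes> d'"]
      by (simp add: n1)
    moreover have 3: "\<langle>a\<rangle> \<otimes> ((?c \<otimes> \<langle>a\<rangle>) \<cdot> ((\<langle>a\<rangle> \<otimes> ?c) \<cdot> (d \<otimes> \<langle>b\<rangle>))) \<otimes> d'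
        = (\<langle>a\<rangle> \<otimes> ((?c \<otimes> \<langle>a\<rangle>) \<cdot> (\<langle>a\<rangle> \<otimes> ?c)) \<otimes> \<langle>b \<odot> b\<rangle>) \<cdot> (\<langle>a\<rangle> \<otimes> d \<otimes> \<langle>b\<rangle> \<otimes> d')"
      using interchange [of "\<langle>a\<rangle>" "\<langle>a\<rangle>" "d \<otimes> \<langle>b\<rangle> \<otimes> d'" "((?c \<otimes> \<langle>a\<rangle>) \<cdot> (\<langle>a\<rangle> \<otimes> ?c)) \<otimes> \<langle>b \<odot> b\<rangle>"]
        interchange [of "d \<otimes> \<langle>b\<rangle>" "(?c \<otimes> \<langle>a\<rangle>) \<cdot> (\<langle>a\<rangle> \<otimes> ?c)" d' "\<langle>b \<odot> b\<rangle>"]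
      by simp
    moreover have "(\<langle>a\<rangle> \<otimes> d \<otimes> \<langle>b\<rangle> \<otimes> d') \<cdot> (d \<otimes> d') = ((\<langle>a\<rangle> \<otimes> d) \<cdot> d) \<otimes> ((\<langle>b\<rangle> \<otimes> d') \<cdot> d')"
      using interchange [of d "\<langle>a\<rangle> \<otimes> d" d' "\<langle>b\<rangle> \<otimes> d'"] by simp
    ultimately have "(\<langle>a \<odot> b\<rangle> \<otimes> ?\<Delta>) \<cdot> ?\<Delta> = (\<langle>a \<odot> b \<odot> a\<rangle> \<otimes> ?c \<otimes> \<langle>b\<rangle>) \<cdot>
        ((\<langle>a\<rangle> \<otimes> ((?c \<otimes> \<langle>a\<rangle>) \<cdot> (\<langle>a\<rangle> \<otimes> ?c)) \<otimes> \<langle>b \<odot> b\<rangle>) \<cdot> (((\<langle>a\<rangle> \<otimes> d) \<cdot> d) \<otimes> ((\<langle>b\<rangle> \<otimes> d') \<cdot> d')))"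
      by (simp add: tensor_\<delta>_def compose_tail [OF 2 [unfolded 3]])
    then show ?thesis
      by (simp flip: w1)
  qed
  have R: "(?\<Delta> \<otimes> \<langle>a \<odot> b\<rangle>) \<cdot> ?\<Delta> = ?W \<cdot> (((d \<otimes> \<langle>a\<rangle>) \<cdot> d) \<otimes> ((d' \<otimes> \<langle>b\<rangle>) \<cdot> d'))"
  proof -
    have "?\<Delta> \<otimes> \<langle>a \<odot> b\<rangle> = (\<langle>a\<rangle> \<otimes> ?c \<otimes> \<langle>b \<odot> a \<odot> b\<rangle>) \<cdot> (d \<otimes> d' \<otimes> \<langle>a \<odot> b\<rangle>)"
      using interchange [of "d \<otimes> d'" "\<langle>a\<rangle> \<otimes> ?c \<otimes> \<langle>b\<rangle>" "\<langle>a \<odot> b\<rangle>" "\<langle>a \<odot> b\<rangle>"]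
      by (simp add: tensor_\<delta>_def)
    moreover have 2: "(d \<otimes> d' \<otimes> \<langle>a \<odot> b\<rangle>) \<cdot> (\<langle>a\<rangle> \<otimes> ?c \<otimes> \<langle>b\<rangle>)
        = d \<otimes> ((\<langle>b\<rangle> \<otimes> ?c) \<cdot> ((?c \<otimes> \<langle>b\<rangle>) \<cdot> (\<langle>a\<rangle> \<otimes> d'))) \<otimes> \<langle>b\<rangle>"
      using interchange [of "\<langle>a\<rangle>" d "?c \<otimes> \<langle>b\<rangle>" "d' \<otimes> \<langle>a \<odot> b\<rangle>"]
        interchange [of ?c "d' \<otimes> \<langle>a\<rangle>" "\<langle>b\<rangle>" "\<langle>b\<rangle>"] by (simp add: n2)
    moreover have 3: "d \<otimes> ((\<langle>b\<rangle> \<otimes> ?c) \<cdot> ((?c \<otimes> \<langle>b\<rangle>) \<cdot> (\<langle>a\<rangle> \<otimes> d'))) \<otimes> \<langle>b\<rangle>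
        = (\<langle>a \<odot> a\<rangle> \<otimes> ((\<langle>b\<rangle> \<otimes> ?c) \<cdot> (?c \<otimes> \<langle>b\<rangle>)) \<otimes> \<langle>b\<rangle>) \<cdot> (d \<otimes> \<langle>a\<rangle> \<otimes> d' \<otimes> \<langle>b\<rangle>)"
      using interchange [of d "\<langle>a \<odot> a\<rangle>" "\<langle>a\<rangle> \<otimes> d' \<otimes> \<langle>b\<rangle>" "((\<langle>b\<rangle> \<otimes> ?c) \<cdot> (?c \<otimes> \<langle>b\<rangle>)) \<otimes> \<langle>b\<rangle>"]
        interchange [of "\<langle>a\<rangle> \<otimes> d'" "(\<langle>b\<rangle> \<otimes> ?c) \<cdot> (?c \<otimes> \<langle>b\<rangle>)" "\<langle>b\<rangle>" "\<langle>b\<rangle>"]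
      by simp
    moreover have "(d \<otimes> \<langle>a\<rangle> \<otimes> d' \<otimes> \<langle>b\<rangle>) \<cdot> (d \<otimes> d') = ((d \<otimes> \<langle>a\<rangle>) \<cdot> d) \<otimes> ((d' \<otimes> \<langle>b\<rangle>) \<cdot> d')"
      using interchange [of d "d \<otimes> \<langle>a\<rangle>" d' "d' \<otimes> \<langle>b\<rangle>"] by simp
    ultimately have "(?\<Delta> \<otimes> \<langle>a \<odot> b\<rangle>) \<cdot> ?\<Delta> = (\<langle>a\<rangle> \<otimes> ?c \<otimes> \<langle>b \<odot> a \<odot> b\<rangle>) \<cdot>
        ((\<langle>a \<odot> a\<rangle> \<otimes> ((\<langle>b\<rangle> \<otimes> ?c) \<cdot> (?c \<otimes> \<langle>b\<rangle>)) \<otimes> \<langle>b\<rangle>) \<cdot> (((d \<otimes> \<langle>a\<rangle>) \<cdot> d) \<otimes> ((d' \<otimes> \<langle>b\<rangle>) \<cdot> d')))"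
      by (simp add: tensor_\<delta>_def compose_tail [OF 2 [unfolded 3]])
    then show ?thesis
      by (simp flip: w2)
  qed
  have "(\<langle>a \<odot> b\<rangle> \<otimes> ?\<Delta>) \<cdot> ?\<Delta> = (?\<Delta> \<otimes> \<langle>a \<odot> b\<rangle>) \<cdot> ?\<Delta>"
    unfolding L R coassociative [OF D] coassociative [OF E] ..
  moreover have "(\<langle>a \<odot> b\<rangle> \<otimes> e \<otimes> e') \<cdot> ?\<Delta> = \<langle>a \<odot> b\<rangle>"
  proof -
    have "(\<langle>a \<odot> b\<rangle> \<otimes> e \<otimes> e') \<cdot> ?\<Delta> = (\<langle>a\<rangle> \<otimes> ((\<langle>b\<rangle> \<otimes> e) \<cdot> ?c) \<otimes> e') \<cdot> (d \<otimes> d')"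
      using tensor_assoc [of "\<langle>a\<rangle>" "\<langle>b\<rangle>" "e \<otimes> e'"]
        interchange [of "\<langle>a\<rangle>" "\<langle>a\<rangle>" "?c \<otimes> \<langle>b\<rangle>" "\<langle>b\<rangle> \<otimes> e \<otimes> e'"]
        interchange [of ?c "\<langle>b\<rangle> \<otimes> e" "\<langle>b\<rangle>" e']
      by (simp add: tensor_\<delta>_def flip: compose_assoc')
    also have "(\<langle>b\<rangle> \<otimes> e) \<cdot> ?c = e \<otimes> \<langle>b\<rangle>"
      using symmetry_natural' [of e "\<langle>b\<rangle>" \<one> b] by simp
    finally show ?thesis
      using interchange [of d "\<langle>a\<rangle> \<otimes> e" d' "\<langle>b\<rangle> \<otimes> e'"] by simp
  qed
  moreover have "((e \<otimes> e') \<otimes> \<langle>a \<odot> b\<rangle>) \<cdot> ?\<Delta> = \<langle>a \<odot> b\<rangle>"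
  proof -
    have "((e \<otimes> e') \<otimes> \<langle>a \<odot> b\<rangle>) \<cdot> ?\<Delta> = (e \<otimes> ((e' \<otimes> \<langle>a\<rangle>) \<cdot> ?c) \<otimes> \<langle>b\<rangle>) \<cdot> (d \<otimes> d')"
      by (simp add: tensor_\<delta>_def interchange [of "\<langle>a\<rangle>" e "?c \<otimes> \<langle>b\<rangle>" "e' \<otimes> \<langle>a \<odot> b\<rangle>"]
          interchange [of ?c "e' \<otimes> \<langle>a\<rangle>" "\<langle>b\<rangle>" "\<langle>b\<rangle>", simplified] flip: compose_assoc')
    also have "(e' \<otimes> \<langle>a\<rangle>) \<cdot> ?c = \<langle>a\<rangle> \<otimes> e'"
      using symmetry_natural' [of "\<langle>a\<rangle>" e' a \<one>] by simp
    finally show ?thesis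
      using interchange [of d "e \<otimes> \<langle>a\<rangle>" d' "e' \<otimes> \<langle>b\<rangle>"] by simp
  qed
  ultimately show ?thesis
    by (simp add: is_coalgebra_def Hom_iff tensor_\<delta>_simps [OF D E])
qed

text \<open>Swapping the two halves of \<open>a \<otimes> b \<otimes> a \<otimes> b\<close> amounts to swapping the two copies of \<open>a\<close> and the
  two copies of \<open>b\<close>.\<close>

lemma tensor_cocommutative:
  assumes D: "is_coalgebra a e d" "\<gamma> a a \<cdot> d = d" and E: "is_coalgebra b e' d'" "\<gamma> b b \<cdot> d' = d'"
  shows "\<gamma> (a \<odot> b) (a \<odot> b) \<cdot> tensor_\<delta> a d b d' = tensor_\<delta> a d b d'"
proof -
  note [simp] = coalgebra_simps [OF D(1)] coalgebra_simps [OF E(1)]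
  let ?c = "\<gamma> a b"
  have 1: "\<gamma> (a \<odot> b) (a \<odot> b) = (\<langle>a\<rangle> \<otimes> ?c \<otimes> \<langle>b\<rangle>) \<cdot> ((\<gamma> a a \<otimes> \<gamma> b b) \<cdot> (\<langle>a\<rangle> \<otimes> \<gamma> b a \<otimes> \<langle>b\<rangle>))"
  proof -
    have "\<gamma> a (a \<odot> b) \<otimes> \<langle>b\<rangle> = (\<langle>a\<rangle> \<otimes> ?c \<otimes> \<langle>b\<rangle>) \<cdot> (\<gamma> a a \<otimes> \<langle>b \<odot> b\<rangle>)"
      using interchange [of "\<gamma> a a \<otimes> \<langle>b\<rangle>" "\<langle>a\<rangle> \<otimes> ?c" "\<langle>b\<rangle>" "\<langle>b\<rangle>"]
      by (simp add: symmetry_hexagon [of a a b])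
    moreover have "\<langle>a\<rangle> \<otimes> \<gamma> b (a \<odot> b) = (\<langle>a \<odot> a\<rangle> \<otimes> \<gamma> b b) \<cdot> (\<langle>a\<rangle> \<otimes> \<gamma> b a \<otimes> \<langle>b\<rangle>)"
      using interchange [of "\<langle>a\<rangle>" "\<langle>a\<rangle>" "\<gamma> b a \<otimes> \<langle>b\<rangle>" "\<langle>a\<rangle> \<otimes> \<gamma> b b"]
        tensor_assoc [of "\<langle>a\<rangle>" "\<langle>a\<rangle>" "\<gamma> b b"] by (simp add: symmetry_hexagon [of b a b])
    moreover have 2: "(\<gamma> a a \<otimes> \<langle>b \<odot> b\<rangle>) \<cdot> (\<langle>a \<odot> a\<rangle> \<otimes> \<gamma> b b) = \<gamma> a a \<otimes> \<gamma> b b"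
      by (simp add: interchange)
    ultimately show ?thesis
      by (simp add: symmetry_hexagon' [of a b "a \<odot> b"] compose_tail [OF 2])
  qed
  have "(\<langle>a\<rangle> \<otimes> \<gamma> b a \<otimes> \<langle>b\<rangle>) \<cdot> (\<langle>a\<rangle> \<otimes> ?c \<otimes> \<langle>b\<rangle>) = \<langle>a \<odot> a \<odot> b \<odot> b\<rangle>"
    by (simp add: interchange)
  then have "\<gamma> (a \<odot> b) (a \<odot> b) \<cdot> (\<langle>a\<rangle> \<otimes> ?c \<otimes> \<langle>b\<rangle>) = (\<langle>a\<rangle> \<otimes> ?c \<otimes> \<langle>b\<rangle>) \<cdot> (\<gamma> a a \<otimes> \<gamma> b b)"
    unfolding 1 by simp
  moreover have "(\<gamma> a a \<otimes> \<gamma> b b) \<cdot> (d \<otimes> d') = d \<otimes> d'"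
    by (simp add: interchange D E)
  ultimately show ?thesis
    by (simp add: tensor_\<delta>_def flip: compose_assoc') (simp add: tensor_\<delta>_def)
qed

end

section \<open>Generalized elements over a cocommutative coalgebra\<close>

text \<open>An element \<open>(Y, p)\<close> of an object \<open>S\<close> is an arrow \<open>p\<close> from
  \<open>X \<otimes> Y\<close> to \<open>S\<close>. It depends on a point of \<open>X\<close>, which may
  be duplicated and discarded, and linearly on \<open>Y\<close>, so that only \<open>Y\<close> has to be
  recorded along with \<open>p\<close>.\<close>

type_synonym ('o, 'm) element = "'o \<times> 'm"

context strict_symmetric_monoidal_category
begin

definition typ_of :: "('o, 'm) element \<Rightarrow> 'o"
  where "typ_of P = target C (snd P)"

definition app :: "'m \<Rightarrow> ('o, 'm) element \<Rightarrow> ('o, 'm) element"  (infixr "\<bullet>" 75)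
  where "F \<bullet> P = (fst P, F \<cdot> snd P)"

lemma fst_app [simp]: "fst (F \<bullet> P) = fst P"
  by (simp add: app_def)

lemma slide:
  assumes "f \<in> Ar C" "g \<in> Ar C"
  shows "(f \<otimes> \<langle>target C g\<rangle>) \<cdot> (\<langle>source C f\<rangle> \<otimes> g) = f \<otimes> g"
    and "(\<langle>target C f\<rangle> \<otimes> g) \<cdot> (f \<otimes> \<langle>source C g\<rangle>) = f \<otimes> g"
  using assms by (auto simp: interchange)

end

text \<open>The coalgebra \<open>X\<close> is the space of parameters of the elements. Cocommutativity makes the two
  copies of a duplicated point interchangeable.\<close>

locale stage = strict_symmetric_monoidal_category C
  for C :: "('o, 'm) monoidal_data" (structure) +
  fixes X :: 'o and e d :: 'm
  assumes coalgebra: "is_coalgebra X e d"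
    and cocommutative_stage: "\<gamma> X X \<cdot> d = d"
begin

definition el :: "('o, 'm) element \<Rightarrow> bool"
  where "el P \<longleftrightarrow> fst P \<in> Ob C \<and> snd P \<in> Ar C \<and> source C (snd P) = X \<odot> fst P"

text \<open>The point of \<open>X\<close> is duplicated, and its second copy is carried past the linear input
  \<open>Y\<close> of \<open>P\<close>.\<close>

definition pair :: "('o, 'm) element \<Rightarrow> ('o, 'm) element \<Rightarrow> ('o, 'm) element"  (infixr "\<boxtimes>" 70)
  where "P \<boxtimes> Q = (fst P \<odot> fst Q,
    (snd P \<otimes> snd Q) \<cdot> ((\<langle>X\<rangle> \<otimes> \<gamma> X (fst P) \<otimes> \<langle>fst Q\<rangle>) \<cdot> (d \<otimes> \<langle>fst P \<odot> fst Q\<rangle>)))"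

definition unit_el :: "('o, 'm) element"  ("\<iota>")
  where "\<iota> = (\<one>, e)"

text \<open>The tautological element of \<open>X\<close>; an arrow from \<open>X\<close> is its own value at this
  element.\<close>

definition generic :: "('o, 'm) element"
  where "generic = (\<one>, \<langle>X\<rangle>)"

definition linear :: "'o \<Rightarrow> ('o, 'm) element"
  where "linear Y = (Y, e \<otimes> \<langle>Y\<rangle>)"

lemmas stage_simps [simp] = coalgebra_simps [OF coalgebra]

lemma el_D [simp]:
  assumes "el P"
  shows "fst P \<in> Ob C" "snd P \<in> Ar C" "source C (snd P) = X \<odot> fst P" "target C (snd P) = typ_of P"
    "typ_of P \<in> Ob C"
  using assms by (auto simp: el_def typ_of_def)

lemma fst_pair [simp]: "fst (P \<boxtimes> Q) = fst P \<odot> fst Q"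
  by (simp add: pair_def)

lemma el_pair [simp]:
  assumes "el P" "el Q"
  shows "el (P \<boxtimes> Q)" "typ_of (P \<boxtimes> Q) = typ_of P \<odot> typ_of Q"
  using assms
  by (simp_all add: el_def typ_of_def pair_def del: el_D)

lemma el_app [simp]:
  assumes "el P" "F \<in> Ar C" "source C F = typ_of P"
  shows "el (F \<bullet> P)" "typ_of (F \<bullet> P) = target C F"
  using assms
  by (simp_all add: el_def typ_of_def app_def del: el_D)

lemma el_special [simp]:
  shows "el \<iota>" "typ_of \<iota> = \<one>" "fst \<iota> = \<one>" "el generic" "typ_of generic = X" "fst generic = \<one>"
    and "Y \<in> Ob C \<Longrightarrow> el (linear Y)" "Y \<in> Ob C \<Longrightarrow> typ_of (linear Y) = Y" "fst (linear Y) = Y"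
  by (simp_all add: el_def typ_of_def unit_el_def generic_def linear_def del: el_D)

lemma app_app [simp]:
  assumes "el P" "F \<in> Ar C" "G \<in> Ar C" "source C F = target C G" "source C G = typ_of P"
  shows "(F \<cdot> G) \<bullet> P = F \<bullet> G \<bullet> P"
  using assms by (simp add: app_def)

lemma app_ident [simp]: "el P \<Longrightarrow> typ_of P = S \<Longrightarrow> \<langle>S\<rangle> \<bullet> P = P"
  by (simp add: app_def)

lemma app_pair [simp]:
  assumes "el P" "el Q" "F \<in> Ar C" "G \<in> Ar C" "source C F = typ_of P" "source C G = typ_of Q"
  shows "(F \<otimes> G) \<bullet> (P \<boxtimes> Q) = (F \<bullet> P) \<boxtimes> (G \<bullet> Q)"
proof -
  have "(F \<otimes> G) \<cdot> (snd P \<otimes> snd Q) = (F \<cdot> snd P) \<otimes> (G \<cdot> snd Q)"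
    using assms by (simp add: interchange)
  from compose_tail [OF this] show ?thesis
    using assms by (simp add: app_def pair_def)
qed

text \<open>Either side duplicates the point twice, so this is coassociativity of \<open>d\<close> together with
  naturality of the symmetry.\<close>

lemma pair_assoc [simp]:
  assumes P: "el P" and Q: "el Q" and R: "el R"
  shows "(P \<boxtimes> Q) \<boxtimes> R = P \<boxtimes> (Q \<boxtimes> R)"
proof -
  obtain Y p Z q W r where PQR: "P = (Y, p)" "Q = (Z, q)" "R = (W, r)"
    by (metis surj_pair)
  note [simp] = el_D [OF P, unfolded PQR fst_conv snd_conv] el_D [OF Q, unfolded PQR fst_conv snd_conv]
    el_D [OF R, unfolded PQR fst_conv snd_conv] ident_merge
  let ?A = "(\<langle>X\<rangle> \<otimes> \<gamma> X Y \<otimes> \<langle>Z\<rangle>) \<cdot> (d \<otimes> \<langle>Y \<odot> Z\<rangle>)"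
  let ?B = "(\<langle>X\<rangle> \<otimes> \<gamma> X Z \<otimes> \<langle>W\<rangle>) \<cdot> (d \<otimes> \<langle>Z \<odot> W\<rangle>)"
  let ?M = "(\<langle>X \<odot> Y \<odot> X\<rangle> \<otimes> \<gamma> X Z \<otimes> \<langle>W\<rangle>) \<cdot>
      ((\<langle>X\<rangle> \<otimes> \<gamma> X Y \<otimes> \<langle>X \<odot> Z \<odot> W\<rangle>) \<cdot> (\<langle>X \<odot> X\<rangle> \<otimes> \<gamma> X Y \<otimes> \<langle>Z \<odot> W\<rangle>))"
  have 1: "(\<langle>X\<rangle> \<otimes> \<gamma> X (Y \<odot> Z) \<otimes> \<langle>W\<rangle>)
      = (\<langle>X \<odot> Y\<rangle> \<otimes> \<gamma> X Z \<otimes> \<langle>W\<rangle>) \<cdot> (\<langle>X\<rangle> \<otimes> \<gamma> X Y \<otimes> \<langle>Z \<odot> W\<rangle>)"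
    using interchange [of "\<gamma> X Y \<otimes> \<langle>Z\<rangle>" "\<langle>Y\<rangle> \<otimes> \<gamma> X Z" "\<langle>W\<rangle>" "\<langle>W\<rangle>"]
      interchange [of "\<langle>X\<rangle>" "\<langle>X\<rangle>" "\<gamma> X Y \<otimes> \<langle>Z \<odot> W\<rangle>" "\<langle>Y\<rangle> \<otimes> \<gamma> X Z \<otimes> \<langle>W\<rangle>"]
    by (simp add: symmetry_hexagon)
  have 2: "(d \<otimes> \<langle>Y \<odot> Z \<odot> X \<odot> W\<rangle>) \<cdot> (\<langle>X \<odot> Y\<rangle> \<otimes> \<gamma> X Z \<otimes> \<langle>W\<rangle>)
      = (\<langle>X \<odot> X \<odot> Y\<rangle> \<otimes> \<gamma> X Z \<otimes> \<langle>W\<rangle>) \<cdot> (d \<otimes> \<langle>Y \<odot> X \<odot> Z \<odot> W\<rangle>)"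
    using slide [of d "\<langle>Y\<rangle> \<otimes> \<gamma> X Z \<otimes> \<langle>W\<rangle>"] by simp
  have 3: "(d \<otimes> \<langle>Y \<odot> X \<odot> Z \<odot> W\<rangle>) \<cdot> (\<langle>X\<rangle> \<otimes> \<gamma> X Y \<otimes> \<langle>Z \<odot> W\<rangle>)
      = (\<langle>X \<odot> X\<rangle> \<otimes> \<gamma> X Y \<otimes> \<langle>Z \<odot> W\<rangle>) \<cdot> (d \<otimes> \<langle>X \<odot> Y \<odot> Z \<odot> W\<rangle>)"
    using slide [of d "\<gamma> X Y \<otimes> \<langle>Z \<odot> W\<rangle>"] by simp
  have 4: "(\<langle>X\<rangle> \<otimes> \<gamma> X Y \<otimes> \<langle>Z \<odot> X \<odot> W\<rangle>) \<cdot> (\<langle>X \<odot> X \<odot> Y\<rangle> \<otimes> \<gamma> X Z \<otimes> \<langle>W\<rangle>)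
      = (\<langle>X \<odot> Y \<odot> X\<rangle> \<otimes> \<gamma> X Z \<otimes> \<langle>W\<rangle>) \<cdot> (\<langle>X\<rangle> \<otimes> \<gamma> X Y \<otimes> \<langle>X \<odot> Z \<odot> W\<rangle>)"
    using slide [of "\<langle>X\<rangle> \<otimes> \<gamma> X Y" "\<gamma> X Z \<otimes> \<langle>W\<rangle>"] by simp
  have 5: "(d \<otimes> \<langle>X \<odot> Y \<odot> Z \<odot> W\<rangle>) \<cdot> (d \<otimes> \<langle>Y \<odot> Z \<odot> W\<rangle>) = ((d \<otimes> \<langle>X\<rangle>) \<cdot> d) \<otimes> \<langle>Y \<odot> Z \<odot> W\<rangle>"
    using interchange [of d "d \<otimes> \<langle>X\<rangle>" "\<langle>Y \<odot> Z \<odot> W\<rangle>" "\<langle>Y \<odot> Z \<odot> W\<rangle>"] by simp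
  have 6: "?A \<otimes> \<langle>X \<odot> W\<rangle> = (\<langle>X\<rangle> \<otimes> \<gamma> X Y \<otimes> \<langle>Z \<odot> X \<odot> W\<rangle>) \<cdot> (d \<otimes> \<langle>Y \<odot> Z \<odot> X \<odot> W\<rangle>)"
    using interchange [of "d \<otimes> \<langle>Y \<odot> Z\<rangle>" "\<langle>X\<rangle> \<otimes> \<gamma> X Y \<otimes> \<langle>Z\<rangle>" "\<langle>X \<odot> W\<rangle>" "\<langle>X \<odot> W\<rangle>"] by simp
  have 7: "\<langle>X \<odot> Y\<rangle> \<otimes> ?B = (\<langle>X \<odot> Y \<odot> X\<rangle> \<otimes> \<gamma> X Z \<otimes> \<langle>W\<rangle>) \<cdot> (\<langle>X \<odot> Y\<rangle> \<otimes> d \<otimes> \<langle>Z \<odot> W\<rangle>)"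
    using interchange [of "\<langle>X \<odot> Y\<rangle>" "\<langle>X \<odot> Y\<rangle>" "d \<otimes> \<langle>Z \<odot> W\<rangle>" "\<langle>X\<rangle> \<otimes> \<gamma> X Z \<otimes> \<langle>W\<rangle>"] by simp
  have 8: "(\<langle>X \<odot> Y\<rangle> \<otimes> d \<otimes> \<langle>Z \<odot> W\<rangle>) \<cdot> (\<langle>X\<rangle> \<otimes> \<gamma> X Y \<otimes> \<langle>Z \<odot> W\<rangle>)
      = (\<langle>X\<rangle> \<otimes> \<gamma> X Y \<otimes> \<langle>X \<odot> Z \<odot> W\<rangle>) \<cdot>
        ((\<langle>X \<odot> X\<rangle> \<otimes> \<gamma> X Y \<otimes> \<langle>Z \<odot> W\<rangle>) \<cdot> (\<langle>X\<rangle> \<otimes> d \<otimes> \<langle>Y \<odot> Z \<odot> W\<rangle>))"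
  proof -
    have "(\<langle>Y\<rangle> \<otimes> d) \<cdot> \<gamma> X Y = (\<gamma> X Y \<otimes> \<langle>X\<rangle>) \<cdot> ((\<langle>X\<rangle> \<otimes> \<gamma> X Y) \<cdot> (d \<otimes> \<langle>Y\<rangle>))"
      using symmetry_natural' [of d "\<langle>Y\<rangle>" "X \<odot> X" Y] by (simp add: symmetry_hexagon')
    then have "(\<langle>Y\<rangle> \<otimes> d \<otimes> \<langle>Z \<odot> W\<rangle>) \<cdot> (\<gamma> X Y \<otimes> \<langle>Z \<odot> W\<rangle>)
        = ((\<gamma> X Y \<otimes> \<langle>X\<rangle>) \<cdot> ((\<langle>X\<rangle> \<otimes> \<gamma> X Y) \<cdot> (d \<otimes> \<langle>Y\<rangle>))) \<otimes> \<langle>Z \<odot> W\<rangle>"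
      using interchange [of "\<gamma> X Y" "\<langle>Y\<rangle> \<otimes> d" "\<langle>Z \<odot> W\<rangle>" "\<langle>Z \<odot> W\<rangle>"] by simp
    also have "\<dots> = (\<gamma> X Y \<otimes> \<langle>X \<odot> Z \<odot> W\<rangle>) \<cdot>
        ((\<langle>X\<rangle> \<otimes> \<gamma> X Y \<otimes> \<langle>Z \<odot> W\<rangle>) \<cdot> (d \<otimes> \<langle>Y \<odot> Z \<odot> W\<rangle>))"
      using interchange [of "(\<langle>X\<rangle> \<otimes> \<gamma> X Y) \<cdot> (d \<otimes> \<langle>Y\<rangle>)" "\<gamma> X Y \<otimes> \<langle>X\<rangle>" "\<langle>Z \<odot> W\<rangle>" "\<langle>Z \<odot> W\<rangle>"]
        interchange [of "d \<otimes> \<langle>Y\<rangle>" "\<langle>X\<rangle> \<otimes> \<gamma> X Y" "\<langle>Z \<odot> W\<rangle>" "\<langle>Z \<odot> W\<rangle>"] by simp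
    finally have *: "(\<langle>Y\<rangle> \<otimes> d \<otimes> \<langle>Z \<odot> W\<rangle>) \<cdot> (\<gamma> X Y \<otimes> \<langle>Z \<odot> W\<rangle>) = \<dots>" .
    have "(\<langle>X \<odot> Y\<rangle> \<otimes> d \<otimes> \<langle>Z \<odot> W\<rangle>) \<cdot> (\<langle>X\<rangle> \<otimes> \<gamma> X Y \<otimes> \<langle>Z \<odot> W\<rangle>)
        = \<langle>X\<rangle> \<otimes> ((\<langle>Y\<rangle> \<otimes> d \<otimes> \<langle>Z \<odot> W\<rangle>) \<cdot> (\<gamma> X Y \<otimes> \<langle>Z \<odot> W\<rangle>))"
      using interchange [of "\<langle>X\<rangle>" "\<langle>X\<rangle>" "\<gamma> X Y \<otimes> \<langle>Z \<odot> W\<rangle>" "\<langle>Y\<rangle> \<otimes> d \<otimes> \<langle>Z \<odot> W\<rangle>"] by simp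
    then show ?thesis
      unfolding * using interchange [of "\<langle>X\<rangle>" "\<langle>X\<rangle>"
          "(\<langle>X\<rangle> \<otimes> \<gamma> X Y \<otimes> \<langle>Z \<odot> W\<rangle>) \<cdot> (d \<otimes> \<langle>Y \<odot> Z \<odot> W\<rangle>)" "\<gamma> X Y \<otimes> \<langle>X \<odot> Z \<odot> W\<rangle>"]
        interchange [of "\<langle>X\<rangle>" "\<langle>X\<rangle>" "d \<otimes> \<langle>Y \<odot> Z \<odot> W\<rangle>" "\<langle>X\<rangle> \<otimes> \<gamma> X Y \<otimes> \<langle>Z \<odot> W\<rangle>"] by simp
  qed
  have 9: "(\<langle>X\<rangle> \<otimes> d \<otimes> \<langle>Y \<odot> Z \<odot> W\<rangle>) \<cdot> (d \<otimes> \<langle>Y \<odot> Z \<odot> W\<rangle>) = ((d \<otimes> \<langle>X\<rangle>) \<cdot> d) \<otimes> \<langle>Y \<odot> Z \<odot> W\<rangle>"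
    using interchange [of d "\<langle>X\<rangle> \<otimes> d" "\<langle>Y \<odot> Z \<odot> W\<rangle>" "\<langle>Y \<odot> Z \<odot> W\<rangle>"] coassociative [OF coalgebra] by simp
  have L: "(?A \<otimes> \<langle>X \<odot> W\<rangle>) \<cdot> ((\<langle>X\<rangle> \<otimes> \<gamma> X (Y \<odot> Z) \<otimes> \<langle>W\<rangle>) \<cdot> (d \<otimes> \<langle>Y \<odot> Z \<odot> W\<rangle>))
     = ?M \<cdot> (((d \<otimes> \<langle>X\<rangle>) \<cdot> d) \<otimes> \<langle>Y \<odot> Z \<odot> W\<rangle>)"
    unfolding 1 6 by (simp add: 5 compose_tail [OF 2] compose_tail [OF 3] compose_tail [OF 4])
  have R: "(\<langle>X \<odot> Y\<rangle> \<otimes> ?B) \<cdot> ((\<langle>X\<rangle> \<otimes> \<gamma> X Y \<otimes> \<langle>Z \<odot> W\<rangle>) \<cdot> (d \<otimes> \<langle>Y \<odot> Z \<odot> W\<rangle>))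
     = ?M \<cdot> (((d \<otimes> \<langle>X\<rangle>) \<cdot> d) \<otimes> \<langle>Y \<odot> Z \<odot> W\<rangle>)"
    unfolding 7 by (simp add: 9 compose_tail [OF 8])
  have "((p \<otimes> q) \<cdot> ?A) \<otimes> r = (p \<otimes> q \<otimes> r) \<cdot> (?A \<otimes> \<langle>X \<odot> W\<rangle>)"
    using interchange [of ?A "p \<otimes> q" "\<langle>X \<odot> W\<rangle>" r] by simp
  moreover have "p \<otimes> ((q \<otimes> r) \<cdot> ?B) = (p \<otimes> q \<otimes> r) \<cdot> (\<langle>X \<odot> Y\<rangle> \<otimes> ?B)"
    using interchange [of "\<langle>X \<odot> Y\<rangle>" p ?B "q \<otimes> r"] by simp
  moreover have "\<langle>X \<odot> Y\<rangle> \<otimes> ?B \<in> Ar C" "source C (\<langle>X \<odot> Y\<rangle> \<otimes> ?B) = X \<odot> Y \<odot> X \<odot> Z \<odot> W"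
    "target C (\<langle>X \<odot> Y\<rangle> \<otimes> ?B) = X \<odot> Y \<odot> X \<odot> Z \<odot> X \<odot> W"
    by simp_all
  ultimately show ?thesis
    unfolding PQR pair_def fst_conv snd_conv using L R
    by (simp del: tensor_assoc ident_merge)
qed

lemma pair_unit [simp]:
  assumes P: "el P"
  shows "\<iota> \<boxtimes> P = P" "P \<boxtimes> \<iota> = P"
proof -
  obtain Y p where Pp: "P = (Y, p)" by (metis surj_pair)
  note [simp] = el_D [OF P, unfolded Pp fst_conv snd_conv] ident_merge
  have 1: "e \<otimes> p = p \<cdot> (e \<otimes> \<langle>X \<odot> Y\<rangle>)"
    using interchange [of e "\<langle>\<one>\<rangle>" "\<langle>X \<odot> Y\<rangle>" p] by simp
  have 2: "(e \<otimes> \<langle>X \<odot> Y\<rangle>) \<cdot> (d \<otimes> \<langle>Y\<rangle>) = \<langle>X \<odot> Y\<rangle>"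
    using interchange [of d "e \<otimes> \<langle>X\<rangle>" "\<langle>Y\<rangle>" "\<langle>Y\<rangle>"] by simp
  show "\<iota> \<boxtimes> P = P"
    by (simp add: pair_def unit_el_def Pp 1 2)
  have 3: "(p \<otimes> e) \<cdot> (\<langle>X\<rangle> \<otimes> \<gamma> X Y) = p \<cdot> (\<langle>X\<rangle> \<otimes> e \<otimes> \<langle>Y\<rangle>)"
  proof -
    have "(\<langle>Y\<rangle> \<otimes> e) \<cdot> \<gamma> X Y = e \<otimes> \<langle>Y\<rangle>"
      using symmetry_natural' [of e "\<langle>Y\<rangle>" \<one> Y] by simp
    then have "(\<langle>X \<odot> Y\<rangle> \<otimes> e) \<cdot> (\<langle>X\<rangle> \<otimes> \<gamma> X Y) = \<langle>X\<rangle> \<otimes> e \<otimes> \<langle>Y\<rangle>"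
      using interchange [of "\<langle>X\<rangle>" "\<langle>X\<rangle>" "\<gamma> X Y" "\<langle>Y\<rangle> \<otimes> e"] by simp
    moreover have "p \<otimes> e = p \<cdot> (\<langle>X \<odot> Y\<rangle> \<otimes> e)"
      using interchange [of "\<langle>X \<odot> Y\<rangle>" p e "\<langle>\<one>\<rangle>"] by simp
    ultimately show ?thesis by simp
  qed
  have 4: "(\<langle>X\<rangle> \<otimes> e \<otimes> \<langle>Y\<rangle>) \<cdot> (d \<otimes> \<langle>Y\<rangle>) = \<langle>X \<odot> Y\<rangle>"
    using interchange [of d "\<langle>X\<rangle> \<otimes> e" "\<langle>Y\<rangle>" "\<langle>Y\<rangle>"] by simp
  show "P \<boxtimes> \<iota> = P"
    by (simp add: pair_def unit_el_def Pp compose_tail [OF 3] 4)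
qed

lemma app_pair_split [simp]:
  assumes "el P" "el Q" "el R" "F \<in> Ar C" "G \<in> Ar C"
    "source C F = typ_of P \<odot> typ_of Q" "source C G = typ_of R"
  shows "(F \<otimes> G) \<bullet> (P \<boxtimes> Q \<boxtimes> R) = (F \<bullet> (P \<boxtimes> Q)) \<boxtimes> (G \<bullet> R)"
  using app_pair [of "P \<boxtimes> Q" R F G] assms by simp

lemma app_pair_split3 [simp]:
  assumes "el P" "el Q" "el R" "el S" "F \<in> Ar C" "G \<in> Ar C"
    "source C F = typ_of P \<odot> typ_of Q \<odot> typ_of R" "source C G = typ_of S"
  shows "(F \<otimes> G) \<bullet> (P \<boxtimes> Q \<boxtimes> R \<boxtimes> S) = (F \<bullet> (P \<boxtimes> Q \<boxtimes> R)) \<boxtimes> (G \<bullet> S)"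
  using app_pair [of "P \<boxtimes> Q \<boxtimes> R" S F G] assms by simp

lemma app_pair_unit [simp]:
  assumes "el P" "F \<in> Ar C" "G \<in> Ar C"
  shows "source C F = \<one> \<Longrightarrow> source C G = typ_of P \<Longrightarrow> (F \<otimes> G) \<bullet> P = (F \<bullet> \<iota>) \<boxtimes> (G \<bullet> P)"
    and "source C F = typ_of P \<Longrightarrow> source C G = \<one> \<Longrightarrow> (F \<otimes> G) \<bullet> P = (F \<bullet> P) \<boxtimes> (G \<bullet> \<iota>)"
  using app_pair [of \<iota> P F G] app_pair [of P \<iota> F G] assms by auto

text \<open>The linear inputs of two elements cannot be permuted, so the symmetry exchanges the elements only if one
  of them has none. Cocommutativity of \<open>d\<close> makes the copies of the point that the two
  elements receive interchangeable.\<close>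

lemma swap [simp]:
  assumes P: "el P" and Q: "el Q" and pure: "fst P = \<one> \<or> fst Q = \<one>"
    and ST: "typ_of P = S" "typ_of Q = T"
  shows "\<gamma> S T \<bullet> (P \<boxtimes> Q) = Q \<boxtimes> P"
proof -
  have 1: "\<gamma> (typ_of P) (typ_of Q) \<bullet> (P \<boxtimes> Q) = Q \<boxtimes> P" if P: "el P" and Q: "el Q" and 1: "fst Q = \<one>" for P Q
  proof -
    obtain Y p q where PQ: "P = (Y, p)" "Q = (\<one>, q)" using 1 by (cases P, cases Q) auto
    define S T where ST: "S = typ_of P" "T = typ_of Q"
    note [simp] = el_D [OF P, unfolded PQ fst_conv snd_conv] el_D [OF Q, unfolded PQ fst_conv snd_conv]
      ident_merge
    have T: "target C p = S" "target C q = T" "S \<in> Ob C" "T \<in> Ob C"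
      using P Q unfolding PQ ST by simp_all
    have n: "\<gamma> S T \<cdot> (p \<otimes> q) = (q \<otimes> p) \<cdot> \<gamma> (X \<odot> Y) X"
      using symmetry_natural' [of p q S T] T by simp
    have h: "\<gamma> (X \<odot> Y) X \<cdot> (\<langle>X\<rangle> \<otimes> \<gamma> X Y) = \<gamma> X X \<otimes> \<langle>Y\<rangle>"
      using interchange [of "\<langle>X\<rangle>" "\<langle>X\<rangle>" "\<gamma> X Y" "\<gamma> Y X"] by (simp add: symmetry_hexagon')
    have c: "(\<gamma> X X \<otimes> \<langle>Y\<rangle>) \<cdot> (d \<otimes> \<langle>Y\<rangle>) = d \<otimes> \<langle>Y\<rangle>"
      using interchange [of d "\<gamma> X X" "\<langle>Y\<rangle>" "\<langle>Y\<rangle>"] by (simp add: cocommutative_stage)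
    show ?thesis
      unfolding ST [symmetric] using T
      by (simp add: PQ app_def pair_def compose_tail [OF n] compose_tail [OF h] c)
  qed
  show ?thesis
  proof (cases "fst Q = \<one>")
    case True
    then show ?thesis using 1 P Q ST by blast
  next
    case False
    then have "\<gamma> (typ_of Q) (typ_of P) \<bullet> (Q \<boxtimes> P) = P \<boxtimes> Q"
      using 1 P Q pure by blast
    then have "\<gamma> (typ_of P) (typ_of Q) \<bullet> (P \<boxtimes> Q)
        = (\<gamma> (typ_of P) (typ_of Q) \<cdot> \<gamma> (typ_of Q) (typ_of P)) \<bullet> (Q \<boxtimes> P)"
      using P Q by (simp del: symmetry_involutive)
    also have "\<dots> = Q \<boxtimes> P"
      using P Q by simp
    finally show ?thesis
      using ST by simp
  qed
qed

lemma scalar_commute: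
  assumes "el P" "el s" "fst s = \<one>" "typ_of s = \<one>"
  shows "P \<boxtimes> s = s \<boxtimes> P"
  using swap [of P s "typ_of P" \<one>] assms by (simp del: swap)

lemma generic_linear: "Y \<in> Ob C \<Longrightarrow> generic \<boxtimes> linear Y = (Y, \<langle>X \<odot> Y\<rangle>)"
  using interchange [of d "\<langle>X\<rangle> \<otimes> e" "\<langle>Y\<rangle>" "\<langle>Y\<rangle>"] by (simp add: pair_def generic_def linear_def)

lemma linear_pair [simp]:
  assumes [simp]: "Y \<in> Ob C" "Z \<in> Ob C"
  shows "linear Y \<boxtimes> linear Z = linear (Y \<odot> Z)"
proof -
  note [simp] = ident_merge
  have 1: "(\<langle>Y\<rangle> \<otimes> e) \<cdot> \<gamma> X Y = e \<otimes> \<langle>Y\<rangle>"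
    using symmetry_natural' [of e "\<langle>Y\<rangle>" \<one> Y] by simp
  have 2: "(e \<otimes> \<langle>Y\<rangle> \<otimes> e \<otimes> \<langle>Z\<rangle>) \<cdot> (\<langle>X\<rangle> \<otimes> \<gamma> X Y \<otimes> \<langle>Z\<rangle>) = e \<otimes> e \<otimes> \<langle>Y \<odot> Z\<rangle>"
    using interchange [of "\<langle>X\<rangle>" e "\<gamma> X Y \<otimes> \<langle>Z\<rangle>" "\<langle>Y\<rangle> \<otimes> e \<otimes> \<langle>Z\<rangle>"]
      interchange [of "\<gamma> X Y" "\<langle>Y\<rangle> \<otimes> e" "\<langle>Z\<rangle>" "\<langle>Z\<rangle>"] by (simp add: 1)
  have 3: "(e \<otimes> e) \<cdot> d = e"
  proof -
    have "(e \<cdot> (\<langle>X\<rangle> \<otimes> e)) \<cdot> d = e" by simp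
    then show ?thesis
      using interchange [of "\<langle>X\<rangle>" e e "\<langle>\<one>\<rangle>"] by (simp del: compose_assoc')
  qed
  have 4: "(e \<otimes> e \<otimes> \<langle>Y \<odot> Z\<rangle>) \<cdot> (d \<otimes> \<langle>Y \<odot> Z\<rangle>) = e \<otimes> \<langle>Y \<odot> Z\<rangle>"
    using interchange [of d "e \<otimes> e" "\<langle>Y \<odot> Z\<rangle>" "\<langle>Y \<odot> Z\<rangle>"] by (simp add: 3)
  show ?thesis
    by (simp add: pair_def linear_def compose_tail [OF 2] 4)
qed

text \<open>By this formula equality of arrows can be tested on a single pair of elements.\<close>

lemma app_generic_linear:
  assumes "F \<in> Ar C" "source C F = X \<odot> Y" "Y \<in> Ob C"
  shows "F \<bullet> (generic \<boxtimes> linear Y) = (Y, F)"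
  using assms by (simp add: generic_linear app_def)

lemma pair_linear:
  assumes P: "el P" and S: "S \<in> Ob C"
  shows "P \<boxtimes> linear S = (fst P \<odot> S, snd P \<otimes> \<langle>S\<rangle>)"
proof -
  obtain Y p where Pp: "P = (Y, p)" by (metis surj_pair)
  note [simp] = el_D [OF P, unfolded Pp fst_conv snd_conv] ident_merge S
  have 1: "(\<langle>Y\<rangle> \<otimes> e) \<cdot> \<gamma> X Y = e \<otimes> \<langle>Y\<rangle>"
    using symmetry_natural' [of e "\<langle>Y\<rangle>" \<one> Y] by simp
  have 2: "(\<langle>X \<odot> Y\<rangle> \<otimes> e \<otimes> \<langle>S\<rangle>) \<cdot> (\<langle>X\<rangle> \<otimes> \<gamma> X Y \<otimes> \<langle>S\<rangle>) = \<langle>X\<rangle> \<otimes> e \<otimes> \<langle>Y \<odot> S\<rangle>"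
    using interchange [of "\<langle>X\<rangle>" "\<langle>X\<rangle>" "\<gamma> X Y \<otimes> \<langle>S\<rangle>" "\<langle>Y\<rangle> \<otimes> e \<otimes> \<langle>S\<rangle>"]
      interchange [of "\<gamma> X Y" "\<langle>Y\<rangle> \<otimes> e" "\<langle>S\<rangle>" "\<langle>S\<rangle>"] by (simp add: 1)
  have 3: "(\<langle>X\<rangle> \<otimes> e \<otimes> \<langle>Y \<odot> S\<rangle>) \<cdot> (d \<otimes> \<langle>Y \<odot> S\<rangle>) = \<langle>X \<odot> Y \<odot> S\<rangle>"
    using interchange [of d "\<langle>X\<rangle> \<otimes> e" "\<langle>Y \<odot> S\<rangle>" "\<langle>Y \<odot> S\<rangle>"] by simp
  have 4: "p \<otimes> e \<otimes> \<langle>S\<rangle> = (p \<otimes> \<langle>S\<rangle>) \<cdot> (\<langle>X \<odot> Y\<rangle> \<otimes> e \<otimes> \<langle>S\<rangle>)"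
    using interchange [of "\<langle>X \<odot> Y\<rangle>" p "e \<otimes> \<langle>S\<rangle>" "\<langle>S\<rangle>"] by simp
  show ?thesis
    by (simp add: Pp pair_def linear_def 4 compose_tail [OF 2] 3)
qed

text \<open>The value of \<open>F\<close> at \<open>P \<boxtimes> U\<close> arises from its value at
  \<open>P \<boxtimes> linear S\<close> by composition with the arrow of \<open>U\<close>. The lemma
  gives access to elements \<open>U\<close> of a tensor product that are not pairs, such as images of
  comultiplications and coactions: they may be replaced by the pair of two linear inputs.\<close>

lemma linear_ext:
  assumes P: "el P" and P': "el P'" "fst P' = fst P" and U: "el U" "typ_of U = S"
    and F: "F \<in> Ar C" "source C F = typ_of P \<odot> S" and G: "G \<in> Ar C" "source C G = typ_of P' \<odot> S"
    and eq: "F \<bullet> (P \<boxtimes> linear S) = G \<bullet> (P' \<boxtimes> linear S)"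
  shows "F \<bullet> (P \<boxtimes> U) = G \<bullet> (P' \<boxtimes> U)"
proof -
  have S: "S \<in> Ob C" using U by auto
  let ?W = "(\<langle>X \<odot> fst P\<rangle> \<otimes> snd U) \<cdot>
      ((\<langle>X\<rangle> \<otimes> \<gamma> X (fst P) \<otimes> \<langle>fst U\<rangle>) \<cdot> (d \<otimes> \<langle>fst P \<odot> fst U\<rangle>))"
  have *: "F \<bullet> (Q \<boxtimes> U) = (fst P \<odot> fst U, snd (F \<bullet> (Q \<boxtimes> linear S)) \<cdot> ?W)"
    if Q: "el Q" "fst Q = fst P" "F \<in> Ar C" "source C F = typ_of Q \<odot> S" for Q F
  proof -
    note [simp] = el_D [OF Q(1)] el_D [OF U(1)] U(2) Q S el_D(1) [OF P] ident_merge
    have "snd Q \<otimes> snd U = (snd Q \<otimes> \<langle>S\<rangle>) \<cdot> (\<langle>X \<odot> fst P\<rangle> \<otimes> snd U)"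
      using slide(1) [of "snd Q" "snd U"] by simp
    moreover have "F \<bullet> (Q \<boxtimes> linear S) = (fst P \<odot> S, F \<cdot> (snd Q \<otimes> \<langle>S\<rangle>))"
      by (simp add: pair_linear app_def)
    ultimately show ?thesis
      by (simp add: app_def pair_def)
  qed
  show ?thesis
    using * [OF P refl F] * [OF P' G] eq by simp
qed

text \<open>Here \<open>P\<close> must have no linear input, because the one of \<open>U\<close> has to be moved
  past it.\<close>

lemma linear_ext_left:
  assumes P: "el P" "fst P = \<one>" and P': "el P'" "fst P' = \<one>" and U: "el U" "typ_of U = S"
    and F: "F \<in> Ar C" "source C F = S \<odot> typ_of P" and G: "G \<in> Ar C" "source C G = S \<odot> typ_of P'"
    and eq: "F \<bullet> (linear S \<boxtimes> P) = G \<bullet> (linear S \<boxtimes> P')"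
  shows "F \<bullet> (U \<boxtimes> P) = G \<bullet> (U \<boxtimes> P')"
proof -
  have S: "S \<in> Ob C" using U by auto
  have *: "F \<bullet> (V \<boxtimes> Q) = (F \<cdot> \<gamma> (typ_of Q) S) \<bullet> (Q \<boxtimes> V)"
    if "el V" "typ_of V = S" "el Q" "fst Q = \<one>" "F \<in> Ar C" "source C F = S \<odot> typ_of Q" for F Q V
    using that S by simp
  show ?thesis
    unfolding * [OF U P F] * [OF U P' G]
  proof (rule linear_ext [OF P(1) P'(1) _ U])
    show "(F \<cdot> \<gamma> (typ_of P) S) \<bullet> (P \<boxtimes> linear S) = (G \<cdot> \<gamma> (typ_of P') S) \<bullet> (P' \<boxtimes> linear S)"
      using eq * [OF _ _ P F, of "linear S"] * [OF _ _ P' G, of "linear S"] S by simp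
  qed (use S F G P P' in simp_all)
qed

text \<open>The equation says that the comultiplication \<open>c\<close> and duplication of the point have the same
  effect on \<open>a\<close>.\<close>

definition grouplike :: "'o \<Rightarrow> 'm \<Rightarrow> ('o, 'm) element \<Rightarrow> bool"
  where "grouplike D c a \<longleftrightarrow> el a \<and> fst a = \<one> \<and> typ_of a = D \<and> c \<bullet> a = a \<boxtimes> a"

lemma generic_grouplike: "grouplike X d generic"
proof -
  have "d \<bullet> generic = generic \<boxtimes> generic"
    by (simp add: pair_def generic_def app_def)
  then show ?thesis by (simp add: grouplike_def)
qed

end

context strict_symmetric_monoidal_category
begin

text \<open>Change of parameters along a morphism \<open>t\<close> of coalgebras.\<close>

definition pull :: "'m \<Rightarrow> ('o, 'm) element \<Rightarrow> ('o, 'm) element"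
  where "pull t P = (fst P, snd P \<cdot> (t \<otimes> \<langle>fst P\<rangle>))"

lemma stage_product:
  assumes "stage C X e d" "stage C X' e' d'"
  shows "stage C (X \<odot> X') (e \<otimes> e') (tensor_\<delta> X d X' d')"
proof -
  interpret S: stage C X e d by fact
  interpret S': stage C X' e' d' by fact
  show ?thesis
    using tensor_coalgebra [OF S.coalgebra S'.coalgebra]
      tensor_cocommutative [OF S.coalgebra S.cocommutative_stage S'.coalgebra S'.cocommutative_stage]
    by unfold_locales auto
qed

context
  fixes X e d X' e' d' t
  assumes S: "stage C X e d" and S': "stage C X' e' d'"
    and t: "t \<in> Ar C" "source C t = X'" "target C t = X" and dt: "d \<cdot> t = (t \<otimes> t) \<cdot> d'"
begin

interpretation S: stage C X e d by (rule S)
interpretation S': stage C X' e' d' by (rule S')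

lemma el_pull:
  assumes "S.el P"
  shows "S'.el (pull t P)" "typ_of (pull t P) = typ_of P" "fst (pull t P) = fst P"
proof -
  show "S'.el (pull t P)" "typ_of (pull t P) = typ_of P" "fst (pull t P) = fst P"
    using S.el_D [OF assms] t
      by (simp_all add: pull_def S'.el_def typ_of_def del: S.el_D S'.el_D)
qed

lemma pull_app:
  assumes "S.el P" "F \<in> Ar C" "source C F = typ_of P"
  shows "pull t (F \<bullet> P) = F \<bullet> pull t P"
  using S.el_D [OF assms(1)] assms(2,3) t by (simp add: pull_def app_def)

lemma pull_pair:
  assumes P: "S.el P" and Q: "S.el Q"
  shows "pull t (S.pair P Q) = S'.pair (pull t P) (pull t Q)"
proof -
  obtain Y p Z q where PQ: "P = (Y, p)" "Q = (Z, q)" by (metis surj_pair)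
  note [simp] = S.el_D [OF P, unfolded PQ fst_conv snd_conv] S.el_D [OF Q, unfolded PQ fst_conv snd_conv]
    ident_merge t
  have 1: "(d \<otimes> \<langle>Y \<odot> Z\<rangle>) \<cdot> (t \<otimes> \<langle>Y \<odot> Z\<rangle>) = (t \<otimes> t \<otimes> \<langle>Y \<odot> Z\<rangle>) \<cdot> (d' \<otimes> \<langle>Y \<odot> Z\<rangle>)"
    using interchange [of t d "\<langle>Y \<odot> Z\<rangle>" "\<langle>Y \<odot> Z\<rangle>"]
      interchange [of d' "t \<otimes> t" "\<langle>Y \<odot> Z\<rangle>" "\<langle>Y \<odot> Z\<rangle>"] by (simp add: dt)
  have n: "\<gamma> X Y \<cdot> (t \<otimes> \<langle>Y\<rangle>) = (\<langle>Y\<rangle> \<otimes> t) \<cdot> \<gamma> X' Y"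
    using symmetry_natural' [of t "\<langle>Y\<rangle>" X Y] by simp
  have 2: "(\<langle>X\<rangle> \<otimes> \<gamma> X Y \<otimes> \<langle>Z\<rangle>) \<cdot> (t \<otimes> t \<otimes> \<langle>Y \<odot> Z\<rangle>)
      = (t \<otimes> \<langle>Y\<rangle> \<otimes> t \<otimes> \<langle>Z\<rangle>) \<cdot> (\<langle>X'\<rangle> \<otimes> \<gamma> X' Y \<otimes> \<langle>Z\<rangle>)"
    using interchange [of t "\<langle>X\<rangle>" "t \<otimes> \<langle>Y \<odot> Z\<rangle>" "\<gamma> X Y \<otimes> \<langle>Z\<rangle>"]
      interchange [of "t \<otimes> \<langle>Y\<rangle>" "\<gamma> X Y" "\<langle>Z\<rangle>" "\<langle>Z\<rangle>"]
      interchange [of "\<langle>X'\<rangle>" t "\<gamma> X' Y \<otimes> \<langle>Z\<rangle>" "\<langle>Y\<rangle> \<otimes> t \<otimes> \<langle>Z\<rangle>"]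
      interchange [of "\<gamma> X' Y" "\<langle>Y\<rangle> \<otimes> t" "\<langle>Z\<rangle>" "\<langle>Z\<rangle>"] by (simp add: n)
  have 3: "(p \<cdot> (t \<otimes> \<langle>Y\<rangle>)) \<otimes> (q \<cdot> (t \<otimes> \<langle>Z\<rangle>)) = (p \<otimes> q) \<cdot> (t \<otimes> \<langle>Y\<rangle> \<otimes> t \<otimes> \<langle>Z\<rangle>)"
    using interchange [of "t \<otimes> \<langle>Y\<rangle>" p "t \<otimes> \<langle>Z\<rangle>" q] by simp
  show ?thesis
    by (simp add: PQ pull_def S.pair_def S'.pair_def 1 3 compose_tail [OF 2])
qed

lemma pull_grouplike:
  assumes "S.grouplike D c a" "c \<in> Ar C" "source C c = D"
  shows "S'.grouplike D c (pull t a)"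
  using assms el_pull [of a] pull_app [of a c] pull_pair [of a a]
  by (simp add: S.grouplike_def S'.grouplike_def)

end

lemma product_projections:
  assumes S: "stage C X e d" and S': "stage C X' e' d'"
  shows "tensor_\<delta> X d X' d' \<in> Ar C"
    and "d \<cdot> (\<langle>X\<rangle> \<otimes> e') = ((\<langle>X\<rangle> \<otimes> e') \<otimes> (\<langle>X\<rangle> \<otimes> e')) \<cdot> tensor_\<delta> X d X' d'"
    and "d' \<cdot> (e \<otimes> \<langle>X'\<rangle>) = ((e \<otimes> \<langle>X'\<rangle>) \<otimes> (e \<otimes> \<langle>X'\<rangle>)) \<cdot> tensor_\<delta> X d X' d'"
proof -
  interpret S: stage C X e d by fact
  interpret S': stage C X' e' d' by fact
  show "tensor_\<delta> X d X' d' \<in> Ar C"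
    by (rule tensor_\<delta>_simps [OF S.coalgebra S'.coalgebra])
  show "d \<cdot> (\<langle>X\<rangle> \<otimes> e') = ((\<langle>X\<rangle> \<otimes> e') \<otimes> (\<langle>X\<rangle> \<otimes> e')) \<cdot> tensor_\<delta> X d X' d'"
    using tensor_\<delta>_discard(1) [OF S.coalgebra S'.coalgebra]
      interchange [of "\<langle>X\<rangle>" d e' "\<langle>\<one>\<rangle>"] by simp
  show "d' \<cdot> (e \<otimes> \<langle>X'\<rangle>) = ((e \<otimes> \<langle>X'\<rangle>) \<otimes> (e \<otimes> \<langle>X'\<rangle>)) \<cdot> tensor_\<delta> X d X' d'"
    using tensor_\<delta>_discard(2) [OF S.coalgebra S'.coalgebra]
      interchange [of e "\<langle>\<one>\<rangle>" "\<langle>X'\<rangle>" d'] by simp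
qed

text \<open>Elements with independent parameters, made comparable over the product of the two stages: the counits
  discard exactly those halves of the duplicated pair of points that are not used.\<close>

lemma external_pair:
  assumes S: "stage C X e d" and S': "stage C X' e' d'"
    and P: "stage.el C X P" and Q: "stage.el C X' Q"
  shows "stage.pair C (X \<odot> X') (tensor_\<delta> X d X' d') (pull (\<langle>X\<rangle> \<otimes> e') P) (pull (e \<otimes> \<langle>X'\<rangle>) Q)
    = (fst P \<odot> fst Q, (snd P \<otimes> snd Q) \<cdot> (\<langle>X\<rangle> \<otimes> \<gamma> X' (fst P) \<otimes> \<langle>fst Q\<rangle>))"
proof -
  interpret S: stage C X e d by fact
  interpret S': stage C X' e' d' by fact
  interpret T: stage C "X \<odot> X'" "e \<otimes> e'" "tensor_\<delta> X d X' d'"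
    by (rule stage_product [OF S S'])
  obtain Y p Z q where PQ: "P = (Y, p)" "Q = (Z, q)" by (metis surj_pair)
  note [simp] = S.el_D [OF P, unfolded PQ fst_conv snd_conv] S'.el_D [OF Q, unfolded PQ fst_conv snd_conv]
    ident_merge
  let ?\<Delta> = "tensor_\<delta> X d X' d'"
  have 1: "(p \<cdot> (\<langle>X\<rangle> \<otimes> e' \<otimes> \<langle>Y\<rangle>)) \<otimes> (q \<cdot> (e \<otimes> \<langle>X' \<odot> Z\<rangle>))
      = (p \<otimes> q) \<cdot> (\<langle>X\<rangle> \<otimes> e' \<otimes> \<langle>Y\<rangle> \<otimes> e \<otimes> \<langle>X' \<odot> Z\<rangle>)"
    using interchange [of "\<langle>X\<rangle> \<otimes> e' \<otimes> \<langle>Y\<rangle>" p "e \<otimes> \<langle>X' \<odot> Z\<rangle>" q] by simp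
  have n: "(\<langle>Y\<rangle> \<otimes> e \<otimes> \<langle>X'\<rangle>) \<cdot> \<gamma> (X \<odot> X') Y = \<gamma> X' Y \<cdot> (e \<otimes> \<langle>X' \<odot> Y\<rangle>)"
    using symmetry_natural' [of "e \<otimes> \<langle>X'\<rangle>" "\<langle>Y\<rangle>" X' Y] by simp
  have 2: "(\<langle>X\<rangle> \<otimes> e' \<otimes> \<langle>Y\<rangle> \<otimes> e \<otimes> \<langle>X' \<odot> Z\<rangle>) \<cdot> (\<langle>X \<odot> X'\<rangle> \<otimes> \<gamma> (X \<odot> X') Y \<otimes> \<langle>Z\<rangle>)
      = (\<langle>X\<rangle> \<otimes> \<gamma> X' Y \<otimes> \<langle>Z\<rangle>) \<cdot> (\<langle>X\<rangle> \<otimes> e' \<otimes> e \<otimes> \<langle>X' \<odot> Y \<odot> Z\<rangle>)"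
  proof -
    have "(\<langle>X\<rangle> \<otimes> e' \<otimes> \<langle>Y\<rangle> \<otimes> e \<otimes> \<langle>X' \<odot> Z\<rangle>) \<cdot> (\<langle>X \<odot> X'\<rangle> \<otimes> \<gamma> (X \<odot> X') Y \<otimes> \<langle>Z\<rangle>)
        = \<langle>X\<rangle> \<otimes> e' \<otimes> (((\<langle>Y\<rangle> \<otimes> e \<otimes> \<langle>X'\<rangle>) \<cdot> \<gamma> (X \<odot> X') Y) \<otimes> \<langle>Z\<rangle>)"
      using interchange [of "\<langle>X \<odot> X'\<rangle>" "\<langle>X\<rangle> \<otimes> e'" "\<gamma> (X \<odot> X') Y \<otimes> \<langle>Z\<rangle>" "\<langle>Y\<rangle> \<otimes> e \<otimes> \<langle>X' \<odot> Z\<rangle>"]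
        interchange [of "\<gamma> (X \<odot> X') Y" "\<langle>Y\<rangle> \<otimes> e \<otimes> \<langle>X'\<rangle>" "\<langle>Z\<rangle>" "\<langle>Z\<rangle>"] by simp
    also have "\<dots> = (\<langle>X\<rangle> \<otimes> \<gamma> X' Y \<otimes> \<langle>Z\<rangle>) \<cdot> (\<langle>X\<rangle> \<otimes> e' \<otimes> e \<otimes> \<langle>X' \<odot> Y \<odot> Z\<rangle>)"
      unfolding n using interchange [of "\<langle>X\<rangle> \<otimes> e'" "\<langle>X\<rangle>" "e \<otimes> \<langle>X' \<odot> Y \<odot> Z\<rangle>" "\<gamma> X' Y \<otimes> \<langle>Z\<rangle>"]
        interchange [of "e \<otimes> \<langle>X' \<odot> Y\<rangle>" "\<gamma> X' Y" "\<langle>Z\<rangle>" "\<langle>Z\<rangle>"] by simp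
    finally show ?thesis .
  qed
  have 3: "(\<langle>X\<rangle> \<otimes> e' \<otimes> e \<otimes> \<langle>X' \<odot> Y \<odot> Z\<rangle>) \<cdot> (?\<Delta> \<otimes> \<langle>Y \<odot> Z\<rangle>) = \<langle>X \<odot> X' \<odot> Y \<odot> Z\<rangle>"
    using tensor_\<delta>_discard(3) [OF S.coalgebra S'.coalgebra]
      interchange [of ?\<Delta> "\<langle>X\<rangle> \<otimes> e' \<otimes> e \<otimes> \<langle>X'\<rangle>" "\<langle>Y \<odot> Z\<rangle>" "\<langle>Y \<odot> Z\<rangle>"] by simp
  show ?thesis
    by (simp add: PQ pull_def T.pair_def 1 3 compose_tail [OF 2])
qed

end

section \<open>Algebra-valued elements\<close>

context strict_symmetric_monoidal_category
begin

lemma is_algebra_simps [simp]: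
  assumes "is_algebra A"
  shows "obj A \<in> Ob C" "\<eta> A \<in> Ar C" "source C (\<eta> A) = \<one>" "target C (\<eta> A) = obj A"
    "\<mu> A \<in> Ar C" "source C (\<mu> A) = obj A \<odot> obj A" "target C (\<mu> A) = obj A"
  using assms by (auto simp: is_algebra_def Hom_def)

end

context stage
begin

definition mul :: "('o, 'm, 'z) algebra_scheme \<Rightarrow> ('o, 'm) element \<Rightarrow> ('o, 'm) element \<Rightarrow> ('o, 'm) element"
  where "mul A P Q = \<mu> A \<bullet> (P \<boxtimes> Q)"

definition one :: "('o, 'm, 'z) algebra_scheme \<Rightarrow> ('o, 'm) element"
  where "one A = \<eta> A \<bullet> \<iota>"

lemma app_\<mu> [simp]: "\<mu> A \<bullet> (P \<boxtimes> Q) = mul A P Q"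
  by (simp add: mul_def)

lemma app_\<eta> [simp]: "\<eta> A \<bullet> \<iota> = one A"
  by (simp add: one_def)

lemma fst_mul [simp]: "fst (mul A P Q) = fst P \<odot> fst Q"
  by (simp add: mul_def del: app_\<mu>)

lemma el_mul [simp]:
  assumes "is_algebra A" "el P" "el Q" "typ_of P = obj A" "typ_of Q = obj A"
  shows "el (mul A P Q)" "typ_of (mul A P Q) = obj A"
  using assms by (simp_all add: mul_def del: app_\<mu>)

lemma el_one [simp]:
  assumes "is_algebra A"
  shows "el (one A)" "typ_of (one A) = obj A" "fst (one A) = \<one>"
  using assms by (simp_all add: one_def del: app_\<eta>)

lemma mul_assoc [simp]:
  assumes "is_algebra A" "el P" "el Q" "el R" "typ_of P = obj A" "typ_of Q = obj A" "typ_of R = obj A"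
  shows "mul A (mul A P Q) R = mul A P (mul A Q R)"
proof -
  have "(\<mu> A \<cdot> (\<langle>obj A\<rangle> \<otimes> \<mu> A)) \<bullet> (P \<boxtimes> Q \<boxtimes> R) = (\<mu> A \<cdot> (\<mu> A \<otimes> \<langle>obj A\<rangle>)) \<bullet> (P \<boxtimes> Q \<boxtimes> R)"
    using assms(1) by (simp add: is_algebra_def)
  then show ?thesis using assms by simp
qed

lemma mul_one [simp]:
  assumes "is_algebra A" "el P" "typ_of P = obj A"
  shows "mul A P (one A) = P" "mul A (one A) P = P"
proof -
  have 1: "\<mu> A \<cdot> (\<langle>obj A\<rangle> \<otimes> \<eta> A) = \<langle>obj A\<rangle>" "\<mu> A \<cdot> (\<eta> A \<otimes> \<langle>obj A\<rangle>) = \<langle>obj A\<rangle>"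
    using assms(1) by (auto simp: is_algebra_def)
  have "(\<mu> A \<cdot> (\<langle>obj A\<rangle> \<otimes> \<eta> A)) \<bullet> P = mul A P (one A)" "(\<mu> A \<cdot> (\<eta> A \<otimes> \<langle>obj A\<rangle>)) \<bullet> P = mul A (one A) P"
    using assms by simp_all
  then show "mul A P (one A) = P" "mul A (one A) P = P"
    unfolding 1 using assms by simp_all
qed

lemma app_conv [simp]:
  assumes "el P" "c \<bullet> P = P \<boxtimes> P" "c \<in> Ar C" "source C c = typ_of P" "target C c = typ_of P \<odot> typ_of P"
    "is_algebra A" "f \<in> Ar C" "g \<in> Ar C" "source C f = typ_of P" "source C g = typ_of P"
    "target C f = obj A" "target C g = obj A"
  shows "conv c A f g \<bullet> P = mul A (f \<bullet> P) (g \<bullet> P)"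
  using assms by (simp add: conv_def)

lemma app_pair_split4 [simp]:
  assumes "el P" "el Q" "el R" "el S" "el T" "F \<in> Ar C" "G \<in> Ar C"
    "source C F = typ_of P \<odot> typ_of Q \<odot> typ_of R \<odot> typ_of S" "source C G = typ_of T"
  shows "(F \<otimes> G) \<bullet> (P \<boxtimes> Q \<boxtimes> R \<boxtimes> S \<boxtimes> T) = (F \<bullet> (P \<boxtimes> Q \<boxtimes> R \<boxtimes> S)) \<boxtimes> (G \<bullet> T)"
proof -
  have "(F \<otimes> G) \<bullet> ((P \<boxtimes> Q \<boxtimes> R \<boxtimes> S) \<boxtimes> T) = (F \<bullet> (P \<boxtimes> Q \<boxtimes> R \<boxtimes> S)) \<boxtimes> (G \<bullet> T)"
    by (rule app_pair) (use assms in simp_all)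
  moreover have "(P \<boxtimes> Q \<boxtimes> R \<boxtimes> S) \<boxtimes> T = P \<boxtimes> Q \<boxtimes> R \<boxtimes> S \<boxtimes> T"
    using assms by simp
  ultimately show ?thesis by simp
qed

text \<open>Multiplication in \<open>A \<otimes> B\<close>.  The element \<open>U\<close> is not assumed to be a pair, so it stands for
  images of comultiplications and coactions.\<close>

definition mul2 :: "('o, 'm, 'y) algebra_scheme \<Rightarrow> ('o, 'm, 'z) algebra_scheme
    \<Rightarrow> ('o, 'm) element \<Rightarrow> ('o, 'm) element \<Rightarrow> ('o, 'm) element"
  where "mul2 A B U V = tensor_\<mu> A B \<bullet> (U \<boxtimes> V)"

lemma tensor_\<mu>_simps [simp]:
  assumes "is_algebra A" "is_algebra B"
  shows "tensor_\<mu> A B \<in> Ar C" "source C (tensor_\<mu> A B) = obj A \<odot> obj B \<odot> obj A \<odot> obj B"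
    "target C (tensor_\<mu> A B) = obj A \<odot> obj B"
  using assms by (simp_all add: tensor_\<mu>_def)

lemma app_tensor_\<mu> [simp]:
  assumes "is_algebra A" "is_algebra B" "el P" "el Q" "el R" "el S"
    "typ_of P = obj A" "typ_of Q = obj B" "typ_of R = obj A" "typ_of S = obj B"
    "fst Q = \<one> \<or> fst R = \<one>"
  shows "tensor_\<mu> A B \<bullet> (P \<boxtimes> Q \<boxtimes> R \<boxtimes> S) = mul A P R \<boxtimes> mul B Q S"
  using assms by (simp add: tensor_\<mu>_def)

lemma mul2_pair [simp]:
  assumes "is_algebra A" "is_algebra B" "el P" "el Q" "el R" "el S"
    "typ_of P = obj A" "typ_of Q = obj B" "typ_of R = obj A" "typ_of S = obj B"
    "fst Q = \<one> \<or> fst R = \<one>"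
  shows "mul2 A B (P \<boxtimes> Q) (R \<boxtimes> S) = mul A P R \<boxtimes> mul B Q S"
  using assms by (simp add: mul2_def)

text \<open>For a pair \<open>U\<close> this is associativity in either factor, and \<open>linear_ext_left\<close>
  reduces the general case to that one.\<close>

lemma mul2_assoc:
  assumes A: "is_algebra A" and B: "is_algebra B" and U: "el U" "typ_of U = obj A \<odot> obj B"
    and P: "el P" "fst P = \<one>" "typ_of P = obj A" and Q: "el Q" "fst Q = \<one>" "typ_of Q = obj B"
    and R: "el R" "fst R = \<one>" "typ_of R = obj A" and S: "el S" "fst S = \<one>" "typ_of S = obj B"
  shows "mul2 A B (mul2 A B U (P \<boxtimes> Q)) (R \<boxtimes> S) = mul2 A B U (mul A P R \<boxtimes> mul B Q S)"
proof -
  note [simp] = assms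
  have "(tensor_\<mu> A B \<cdot> (tensor_\<mu> A B \<otimes> \<langle>obj A \<odot> obj B\<rangle>)) \<bullet> (U \<boxtimes> (P \<boxtimes> Q \<boxtimes> R \<boxtimes> S))
      = tensor_\<mu> A B \<bullet> (U \<boxtimes> (mul A P R \<boxtimes> mul B Q S))"
  proof (rule linear_ext_left [where S = "obj A \<odot> obj B"])
    have L: "linear (obj A \<odot> obj B) = linear (obj A) \<boxtimes> linear (obj B)"
      by simp
    have "(tensor_\<mu> A B \<otimes> \<langle>obj A \<odot> obj B\<rangle>) \<bullet> (linear (obj A) \<boxtimes> linear (obj B) \<boxtimes> P \<boxtimes> Q \<boxtimes> R \<boxtimes> S)
        = mul A (linear (obj A)) P \<boxtimes> mul B (linear (obj B)) Q \<boxtimes> R \<boxtimes> S"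
      by (subst app_pair_split4) (simp_all del: linear_pair)
    then show "(tensor_\<mu> A B \<cdot> (tensor_\<mu> A B \<otimes> \<langle>obj A \<odot> obj B\<rangle>)) \<bullet> (linear (obj A \<odot> obj B) \<boxtimes> (P \<boxtimes> Q \<boxtimes> R \<boxtimes> S))
      = tensor_\<mu> A B \<bullet> (linear (obj A \<odot> obj B) \<boxtimes> (mul A P R \<boxtimes> mul B Q S))"
      unfolding L by (simp del: linear_pair)
  qed simp_all
  moreover have "(tensor_\<mu> A B \<otimes> \<langle>obj A \<odot> obj B\<rangle>) \<bullet> (U \<boxtimes> (P \<boxtimes> Q \<boxtimes> R \<boxtimes> S))
      = (tensor_\<mu> A B \<bullet> (U \<boxtimes> P \<boxtimes> Q)) \<boxtimes> R \<boxtimes> S"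
    by (subst app_pair_split3) simp_all
  ultimately show ?thesis
    by (simp add: mul2_def)
qed

end

section \<open>Cocommutative weak Hopf algebras\<close>

locale cocommutative_wha = strict_symmetric_monoidal_category C
  for C :: "('o, 'm) monoidal_data" (structure) +
  fixes H :: "('o, 'm) weak_hopf"
  assumes wha: "weak_hopf_algebra H" and cocomm: "cocommutative H"
begin

text \<open>Following the convention that identities are denoted by their objects.\<close>

abbreviation id_H :: 'm  ("\<H>")
  where "\<H> \<equiv> \<langle>obj H\<rangle>"

lemma algebra_H [simp]: "is_algebra H"
  using wha by (simp add: weak_hopf_algebra_def)

lemma coalgebra_H: "is_coalgebra (obj H) (\<epsilon> H) (\<delta> H)"
  using wha by (simp add: weak_hopf_algebra_def)

lemmas H_simps [simp] = coalgebra_simps [OF coalgebra_H]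

lemma antipode_simps [simp]:
  "antipode H \<in> Ar C" "source C (antipode H) = obj H" "target C (antipode H) = obj H"
  using wha by (auto simp: weak_hopf_algebra_def Hom_def)

lemma \<Pi>_simps [simp]:
  "\<Pi>L H \<in> Ar C" "source C (\<Pi>L H) = obj H" "target C (\<Pi>L H) = obj H"
  "\<Pi>R H \<in> Ar C" "source C (\<Pi>R H) = obj H" "target C (\<Pi>R H) = obj H"
  by (simp_all add: \<Pi>L_def \<Pi>R_def)

lemma \<delta>2_simps [simp]:
  "\<delta>2 H \<in> Ar C" "source C (\<delta>2 H) = obj H \<odot> obj H" "target C (\<delta>2 H) = obj H \<odot> obj H \<odot> obj H \<odot> obj H"
  by (simp_all add: \<delta>2_def tensor_\<delta>_def)

lemma \<delta>3_simps [simp]: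
  "\<delta>3 H \<in> Ar C" "source C (\<delta>3 H) = obj H \<odot> obj H \<odot> obj H"
  "target C (\<delta>3 H) = obj H \<odot> obj H \<odot> obj H \<odot> obj H \<odot> obj H \<odot> obj H"
  by (simp_all add: \<delta>3_def tensor_\<delta>_def)

lemma stage1: "stage C (obj H) (\<epsilon> H) (\<delta> H)"
  using cocomm coalgebra_H by unfold_locales (auto simp: cocommutative_def)

lemma stage2: "stage C (obj H \<odot> obj H) (\<epsilon> H \<otimes> \<epsilon> H) (\<delta>2 H)"
  using stage_product [OF stage1 stage1] by (simp add: \<delta>2_def)

lemma stage3: "stage C (obj H \<odot> obj H \<odot> obj H) (\<epsilon> H \<otimes> \<epsilon> H \<otimes> \<epsilon> H) (\<delta>3 H)"
  using stage_product [OF stage2 stage1] by (simp add: \<delta>3_def)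

end

locale wha_stage = cocommutative_wha C H + stage C X e d
  for C :: "('o, 'm) monoidal_data" (structure) and H X e d
begin

abbreviation gl :: "('o, 'm) element \<Rightarrow> bool"
  where "gl \<equiv> grouplike (obj H) (\<delta> H)"

lemma gl_simps [simp]:
  assumes "gl a"
  shows "el a" "fst a = \<one>" "typ_of a = obj H" "\<delta> H \<bullet> a = a \<boxtimes> a"
  using assms by (auto simp: grouplike_def)

lemma glI:
  assumes "el a" "fst a = \<one>" "typ_of a = obj H" "\<delta> H \<bullet> a = a \<boxtimes> a"
  shows "gl a"
  using assms by (simp add: grouplike_def del: gl_simps)

end

context cocommutative_wha
begin

lemma wha_stageI: "stage C X e d \<Longrightarrow> wha_stage C H X e d"
  by (intro wha_stage.intro cocommutative_wha_axioms)

text \<open>The comparison principle for arrows: it suffices to know the values at a grouplike \<open>a\<close>,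
  because the tautological element of \<open>H\<close>, at which the values determine the arrow, is
  grouplike.\<close>

lemma generic_ext1:
  assumes "F \<in> Ar C" "G \<in> Ar C" "source C F = obj H \<odot> Y" "source C G = obj H \<odot> Y" "Y \<in> Ob C"
    and eq: "\<And>X e d a P. wha_stage C H X e d \<Longrightarrow> stage.grouplike C X d (obj H) (\<delta> H) a \<Longrightarrow> stage.el C X P
      \<Longrightarrow> typ_of P = Y \<Longrightarrow> F \<bullet> stage.pair C X d a P = G \<bullet> stage.pair C X d a P"
  shows "F = G"
proof -
  interpret stage C "obj H" "\<epsilon> H" "\<delta> H" by (rule stage1)
  have "F \<bullet> pair generic (linear Y) = G \<bullet> pair generic (linear Y)"
    using assms(5) by (intro eq [OF wha_stageI [OF stage1]] generic_grouplike) auto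
  then show ?thesis
    using assms by (simp add: app_generic_linear)
qed

text \<open>The coordinates of \<open>H \<otimes> H\<close> are the tautological elements of the two factors,
  pulled back along the projections.\<close>

lemma generic_pair2:
  "\<exists>a b. stage.grouplike C (obj H \<odot> obj H) (\<delta>2 H) (obj H) (\<delta> H) a
    \<and> stage.grouplike C (obj H \<odot> obj H) (\<delta>2 H) (obj H) (\<delta> H) b
    \<and> stage.pair C (obj H \<odot> obj H) (\<delta>2 H) a b = stage.generic C (obj H \<odot> obj H)"
proof -
  interpret S: stage C "obj H" "\<epsilon> H" "\<delta> H" by (rule stage1)
  interpret T: stage C "obj H \<odot> obj H" "\<epsilon> H \<otimes> \<epsilon> H" "\<delta>2 H" by (rule stage2)
  let ?a = "pull (\<H> \<otimes> \<epsilon> H) S.generic" and ?b = "pull (\<epsilon> H \<otimes> \<H>) S.generic"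
  note pr = product_projections [OF stage1 stage1, folded \<delta>2_def]
  have "T.grouplike (obj H) (\<delta> H) ?a"
    using pr(2) by (intro pull_grouplike [OF stage1 stage2] S.generic_grouplike) simp_all
  moreover have "T.grouplike (obj H) (\<delta> H) ?b"
    using pr(3) by (intro pull_grouplike [OF stage1 stage2] S.generic_grouplike) simp_all
  moreover have "T.pair ?a ?b = T.generic"
    using external_pair [OF stage1 stage1 S.el_special(4) S.el_special(4), folded \<delta>2_def]
    by (simp add: S.generic_def T.generic_def)
  ultimately show ?thesis by blast
qed

lemma generic_pair3:
  "\<exists>a b c. stage.grouplike C (obj H \<odot> obj H \<odot> obj H) (\<delta>3 H) (obj H) (\<delta> H) a
    \<and> stage.grouplike C (obj H \<odot> obj H \<odot> obj H) (\<delta>3 H) (obj H) (\<delta> H) b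
    \<and> stage.grouplike C (obj H \<odot> obj H \<odot> obj H) (\<delta>3 H) (obj H) (\<delta> H) c
    \<and> stage.pair C (obj H \<odot> obj H \<odot> obj H) (\<delta>3 H) a (stage.pair C (obj H \<odot> obj H \<odot> obj H) (\<delta>3 H) b c)
      = stage.generic C (obj H \<odot> obj H \<odot> obj H)"
proof -
  interpret S: stage C "obj H" "\<epsilon> H" "\<delta> H" by (rule stage1)
  interpret T: stage C "obj H \<odot> obj H" "\<epsilon> H \<otimes> \<epsilon> H" "\<delta>2 H" by (rule stage2)
  interpret R: stage C "obj H \<odot> obj H \<odot> obj H" "\<epsilon> H \<otimes> \<epsilon> H \<otimes> \<epsilon> H" "\<delta>3 H" by (rule stage3)
  obtain a b where ab: "T.grouplike (obj H) (\<delta> H) a" "T.grouplike (obj H) (\<delta> H) b" "T.pair a b = T.generic"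
    using generic_pair2 by blast
  have el: "T.el a" "T.el b"
    using ab by (auto simp: T.grouplike_def)
  let ?t = "\<langle>obj H \<odot> obj H\<rangle> \<otimes> \<epsilon> H" and ?s = "(\<epsilon> H \<otimes> \<epsilon> H) \<otimes> \<H>"
  let ?a = "pull ?t a" and ?b = "pull ?t b" and ?c = "pull ?s S.generic"
  note pr = product_projections [OF stage2 stage1, folded \<delta>3_def]
  have t: "?t \<in> Ar C" "source C ?t = obj H \<odot> obj H \<odot> obj H" "target C ?t = obj H \<odot> obj H"
    "\<delta>2 H \<cdot> ?t = (?t \<otimes> ?t) \<cdot> \<delta>3 H"
    using pr(2) by simp_all
  have s: "?s \<in> Ar C" "source C ?s = obj H \<odot> obj H \<odot> obj H" "target C ?s = obj H"
    "\<delta> H \<cdot> ?s = (?s \<otimes> ?s) \<cdot> \<delta>3 H"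
    using pr(3) by simp_all
  have abc: "R.grouplike (obj H) (\<delta> H) ?a" "R.grouplike (obj H) (\<delta> H) ?b" "R.grouplike (obj H) (\<delta> H) ?c"
    using pull_grouplike [OF stage2 stage3 t ab(1)] pull_grouplike [OF stage2 stage3 t ab(2)]
      pull_grouplike [OF stage1 stage3 s S.generic_grouplike] by simp_all
  then have el': "R.el ?a" "R.el ?b" "R.el ?c"
    by (simp_all add: R.grouplike_def)
  have "R.pair ?a (R.pair ?b ?c) = R.pair (pull ?t (T.pair a b)) ?c"
    unfolding pull_pair [OF stage2 stage3 t el] using el' by simp
  also have "\<dots> = R.generic"
    unfolding ab(3) using external_pair [OF stage2 stage1 T.el_special(4) S.el_special(4), folded \<delta>3_def]
    by (simp add: S.generic_def T.generic_def R.generic_def)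
  finally show ?thesis
    using abc by blast
qed

lemma generic_ext2:
  assumes "F \<in> Ar C" "G \<in> Ar C" "source C F = obj H \<odot> obj H \<odot> Y" "source C G = obj H \<odot> obj H \<odot> Y" "Y \<in> Ob C"
    and eq: "\<And>X e d a b P. wha_stage C H X e d \<Longrightarrow> stage.grouplike C X d (obj H) (\<delta> H) a
      \<Longrightarrow> stage.grouplike C X d (obj H) (\<delta> H) b \<Longrightarrow> stage.el C X P \<Longrightarrow> typ_of P = Y
      \<Longrightarrow> F \<bullet> stage.pair C X d a (stage.pair C X d b P) = G \<bullet> stage.pair C X d a (stage.pair C X d b P)"
  shows "F = G"
proof -
  interpret stage C "obj H \<odot> obj H" "\<epsilon> H \<otimes> \<epsilon> H" "\<delta>2 H" by (rule stage2)
  obtain a b where ab: "grouplike (obj H) (\<delta> H) a" "grouplike (obj H) (\<delta> H) b" "pair a b = generic"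
    using generic_pair2 by blast
  have "F \<bullet> pair a (pair b (linear Y)) = G \<bullet> pair a (pair b (linear Y))"
    using assms(5) ab by (intro eq [OF wha_stageI [OF stage2]]) auto
  moreover have "pair a (pair b (linear Y)) = pair generic (linear Y)"
    using ab assms(5) pair_assoc [of a b "linear Y"] by (simp add: grouplike_def)
  ultimately show ?thesis
    using assms by (simp add: app_generic_linear)
qed

lemma generic_ext1':
  assumes "F \<in> Ar C" "G \<in> Ar C" "source C F = obj H" "source C G = obj H"
    and eq: "\<And>X e d a. wha_stage C H X e d \<Longrightarrow> stage.grouplike C X d (obj H) (\<delta> H) a \<Longrightarrow> F \<bullet> a = G \<bullet> a"
  shows "F = G"
proof -
  interpret stage C "obj H" "\<epsilon> H" "\<delta> H" by (rule stage1)
  have "F \<bullet> generic = G \<bullet> generic"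
    by (intro eq [OF wha_stageI [OF stage1]] generic_grouplike)
  then show ?thesis
    using assms by (simp add: generic_def app_def)
qed

lemma generic_ext2':
  assumes "F \<in> Ar C" "G \<in> Ar C" "source C F = obj H \<odot> obj H" "source C G = obj H \<odot> obj H"
    and eq: "\<And>X e d a b. wha_stage C H X e d \<Longrightarrow> stage.grouplike C X d (obj H) (\<delta> H) a
      \<Longrightarrow> stage.grouplike C X d (obj H) (\<delta> H) b \<Longrightarrow> F \<bullet> stage.pair C X d a b = G \<bullet> stage.pair C X d a b"
  shows "F = G"
proof -
  interpret stage C "obj H \<odot> obj H" "\<epsilon> H \<otimes> \<epsilon> H" "\<delta>2 H" by (rule stage2)
  obtain a b where ab: "grouplike (obj H) (\<delta> H) a" "grouplike (obj H) (\<delta> H) b" "pair a b = generic"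
    using generic_pair2 by blast
  have "F \<bullet> pair a b = G \<bullet> pair a b"
    using ab by (intro eq [OF wha_stageI [OF stage2]]) auto
  then show ?thesis
    using assms ab(3) by (simp add: generic_def app_def)
qed

lemma generic_ext3':
  assumes "F \<in> Ar C" "G \<in> Ar C" "source C F = obj H \<odot> obj H \<odot> obj H" "source C G = obj H \<odot> obj H \<odot> obj H"
    and eq: "\<And>X e d a b c. wha_stage C H X e d \<Longrightarrow> stage.grouplike C X d (obj H) (\<delta> H) a
      \<Longrightarrow> stage.grouplike C X d (obj H) (\<delta> H) b \<Longrightarrow> stage.grouplike C X d (obj H) (\<delta> H) c
      \<Longrightarrow> F \<bullet> stage.pair C X d a (stage.pair C X d b c) = G \<bullet> stage.pair C X d a (stage.pair C X d b c)"
  shows "F = G"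
proof -
  interpret stage C "obj H \<odot> obj H \<odot> obj H" "\<epsilon> H \<otimes> \<epsilon> H \<otimes> \<epsilon> H" "\<delta>3 H" by (rule stage3)
  obtain a b c where abc: "grouplike (obj H) (\<delta> H) a" "grouplike (obj H) (\<delta> H) b"
    "grouplike (obj H) (\<delta> H) c" "pair a (pair b c) = generic"
    using generic_pair3 by blast
  have "F \<bullet> pair a (pair b c) = G \<bullet> pair a (pair b c)"
    using abc by (intro eq [OF wha_stageI [OF stage3]]) auto
  then show ?thesis
    using assms abc(4) by (simp add: generic_def app_def)
qed

end

context wha_stage
begin

abbreviation prod_H :: "('o, 'm) element \<Rightarrow> ('o, 'm) element \<Rightarrow> ('o, 'm) element"  (infixr "\<star>" 72)
  where "a \<star> b \<equiv> mul H a b"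

section \<open>Counit values as scalars\<close>

text \<open>For a product \<open>a = b \<star> c\<close> the scalar expresses that \<open>b\<close> and
  \<open>c\<close> are composable.\<close>

definition scale :: "('o, 'm) element \<Rightarrow> ('o, 'm) element \<Rightarrow> ('o, 'm) element"  (infixr "\<triangleright>" 70)
  where "a \<triangleright> P = (\<epsilon> H \<bullet> a) \<boxtimes> P"

lemma pair_\<epsilon> [simp]:
  "(\<epsilon> H \<bullet> a) \<boxtimes> P = a \<triangleright> P"
  "\<lbrakk>el a; fst a = \<one>; typ_of a = obj H; el P\<rbrakk> \<Longrightarrow> P \<boxtimes> (\<epsilon> H \<bullet> a) = a \<triangleright> P"
  using scalar_commute [of P "\<epsilon> H \<bullet> a"] by (simp_all add: scale_def)

lemma el_scale [simp]:
  assumes "el a" "typ_of a = obj H" "el P"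
  shows "el (a \<triangleright> P)" "typ_of (a \<triangleright> P) = typ_of P"
  using assms by (simp_all add: scale_def del: pair_\<epsilon>)

lemma scale_pair [simp]:
  assumes "el a" "typ_of a = obj H" "el P" "el Q"
  shows "(a \<triangleright> P) \<boxtimes> Q = a \<triangleright> (P \<boxtimes> Q)"
    and "fst a = \<one> \<Longrightarrow> P \<boxtimes> (a \<triangleright> Q) = a \<triangleright> (P \<boxtimes> Q)"
proof -
  show "(a \<triangleright> P) \<boxtimes> Q = a \<triangleright> (P \<boxtimes> Q)"
    using assms by (simp add: scale_def del: pair_\<epsilon>)
  assume a: "fst a = \<one>"
  have "P \<boxtimes> (a \<triangleright> Q) = (P \<boxtimes> (\<epsilon> H \<bullet> a)) \<boxtimes> Q"
    using assms by (simp add: scale_def del: pair_\<epsilon>)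
  also have "\<dots> = ((\<epsilon> H \<bullet> a) \<boxtimes> P) \<boxtimes> Q"
    using assms a scalar_commute [of P "\<epsilon> H \<bullet> a"] by simp
  also have "\<dots> = a \<triangleright> (P \<boxtimes> Q)"
    using assms by (simp add: scale_def del: pair_\<epsilon>)
  finally show "P \<boxtimes> (a \<triangleright> Q) = a \<triangleright> (P \<boxtimes> Q)" .
qed

lemma app_scale [simp]:
  assumes "el a" "typ_of a = obj H" "el P" "F \<in> Ar C" "source C F = typ_of P"
  shows "F \<bullet> (a \<triangleright> P) = a \<triangleright> (F \<bullet> P)"
proof -
  have "(\<langle>\<one>\<rangle> \<otimes> F) \<bullet> (a \<triangleright> P) = a \<triangleright> (F \<bullet> P)"
    unfolding scale_def using assms by (subst app_pair) (simp_all del: pair_\<epsilon>)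
  then show ?thesis using assms by simp
qed

lemma scale_left_commute [simp]:
  assumes "el a" "typ_of a = obj H" "fst a = \<one>" "el b" "typ_of b = obj H" "el P"
  shows "b \<triangleright> a \<triangleright> P = a \<triangleright> b \<triangleright> P"
  using scale_pair(2) [of a "\<epsilon> H \<bullet> b" P] assms by simp

lemma mul_scale [simp]:
  assumes "is_algebra A" "el a" "typ_of a = obj H" "el P" "el Q" "typ_of P = obj A" "typ_of Q = obj A"
  shows "mul A (a \<triangleright> P) Q = a \<triangleright> mul A P Q"
    and "fst a = \<one> \<Longrightarrow> mul A P (a \<triangleright> Q) = a \<triangleright> mul A P Q"
  using assms by (simp_all add: mul_def del: app_\<mu>)

lemma gl_scale [simp]:
  assumes "gl a"
  shows "a \<triangleright> a = a" "el P \<Longrightarrow> a \<triangleright> a \<triangleright> P = a \<triangleright> P"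
    and "F \<in> Ar C \<Longrightarrow> source C F = obj H \<Longrightarrow> a \<triangleright> (F \<bullet> a) = F \<bullet> a"
proof -
  have "a = a \<triangleright> a"
    using app_app [of a "\<epsilon> H \<otimes> \<H>" "\<delta> H"] assms by simp
  then show 1: "a \<triangleright> a = a" ..
  then show "F \<in> Ar C \<Longrightarrow> source C F = obj H \<Longrightarrow> a \<triangleright> (F \<bullet> a) = F \<bullet> a"
    using assms app_scale [of a a F] by simp
  have "\<epsilon> H \<bullet> (a \<triangleright> a) = \<epsilon> H \<bullet> a"
    by (simp only: 1)
  then have "a \<triangleright> (\<epsilon> H \<bullet> a) = \<epsilon> H \<bullet> a"
    using assms by simp
  then have "(a \<triangleright> (\<epsilon> H \<bullet> a)) \<boxtimes> P = (\<epsilon> H \<bullet> a) \<boxtimes> P" if "el P"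
    by simp
  then show "el P \<Longrightarrow> a \<triangleright> a \<triangleright> P = a \<triangleright> P"
    using assms by simp
qed

lemma scale_scale [simp]:
  assumes "el a" "typ_of a = obj H" "el b" "typ_of b = obj H" "el P"
  shows "(a \<triangleright> b) \<triangleright> P = a \<triangleright> b \<triangleright> P"
proof -
  have "(\<epsilon> H \<bullet> (a \<triangleright> b)) \<boxtimes> P = a \<triangleright> b \<triangleright> P"
    using assms by (subst app_scale) (simp_all del: app_scale)
  then show ?thesis by simp
qed

lemma gl_scale_app2 [simp]:
  assumes "gl a" "G \<in> Ar C" "source C G = obj H" "F \<in> Ar C" "source C F = target C G"
  shows "a \<triangleright> (F \<bullet> G \<bullet> a) = F \<bullet> G \<bullet> a"
  using app_scale [of a "G \<bullet> a" F] assms by (simp del: app_scale)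

lemma gl_scale2 [simp]:
  assumes "gl a" "el b" "typ_of b = obj H" "fst b = \<one>"
  shows "a \<triangleright> b \<triangleright> a = b \<triangleright> a"
    and "F \<in> Ar C \<Longrightarrow> source C F = obj H \<Longrightarrow> a \<triangleright> b \<triangleright> (F \<bullet> a) = b \<triangleright> (F \<bullet> a)"
proof -
  have "a \<triangleright> b \<triangleright> P = b \<triangleright> a \<triangleright> P" if "el P" for P
    using assms that by (intro scale_left_commute) simp_all
  then show "a \<triangleright> b \<triangleright> a = b \<triangleright> a"
    and "F \<in> Ar C \<Longrightarrow> source C F = obj H \<Longrightarrow> a \<triangleright> b \<triangleright> (F \<bullet> a) = b \<triangleright> (F \<bullet> a)"
    using assms by (simp_all del: scale_left_commute)
qed

lemma app_\<delta>23 [simp]: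
  assumes "gl a" "gl b"
  shows "\<delta>2 H \<bullet> (a \<boxtimes> b) = a \<boxtimes> b \<boxtimes> a \<boxtimes> b"
    and "gl c \<Longrightarrow> \<delta>3 H \<bullet> (a \<boxtimes> b \<boxtimes> c) = a \<boxtimes> b \<boxtimes> c \<boxtimes> a \<boxtimes> b \<boxtimes> c"
proof -
  note [simp] = assms
  show *: "\<delta>2 H \<bullet> (a \<boxtimes> b) = a \<boxtimes> b \<boxtimes> a \<boxtimes> b"
    by (simp add: \<delta>2_def tensor_\<delta>_def)
  assume c [simp]: "gl c"
  have "\<gamma> (obj H \<odot> obj H) (obj H) \<bullet> ((a \<boxtimes> b) \<boxtimes> c) = c \<boxtimes> a \<boxtimes> b"
    by (rule swap) simp_all
  then have "(\<gamma> (obj H \<odot> obj H) (obj H) \<otimes> \<H>) \<bullet> (a \<boxtimes> b \<boxtimes> c \<boxtimes> c) = c \<boxtimes> a \<boxtimes> b \<boxtimes> c"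
    by (subst app_pair_split3) simp_all
  then show "\<delta>3 H \<bullet> (a \<boxtimes> b \<boxtimes> c) = a \<boxtimes> b \<boxtimes> c \<boxtimes> a \<boxtimes> b \<boxtimes> c"
    by (simp add: \<delta>3_def tensor_\<delta>_def * )
qed

lemma gl_mul [simp]:
  assumes "gl a" "gl b"
  shows "gl (a \<star> b)"
proof -
  have "\<delta> H \<cdot> \<mu> H = (\<mu> H \<otimes> \<mu> H) \<cdot> \<delta>2 H"
    using wha by (simp add: weak_hopf_algebra_def)
  then have "(\<delta> H \<cdot> \<mu> H) \<bullet> (a \<boxtimes> b) = ((\<mu> H \<otimes> \<mu> H) \<cdot> \<delta>2 H) \<bullet> (a \<boxtimes> b)"
    by simp
  then have "\<delta> H \<bullet> (a \<star> b) = (a \<star> b) \<boxtimes> (a \<star> b)"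
    using assms by (simp add: \<delta>2_def tensor_\<delta>_def)
  then show ?thesis
    by (intro glI) (use assms in simp_all)
qed

text \<open>Weak multiplicativity of the counit: three factors are composable if each is composable with the next.\<close>

lemma \<epsilon>_mul3 [simp]:
  assumes "gl a" "gl b" "gl c" "el P"
  shows "(a \<star> b \<star> c) \<triangleright> P = (a \<star> b) \<triangleright> (b \<star> c) \<triangleright> P"
proof -
  have "\<epsilon> H \<cdot> \<mu> H \<cdot> (\<mu> H \<otimes> \<H>) = (\<epsilon> H \<otimes> \<epsilon> H) \<cdot> (\<mu> H \<otimes> \<mu> H) \<cdot> (\<H> \<otimes> \<delta> H \<otimes> \<H>)"
    using wha by (simp add: weak_hopf_algebra_def)
  then have "(\<epsilon> H \<cdot> \<mu> H \<cdot> (\<mu> H \<otimes> \<H>)) \<bullet> (a \<boxtimes> b \<boxtimes> c)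
      = ((\<epsilon> H \<otimes> \<epsilon> H) \<cdot> (\<mu> H \<otimes> \<mu> H) \<cdot> (\<H> \<otimes> \<delta> H \<otimes> \<H>)) \<bullet> (a \<boxtimes> b \<boxtimes> c)"
    by (simp only:)
  then have "\<epsilon> H \<bullet> (a \<star> b \<star> c) = (a \<star> b) \<triangleright> (\<epsilon> H \<bullet> (b \<star> c))"
    using assms by simp
  then have "(\<epsilon> H \<bullet> (a \<star> b \<star> c)) \<boxtimes> P = ((a \<star> b) \<triangleright> (\<epsilon> H \<bullet> (b \<star> c))) \<boxtimes> P"
    by (simp only:)
  then show ?thesis
    using assms by simp
qed

lemma mul_scale_self [simp]:
  assumes "gl a" "gl b"
  shows "a \<triangleright> (a \<star> b) = a \<star> b" "b \<triangleright> (a \<star> b) = a \<star> b"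
  using mul_scale(1) [of H a a b] mul_scale(2) [of H b a b] assms by simp_all

lemma scale_mul [simp]:
  assumes "gl a" "gl b" "el P"
  shows "(a \<star> b) \<triangleright> a \<triangleright> P = (a \<star> b) \<triangleright> P" "(a \<star> b) \<triangleright> b \<triangleright> P = (a \<star> b) \<triangleright> P"
    "a \<triangleright> (a \<star> b) \<triangleright> P = (a \<star> b) \<triangleright> P" "b \<triangleright> (a \<star> b) \<triangleright> P = (a \<star> b) \<triangleright> P"
proof -
  have "\<epsilon> H \<bullet> (a \<triangleright> (a \<star> b)) = \<epsilon> H \<bullet> (a \<star> b)" "\<epsilon> H \<bullet> (b \<triangleright> (a \<star> b)) = \<epsilon> H \<bullet> (a \<star> b)"
    using assms by (simp_all del: app_scale)
  then have "(a \<triangleright> (\<epsilon> H \<bullet> (a \<star> b))) \<boxtimes> P = (a \<star> b) \<triangleright> P" "(b \<triangleright> (\<epsilon> H \<bullet> (a \<star> b))) \<boxtimes> P = (a \<star> b) \<triangleright> P"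
    using assms by (simp_all del: mul_scale_self)
  then show "a \<triangleright> (a \<star> b) \<triangleright> P = (a \<star> b) \<triangleright> P" "b \<triangleright> (a \<star> b) \<triangleright> P = (a \<star> b) \<triangleright> P"
    using assms by (simp_all del: scale_left_commute)
  moreover have "(a \<star> b) \<triangleright> a \<triangleright> P = a \<triangleright> (a \<star> b) \<triangleright> P" "(a \<star> b) \<triangleright> b \<triangleright> P = b \<triangleright> (a \<star> b) \<triangleright> P"
    using assms by (auto intro!: scale_left_commute simp del: scale_left_commute)
  ultimately show "(a \<star> b) \<triangleright> a \<triangleright> P = (a \<star> b) \<triangleright> P" "(a \<star> b) \<triangleright> b \<triangleright> P = (a \<star> b) \<triangleright> P"
    by simp_all
qed

end

context cocommutative_wha
begin

text \<open>On grouplike elements \<open>\<pi>l\<close> sends \<open>z \<otimes> a\<close> to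
  \<open>\<epsilon>(z a) z\<close> and \<open>\<pi>r\<close> sends \<open>a \<otimes> z\<close> to
  \<open>\<epsilon>(a z) z\<close>. At \<open>z = 1\<close> these are \<open>\<Pi>\<^sup>L a\<close>
  and \<open>\<Pi>\<^sup>R a\<close>.\<close>

definition \<pi>l :: 'm
  where "\<pi>l = ((\<epsilon> H \<cdot> \<mu> H) \<otimes> \<H>) \<cdot> (\<H> \<otimes> \<gamma> (obj H) (obj H)) \<cdot> (\<delta> H \<otimes> \<H>)"

definition \<pi>r :: 'm
  where "\<pi>r = (\<H> \<otimes> (\<epsilon> H \<cdot> \<mu> H)) \<cdot> (\<gamma> (obj H) (obj H) \<otimes> \<H>) \<cdot> (\<H> \<otimes> \<delta> H)"

lemma \<pi>_simps [simp]:
  "\<pi>l \<in> Ar C" "source C \<pi>l = obj H \<odot> obj H" "target C \<pi>l = obj H"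
  "\<pi>r \<in> Ar C" "source C \<pi>r = obj H \<odot> obj H" "target C \<pi>r = obj H"
  by (simp_all add: \<pi>l_def \<pi>r_def)

end

context wha_stage
begin

lemma app_\<pi>l [simp]: "gl z \<Longrightarrow> gl a \<Longrightarrow> \<pi>l \<bullet> (z \<boxtimes> a) = (z \<star> a) \<triangleright> z"
  and app_\<pi>r [simp]: "gl z \<Longrightarrow> gl a \<Longrightarrow> \<pi>r \<bullet> (a \<boxtimes> z) = (a \<star> z) \<triangleright> z"
  by (simp_all add: \<pi>l_def \<pi>r_def)

lemma \<Pi>L_eq: "el P \<Longrightarrow> typ_of P = obj H \<Longrightarrow> \<Pi>L H \<bullet> P = \<pi>l \<bullet> (one H \<boxtimes> P)"
  by (simp add: \<Pi>L_def \<pi>l_def)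

lemma \<Pi>R_eq: "el P \<Longrightarrow> typ_of P = obj H \<Longrightarrow> \<Pi>R H \<bullet> P = \<pi>r \<bullet> (P \<boxtimes> one H)"
  by (simp add: \<Pi>R_def \<pi>r_def)

lemma mul_\<Pi>_gen:
  assumes "gl a" "gl z" "gl b"
  shows "(\<mu> H \<cdot> (\<H> \<otimes> \<pi>l)) \<bullet> (a \<boxtimes> z \<boxtimes> b) = (\<pi>l \<cdot> (\<mu> H \<otimes> \<H>)) \<bullet> (a \<boxtimes> z \<boxtimes> b)"
    and "(\<mu> H \<cdot> (\<pi>r \<otimes> \<H>)) \<bullet> (a \<boxtimes> z \<boxtimes> b) = (\<pi>r \<cdot> (\<H> \<otimes> \<mu> H)) \<bullet> (a \<boxtimes> z \<boxtimes> b)"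
  using assms by simp_all

end

context cocommutative_wha
begin

lemma mul_\<pi>l: "\<mu> H \<cdot> (\<H> \<otimes> \<pi>l) = \<pi>l \<cdot> (\<mu> H \<otimes> \<H>)"
  by (rule generic_ext3') (simp_all only: wha_stage.mul_\<Pi>_gen, simp_all)

lemma mul_\<pi>r: "\<mu> H \<cdot> (\<pi>r \<otimes> \<H>) = \<pi>r \<cdot> (\<H> \<otimes> \<mu> H)"
  by (rule generic_ext3') (simp_all only: wha_stage.mul_\<Pi>_gen, simp_all)

end

context wha_stage
begin

text \<open>Groupoid intuition: \<open>\<epsilon> (a b)\<close> tests whether \<open>a\<close> and \<open>b\<close> are composable.  Write \<open>a\<close> as \<open>a 1\<close>, expand
  \<open>\<epsilon> (a 1 b)\<close> by weak multiplicativity of the counit, and absorb \<open>\<epsilon> (a 1)\<close>.\<close>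

lemma mul_\<Pi>L:
  assumes "el P" "typ_of P = obj H" "el Q" "typ_of Q = obj H"
  shows "P \<star> (\<Pi>L H \<bullet> Q) = \<pi>l \<bullet> (P \<boxtimes> Q)"
proof -
  have "(\<mu> H \<cdot> (\<H> \<otimes> \<pi>l)) \<bullet> (P \<boxtimes> one H \<boxtimes> Q) = (\<pi>l \<cdot> (\<mu> H \<otimes> \<H>)) \<bullet> (P \<boxtimes> one H \<boxtimes> Q)"
    by (simp only: mul_\<pi>l)
  then show ?thesis
    using assms by (simp add: \<Pi>L_eq)
qed

lemma mul_\<Pi>R:
  assumes "el P" "typ_of P = obj H" "el Q" "typ_of Q = obj H"
  shows "(\<Pi>R H \<bullet> P) \<star> Q = \<pi>r \<bullet> (P \<boxtimes> Q)"
proof -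
  have "(\<mu> H \<cdot> (\<pi>r \<otimes> \<H>)) \<bullet> (P \<boxtimes> one H \<boxtimes> Q) = (\<pi>r \<cdot> (\<H> \<otimes> \<mu> H)) \<bullet> (P \<boxtimes> one H \<boxtimes> Q)"
    by (simp only: mul_\<pi>r)
  then show ?thesis
    using assms by (simp add: \<Pi>R_eq)
qed

lemma gl_mul_\<Pi> [simp]:
  assumes "gl a" "gl b"
  shows "a \<star> (\<Pi>L H \<bullet> b) = (a \<star> b) \<triangleright> a" "(\<Pi>R H \<bullet> a) \<star> b = (a \<star> b) \<triangleright> b"
  using assms by (simp_all add: mul_\<Pi>L mul_\<Pi>R)

end

context cocommutative_wha
begin

section \<open>The comultiplication of the unit\<close>

text \<open>\<open>\<omega>\<close> and \<open>\<omega>'\<close> keep a pair of grouplike elements exactly if they are composable, in this or in the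
  opposite order.  By the axioms for the unit each of them sends \<open>1 \<otimes> 1\<close> to \<open>\<delta> 1\<close>.\<close>

definition \<omega> :: 'm
  where "\<omega> = (\<H> \<otimes> (\<epsilon> H \<cdot> \<mu> H) \<otimes> \<H>) \<cdot> (\<delta> H \<otimes> \<delta> H)"

definition \<omega>' :: 'm
  where "\<omega>' = (\<H> \<otimes> (\<epsilon> H \<cdot> (\<mu> H \<cdot> \<gamma> (obj H) (obj H))) \<otimes> \<H>) \<cdot> (\<delta> H \<otimes> \<delta> H)"

lemma \<omega>_simps [simp]:
  "\<omega> \<in> Ar C" "source C \<omega> = obj H \<odot> obj H" "target C \<omega> = obj H \<odot> obj H"
  "\<omega>' \<in> Ar C" "source C \<omega>' = obj H \<odot> obj H" "target C \<omega>' = obj H \<odot> obj H"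
  by (simp_all add: \<omega>_def \<omega>'_def)

end

context wha_stage
begin

lemma app_\<omega> [simp]:
  assumes "gl z" "gl w"
  shows "\<omega> \<bullet> (z \<boxtimes> w) = (z \<star> w) \<triangleright> (z \<boxtimes> w)" "\<omega>' \<bullet> (z \<boxtimes> w) = (w \<star> z) \<triangleright> (z \<boxtimes> w)"
  using assms by (simp_all add: \<omega>_def \<omega>'_def)

text \<open>The unit axioms, with the three tensor factors of \<open>\<delta>\<^sup>2 1\<close> kept.\<close>

lemma unit_axioms:
  "(\<delta> H \<otimes> \<H>) \<bullet> \<delta> H \<bullet> one H = (\<H> \<otimes> \<mu> H \<otimes> \<H>) \<bullet> ((\<delta> H \<bullet> one H) \<boxtimes> (\<delta> H \<bullet> one H))"
  "(\<delta> H \<otimes> \<H>) \<bullet> \<delta> H \<bullet> one H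
    = (\<H> \<otimes> (\<mu> H \<cdot> \<gamma> (obj H) (obj H)) \<otimes> \<H>) \<bullet> ((\<delta> H \<bullet> one H) \<boxtimes> (\<delta> H \<bullet> one H))"
proof -
  have 1: "(\<delta> H \<otimes> \<H>) \<cdot> \<delta> H \<cdot> \<eta> H = (\<H> \<otimes> \<mu> H \<otimes> \<H>) \<cdot> (\<delta> H \<otimes> \<delta> H) \<cdot> (\<eta> H \<otimes> \<eta> H)"
    and 2: "(\<delta> H \<otimes> \<H>) \<cdot> \<delta> H \<cdot> \<eta> H
      = (\<H> \<otimes> (\<mu> H \<cdot> \<gamma> (obj H) (obj H)) \<otimes> \<H>) \<cdot> (\<delta> H \<otimes> \<delta> H) \<cdot> (\<eta> H \<otimes> \<eta> H)"
    using wha unfolding weak_hopf_algebra_def by blast+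
  have "((\<delta> H \<otimes> \<H>) \<cdot> \<delta> H \<cdot> \<eta> H) \<bullet> \<iota>
      = ((\<H> \<otimes> \<mu> H \<otimes> \<H>) \<cdot> (\<delta> H \<otimes> \<delta> H) \<cdot> (\<eta> H \<otimes> \<eta> H)) \<bullet> \<iota>"
    by (simp only: 1)
  then show "(\<delta> H \<otimes> \<H>) \<bullet> \<delta> H \<bullet> one H = (\<H> \<otimes> \<mu> H \<otimes> \<H>) \<bullet> ((\<delta> H \<bullet> one H) \<boxtimes> (\<delta> H \<bullet> one H))"
    by simp
  have "((\<delta> H \<otimes> \<H>) \<cdot> \<delta> H \<cdot> \<eta> H) \<bullet> \<iota>
      = ((\<H> \<otimes> (\<mu> H \<cdot> \<gamma> (obj H) (obj H)) \<otimes> \<H>) \<cdot> (\<delta> H \<otimes> \<delta> H) \<cdot> (\<eta> H \<otimes> \<eta> H)) \<bullet> \<iota>"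
    by (simp only: 2)
  then show "(\<delta> H \<otimes> \<H>) \<bullet> \<delta> H \<bullet> one H
    = (\<H> \<otimes> (\<mu> H \<cdot> \<gamma> (obj H) (obj H)) \<otimes> \<H>) \<bullet> ((\<delta> H \<bullet> one H) \<boxtimes> (\<delta> H \<bullet> one H))"
    by simp
qed

text \<open>The counit is applied to the middle factor of \<open>unit_axioms\<close>.\<close>

lemma \<omega>_one: "\<omega> \<bullet> (one H \<boxtimes> one H) = \<delta> H \<bullet> one H" "\<omega>' \<bullet> (one H \<boxtimes> one H) = \<delta> H \<bullet> one H"
proof -
  have "(\<H> \<otimes> \<epsilon> H \<otimes> \<H>) \<cdot> (\<delta> H \<otimes> \<H>) = \<langle>obj H \<odot> obj H\<rangle>"
    using interchange [of "\<delta> H" "\<H> \<otimes> \<epsilon> H" "\<H>" "\<H>"] by simp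
  then have *: "(\<H> \<otimes> \<epsilon> H \<otimes> \<H>) \<bullet> (\<delta> H \<otimes> \<H>) \<bullet> \<delta> H \<bullet> one H = \<delta> H \<bullet> one H"
    by (simp flip: app_app [of "\<delta> H \<bullet> one H"])
  have l: "(\<H> \<otimes> \<epsilon> H \<otimes> \<H>) \<cdot> (\<H> \<otimes> f \<otimes> \<H>) = \<H> \<otimes> (\<epsilon> H \<cdot> f) \<otimes> \<H>"
    if "f \<in> Ar C" "target C f = obj H" for f
    using that interchange [of "\<H>" "\<H>" "f \<otimes> \<H>" "\<epsilon> H \<otimes> \<H>"]
      interchange [of f "\<epsilon> H" "\<H>" "\<H>"] by simp
  have r: "(\<H> \<otimes> (\<epsilon> H \<cdot> f) \<otimes> \<H>) \<bullet> U
      = (\<H> \<otimes> \<epsilon> H \<otimes> \<H>) \<bullet> (\<H> \<otimes> f \<otimes> \<H>) \<bullet> U"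
    if "f \<in> Ar C" "target C f = obj H" "el U" "typ_of U = obj H \<odot> source C f \<odot> obj H" for f U
    unfolding l [OF that(1,2), symmetric] using that by simp
  have "\<omega> \<bullet> (one H \<boxtimes> one H) = (\<H> \<otimes> (\<epsilon> H \<cdot> \<mu> H) \<otimes> \<H>) \<bullet> ((\<delta> H \<bullet> one H) \<boxtimes> (\<delta> H \<bullet> one H))"
    by (simp add: \<omega>_def)
  also have "\<dots> = (\<H> \<otimes> \<epsilon> H \<otimes> \<H>) \<bullet>
      ((\<H> \<otimes> \<mu> H \<otimes> \<H>) \<bullet> ((\<delta> H \<bullet> one H) \<boxtimes> (\<delta> H \<bullet> one H)))"
    by (rule r) simp_all
  finally show "\<omega> \<bullet> (one H \<boxtimes> one H) = \<delta> H \<bullet> one H"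
    by (simp only: * flip: unit_axioms(1))
  have "\<omega>' \<bullet> (one H \<boxtimes> one H) = (\<H> \<otimes> (\<epsilon> H \<cdot> (\<mu> H \<cdot> \<gamma> (obj H) (obj H))) \<otimes> \<H>)
      \<bullet> ((\<delta> H \<bullet> one H) \<boxtimes> (\<delta> H \<bullet> one H))"
    by (simp add: \<omega>'_def)
  also have "\<dots> = (\<H> \<otimes> \<epsilon> H \<otimes> \<H>) \<bullet>
      ((\<H> \<otimes> (\<mu> H \<cdot> \<gamma> (obj H) (obj H)) \<otimes> \<H>) \<bullet> ((\<delta> H \<bullet> one H) \<boxtimes> (\<delta> H \<bullet> one H)))"
    by (rule r) simp_all
  finally show "\<omega>' \<bullet> (one H \<boxtimes> one H) = \<delta> H \<bullet> one H"
    by (simp only: * flip: unit_axioms(2))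
qed

end

context wha_stage
begin

lemma \<pi>_alt_gen:
  assumes "gl z" "gl a"
  shows "\<pi>l \<bullet> (z \<boxtimes> a) = ((\<H> \<otimes> (\<epsilon> H \<cdot> \<mu> H)) \<cdot> (\<delta> H \<otimes> \<H>)) \<bullet> (z \<boxtimes> a)"
    and "\<pi>r \<bullet> (a \<boxtimes> z) = (((\<epsilon> H \<cdot> \<mu> H) \<otimes> \<H>) \<cdot> (\<H> \<otimes> \<delta> H)) \<bullet> (a \<boxtimes> z)"
  using assms by simp_all

lemma \<omega>_\<pi>_gen:
  assumes "gl z" "gl w"
  shows "((\<pi>r \<otimes> \<H>) \<cdot> ((\<H> \<otimes> \<gamma> (obj H) (obj H)) \<cdot> (\<delta> H \<otimes> \<H>))) \<bullet> (z \<boxtimes> w)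
      = (\<gamma> (obj H) (obj H) \<cdot> \<omega>) \<bullet> (z \<boxtimes> w)"
    and "(((\<pi>l \<cdot> \<gamma> (obj H) (obj H)) \<otimes> \<H>) \<cdot> ((\<H> \<otimes> \<gamma> (obj H) (obj H)) \<cdot> (\<delta> H \<otimes> \<H>))) \<bullet> (z \<boxtimes> w)
      = (\<gamma> (obj H) (obj H) \<cdot> \<omega>') \<bullet> (z \<boxtimes> w)"
  using assms by simp_all

lemma \<Pi>_\<delta>_gen:
  assumes "gl z"
  shows "((\<Pi>R H \<otimes> \<H>) \<cdot> \<delta> H) \<bullet> z
      = (((\<pi>r \<otimes> \<H>) \<cdot> ((\<H> \<otimes> \<gamma> (obj H) (obj H)) \<cdot> (\<delta> H \<otimes> \<H>))) \<cdot> (\<H> \<otimes> \<eta> H)) \<bullet> z"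
    and "((\<Pi>L H \<otimes> \<H>) \<cdot> \<delta> H) \<bullet> z
      = ((((\<pi>l \<cdot> \<gamma> (obj H) (obj H)) \<otimes> \<H>) \<cdot> ((\<H> \<otimes> \<gamma> (obj H) (obj H)) \<cdot> (\<delta> H \<otimes> \<H>)))
        \<cdot> (\<H> \<otimes> \<eta> H)) \<bullet> z"
  using assms by (simp_all add: \<Pi>R_eq \<Pi>L_eq)

end

context cocommutative_wha
begin

lemma \<pi>l_alt: "\<pi>l = (\<H> \<otimes> (\<epsilon> H \<cdot> \<mu> H)) \<cdot> (\<delta> H \<otimes> \<H>)"
  by (rule generic_ext2') (simp_all only: wha_stage.\<pi>_alt_gen, simp_all)

lemma \<pi>r_alt: "\<pi>r = ((\<epsilon> H \<cdot> \<mu> H) \<otimes> \<H>) \<cdot> (\<H> \<otimes> \<delta> H)"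
  by (rule generic_ext2') (simp_all only: wha_stage.\<pi>_alt_gen, simp_all)

lemma \<omega>_\<pi>r: "(\<pi>r \<otimes> \<H>) \<cdot> ((\<H> \<otimes> \<gamma> (obj H) (obj H)) \<cdot> (\<delta> H \<otimes> \<H>))
    = \<gamma> (obj H) (obj H) \<cdot> \<omega>"
  by (rule generic_ext2') (simp_all only: wha_stage.\<omega>_\<pi>_gen, simp_all)

lemma \<omega>'_\<pi>l: "((\<pi>l \<cdot> \<gamma> (obj H) (obj H)) \<otimes> \<H>) \<cdot> ((\<H> \<otimes> \<gamma> (obj H) (obj H)) \<cdot> (\<delta> H \<otimes> \<H>))
    = \<gamma> (obj H) (obj H) \<cdot> \<omega>'"
  by (rule generic_ext2') (simp_all only: wha_stage.\<omega>_\<pi>_gen, simp_all)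

lemma \<Pi>R_\<delta>: "(\<Pi>R H \<otimes> \<H>) \<cdot> \<delta> H = (\<gamma> (obj H) (obj H) \<cdot> \<omega>) \<cdot> (\<H> \<otimes> \<eta> H)"
  unfolding \<omega>_\<pi>r [symmetric]
  by (rule generic_ext1') (simp_all only: wha_stage.\<Pi>_\<delta>_gen, simp_all)

lemma \<Pi>L_\<delta>: "(\<Pi>L H \<otimes> \<H>) \<cdot> \<delta> H = (\<gamma> (obj H) (obj H) \<cdot> \<omega>') \<cdot> (\<H> \<otimes> \<eta> H)"
  unfolding \<omega>'_\<pi>l [symmetric]
  by (rule generic_ext1') (simp_all only: wha_stage.\<Pi>_\<delta>_gen, simp_all)

end

context wha_stage
begin

lemma swap_\<delta>: "el P \<Longrightarrow> typ_of P = obj H \<Longrightarrow> \<gamma> (obj H) (obj H) \<bullet> \<delta> H \<bullet> P = \<delta> H \<bullet> P"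
proof -
  assume P: "el P" "typ_of P = obj H"
  have "(\<gamma> (obj H) (obj H) \<cdot> \<delta> H) \<bullet> P = \<delta> H \<bullet> P"
    using cocomm by (simp only: cocommutative_def)
  then show ?thesis using P by simp
qed

text \<open>The formula for \<open>(\<Pi> \<otimes> H) \<circ> \<delta>\<close> turns \<open>\<delta> 1\<close>
  into \<open>\<omega>(1 \<otimes> 1)\<close> or \<open>\<omega>'(1 \<otimes> 1)\<close>, up to the
  symmetry, and this is \<open>\<delta> 1\<close> again.\<close>

lemma \<Pi>_\<delta>_one:
  "(\<Pi>R H \<otimes> \<H>) \<bullet> \<delta> H \<bullet> one H = \<delta> H \<bullet> one H" "(\<Pi>L H \<otimes> \<H>) \<bullet> \<delta> H \<bullet> one H = \<delta> H \<bullet> one H"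
proof -
  have "((\<Pi>R H \<otimes> \<H>) \<cdot> \<delta> H) \<bullet> one H = ((\<gamma> (obj H) (obj H) \<cdot> \<omega>) \<cdot> (\<H> \<otimes> \<eta> H)) \<bullet> one H"
    by (simp only: \<Pi>R_\<delta>)
  then show "(\<Pi>R H \<otimes> \<H>) \<bullet> \<delta> H \<bullet> one H = \<delta> H \<bullet> one H"
    by (simp add: \<omega>_one swap_\<delta>)
  have "((\<Pi>L H \<otimes> \<H>) \<cdot> \<delta> H) \<bullet> one H = ((\<gamma> (obj H) (obj H) \<cdot> \<omega>') \<cdot> (\<H> \<otimes> \<eta> H)) \<bullet> one H"
    by (simp only: \<Pi>L_\<delta>)
  then show "(\<Pi>L H \<otimes> \<H>) \<bullet> \<delta> H \<bullet> one H = \<delta> H \<bullet> one H"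
    by (simp add: \<omega>_one swap_\<delta>)
qed

lemma \<Pi>_\<delta>_one':
  "(\<H> \<otimes> \<Pi>R H) \<bullet> \<delta> H \<bullet> one H = \<delta> H \<bullet> one H" "(\<H> \<otimes> \<Pi>L H) \<bullet> \<delta> H \<bullet> one H = \<delta> H \<bullet> one H"
proof -
  have *: "(\<H> \<otimes> f) \<bullet> \<delta> H \<bullet> one H = \<gamma> (obj H) (obj H) \<bullet> (f \<otimes> \<H>) \<bullet> \<delta> H \<bullet> one H"
    if "f \<in> Ar C" "source C f = obj H" "target C f = obj H" for f
  proof -
    have "(\<gamma> (obj H) (obj H) \<cdot> (f \<otimes> \<H>)) \<bullet> \<delta> H \<bullet> one H
        = ((\<H> \<otimes> f) \<cdot> \<gamma> (obj H) (obj H)) \<bullet> \<delta> H \<bullet> one H"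
      using symmetry_natural' [of f "\<H>" "obj H" "obj H"] that by simp
    then show ?thesis using that by (simp add: swap_\<delta>)
  qed
  show "(\<H> \<otimes> \<Pi>R H) \<bullet> \<delta> H \<bullet> one H = \<delta> H \<bullet> one H" "(\<H> \<otimes> \<Pi>L H) \<bullet> \<delta> H \<bullet> one H = \<delta> H \<bullet> one H"
    by (simp_all add: * \<Pi>_\<delta>_one swap_\<delta>)
qed

text \<open>The value \<open>\<Pi>\<^sup>L a\<close> is a leg of \<open>\<delta> 1\<close>, contracted with
  \<open>a\<close>; both projections fix the legs of \<open>\<delta> 1\<close>.\<close>

lemma app_\<Pi>_\<Pi>:
  assumes f: "f = \<Pi>L H \<or> f = \<Pi>R H" and P: "el P" "typ_of P = obj H"
  shows "f \<bullet> \<Pi>L H \<bullet> P = \<Pi>L H \<bullet> P" "f \<bullet> \<Pi>R H \<bullet> P = \<Pi>R H \<bullet> P" "f \<bullet> one H = one H"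
proof -
  have [simp]: "f \<in> Ar C" "source C f = obj H" "target C f = obj H"
    and 1: "(f \<otimes> \<H>) \<bullet> \<delta> H \<bullet> one H = \<delta> H \<bullet> one H" "(\<H> \<otimes> f) \<bullet> \<delta> H \<bullet> one H = \<delta> H \<bullet> one H"
    using f by (auto simp: \<Pi>_\<delta>_one \<Pi>_\<delta>_one')
  note [simp] = P
  have L: "f \<cdot> (\<H> \<otimes> (\<epsilon> H \<cdot> \<mu> H)) = (\<H> \<otimes> (\<epsilon> H \<cdot> \<mu> H)) \<cdot> (f \<otimes> \<langle>obj H \<odot> obj H\<rangle>)"
    using interchange [of "\<H>" f "\<epsilon> H \<cdot> \<mu> H" "\<langle>\<one>\<rangle>"] interchange [of f "\<H>" "\<langle>obj H \<odot> obj H\<rangle>" "\<epsilon> H \<cdot> \<mu> H"]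
    by simp
  have "f \<bullet> \<Pi>L H \<bullet> P = (f \<cdot> (\<H> \<otimes> (\<epsilon> H \<cdot> \<mu> H))) \<bullet> ((\<delta> H \<bullet> one H) \<boxtimes> P)"
    by (simp add: \<Pi>L_eq \<pi>l_alt)
  also have "\<dots> = (\<H> \<otimes> (\<epsilon> H \<cdot> \<mu> H)) \<bullet> (((f \<otimes> \<H>) \<otimes> \<H>) \<bullet> ((\<delta> H \<bullet> one H) \<boxtimes> P))"
    unfolding L by simp
  also have "((f \<otimes> \<H>) \<otimes> \<H>) \<bullet> ((\<delta> H \<bullet> one H) \<boxtimes> P) = (\<delta> H \<bullet> one H) \<boxtimes> P"
    by (subst app_pair) (simp_all add: 1)
  finally show "f \<bullet> \<Pi>L H \<bullet> P = \<Pi>L H \<bullet> P"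
    by (simp add: \<Pi>L_eq \<pi>l_alt)
  have R: "f \<cdot> ((\<epsilon> H \<cdot> \<mu> H) \<otimes> \<H>) = ((\<epsilon> H \<cdot> \<mu> H) \<otimes> \<H>) \<cdot> (\<langle>obj H \<odot> obj H\<rangle> \<otimes> f)"
    using interchange [of "\<epsilon> H \<cdot> \<mu> H" "\<langle>\<one>\<rangle>" "\<H>" f] interchange [of "\<langle>obj H \<odot> obj H\<rangle>" "\<epsilon> H \<cdot> \<mu> H" f "\<H>"]
    by simp
  have "f \<bullet> \<Pi>R H \<bullet> P = (f \<cdot> ((\<epsilon> H \<cdot> \<mu> H) \<otimes> \<H>)) \<bullet> (P \<boxtimes> (\<delta> H \<bullet> one H))"
    by (simp add: \<Pi>R_eq \<pi>r_alt)
  also have "\<dots> = ((\<epsilon> H \<cdot> \<mu> H) \<otimes> \<H>) \<bullet> ((\<H> \<otimes> (\<H> \<otimes> f)) \<bullet> (P \<boxtimes> (\<delta> H \<bullet> one H)))"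
    unfolding R by (simp add: ident_merge)
  also have "(\<H> \<otimes> (\<H> \<otimes> f)) \<bullet> (P \<boxtimes> (\<delta> H \<bullet> one H)) = P \<boxtimes> (\<delta> H \<bullet> one H)"
    by (subst app_pair) (simp_all add: 1)
  finally show "f \<bullet> \<Pi>R H \<bullet> P = \<Pi>R H \<bullet> P"
    by (simp add: \<Pi>R_eq \<pi>r_alt)
  have id: "(\<H> \<otimes> \<epsilon> H) \<bullet> \<delta> H \<bullet> one H = one H"
  proof -
    have "((\<H> \<otimes> \<epsilon> H) \<cdot> \<delta> H) \<bullet> one H = one H"
      unfolding H_simps by simp
    then show ?thesis by (simp del: H_simps(8))
  qed
  have fe: "f \<cdot> (\<H> \<otimes> \<epsilon> H) = (\<H> \<otimes> \<epsilon> H) \<cdot> (f \<otimes> \<H>)"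
    using interchange [of "\<H>" f "\<epsilon> H" "\<langle>\<one>\<rangle>"] interchange [of f "\<H>" "\<H>" "\<epsilon> H"] by simp
  have "f \<bullet> one H = (f \<cdot> (\<H> \<otimes> \<epsilon> H)) \<bullet> \<delta> H \<bullet> one H"
    by (simp add: id)
  also have "\<dots> = one H"
    unfolding fe by (simp add: 1 id)
  finally show "f \<bullet> one H = one H" .
qed

lemma \<Pi>_\<Pi> [simp]:
  assumes "el P" "typ_of P = obj H"
  shows "\<Pi>L H \<bullet> \<Pi>L H \<bullet> P = \<Pi>L H \<bullet> P" "\<Pi>L H \<bullet> \<Pi>R H \<bullet> P = \<Pi>R H \<bullet> P"
    "\<Pi>R H \<bullet> \<Pi>L H \<bullet> P = \<Pi>L H \<bullet> P" "\<Pi>R H \<bullet> \<Pi>R H \<bullet> P = \<Pi>R H \<bullet> P"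
  using app_\<Pi>_\<Pi> [OF _ assms] by blast+

lemma \<Pi>_one [simp]: "\<Pi>L H \<bullet> one H = one H" "\<Pi>R H \<bullet> one H = one H"
  using app_\<Pi>_\<Pi> [of _ "one H"] by simp_all

end

context cocommutative_wha
begin

section \<open>Targets, sources and inverses of grouplike elements\<close>

text \<open>The steps that lead from \<open>\<Pi>\<^sup>L a \<otimes> \<Pi>\<^sup>L a\<close> to
  \<open>\<delta> (\<Pi>\<^sup>L a)\<close>, with a generic \<open>z\<close> in the place of the unit.
  The next lemmas about \<open>\<Pi>\<^sup>L\<close> and \<open>\<Pi>\<^sup>R\<close> serve the same
  purpose.\<close>

lemma \<Pi>L_pair:
  "(\<pi>l \<otimes> \<Pi>L H) \<cdot> (\<H> \<otimes> \<delta> H)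
    = (\<H> \<otimes> (\<Pi>L H \<cdot> \<mu> H)) \<cdot> (((\<H> \<otimes> \<Pi>R H) \<cdot> \<delta> H) \<otimes> \<H>)"
  "(\<H> \<otimes> (\<Pi>L H \<cdot> \<mu> H)) \<cdot> (\<delta> H \<otimes> \<H>)
    = ((\<H> \<otimes> (\<pi>l \<cdot> (\<H> \<otimes> \<mu> H))) \<cdot> (((\<H> \<otimes> \<gamma> (obj H) (obj H)) \<cdot> (\<delta> H \<otimes> \<H>)) \<otimes> \<H>))
      \<cdot> (\<H> \<otimes> \<eta> H \<otimes> \<H>)"
  "(\<pi>l \<otimes> \<H>) \<cdot> (\<H> \<otimes> \<gamma> (obj H) (obj H)) \<cdot> (\<delta> H \<otimes> \<H>) = \<delta> H \<cdot> \<pi>l"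
proof -
  show "(\<pi>l \<otimes> \<Pi>L H) \<cdot> (\<H> \<otimes> \<delta> H)
    = (\<H> \<otimes> (\<Pi>L H \<cdot> \<mu> H)) \<cdot> (((\<H> \<otimes> \<Pi>R H) \<cdot> \<delta> H) \<otimes> \<H>)"
  proof (rule generic_ext2', goal_cases)
    case (5 X e d z a)
    then interpret wha_stage C H X e d by simp
    show ?case using 5 by simp
  qed simp_all
  show "(\<H> \<otimes> (\<Pi>L H \<cdot> \<mu> H)) \<cdot> (\<delta> H \<otimes> \<H>)
    = ((\<H> \<otimes> (\<pi>l \<cdot> (\<H> \<otimes> \<mu> H))) \<cdot> (((\<H> \<otimes> \<gamma> (obj H) (obj H)) \<cdot> (\<delta> H \<otimes> \<H>)) \<otimes> \<H>))
      \<cdot> (\<H> \<otimes> \<eta> H \<otimes> \<H>)"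
  proof (rule generic_ext2', goal_cases)
    case (5 X e d z a)
    then interpret wha_stage C H X e d by simp
    show ?case using 5 by (simp add: \<Pi>L_eq [of "mul H z a"])
  qed simp_all
  show "(\<pi>l \<otimes> \<H>) \<cdot> (\<H> \<otimes> \<gamma> (obj H) (obj H)) \<cdot> (\<delta> H \<otimes> \<H>) = \<delta> H \<cdot> \<pi>l"
  proof (rule generic_ext2', goal_cases)
    case (5 X e d z a)
    then interpret wha_stage C H X e d by simp
    show ?case using 5 by simp
  qed simp_all
qed

lemma \<Pi>L_pair3:
  "(\<H> \<otimes> (\<pi>l \<cdot> (\<H> \<otimes> \<mu> H))) \<cdot> (((\<H> \<otimes> \<gamma> (obj H) (obj H)) \<cdot> (\<delta> H \<otimes> \<H>)) \<otimes> \<H>)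
    = (\<pi>l \<otimes> \<H>) \<cdot> (\<H> \<otimes> \<gamma> (obj H) (obj H)) \<cdot> (\<omega>' \<otimes> \<H>)"
proof (rule generic_ext3', goal_cases)
  case (5 X e d z w a)
  then interpret wha_stage C H X e d by simp
  show ?case using 5 by simp
qed simp_all

lemma \<Pi>R_pair:
  "(\<Pi>R H \<otimes> \<pi>r) \<cdot> (\<delta> H \<otimes> \<H>)
    = ((\<Pi>R H \<cdot> \<mu> H) \<otimes> \<H>) \<cdot> (\<H> \<otimes> ((\<Pi>L H \<otimes> \<H>) \<cdot> \<delta> H))"
  "((\<Pi>R H \<cdot> \<mu> H) \<otimes> \<H>) \<cdot> (\<H> \<otimes> \<delta> H)
    = (((\<pi>r \<cdot> (\<mu> H \<otimes> \<H>)) \<otimes> \<H>) \<cdot> (\<H> \<otimes> ((\<gamma> (obj H) (obj H) \<otimes> \<H>) \<cdot> (\<H> \<otimes> \<delta> H))))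
      \<cdot> (\<H> \<otimes> \<eta> H \<otimes> \<H>)"
  "(\<H> \<otimes> \<pi>r) \<cdot> (\<gamma> (obj H) (obj H) \<otimes> \<H>) \<cdot> (\<H> \<otimes> \<delta> H) = \<delta> H \<cdot> \<pi>r"
proof -
  show "(\<Pi>R H \<otimes> \<pi>r) \<cdot> (\<delta> H \<otimes> \<H>)
    = ((\<Pi>R H \<cdot> \<mu> H) \<otimes> \<H>) \<cdot> (\<H> \<otimes> ((\<Pi>L H \<otimes> \<H>) \<cdot> \<delta> H))"
  proof (rule generic_ext2', goal_cases)
    case (5 X e d z a)
    then interpret wha_stage C H X e d by simp
    show ?case using 5 by simp
  qed simp_all
  show "((\<Pi>R H \<cdot> \<mu> H) \<otimes> \<H>) \<cdot> (\<H> \<otimes> \<delta> H)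
    = (((\<pi>r \<cdot> (\<mu> H \<otimes> \<H>)) \<otimes> \<H>) \<cdot> (\<H> \<otimes> ((\<gamma> (obj H) (obj H) \<otimes> \<H>) \<cdot> (\<H> \<otimes> \<delta> H))))
      \<cdot> (\<H> \<otimes> \<eta> H \<otimes> \<H>)"
  proof (rule generic_ext2', goal_cases)
    case (5 X e d a z)
    then interpret wha_stage C H X e d by simp
    show ?case using 5 by (simp add: \<Pi>R_eq [of "mul H a z"])
  qed simp_all
  show "(\<H> \<otimes> \<pi>r) \<cdot> (\<gamma> (obj H) (obj H) \<otimes> \<H>) \<cdot> (\<H> \<otimes> \<delta> H) = \<delta> H \<cdot> \<pi>r"
  proof (rule generic_ext2', goal_cases)
    case (5 X e d a z)
    then interpret wha_stage C H X e d by simp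
    show ?case using 5 by simp
  qed simp_all
qed

lemma \<Pi>R_pair3:
  "((\<pi>r \<cdot> (\<mu> H \<otimes> \<H>)) \<otimes> \<H>) \<cdot> (\<H> \<otimes> ((\<gamma> (obj H) (obj H) \<otimes> \<H>) \<cdot> (\<H> \<otimes> \<delta> H)))
    = (\<H> \<otimes> \<pi>r) \<cdot> (\<gamma> (obj H) (obj H) \<otimes> \<H>) \<cdot> (\<H> \<otimes> \<omega>')"
proof (rule generic_ext3', goal_cases)
  case (5 X e d a w z)
  then interpret wha_stage C H X e d by simp
  show ?case using 5 by simp
qed simp_all

text \<open>At \<open>z = 1\<close> these identities say that \<open>\<Pi>\<^sup>L a\<close> is a left unit and
  \<open>\<Pi>\<^sup>R a\<close> a right unit for \<open>a\<close>.\<close>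

lemma mul_\<pi>:
  "\<mu> H \<cdot> (\<pi>l \<otimes> \<H>) \<cdot> (\<H> \<otimes> \<delta> H) = \<mu> H"
  "\<mu> H \<cdot> (\<H> \<otimes> \<pi>r) \<cdot> (\<delta> H \<otimes> \<H>) = \<mu> H"
proof -
  show "\<mu> H \<cdot> (\<pi>l \<otimes> \<H>) \<cdot> (\<H> \<otimes> \<delta> H) = \<mu> H"
  proof (rule generic_ext2', goal_cases)
    case (5 X e d z a)
    then interpret wha_stage C H X e d by simp
    show ?case using 5 by simp
  qed simp_all
  show "\<mu> H \<cdot> (\<H> \<otimes> \<pi>r) \<cdot> (\<delta> H \<otimes> \<H>) = \<mu> H"
  proof (rule generic_ext2', goal_cases)
    case (5 X e d a z)
    then interpret wha_stage C H X e d by simp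
    show ?case using 5 by simp
  qed simp_all
qed

end

context wha_stage
begin

lemma gl_\<Pi>L [simp]:
  assumes a: "gl a"
  shows "gl (\<Pi>L H \<bullet> a)"
proof (rule glI)
  note [simp] = a \<Pi>_\<delta>_one' \<omega>_one
  have "(\<Pi>L H \<bullet> a) \<boxtimes> (\<Pi>L H \<bullet> a) = ((\<pi>l \<otimes> \<Pi>L H) \<cdot> (\<H> \<otimes> \<delta> H)) \<bullet> (one H \<boxtimes> a)"
    by (simp add: \<Pi>L_eq)
  also have "\<dots> = ((\<H> \<otimes> (\<Pi>L H \<cdot> \<mu> H)) \<cdot> (\<delta> H \<otimes> \<H>)) \<bullet> (one H \<boxtimes> a)"
    unfolding \<Pi>L_pair(1) by simp
  also have "\<dots> = ((\<H> \<otimes> (\<pi>l \<cdot> (\<H> \<otimes> \<mu> H))) \<cdot> (((\<H> \<otimes> \<gamma> (obj H) (obj H)) \<cdot> (\<delta> H \<otimes> \<H>)) \<otimes> \<H>))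
      \<bullet> ((\<H> \<otimes> \<eta> H \<otimes> \<H>) \<bullet> (one H \<boxtimes> a))"
    unfolding \<Pi>L_pair(2) by (subst app_app) simp_all
  also have "\<dots> = ((\<pi>l \<otimes> \<H>) \<cdot> (\<H> \<otimes> \<gamma> (obj H) (obj H)) \<cdot> (\<delta> H \<otimes> \<H>)) \<bullet> (one H \<boxtimes> a)"
    unfolding \<Pi>L_pair3 by simp
  also have "\<dots> = \<delta> H \<bullet> \<Pi>L H \<bullet> a"
    unfolding \<Pi>L_pair(3) by (simp add: \<Pi>L_eq)
  finally show "\<delta> H \<bullet> \<Pi>L H \<bullet> a = (\<Pi>L H \<bullet> a) \<boxtimes> (\<Pi>L H \<bullet> a)" ..
qed (use a in simp_all)

lemma gl_\<Pi>R [simp]: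
  assumes a: "gl a"
  shows "gl (\<Pi>R H \<bullet> a)"
proof (rule glI)
  note [simp] = a \<Pi>_\<delta>_one \<omega>_one
  have "(\<Pi>R H \<bullet> a) \<boxtimes> (\<Pi>R H \<bullet> a) = ((\<Pi>R H \<otimes> \<pi>r) \<cdot> (\<delta> H \<otimes> \<H>)) \<bullet> (a \<boxtimes> one H)"
    by (simp add: \<Pi>R_eq)
  also have "\<dots> = (((\<Pi>R H \<cdot> \<mu> H) \<otimes> \<H>) \<cdot> (\<H> \<otimes> \<delta> H)) \<bullet> (a \<boxtimes> one H)"
    unfolding \<Pi>R_pair(1) by simp
  also have "\<dots> = (((\<pi>r \<cdot> (\<mu> H \<otimes> \<H>)) \<otimes> \<H>) \<cdot> (\<H> \<otimes> ((\<gamma> (obj H) (obj H) \<otimes> \<H>) \<cdot> (\<H> \<otimes> \<delta> H))))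
      \<bullet> ((\<H> \<otimes> \<eta> H \<otimes> \<H>) \<bullet> (a \<boxtimes> one H))"
    unfolding \<Pi>R_pair(2) by (subst app_app) simp_all
  also have "\<dots> = ((\<H> \<otimes> \<pi>r) \<cdot> (\<gamma> (obj H) (obj H) \<otimes> \<H>) \<cdot> (\<H> \<otimes> \<delta> H)) \<bullet> (a \<boxtimes> one H)"
    unfolding \<Pi>R_pair3 by simp
  also have "\<dots> = \<delta> H \<bullet> \<Pi>R H \<bullet> a"
    unfolding \<Pi>R_pair(3) by (simp add: \<Pi>R_eq)
  finally show "\<delta> H \<bullet> \<Pi>R H \<bullet> a = (\<Pi>R H \<bullet> a) \<boxtimes> (\<Pi>R H \<bullet> a)" ..
qed (use a in simp_all)

abbreviation inv_H :: "('o, 'm) element \<Rightarrow> ('o, 'm) element"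
  where "inv_H a \<equiv> antipode H \<bullet> a"

lemma \<Pi>_mul [simp]:
  assumes "gl a"
  shows "(\<Pi>L H \<bullet> a) \<star> a = a" "a \<star> (\<Pi>R H \<bullet> a) = a"
proof -
  note [simp] = assms
  have "(\<mu> H \<cdot> (\<pi>l \<otimes> \<H>) \<cdot> (\<H> \<otimes> \<delta> H)) \<bullet> (one H \<boxtimes> a) = \<mu> H \<bullet> (one H \<boxtimes> a)"
    unfolding mul_\<pi> ..
  then show "(\<Pi>L H \<bullet> a) \<star> a = a" by (simp add: \<Pi>L_eq)
  have "(\<mu> H \<cdot> (\<H> \<otimes> \<pi>r) \<cdot> (\<delta> H \<otimes> \<H>)) \<bullet> (a \<boxtimes> one H) = \<mu> H \<bullet> (a \<boxtimes> one H)"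
    unfolding mul_\<pi> ..
  then show "a \<star> (\<Pi>R H \<bullet> a) = a" by (simp add: \<Pi>R_eq)
qed

lemma inv_H [simp]:
  assumes "gl a"
  shows "a \<star> inv_H a = \<Pi>L H \<bullet> a" "inv_H a \<star> a = \<Pi>R H \<bullet> a" "inv_H a \<star> (\<Pi>L H \<bullet> a) = inv_H a"
    "(\<Pi>R H \<bullet> a) \<star> inv_H a = inv_H a"
proof -
  note [simp] = assms
  have 1: "conv (\<delta> H) H \<H> (antipode H) = \<Pi>L H"
    and 2: "conv (\<delta> H) H (antipode H) \<H> = \<Pi>R H"
    and 3: "conv (\<delta> H) H (conv (\<delta> H) H (antipode H) \<H>) (antipode H) = antipode H"
    using wha unfolding weak_hopf_algebra_def by blast+
  have "conv (\<delta> H) H \<H> (antipode H) \<bullet> a = \<Pi>L H \<bullet> a"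
    unfolding 1 ..
  then show L: "a \<star> inv_H a = \<Pi>L H \<bullet> a" by simp
  have "conv (\<delta> H) H (antipode H) \<H> \<bullet> a = \<Pi>R H \<bullet> a"
    unfolding 2 ..
  then show R: "inv_H a \<star> a = \<Pi>R H \<bullet> a" by simp
  have "conv (\<delta> H) H (\<Pi>R H) (antipode H) \<bullet> a = inv_H a"
    using 3 unfolding 2 by simp
  then show 4: "(\<Pi>R H \<bullet> a) \<star> inv_H a = inv_H a" by simp
  have "inv_H a \<star> (\<Pi>L H \<bullet> a) = (inv_H a \<star> a) \<star> inv_H a"
    by (simp add: L del: 2)
  then show "inv_H a \<star> (\<Pi>L H \<bullet> a) = inv_H a"
    unfolding R 4 .
qed

lemma \<delta>_mul:
  assumes "el P" "el Q" "typ_of P = obj H" "typ_of Q = obj H"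
  shows "\<delta> H \<bullet> (P \<star> Q) = mul2 H H (\<delta> H \<bullet> P) (\<delta> H \<bullet> Q)"
proof -
  have "\<delta> H \<cdot> \<mu> H = (\<mu> H \<otimes> \<mu> H) \<cdot> \<delta>2 H"
    using wha by (simp add: weak_hopf_algebra_def)
  then have "(\<delta> H \<cdot> \<mu> H) \<bullet> (P \<boxtimes> Q) = ((\<mu> H \<otimes> \<mu> H) \<cdot> \<delta>2 H) \<bullet> (P \<boxtimes> Q)"
    by simp
  then show ?thesis
    using assms by (simp add: \<delta>2_def tensor_\<delta>_def mul2_def tensor_\<mu>_def)
qed

text \<open>Inverses are unique: both \<open>\<delta> (\<lambda> a)\<close> and
  \<open>\<lambda> a \<otimes> \<lambda> a\<close> are inverse to
  \<open>\<delta> a = a \<otimes> a\<close>.\<close>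

lemma gl_inv [simp]:
  assumes a: "gl a"
  shows "gl (inv_H a)"
proof (rule glI)
  note [simp] = a
  have "\<delta> H \<bullet> inv_H a = \<delta> H \<bullet> (inv_H a \<star> (\<Pi>L H \<bullet> a))"
    by simp
  also have "\<dots> = mul2 H H (\<delta> H \<bullet> inv_H a) (mul H a (inv_H a) \<boxtimes> mul H a (inv_H a))"
    by (subst \<delta>_mul) simp_all
  also have "\<dots> = mul2 H H (mul2 H H (\<delta> H \<bullet> inv_H a) (a \<boxtimes> a)) (inv_H a \<boxtimes> inv_H a)"
    by (rule mul2_assoc [symmetric]) simp_all
  also have "mul2 H H (\<delta> H \<bullet> inv_H a) (a \<boxtimes> a) = \<delta> H \<bullet> (inv_H a \<star> a)"
    by (subst \<delta>_mul) simp_all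
  finally show "\<delta> H \<bullet> inv_H a = inv_H a \<boxtimes> inv_H a"
    by simp
qed (use a in simp_all)

lemma scale_\<Pi> [simp]:
  assumes a: "gl a" and P: "el P"
  shows "(\<Pi>L H \<bullet> a) \<triangleright> P = a \<triangleright> P" "(\<Pi>R H \<bullet> a) \<triangleright> P = a \<triangleright> P" "(inv_H a) \<triangleright> P = a \<triangleright> P"
proof -
  note [simp] = a P
  have "a \<triangleright> P = (\<Pi>L H \<bullet> a) \<triangleright> a \<triangleright> P"
    using scale_mul(3) [of "\<Pi>L H \<bullet> a" a P] by simp
  moreover have "(\<Pi>L H \<bullet> a) \<triangleright> P = a \<triangleright> (\<Pi>L H \<bullet> a) \<triangleright> P"
    using scale_mul(3) [of a "inv_H a" P] by simp
  ultimately show L: "(\<Pi>L H \<bullet> a) \<triangleright> P = a \<triangleright> P"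
    using scale_left_commute [of a "\<Pi>L H \<bullet> a" P] by (simp del: scale_left_commute)
  have "a \<triangleright> P = (\<Pi>R H \<bullet> a) \<triangleright> a \<triangleright> P"
    using scale_mul(4) [of a "\<Pi>R H \<bullet> a" P] by simp
  moreover have "(\<Pi>R H \<bullet> a) \<triangleright> P = a \<triangleright> (\<Pi>R H \<bullet> a) \<triangleright> P"
    using scale_mul(4) [of "inv_H a" a P] by simp
  ultimately show R: "(\<Pi>R H \<bullet> a) \<triangleright> P = a \<triangleright> P"
    using scale_left_commute [of a "\<Pi>R H \<bullet> a" P] by (simp del: scale_left_commute)
  have "inv_H a \<triangleright> P = (\<Pi>L H \<bullet> a) \<triangleright> inv_H a \<triangleright> P"
    using scale_mul(4) [of "inv_H a" "\<Pi>L H \<bullet> a" P] by (simp del: gl_mul_\<Pi>)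
  moreover have "(\<Pi>L H \<bullet> a) \<triangleright> P = inv_H a \<triangleright> (\<Pi>L H \<bullet> a) \<triangleright> P"
    using scale_mul(4) [of a "inv_H a" P] by simp
  ultimately show "(inv_H a) \<triangleright> P = a \<triangleright> P"
    using scale_left_commute [of "inv_H a" "\<Pi>L H \<bullet> a" P] L by (simp del: scale_left_commute)
qed

text \<open>Units are idempotent and commute: \<open>x y\<close> is a multiple both of \<open>x\<close> and of \<open>y\<close>.\<close>

lemma \<Pi>L_commute:
  assumes a: "gl a" and b: "gl b"
  shows "(\<Pi>L H \<bullet> a) \<star> (\<Pi>L H \<bullet> b) = (\<Pi>L H \<bullet> b) \<star> (\<Pi>L H \<bullet> a)"
proof -
  define x y where "x = \<Pi>L H \<bullet> a" and "y = \<Pi>L H \<bullet> b"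
  have [simp]: "gl x" "gl y" using a b by (simp_all add: x_def y_def)
  have fixed: "\<Pi>L H \<bullet> x = x" "\<Pi>L H \<bullet> y = y" "\<Pi>R H \<bullet> x = x" "\<Pi>R H \<bullet> y = y"
    using a b by (simp_all add: x_def y_def)
  have xx: "x \<star> x = x"
    using \<Pi>_mul [of x] fixed by simp
  have xy: "x \<star> y = (x \<star> y) \<triangleright> x" "y \<star> x = (y \<star> x) \<triangleright> x"
    using gl_mul_\<Pi>(1) [of x y] gl_mul_\<Pi>(2) [of y x] fixed by simp_all
  have "(x \<star> y) \<star> x = x \<star> y"
    by (subst (1 2) xy(1)) (simp add: xx del: mul_assoc)
  moreover have "x \<star> (y \<star> x) = y \<star> x"
    by (subst (1 2) xy(2)) (simp add: xx del: mul_assoc)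
  ultimately show ?thesis
    by (simp flip: x_def y_def)
qed

text \<open>A product \<open>a b\<close> of composable factors has the target of \<open>a\<close> and the source of
  \<open>b\<close>.\<close>

lemma \<Pi>_product [simp]:
  assumes "gl a" "gl b"
  shows "\<Pi>L H \<bullet> (a \<star> b) = (a \<star> b) \<triangleright> (\<Pi>L H \<bullet> a)" "\<Pi>R H \<bullet> (a \<star> b) = (a \<star> b) \<triangleright> (\<Pi>R H \<bullet> b)"
proof -
  define g where "g = a \<star> b"
  note [simp] = assms
  have g [simp]: "gl g" by (simp add: g_def)
  have "(\<Pi>L H \<bullet> a) \<star> g = g"
    using mul_assoc [of H "\<Pi>L H \<bullet> a" a b] by (simp add: g_def del: mul_assoc)
  then have "\<Pi>L H \<bullet> g = (\<Pi>L H \<bullet> a) \<star> (\<Pi>L H \<bullet> g)" "(\<Pi>L H \<bullet> a) \<star> (\<Pi>L H \<bullet> g) = g \<triangleright> (\<Pi>L H \<bullet> a)"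
    using mul_assoc [of H "\<Pi>L H \<bullet> a" g "inv_H g"] by simp_all
  then show "\<Pi>L H \<bullet> (a \<star> b) = (a \<star> b) \<triangleright> (\<Pi>L H \<bullet> a)"
    by (simp only: g_def)
  have "g \<star> (\<Pi>R H \<bullet> b) = g"
    by (simp add: g_def del: gl_mul_\<Pi>)
  then have "\<Pi>R H \<bullet> g = (\<Pi>R H \<bullet> g) \<star> (\<Pi>R H \<bullet> b)" "(\<Pi>R H \<bullet> g) \<star> (\<Pi>R H \<bullet> b) = g \<triangleright> (\<Pi>R H \<bullet> b)"
    using mul_assoc [of H "inv_H g" g "\<Pi>R H \<bullet> b"] by simp_all
  then show "\<Pi>R H \<bullet> (a \<star> b) = (a \<star> b) \<triangleright> (\<Pi>R H \<bullet> b)"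
    by (simp only: g_def)
qed

lemma \<Pi>_inv [simp]:
  assumes a: "gl a"
  shows "\<Pi>L H \<bullet> inv_H a = \<Pi>R H \<bullet> a" "\<Pi>R H \<bullet> inv_H a = \<Pi>L H \<bullet> a"
proof -
  note [simp] = a
  have "\<Pi>L H \<bullet> (inv_H a \<star> a) = (inv_H a \<star> a) \<triangleright> (\<Pi>L H \<bullet> inv_H a)"
    by (rule \<Pi>_product) simp_all
  then show "\<Pi>L H \<bullet> inv_H a = \<Pi>R H \<bullet> a" by simp
  have "\<Pi>R H \<bullet> (a \<star> inv_H a) = (a \<star> inv_H a) \<triangleright> (\<Pi>R H \<bullet> inv_H a)"
    by (rule \<Pi>_product) simp_all
  then show "\<Pi>R H \<bullet> inv_H a = \<Pi>L H \<bullet> a" by simp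
qed

end

section \<open>Comodule algebras\<close>

context strict_symmetric_monoidal_category
begin

lemma slide_scalar:
  assumes "s \<in> Ar C" "source C s = S \<odot> T" "target C s = \<one>" "S \<in> Ob C" "T \<in> Ob C" "Y \<in> Ob C"
  shows "(\<langle>Y\<rangle> \<otimes> s) \<cdot> (\<gamma> S Y \<otimes> \<langle>T\<rangle>) = (s \<otimes> \<langle>Y\<rangle>) \<cdot> (\<langle>S\<rangle> \<otimes> \<gamma> Y T)"
proof -
  have "s \<otimes> \<langle>Y\<rangle> = (\<langle>Y\<rangle> \<otimes> s) \<cdot> \<gamma> (S \<odot> T) Y"
    using symmetry_natural' [of s "\<langle>Y\<rangle>" \<one> Y] assms by simp
  moreover have "\<gamma> (S \<odot> T) Y \<cdot> (\<langle>S\<rangle> \<otimes> \<gamma> Y T) = \<gamma> S Y \<otimes> \<langle>T\<rangle>"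
    using assms interchange [of "\<langle>S\<rangle>" "\<langle>S\<rangle>" "\<gamma> Y T" "\<gamma> T Y"] by (simp add: symmetry_hexagon')
  ultimately show ?thesis
    using assms by simp
qed

end

context cocommutative_wha
begin

lemma comodule_algebra_simps [simp]:
  assumes "right_comodule_algebra H B"
  shows "is_algebra B" "\<rho> B \<in> Ar C" "source C (\<rho> B) = obj B" "target C (\<rho> B) = obj B \<odot> obj H"
  using assms by (auto simp: right_comodule_algebra_def right_comodule_def Hom_def)

text \<open>The value of \<open>f \<and> f\<^sup>-\<^sup>1\<close> for every cleaving \<open>f\<close>. In the
  groupoid picture \<open>u a\<close> is the unit of \<open>B\<close> at the target of \<open>a\<close>;
  for \<open>B = H\<close> it is \<open>\<Pi>\<^sup>L a\<close>.\<close>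

definition u_map :: "('o, 'm, 'z) comodule_algebra_scheme \<Rightarrow> 'm"
  where "u_map B = (\<langle>obj B\<rangle> \<otimes> (\<epsilon> H \<cdot> \<mu> H)) \<cdot> ((\<rho> B \<cdot> \<eta> B) \<otimes> \<H>)"

lemma u_map_simps [simp]:
  assumes "right_comodule_algebra H B"
  shows "u_map B \<in> Ar C" "source C (u_map B) = obj H" "target C (u_map B) = obj B"
    "e_map H B \<in> Ar C" "source C (e_map H B) = obj H" "target C (e_map H B) = obj B"
  using assms by (simp_all add: u_map_def e_map_def)

end

context wha_stage
begin

lemma \<epsilon>_scale: "el g \<Longrightarrow> typ_of g = obj H \<Longrightarrow> \<epsilon> H \<bullet> g = g \<triangleright> \<iota>"
  by (simp add: scale_def del: pair_\<epsilon>)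

text \<open>If the unit \<open>\<Pi>\<^sup>L z\<close> is composable with \<open>a\<close>, then it is the target
  of \<open>a\<close>.\<close>

lemma \<Pi>L_scale_exchange:
  assumes "gl z" "gl a"
  shows "((\<Pi>L H \<bullet> z) \<star> a) \<triangleright> (\<Pi>L H \<bullet> z) = ((\<Pi>L H \<bullet> z) \<star> a) \<triangleright> (\<Pi>L H \<bullet> a)"
proof -
  note [simp] = assms
  have *: "(\<Pi>L H \<bullet> z) \<star> a = ((\<Pi>L H \<bullet> z) \<star> a) \<triangleright> a"
    using gl_mul_\<Pi>(2) [of "\<Pi>L H \<bullet> z" a] by simp
  have "\<Pi>L H \<bullet> ((\<Pi>L H \<bullet> z) \<star> a) = ((\<Pi>L H \<bullet> z) \<star> a) \<triangleright> (\<Pi>L H \<bullet> z)"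
    by simp
  moreover have "\<Pi>L H \<bullet> (((\<Pi>L H \<bullet> z) \<star> a) \<triangleright> a) = ((\<Pi>L H \<bullet> z) \<star> a) \<triangleright> (\<Pi>L H \<bullet> a)"
    by simp
  ultimately show ?thesis
    unfolding * [symmetric] by simp
qed

end

context cocommutative_wha
begin

lemma \<epsilon>_mul_\<Pi>L: "(\<epsilon> H \<cdot> \<mu> H) \<cdot> (\<H> \<otimes> \<Pi>L H) = \<epsilon> H \<cdot> \<mu> H"
proof (rule generic_ext2', goal_cases)
  case (5 X e d z a)
  then interpret wha_stage C H X e d by simp
  show ?case using 5 by (simp add: \<epsilon>_scale)
qed simp_all

lemma \<pi>l_\<Pi>L: "\<pi>l \<cdot> (\<Pi>L H \<otimes> \<H>)
    = ((\<epsilon> H \<cdot> \<mu> H) \<otimes> \<Pi>L H) \<cdot> (\<H> \<otimes> \<delta> H) \<cdot> (\<Pi>L H \<otimes> \<H>)"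
proof (rule generic_ext2', goal_cases)
  case (5 X e d z a)
  then interpret wha_stage C H X e d by simp
  show ?case using 5 \<Pi>L_scale_exchange [of z a] by simp
qed simp_all

lemma \<epsilon>_mul_\<Pi>R: "(\<epsilon> H \<cdot> \<mu> H) \<cdot> \<gamma> (obj H) (obj H) \<cdot> (\<Pi>L H \<otimes> \<H>)
    = (\<epsilon> H \<cdot> \<mu> H) \<cdot> (\<H> \<otimes> \<Pi>R H) \<cdot> (\<Pi>L H \<otimes> \<H>)"
proof (rule generic_ext2', goal_cases)
  case (5 X e d z a)
  then interpret wha_stage C H X e d by simp
  have "mul H (\<Pi>L H \<bullet> z) (\<Pi>R H \<bullet> a) = mul H (\<Pi>R H \<bullet> a) (\<Pi>L H \<bullet> z)"
    using \<Pi>L_commute [of z "\<Pi>R H \<bullet> a"] 5 by (simp del: gl_mul_\<Pi>)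
  then show ?case using 5 by (simp add: \<epsilon>_scale)
qed simp_all

end

context wha_stage
begin

abbreviation mul_in :: "('o, 'm) element \<Rightarrow> ('o, 'm, 'z) algebra_scheme \<Rightarrow> ('o, 'm) element \<Rightarrow> ('o, 'm) element"
    ("_ \<star>\<^bsub>_\<^esub> _" [73, 0, 72] 72)
  where "P \<star>\<^bsub>B\<^esub> Q \<equiv> mul B P Q"

text \<open>Homogeneous elements. In the groupoid picture these are the elements of the component of
  \<open>B\<close> at \<open>a\<close>.\<close>

definition deg :: "('o, 'm, 'z) comodule_algebra_scheme \<Rightarrow> ('o, 'm) element \<Rightarrow> ('o, 'm) element \<Rightarrow> bool"
  where "deg B P a \<longleftrightarrow> el P \<and> typ_of P = obj B \<and> \<rho> B \<bullet> P = P \<boxtimes> a"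

definition coinv :: "('o, 'm, 'z) comodule_algebra_scheme \<Rightarrow> ('o, 'm) element \<Rightarrow> bool"
  where "coinv B P \<longleftrightarrow> el P \<and> typ_of P = obj B \<and> (\<langle>obj B\<rangle> \<otimes> \<Pi>L H) \<bullet> \<rho> B \<bullet> P = \<rho> B \<bullet> P"

lemma degD: "deg B P a \<Longrightarrow> el P" "deg B P a \<Longrightarrow> typ_of P = obj B" "deg B P a \<Longrightarrow> \<rho> B \<bullet> P = P \<boxtimes> a"
  by (simp_all add: deg_def)

lemma coinvD: "coinv B P \<Longrightarrow> el P" "coinv B P \<Longrightarrow> typ_of P = obj B"
  "coinv B P \<Longrightarrow> (\<langle>obj B\<rangle> \<otimes> \<Pi>L H) \<bullet> \<rho> B \<bullet> P = \<rho> B \<bullet> P"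
  by (simp_all add: coinv_def)

context
  fixes B :: "('o, 'm, 'z) comodule_algebra_scheme"
  assumes B [simp]: "right_comodule_algebra H B"
begin

lemma \<rho>_mul:
  assumes "el P" "el Q" "typ_of P = obj B" "typ_of Q = obj B"
  shows "\<rho> B \<bullet> (P \<star>\<^bsub>B\<^esub> Q) = mul2 B H (\<rho> B \<bullet> P) (\<rho> B \<bullet> Q)"
proof -
  have "\<rho> B \<cdot> \<mu> B = tensor_\<mu> B H \<cdot> (\<rho> B \<otimes> \<rho> B)"
    using B unfolding right_comodule_algebra_def by blast
  then have "(\<rho> B \<cdot> \<mu> B) \<bullet> (P \<boxtimes> Q) = (tensor_\<mu> B H \<cdot> (\<rho> B \<otimes> \<rho> B)) \<bullet> (P \<boxtimes> Q)"
    by simp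
  then show ?thesis
    using assms by (simp add: mul2_def)
qed

lemma \<rho>_counit:
  assumes "el P" "typ_of P = obj B"
  shows "(\<langle>obj B\<rangle> \<otimes> \<epsilon> H) \<bullet> \<rho> B \<bullet> P = P"
proof -
  have "(\<langle>obj B\<rangle> \<otimes> \<epsilon> H) \<cdot> \<rho> B = \<langle>obj B\<rangle>"
    using B unfolding right_comodule_algebra_def right_comodule_def by blast
  then have "((\<langle>obj B\<rangle> \<otimes> \<epsilon> H) \<cdot> \<rho> B) \<bullet> P = \<langle>obj B\<rangle> \<bullet> P"
    by simp
  then show ?thesis
    using assms by simp
qed

lemma \<rho>_coassoc:
  assumes "el P" "typ_of P = obj B"
  shows "(\<rho> B \<otimes> \<H>) \<bullet> \<rho> B \<bullet> P = (\<langle>obj B\<rangle> \<otimes> \<delta> H) \<bullet> \<rho> B \<bullet> P"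
proof -
  have "(\<rho> B \<otimes> \<H>) \<cdot> \<rho> B = (\<langle>obj B\<rangle> \<otimes> \<delta> H) \<cdot> \<rho> B"
    using B unfolding right_comodule_algebra_def right_comodule_def by blast
  then have "((\<rho> B \<otimes> \<H>) \<cdot> \<rho> B) \<bullet> P = ((\<langle>obj B\<rangle> \<otimes> \<delta> H) \<cdot> \<rho> B) \<bullet> P"
    by simp
  then show ?thesis
    using assms by simp
qed

lemma \<rho>_one: "(\<langle>obj B\<rangle> \<otimes> \<Pi>L H) \<bullet> \<rho> B \<bullet> one B = \<rho> B \<bullet> one B"
proof -
  have "(\<langle>obj B\<rangle> \<otimes> \<Pi>L H) \<cdot> \<rho> B \<cdot> \<eta> B = \<rho> B \<cdot> \<eta> B"
    using B unfolding right_comodule_algebra_def by blast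
  then have "((\<langle>obj B\<rangle> \<otimes> \<Pi>L H) \<cdot> \<rho> B \<cdot> \<eta> B) \<bullet> \<iota> = (\<rho> B \<cdot> \<eta> B) \<bullet> \<iota>"
    by simp
  then show ?thesis by simp
qed

lemma deg_scale:
  assumes "deg B P a" "gl a"
  shows "a \<triangleright> P = P"
  using \<rho>_counit [of P] assms degD [OF assms(1)] by simp

lemma deg_mul:
  assumes P: "deg B P a" and Q: "deg B Q b" and "gl a" "gl b"
  shows "deg B (P \<star>\<^bsub>B\<^esub> Q) (a \<star> b)"
  using \<rho>_mul [of P Q] assms(3,4) by (simp add: deg_def degD [OF P] degD [OF Q])

lemma deg_coinv: "deg B P a \<Longrightarrow> gl a \<Longrightarrow> \<Pi>L H \<bullet> a = a \<Longrightarrow> coinv B P"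
  by (simp add: deg_def coinv_def)

text \<open>If \<open>c\<close> is coinvariant, the second factor of \<open>\<rho> c\<close> acts on a homogeneous element by a
  scalar, by the formula for \<open>a \<Pi>\<^sup>L(h)\<close>; the counit law identifies that scalar.\<close>

lemma deg_mul_coinv:
  assumes P: "deg B P a" and a [simp]: "gl a" and c: "coinv B c"
  shows "deg B (P \<star>\<^bsub>B\<^esub> c) a"
proof -
  note [simp] = degD [OF P] coinvD(1,2) [OF c]
  let ?F = "tensor_\<mu> B H \<cdot> (\<langle>obj B \<odot> obj H\<rangle> \<otimes> (\<langle>obj B\<rangle> \<otimes> \<Pi>L H))"
  let ?M = "((\<langle>obj B\<rangle> \<otimes> \<epsilon> H) \<cdot> tensor_\<mu> B H)"
  have "?F \<bullet> ((P \<boxtimes> a) \<boxtimes> (\<rho> B \<bullet> c))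
      = (\<gamma> (obj H) (obj B) \<cdot> (\<H> \<otimes> ?M)) \<bullet> ((a \<boxtimes> P \<boxtimes> a) \<boxtimes> (\<rho> B \<bullet> c))"
  proof (rule linear_ext [where S = "obj B \<odot> obj H"])
    let ?b = "linear (obj B)" and ?h = "linear (obj H)"
    have L: "linear (obj B \<odot> obj H) = ?b \<boxtimes> ?h"
      by simp
    have 1: "(\<langle>obj B \<odot> obj H\<rangle> \<otimes> (\<langle>obj B\<rangle> \<otimes> \<Pi>L H)) \<bullet> (P \<boxtimes> a \<boxtimes> ?b \<boxtimes> ?h) = P \<boxtimes> a \<boxtimes> ?b \<boxtimes> (\<Pi>L H \<bullet> ?h)"
      by (subst app_pair_split) (simp_all del: linear_pair)
    have 2: "\<epsilon> H \<bullet> (a \<star> ?h) \<boxtimes> a = a \<boxtimes> (\<epsilon> H \<bullet> (a \<star> ?h))"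
      using swap [of "\<epsilon> H \<bullet> (a \<star> ?h)" a \<one> "obj H"] by (simp del: swap pair_\<epsilon>)
    have "?F \<bullet> ((P \<boxtimes> a) \<boxtimes> (?b \<boxtimes> ?h)) = (P \<star>\<^bsub>B\<^esub> ?b) \<boxtimes> a \<boxtimes> (\<epsilon> H \<bullet> (a \<star> ?h))"
      by (simp add: 1 mul_\<Pi>L \<pi>l_alt del: linear_pair pair_\<epsilon>)
    also have "\<dots> = (\<gamma> (obj H) (obj B) \<cdot> (\<H> \<otimes> ?M)) \<bullet> ((a \<boxtimes> P \<boxtimes> a) \<boxtimes> (?b \<boxtimes> ?h))"
      by (simp add: 2 [symmetric] del: linear_pair pair_\<epsilon>)
    finally show "?F \<bullet> ((P \<boxtimes> a) \<boxtimes> linear (obj B \<odot> obj H))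
      = (\<gamma> (obj H) (obj B) \<cdot> (\<H> \<otimes> ?M)) \<bullet> ((a \<boxtimes> P \<boxtimes> a) \<boxtimes> linear (obj B \<odot> obj H))"
      unfolding L .
  qed simp_all
  moreover have "(\<langle>obj B \<odot> obj H\<rangle> \<otimes> (\<langle>obj B\<rangle> \<otimes> \<Pi>L H)) \<bullet> (P \<boxtimes> a \<boxtimes> (\<rho> B \<bullet> c)) = P \<boxtimes> a \<boxtimes> (\<rho> B \<bullet> c)"
    by (subst app_pair_split) (simp_all add: coinvD(3) [OF c])
  moreover have "?M \<bullet> (P \<boxtimes> a \<boxtimes> (\<rho> B \<bullet> c)) = P \<star>\<^bsub>B\<^esub> c"
    using \<rho>_counit [of "P \<star>\<^bsub>B\<^esub> c"] \<rho>_mul [of P c] by (simp add: mul2_def)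
  ultimately show ?thesis
    using \<rho>_mul [of P c] by (simp add: deg_def mul2_def)
qed

text \<open>As in \<open>deg_mul_coinv\<close>, with the formula for \<open>\<Pi>\<^sup>R(h) a\<close> and the fact
  that \<open>\<Pi>\<^sup>R\<close> fixes the image of \<open>\<Pi>\<^sup>L\<close>.\<close>

lemma deg_coinv_mul:
  assumes P: "deg B P a" and a [simp]: "gl a" and c: "coinv B c" and pure: "fst P = \<one>"
  shows "deg B (c \<star>\<^bsub>B\<^esub> P) a"
proof -
  note [simp] = degD [OF P] coinvD(1,2) [OF c] pure
  let ?F = "tensor_\<mu> B H \<cdot> ((\<langle>obj B\<rangle> \<otimes> \<Pi>L H) \<otimes> \<langle>obj B \<odot> obj H\<rangle>)"
  let ?M = "(\<langle>obj B\<rangle> \<otimes> \<epsilon> H) \<cdot> ?F"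
  have "?F \<bullet> ((\<rho> B \<bullet> c) \<boxtimes> (P \<boxtimes> a)) = (?M \<otimes> \<H>) \<bullet> ((\<rho> B \<bullet> c) \<boxtimes> (P \<boxtimes> a \<boxtimes> a))"
  proof (rule linear_ext_left [where S = "obj B \<odot> obj H"])
    let ?b = "linear (obj B)" and ?h = "linear (obj H)"
    have L: "linear (obj B \<odot> obj H) = ?b \<boxtimes> ?h"
      by simp
    have 0: "((\<langle>obj B\<rangle> \<otimes> \<Pi>L H) \<otimes> \<langle>obj B \<odot> obj H\<rangle>) \<bullet> (?b \<boxtimes> ?h \<boxtimes> P \<boxtimes> a) = ?b \<boxtimes> (\<Pi>L H \<bullet> ?h) \<boxtimes> P \<boxtimes> a"
      by (simp del: linear_pair)
    have "\<Pi>L H \<bullet> ?h \<star> a = \<pi>r \<bullet> ((\<Pi>L H \<bullet> ?h) \<boxtimes> a)"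
      using mul_\<Pi>R [of "\<Pi>L H \<bullet> ?h" a] by simp
    also have "\<dots> = (\<epsilon> H \<bullet> (\<Pi>L H \<bullet> ?h \<star> a)) \<boxtimes> a"
      by (simp add: \<pi>r_alt del: pair_\<epsilon>)
    finally have 1: "\<Pi>L H \<bullet> ?h \<star> a = (\<epsilon> H \<bullet> (\<Pi>L H \<bullet> ?h \<star> a)) \<boxtimes> a" .
    have 2: "?F \<bullet> (?b \<boxtimes> ?h \<boxtimes> P \<boxtimes> a) = (?b \<star>\<^bsub>B\<^esub> P) \<boxtimes> (\<Pi>L H \<bullet> ?h \<star> a)"
      by (simp add: 0 del: linear_pair)
    then have 3: "?M \<bullet> (?b \<boxtimes> ?h \<boxtimes> P \<boxtimes> a) = (?b \<star>\<^bsub>B\<^esub> P) \<boxtimes> (\<epsilon> H \<bullet> (\<Pi>L H \<bullet> ?h \<star> a))"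
      by (subst app_app) (simp_all del: linear_pair pair_\<epsilon>)
    have "?F \<bullet> ((?b \<boxtimes> ?h) \<boxtimes> (P \<boxtimes> a)) = (?b \<star>\<^bsub>B\<^esub> P) \<boxtimes> (\<Pi>L H \<bullet> ?h \<star> a)"
      using 2 by (simp del: linear_pair pair_\<epsilon> app_app)
    also have "\<dots> = (?b \<star>\<^bsub>B\<^esub> P) \<boxtimes> ((\<epsilon> H \<bullet> (\<Pi>L H \<bullet> ?h \<star> a)) \<boxtimes> a)"
      by (rule arg_cong [OF 1])
    also have "\<dots> = (?M \<bullet> (?b \<boxtimes> ?h \<boxtimes> P \<boxtimes> a)) \<boxtimes> a"
      unfolding 3 by (simp del: pair_\<epsilon>)
    also have "\<dots> = (?M \<otimes> \<H>) \<bullet> ((?b \<boxtimes> ?h) \<boxtimes> (P \<boxtimes> a \<boxtimes> a))"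
      by (simp add: app_pair_split4 del: linear_pair app_app)
    finally show "?F \<bullet> (linear (obj B \<odot> obj H) \<boxtimes> (P \<boxtimes> a))
        = (?M \<otimes> \<H>) \<bullet> (linear (obj B \<odot> obj H) \<boxtimes> (P \<boxtimes> a \<boxtimes> a))"
      unfolding L .
  qed simp_all
  moreover have 4: "((\<langle>obj B\<rangle> \<otimes> \<Pi>L H) \<otimes> \<langle>obj B \<odot> obj H\<rangle>) \<bullet> ((\<rho> B \<bullet> c) \<boxtimes> P \<boxtimes> a) = (\<rho> B \<bullet> c) \<boxtimes> P \<boxtimes> a"
    by (subst app_pair) (simp_all add: coinvD(3) [OF c])
  moreover have 5: "?M \<bullet> ((\<rho> B \<bullet> c) \<boxtimes> P \<boxtimes> a) = c \<star>\<^bsub>B\<^esub> P"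
    using \<rho>_counit [of "c \<star>\<^bsub>B\<^esub> P"] \<rho>_mul [of c P] 4 by (simp add: mul2_def)
  moreover have "(?M \<otimes> \<H>) \<bullet> ((\<rho> B \<bullet> c) \<boxtimes> (P \<boxtimes> a \<boxtimes> a)) = (?M \<bullet> ((\<rho> B \<bullet> c) \<boxtimes> P \<boxtimes> a)) \<boxtimes> a"
    by (subst app_pair_split3) (simp_all del: app_app)
  ultimately show ?thesis
    using \<rho>_mul [of c P] by (simp add: deg_def mul2_def)
qed

lemma app_u:
  assumes "el a" "typ_of a = obj H"
  shows "u_map B \<bullet> a = (\<langle>obj B\<rangle> \<otimes> (\<epsilon> H \<cdot> \<mu> H)) \<bullet> ((\<rho> B \<bullet> one B) \<boxtimes> a)"
  using assms by (simp add: u_map_def)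

lemma app_second:
  assumes "f \<in> Ar C" "source C f = obj H" "target C f = obj H" "K \<in> Ar C" "source C K = obj H \<odot> obj H"
    "el U" "typ_of U = obj B \<odot> obj H" "el a" "typ_of a = obj H"
  shows "(\<langle>obj B\<rangle> \<otimes> K) \<bullet> (U \<boxtimes> (f \<bullet> a)) = (\<langle>obj B\<rangle> \<otimes> (K \<cdot> (\<H> \<otimes> f))) \<bullet> (U \<boxtimes> a)"
    and "(\<langle>obj B\<rangle> \<otimes> K) \<bullet> (((\<langle>obj B\<rangle> \<otimes> f) \<bullet> U) \<boxtimes> a) = (\<langle>obj B\<rangle> \<otimes> (K \<cdot> (f \<otimes> \<H>))) \<bullet> (U \<boxtimes> a)"
proof -
  note [simp] = assms
  have "\<langle>obj B\<rangle> \<otimes> (K \<cdot> (\<H> \<otimes> f)) = (\<langle>obj B\<rangle> \<otimes> K) \<cdot> (\<langle>obj B \<odot> obj H\<rangle> \<otimes> f)"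
    using interchange [of "\<langle>obj B\<rangle>" "\<langle>obj B\<rangle>" "\<H> \<otimes> f" K] by (simp add: ident_merge)
  then show "(\<langle>obj B\<rangle> \<otimes> K) \<bullet> (U \<boxtimes> (f \<bullet> a)) = (\<langle>obj B\<rangle> \<otimes> (K \<cdot> (\<H> \<otimes> f))) \<bullet> (U \<boxtimes> a)"
    by simp
  have "\<langle>obj B\<rangle> \<otimes> (K \<cdot> (f \<otimes> \<H>)) = (\<langle>obj B\<rangle> \<otimes> K) \<cdot> ((\<langle>obj B\<rangle> \<otimes> f) \<otimes> \<H>)"
    using interchange [of "\<langle>obj B\<rangle>" "\<langle>obj B\<rangle>" "f \<otimes> \<H>" K] by simp
  moreover have "((\<langle>obj B\<rangle> \<otimes> f) \<otimes> \<H>) \<bullet> (U \<boxtimes> a) = ((\<langle>obj B\<rangle> \<otimes> f) \<bullet> U) \<boxtimes> a"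
    by (subst app_pair) simp_all
  ultimately show "(\<langle>obj B\<rangle> \<otimes> K) \<bullet> (((\<langle>obj B\<rangle> \<otimes> f) \<bullet> U) \<boxtimes> a)
      = (\<langle>obj B\<rangle> \<otimes> (K \<cdot> (f \<otimes> \<H>))) \<bullet> (U \<boxtimes> a)"
    by simp
qed

text \<open>By \<open>\<rho>_one\<close> the second factor of \<open>\<rho> 1\<close> may be replaced by its image under \<open>\<Pi>\<^sup>L\<close>.\<close>

lemma \<rho>_one_\<Pi>L:
  assumes "K \<in> Ar C" "source C K = obj H \<odot> obj H" "el a" "typ_of a = obj H"
  shows "(\<langle>obj B\<rangle> \<otimes> (K \<cdot> (\<Pi>L H \<otimes> \<H>))) \<bullet> ((\<rho> B \<bullet> one B) \<boxtimes> a) = (\<langle>obj B\<rangle> \<otimes> K) \<bullet> ((\<rho> B \<bullet> one B) \<boxtimes> a)"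
proof -
  have "(\<langle>obj B\<rangle> \<otimes> K) \<bullet> (((\<langle>obj B\<rangle> \<otimes> \<Pi>L H) \<bullet> \<rho> B \<bullet> one B) \<boxtimes> a)
      = (\<langle>obj B\<rangle> \<otimes> (K \<cdot> (\<Pi>L H \<otimes> \<H>))) \<bullet> ((\<rho> B \<bullet> one B) \<boxtimes> a)"
    by (rule app_second) (use assms in simp_all)
  then show ?thesis
    unfolding \<rho>_one by (rule sym)
qed

lemma u_\<Pi>L [simp]:
  assumes "el a" "typ_of a = obj H"
  shows "u_map B \<bullet> \<Pi>L H \<bullet> a = u_map B \<bullet> a"
  using assms by (simp add: app_u app_second \<epsilon>_mul_\<Pi>L)

lemma e_eq_u:
  assumes "gl a"
  shows "e_map H B \<bullet> a = u_map B \<bullet> \<Pi>R H \<bullet> a"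
proof -
  let ?V = "\<rho> B \<bullet> one B" and ?s = "\<epsilon> H \<cdot> \<mu> H" and ?c = "\<gamma> (obj H) (obj H)"
  note [simp] = assms
  have "?V \<boxtimes> a = \<gamma> (obj H) (obj B \<odot> obj H) \<bullet> (a \<boxtimes> ?V)"
    by (rule swap [symmetric]) simp_all
  also have "\<dots> = (\<langle>obj B\<rangle> \<otimes> ?c) \<bullet> (\<gamma> (obj H) (obj B) \<otimes> \<H>) \<bullet> (a \<boxtimes> ?V)"
    by (simp add: symmetry_hexagon)
  finally have 1: "?V \<boxtimes> a = (\<langle>obj B\<rangle> \<otimes> ?c) \<bullet> (\<gamma> (obj H) (obj B) \<otimes> \<H>) \<bullet> (a \<boxtimes> ?V)" .
  have "(\<langle>obj B\<rangle> \<otimes> (?s \<cdot> ?c)) \<cdot> (\<langle>obj B\<rangle> \<otimes> ?c) = \<langle>obj B\<rangle> \<otimes> ?s"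
    by (simp add: interchange)
  then have "((\<langle>obj B\<rangle> \<otimes> (?s \<cdot> ?c)) \<cdot> (\<langle>obj B\<rangle> \<otimes> ?c)) \<bullet> (\<gamma> (obj H) (obj B) \<otimes> \<H>) \<bullet> (a \<boxtimes> ?V)
      = (\<langle>obj B\<rangle> \<otimes> ?s) \<bullet> (\<gamma> (obj H) (obj B) \<otimes> \<H>) \<bullet> (a \<boxtimes> ?V)"
    by (simp only:)
  then have "e_map H B \<bullet> a = (\<langle>obj B\<rangle> \<otimes> (?s \<cdot> ?c)) \<bullet> (?V \<boxtimes> a)"
    by (simp add: e_map_def 1)
  also have "\<dots> = (\<langle>obj B\<rangle> \<otimes> (?s \<cdot> (\<H> \<otimes> \<Pi>R H))) \<bullet> (?V \<boxtimes> a)"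
    using \<rho>_one_\<Pi>L [of "?s \<cdot> ?c" a] \<rho>_one_\<Pi>L [of "?s \<cdot> (\<H> \<otimes> \<Pi>R H)" a] \<epsilon>_mul_\<Pi>R by simp
  also have "\<dots> = u_map B \<bullet> \<Pi>R H \<bullet> a"
    by (simp add: app_u app_second)
  finally show ?thesis .
qed

text \<open>Coassociativity at \<open>1\<close> expresses \<open>\<rho>(u a)\<close> through \<open>\<pi>l\<close>
  and the second leg of \<open>\<rho> 1\<close>; as that leg is fixed by \<open>\<Pi>\<^sup>L\<close>, it
  may be replaced by \<open>\<Pi>\<^sup>L a\<close> wherever it is composable with \<open>a\<close>.\<close>

lemma deg_u [simp]:
  assumes "gl a"
  shows "deg B (u_map B \<bullet> a) (\<Pi>L H \<bullet> a)"
proof -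
  let ?V = "\<rho> B \<bullet> one B" and ?s = "\<epsilon> H \<cdot> \<mu> H"
  let ?K = "(?s \<otimes> \<Pi>L H) \<cdot> (\<H> \<otimes> \<delta> H)"
  note [simp] = assms
  have 1: "\<rho> B \<cdot> (\<langle>obj B\<rangle> \<otimes> ?s) = (\<langle>obj B \<odot> obj H\<rangle> \<otimes> ?s) \<cdot> ((\<rho> B \<otimes> \<H>) \<otimes> \<H>)"
    using interchange [of "\<langle>obj B\<rangle>" "\<rho> B" ?s "\<langle>\<one>\<rangle>"]
      interchange [of "\<rho> B" "\<langle>obj B \<odot> obj H\<rangle>" "\<langle>obj H \<odot> obj H\<rangle>" ?s] by simp
  have 2: "(\<langle>obj B \<odot> obj H\<rangle> \<otimes> ?s) \<cdot> ((\<langle>obj B\<rangle> \<otimes> \<delta> H) \<otimes> \<H>) = \<langle>obj B\<rangle> \<otimes> \<pi>l"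
    using interchange [of "\<langle>obj B\<rangle>" "\<langle>obj B\<rangle>" "\<delta> H \<otimes> \<H>" "\<H> \<otimes> ?s"]
    by (simp add: \<pi>l_alt ident_merge)
  have 3: "((\<rho> B \<otimes> \<H>) \<otimes> \<H>) \<bullet> (?V \<boxtimes> a) = ((\<rho> B \<otimes> \<H>) \<bullet> ?V) \<boxtimes> a"
    and 4: "((\<langle>obj B\<rangle> \<otimes> \<delta> H) \<otimes> \<H>) \<bullet> (?V \<boxtimes> a) = ((\<langle>obj B\<rangle> \<otimes> \<delta> H) \<bullet> ?V) \<boxtimes> a"
    by (subst app_pair; simp)+
  have "\<rho> B \<bullet> u_map B \<bullet> a = (\<rho> B \<cdot> (\<langle>obj B\<rangle> \<otimes> ?s)) \<bullet> (?V \<boxtimes> a)"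
    by (simp add: app_u)
  also have "\<dots> = (\<langle>obj B \<odot> obj H\<rangle> \<otimes> ?s) \<bullet> (((\<rho> B \<otimes> \<H>) \<bullet> ?V) \<boxtimes> a)"
    unfolding 1 using 3 by (subst app_app) simp_all
  also have "\<dots> = ((\<langle>obj B \<odot> obj H\<rangle> \<otimes> ?s) \<cdot> ((\<langle>obj B\<rangle> \<otimes> \<delta> H) \<otimes> \<H>)) \<bullet> (?V \<boxtimes> a)"
    using 4 by (subst app_app) (simp_all add: \<rho>_coassoc)
  also have "\<dots> = (\<langle>obj B\<rangle> \<otimes> \<pi>l) \<bullet> (?V \<boxtimes> a)"
    unfolding 2 ..
  also have "\<dots> = (\<langle>obj B\<rangle> \<otimes> ?K) \<bullet> (?V \<boxtimes> a)"
    using \<rho>_one_\<Pi>L [of \<pi>l a] \<rho>_one_\<Pi>L [of ?K a] unfolding \<pi>l_\<Pi>L by simp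
  also have "\<dots> = ((\<langle>obj B\<rangle> \<otimes> ?s \<otimes> \<Pi>L H) \<cdot> (\<langle>obj B \<odot> obj H\<rangle> \<otimes> \<delta> H)) \<bullet> (?V \<boxtimes> a)"
    using interchange [of "\<langle>obj B\<rangle>" "\<langle>obj B\<rangle>" "\<H> \<otimes> \<delta> H" "?s \<otimes> \<Pi>L H"] by (simp add: ident_merge)
  also have "\<dots> = ((\<langle>obj B\<rangle> \<otimes> ?s) \<otimes> \<Pi>L H) \<bullet> (?V \<boxtimes> a \<boxtimes> a)"
    by simp
  also have "\<dots> = (u_map B \<bullet> a) \<boxtimes> (\<Pi>L H \<bullet> a)"
    by (subst app_pair_split) (simp_all add: app_u)
  finally show ?thesis
    by (simp add: deg_def)
qed

lemma \<epsilon>_tensor_\<mu>: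
  "(\<langle>obj B\<rangle> \<otimes> \<epsilon> H) \<cdot> tensor_\<mu> B H
      = (\<mu> B \<cdot> (\<langle>obj B\<rangle> \<otimes> (\<langle>obj B\<rangle> \<otimes> (\<epsilon> H \<cdot> \<mu> H)))) \<cdot> (\<langle>obj B\<rangle> \<otimes> (\<gamma> (obj H) (obj B) \<otimes> \<H>))"
  using interchange [of "\<mu> B" "\<langle>obj B\<rangle>" "\<mu> H" "\<epsilon> H"] interchange [of "\<langle>obj B \<odot> obj B\<rangle>" "\<mu> B" "\<epsilon> H \<cdot> \<mu> H" "\<langle>\<one>\<rangle>"]
  by (simp add: tensor_\<mu>_def ident_merge flip: compose_assoc')

text \<open>This is the counit law for \<open>P\<close>, with \<open>\<rho> P\<close> computed as
  \<open>\<rho>(P 1)\<close>.\<close>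

lemma mul_e:
  assumes P: "deg B P a" and a: "gl a"
  shows "P \<star>\<^bsub>B\<^esub> (u_map B \<bullet> \<Pi>R H \<bullet> a) = P"
proof -
  let ?V = "\<rho> B \<bullet> one B" and ?s = "\<epsilon> H \<cdot> \<mu> H"
  note [simp] = degD [OF P] a
  have "P = (\<langle>obj B\<rangle> \<otimes> \<epsilon> H) \<bullet> \<rho> B \<bullet> (P \<star>\<^bsub>B\<^esub> one B)"
    using \<rho>_counit [of P] by simp
  also have "\<dots> = ((\<langle>obj B\<rangle> \<otimes> \<epsilon> H) \<cdot> tensor_\<mu> B H) \<bullet> (P \<boxtimes> a \<boxtimes> ?V)"
    using \<rho>_mul [of P "one B"] by (simp add: mul2_def)
  also have "\<dots> = P \<star>\<^bsub>B\<^esub> (e_map H B \<bullet> a)"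
    unfolding \<epsilon>_tensor_\<mu> by (simp add: e_map_def)
  finally show ?thesis
    by (simp add: e_eq_u)
qed

text \<open>This is the counit law for \<open>P\<close>, with \<open>\<rho> P\<close> computed as
  \<open>\<rho>(1 P)\<close>.\<close>

lemma u_mul:
  assumes P: "deg B P a" and a: "gl a"
  shows "(u_map B \<bullet> a) \<star>\<^bsub>B\<^esub> P = P"
proof -
  let ?V = "\<rho> B \<bullet> one B" and ?s = "\<epsilon> H \<cdot> \<mu> H"
  note [simp] = degD [OF P] a
  have 1: "(\<langle>obj B\<rangle> \<otimes> \<epsilon> H) \<cdot> tensor_\<mu> B H
      = \<mu> B \<cdot> (((\<langle>obj B\<rangle> \<otimes> ?s) \<otimes> \<langle>obj B\<rangle>) \<cdot> (\<langle>obj B \<odot> obj H\<rangle> \<otimes> \<gamma> (obj B) (obj H)))"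
  proof -
    have "(\<langle>obj B\<rangle> \<otimes> \<epsilon> H) \<cdot> tensor_\<mu> B H
      = \<mu> B \<cdot> (\<langle>obj B\<rangle> \<otimes> ((\<langle>obj B\<rangle> \<otimes> ?s) \<cdot> (\<gamma> (obj H) (obj B) \<otimes> \<H>)))"
      unfolding \<epsilon>_tensor_\<mu> by (simp add: interchange)
    also have "(\<langle>obj B\<rangle> \<otimes> ?s) \<cdot> (\<gamma> (obj H) (obj B) \<otimes> \<H>) = (?s \<otimes> \<langle>obj B\<rangle>) \<cdot> (\<H> \<otimes> \<gamma> (obj B) (obj H))"
      by (rule slide_scalar) simp_all
    also have "\<langle>obj B\<rangle> \<otimes> \<dots> = ((\<langle>obj B\<rangle> \<otimes> ?s) \<otimes> \<langle>obj B\<rangle>) \<cdot> (\<langle>obj B \<odot> obj H\<rangle> \<otimes> \<gamma> (obj B) (obj H))"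
      using interchange [of "\<langle>obj B\<rangle>" "\<langle>obj B\<rangle>" "\<H> \<otimes> \<gamma> (obj B) (obj H)" "?s \<otimes> \<langle>obj B\<rangle>"]
      by (simp add: ident_merge)
    finally show ?thesis .
  qed
  have "P = (\<langle>obj B\<rangle> \<otimes> \<epsilon> H) \<bullet> \<rho> B \<bullet> (one B \<star>\<^bsub>B\<^esub> P)"
    using \<rho>_counit [of P] by simp
  also have "\<dots> = ((\<langle>obj B\<rangle> \<otimes> \<epsilon> H) \<cdot> tensor_\<mu> B H) \<bullet> (?V \<boxtimes> P \<boxtimes> a)"
    using \<rho>_mul [of "one B" P] by (simp add: mul2_def)
  also have "\<dots> = \<mu> B \<bullet> (((\<langle>obj B\<rangle> \<otimes> ?s) \<otimes> \<langle>obj B\<rangle>) \<bullet> (?V \<boxtimes> a \<boxtimes> P))"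
    unfolding 1 by simp
  also have "\<dots> = (u_map B \<bullet> a) \<star>\<^bsub>B\<^esub> P"
    by (subst app_pair_split) (simp_all add: app_u)
  finally show ?thesis ..
qed

text \<open>If \<open>P\<close> has degree \<open>g\<close>, then \<open>P 1\<^sub>0 \<otimes> 1\<^sub>1 = P \<otimes> \<Pi>\<^sup>R(g)\<close>: by \<open>\<rho> (P 1) = P \<otimes> g\<close> the left
  side becomes the right one after multiplication by \<open>g\<^sup>-\<^sup>1\<close> from the left, and this changes
  \<open>P 1\<^sub>0 \<otimes> 1\<^sub>1\<close> only by a scalar that coassociativity of \<open>\<rho>\<close> absorbs.\<close>

lemma deg_mul_\<rho>_one:
  assumes P: "deg B P g" and g: "gl g"
  shows "(\<mu> B \<otimes> \<H>) \<bullet> (P \<boxtimes> (\<rho> B \<bullet> one B)) = P \<boxtimes> (\<Pi>R H \<bullet> g)"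
proof -
  let ?V = "\<rho> B \<bullet> one B" and ?s = "\<epsilon> H \<cdot> \<mu> H"
  let ?b = "linear (obj B)" and ?h = "linear (obj H)"
  note [simp] = degD [OF P] g
  have L: "linear (obj B \<odot> obj H) = ?b \<boxtimes> ?h"
    by simp
  let ?l = "(\<langle>obj B\<rangle> \<otimes> \<mu> H) \<cdot> (\<gamma> (obj H) (obj B) \<otimes> \<H>)"
  let ?F = "?l \<cdot> (\<H> \<otimes> tensor_\<mu> B H)"
  let ?E = "(\<langle>obj B\<rangle> \<otimes> \<epsilon> H) \<cdot> tensor_\<mu> B H"
  let ?G = "(?E \<otimes> \<H>) \<cdot> (\<langle>obj B \<odot> obj H\<rangle> \<otimes> (\<langle>obj B\<rangle> \<otimes> \<delta> H))"
  let ?K = "(?E \<otimes> \<H>) \<cdot> (\<langle>obj B \<odot> obj H\<rangle> \<otimes> (\<rho> B \<otimes> \<H>))"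
  have E: "?E \<bullet> (P \<boxtimes> g \<boxtimes> ?b \<boxtimes> k) = (P \<star>\<^bsub>B\<^esub> ?b) \<boxtimes> (\<epsilon> H \<bullet> (g \<star> k))" if "el k" "typ_of k = obj H" for k
    using that by (simp del: linear_pair pair_\<epsilon>)
  have R: "\<rho> B \<bullet> (P \<star>\<^bsub>B\<^esub> one B) = tensor_\<mu> B H \<bullet> (P \<boxtimes> g \<boxtimes> ?V)"
    by (subst \<rho>_mul) (simp_all add: mul2_def)
  have "P \<boxtimes> (\<Pi>R H \<bullet> g) = ?l \<bullet> (inv_H g \<boxtimes> \<rho> B \<bullet> (P \<star>\<^bsub>B\<^esub> one B))"
    by simp
  also have "\<dots> = ?F \<bullet> ((inv_H g \<boxtimes> P \<boxtimes> g) \<boxtimes> ?V)"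
    unfolding R by simp
  also have "\<dots> = ?G \<bullet> ((P \<boxtimes> g) \<boxtimes> ?V)"
  proof (rule linear_ext [where S = "obj B \<odot> obj H"])
    have 1: "inv_H g \<star> g \<star> ?h = ((\<epsilon> H \<cdot> \<mu> H) \<otimes> \<H>) \<bullet> (g \<boxtimes> \<delta> H \<bullet> ?h)"
    proof -
      have "inv_H g \<star> g \<star> ?h = (inv_H g \<star> g) \<star> ?h"
        by (subst mul_assoc) simp_all
      also have "\<dots> = \<pi>r \<bullet> (g \<boxtimes> ?h)"
        by (simp add: mul_\<Pi>R)
      finally show ?thesis
        by (simp add: \<pi>r_alt)
    qed
    have 2: "(\<langle>obj B \<odot> obj H\<rangle> \<otimes> (\<langle>obj B\<rangle> \<otimes> \<delta> H)) \<bullet> (P \<boxtimes> g \<boxtimes> ?b \<boxtimes> ?h) = P \<boxtimes> g \<boxtimes> ?b \<boxtimes> (\<delta> H \<bullet> ?h)"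
      by (subst app_pair_split) (simp_all del: linear_pair)
    have "?E \<otimes> \<H> = (\<mu> B \<otimes> (?s \<otimes> \<H>)) \<cdot> (\<langle>obj B\<rangle> \<otimes> (\<gamma> (obj H) (obj B) \<otimes> \<langle>obj H \<odot> obj H\<rangle>))"
      using interchange [of "\<mu> B" "\<langle>obj B\<rangle>" "\<mu> H" "\<epsilon> H"]
        compose_tail [of "\<langle>obj B\<rangle> \<otimes> \<epsilon> H" "\<mu> B \<otimes> \<mu> H" "\<mu> B \<otimes> ?s" "\<langle>obj B\<rangle> \<otimes> \<gamma> (obj H) (obj B) \<otimes> \<H>"]
        interchange [of "\<langle>obj B\<rangle> \<otimes> \<gamma> (obj H) (obj B) \<otimes> \<H>" "\<mu> B \<otimes> ?s" "\<H>" "\<H>"]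
      by (simp add: tensor_\<mu>_def)
    then have 3: "(?E \<otimes> \<H>) \<bullet> (P \<boxtimes> g \<boxtimes> ?b \<boxtimes> (\<delta> H \<bullet> ?h))
        = (P \<star>\<^bsub>B\<^esub> ?b) \<boxtimes> ((?s \<otimes> \<H>) \<bullet> (g \<boxtimes> \<delta> H \<bullet> ?h))"
      by (simp del: linear_pair)
    show "?F \<bullet> ((inv_H g \<boxtimes> P \<boxtimes> g) \<boxtimes> linear (obj B \<odot> obj H)) = ?G \<bullet> ((P \<boxtimes> g) \<boxtimes> linear (obj B \<odot> obj H))"
      unfolding L using 3 by (simp add: 1 2 del: linear_pair)
  qed simp_all
  also have "\<dots> = (?E \<otimes> \<H>) \<bullet> (P \<boxtimes> g \<boxtimes> (\<langle>obj B\<rangle> \<otimes> \<delta> H) \<bullet> ?V)"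
    by (subst app_app, simp_all del: app_app tensor_assoc)
  also have "\<dots> = ?K \<bullet> ((P \<boxtimes> g) \<boxtimes> ?V)"
    by (simp add: \<rho>_coassoc del: tensor_assoc)
  also have "\<dots> = (\<mu> B \<otimes> \<H>) \<bullet> (P \<boxtimes> ?V)"
  proof (rule linear_ext [where S = "obj B \<odot> obj H"])
    have "?E \<bullet> (P \<boxtimes> g \<boxtimes> \<rho> B \<bullet> ?b) = P \<star>\<^bsub>B\<^esub> ?b"
      using \<rho>_counit [of "P \<star>\<^bsub>B\<^esub> ?b"] \<rho>_mul [of P ?b] by (simp add: mul2_def)
    then have 3: "(?E \<otimes> \<H>) \<bullet> (P \<boxtimes> g \<boxtimes> (\<rho> B \<bullet> ?b) \<boxtimes> ?h) = (P \<star>\<^bsub>B\<^esub> ?b) \<boxtimes> ?h"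
      by (subst app_pair_split3) (simp_all del: app_app)
    have 2: "(\<langle>obj B \<odot> obj H\<rangle> \<otimes> (\<rho> B \<otimes> \<H>)) \<bullet> (P \<boxtimes> g \<boxtimes> ?b \<boxtimes> ?h) = P \<boxtimes> g \<boxtimes> (\<rho> B \<bullet> ?b) \<boxtimes> ?h"
      by (subst app_pair_split) (simp_all del: linear_pair)
    show "?K \<bullet> ((P \<boxtimes> g) \<boxtimes> linear (obj B \<odot> obj H)) = (\<mu> B \<otimes> \<H>) \<bullet> (P \<boxtimes> linear (obj B \<odot> obj H))"
      unfolding L using 3 by (subst app_app) (simp_all add: 2 del: linear_pair app_app tensor_assoc)
  qed simp_all
  finally show ?thesis ..
qed

lemma mul_u:
  assumes P: "deg B P g" and g: "gl g" and a: "gl a"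
  shows "P \<star>\<^bsub>B\<^esub> (u_map B \<bullet> a) = (g \<star> a) \<triangleright> P"
proof -
  let ?V = "\<rho> B \<bullet> one B" and ?s = "\<epsilon> H \<cdot> \<mu> H"
  note [simp] = degD [OF P] g a
  have 1: "\<mu> B \<cdot> (\<langle>obj B\<rangle> \<otimes> (\<langle>obj B\<rangle> \<otimes> ?s)) = (\<langle>obj B\<rangle> \<otimes> ?s) \<cdot> ((\<mu> B \<otimes> \<H>) \<otimes> \<H>)"
    using interchange [of "\<langle>obj B \<odot> obj B\<rangle>" "\<mu> B" ?s "\<langle>\<one>\<rangle>"]
      interchange [of "\<mu> B" "\<langle>obj B\<rangle>" "\<langle>obj H \<odot> obj H\<rangle>" ?s] by (simp add: ident_merge)
  have 2: "((\<mu> B \<otimes> \<H>) \<otimes> \<H>) \<bullet> ((P \<boxtimes> ?V) \<boxtimes> a) = ((\<mu> B \<otimes> \<H>) \<bullet> (P \<boxtimes> ?V)) \<boxtimes> a"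
    by (subst app_pair) simp_all
  have "P \<star>\<^bsub>B\<^esub> (u_map B \<bullet> a) = (\<mu> B \<cdot> (\<langle>obj B\<rangle> \<otimes> (\<langle>obj B\<rangle> \<otimes> ?s))) \<bullet> ((P \<boxtimes> ?V) \<boxtimes> a)"
    by (simp add: app_u)
  also have "\<dots> = (\<langle>obj B\<rangle> \<otimes> ?s) \<bullet> (((\<mu> B \<otimes> \<H>) \<otimes> \<H>) \<bullet> ((P \<boxtimes> ?V) \<boxtimes> a))"
    unfolding 1 by (rule app_app) simp_all
  also have "\<dots> = (g \<star> a) \<triangleright> P"
    unfolding 2 deg_mul_\<rho>_one [OF P g] by simp
  finally show ?thesis .
qed

lemma u_mul':
  assumes P: "deg B P g" and g: "gl g" and a: "gl a"
  shows "(u_map B \<bullet> a) \<star>\<^bsub>B\<^esub> P = ((\<Pi>L H \<bullet> a) \<star> g) \<triangleright> P"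
proof -
  note [simp] = degD [OF P] g a
  let ?s = "(\<Pi>L H \<bullet> a) \<star> g"
  have "(u_map B \<bullet> a) \<star>\<^bsub>B\<^esub> (u_map B \<bullet> g) = ?s \<triangleright> (u_map B \<bullet> a)"
    by (rule mul_u) simp_all
  also have "\<dots> = u_map B \<bullet> (?s \<triangleright> (\<Pi>L H \<bullet> a))"
    by (simp del: gl_mul_\<Pi>)
  also have "\<dots> = ?s \<triangleright> (u_map B \<bullet> g)"
    by (subst \<Pi>L_scale_exchange) (simp_all del: gl_mul_\<Pi>)
  finally have "((u_map B \<bullet> a) \<star>\<^bsub>B\<^esub> (u_map B \<bullet> g)) \<star>\<^bsub>B\<^esub> P = ?s \<triangleright> ((u_map B \<bullet> g) \<star>\<^bsub>B\<^esub> P)"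
    by (simp del: gl_mul_\<Pi> mul_assoc)
  moreover have "(u_map B \<bullet> g) \<star>\<^bsub>B\<^esub> P = P"
    by (rule u_mul [OF P g])
  moreover have "((u_map B \<bullet> a) \<star>\<^bsub>B\<^esub> (u_map B \<bullet> g)) \<star>\<^bsub>B\<^esub> P = (u_map B \<bullet> a) \<star>\<^bsub>B\<^esub> ((u_map B \<bullet> g) \<star>\<^bsub>B\<^esub> P)"
    by (rule mul_assoc) simp_all
  ultimately show ?thesis
    by simp
qed

text \<open>Both products are homogeneous of degree \<open>\<Pi>\<^sup>L a\<close>, so that \<open>u a\<close> is
  a unit for either of them, on both sides. Hence both are equal to \<open>u(a) c u(a)\<close>.\<close>

lemma u_coinv_commute:
  assumes c: "coinv B c" and a: "gl a"
  shows "(u_map B \<bullet> a) \<star>\<^bsub>B\<^esub> c = c \<star>\<^bsub>B\<^esub> (u_map B \<bullet> a)"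
proof -
  note [simp] = coinvD(1,2) [OF c] a
  have "deg B ((u_map B \<bullet> a) \<star>\<^bsub>B\<^esub> c) (\<Pi>L H \<bullet> a)"
    by (rule deg_mul_coinv) (simp_all add: c)
  then have "((u_map B \<bullet> a) \<star>\<^bsub>B\<^esub> c) \<star>\<^bsub>B\<^esub> (u_map B \<bullet> a) = (u_map B \<bullet> a) \<star>\<^bsub>B\<^esub> c"
    using mul_e [of "(u_map B \<bullet> a) \<star>\<^bsub>B\<^esub> c" "\<Pi>L H \<bullet> a"] by simp
  moreover have "deg B (c \<star>\<^bsub>B\<^esub> (u_map B \<bullet> a)) (\<Pi>L H \<bullet> a)"
    by (rule deg_coinv_mul) (simp_all add: c)
  then have "(u_map B \<bullet> a) \<star>\<^bsub>B\<^esub> (c \<star>\<^bsub>B\<^esub> (u_map B \<bullet> a)) = c \<star>\<^bsub>B\<^esub> (u_map B \<bullet> a)"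
    using u_mul [of "c \<star>\<^bsub>B\<^esub> (u_map B \<bullet> a)" "\<Pi>L H \<bullet> a"] by simp
  ultimately show ?thesis by simp
qed

lemma u_one [simp]: "u_map B \<bullet> one H = one B"
proof -
  let ?s = "\<epsilon> H \<cdot> \<mu> H"
  have "\<mu> H \<cdot> (\<H> \<otimes> \<eta> H) = \<H>"
    using algebra_H unfolding is_algebra_def by blast
  then have 1: "?s \<cdot> (\<H> \<otimes> \<eta> H) = \<epsilon> H"
    by simp
  have "(\<langle>obj B\<rangle> \<otimes> ?s) \<cdot> (\<langle>obj B \<odot> obj H\<rangle> \<otimes> \<eta> H) = \<langle>obj B\<rangle> \<otimes> \<epsilon> H"
    using interchange [of "\<langle>obj B\<rangle>" "\<langle>obj B\<rangle>" "\<H> \<otimes> \<eta> H" ?s] 1 by (simp add: ident_merge)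
  moreover have "u_map B \<bullet> one H = ((\<langle>obj B\<rangle> \<otimes> ?s) \<cdot> (\<langle>obj B \<odot> obj H\<rangle> \<otimes> \<eta> H)) \<bullet> (\<rho> B \<bullet> one B)"
    by (simp add: app_u)
  ultimately show ?thesis
    by (simp add: \<rho>_counit)
qed

end

end

section \<open>Cleft extensions\<close>

context cocommutative_wha
begin

lemma stage0: "stage C \<one> \<langle>\<one>\<rangle> \<langle>\<one>\<rangle>"
  by unfold_locales (simp_all add: is_coalgebra_def Hom_iff)

lemma generic_ext0:
  assumes "F \<in> Ar C" "G \<in> Ar C" "source C F = \<one>" "source C G = \<one>"
    and eq: "\<And>X e d. wha_stage C H X e d \<Longrightarrow> F \<bullet> stage.unit_el C e = G \<bullet> stage.unit_el C e"
  shows "F = G"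
proof -
  interpret stage C \<one> "\<langle>\<one>\<rangle>" "\<langle>\<one>\<rangle>" by (rule stage0)
  have "F \<bullet> unit_el = G \<bullet> unit_el"
    by (rule eq [OF wha_stageI [OF stage0]])
  then show ?thesis
    using assms by (simp add: unit_el_def app_def)
qed

end

locale extension = cocommutative_wha C H
  for C :: "('o, 'm) monoidal_data" (structure) and H :: "('o, 'm) weak_hopf" +
  fixes D :: "('o, 'm) algebra" and B :: "('o, 'm) algebra_extension"
  assumes comodule_algebra [simp]: "right_comodule_algebra H B"
    and coinvariants: "coinvariant_subalgebra H B D (incl B)"
begin

lemma algebra_D [simp]: "is_algebra D"
  using coinvariants by (simp add: coinvariant_subalgebra_def)

lemma incl_simps [simp]: "incl B \<in> Ar C" "source C (incl B) = obj D" "target C (incl B) = obj B"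
  using coinvariants by (auto simp: coinvariant_subalgebra_def is_algebra_morphism_def Hom_def)

lemma incl_coinvariant: "\<rho> B \<cdot> incl B = \<zeta> H B \<cdot> incl B"
  using coinvariants by (auto simp: coinvariant_subalgebra_def is_equalizer_def)

lemma incl_lift:
  assumes "k \<in> Ar C" "target C k = obj B" "\<rho> B \<cdot> k = \<zeta> H B \<cdot> k"
  shows "\<exists>!l. l \<in> Hom C (source C k) (obj D) \<and> incl B \<cdot> l = k"
proof -
  obtain a b where *: "\<rho> B \<in> Hom C a b"
    "\<forall>x. \<forall>k \<in> Hom C x a. \<rho> B \<cdot> k = \<zeta> H B \<cdot> k \<longrightarrow> (\<exists>!l. l \<in> Hom C x (obj D) \<and> incl B \<cdot> l = k)"
    using coinvariants unfolding coinvariant_subalgebra_def is_equalizer_def by blast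
  have "k \<in> Hom C (source C k) a"
    using *(1) assms by (simp add: Hom_iff)
  with *(2) assms(3) show ?thesis by blast
qed

lemma incl_mono:
  assumes "l \<in> Ar C" "l' \<in> Ar C" "source C l = source C l'" "target C l = obj D" "target C l' = obj D"
    and "incl B \<cdot> l = incl B \<cdot> l'"
  shows "l = l'"
proof -
  have "\<rho> B \<cdot> (incl B \<cdot> l) = (\<rho> B \<cdot> incl B) \<cdot> l"
    using assms by simp
  also have "\<dots> = \<zeta> H B \<cdot> (incl B \<cdot> l)"
    unfolding incl_coinvariant using assms by (simp add: \<zeta>_def)
  finally have "\<exists>!m. m \<in> Hom C (source C (incl B \<cdot> l)) (obj D) \<and> incl B \<cdot> m = incl B \<cdot> l"
    using assms by (intro incl_lift) simp_all
  then show ?thesis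
    using assms by (auto simp: Hom_iff)
qed

end

locale extension_stage = extension C H D B + wha_stage C H X e d
  for C :: "('o, 'm) monoidal_data" (structure) and H D B X e d
begin

lemma incl_mul [simp]:
  assumes "el p" "el q" "typ_of p = obj D" "typ_of q = obj D"
  shows "incl B \<bullet> (p \<star>\<^bsub>D\<^esub> q) = incl B \<bullet> p \<star>\<^bsub>B\<^esub> incl B \<bullet> q"
proof -
  have "incl B \<cdot> \<mu> D = \<mu> B \<cdot> (incl B \<otimes> incl B)"
    using coinvariants by (simp add: coinvariant_subalgebra_def is_algebra_morphism_def)
  then have "(incl B \<cdot> \<mu> D) \<bullet> (p \<boxtimes> q) = (\<mu> B \<cdot> (incl B \<otimes> incl B)) \<bullet> (p \<boxtimes> q)"
    by simp
  then show ?thesis using assms by simp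
qed

lemma incl_one [simp]: "incl B \<bullet> one D = one B"
proof -
  have "incl B \<cdot> \<eta> D = \<eta> B"
    using coinvariants by (simp add: coinvariant_subalgebra_def is_algebra_morphism_def)
  then have "(incl B \<cdot> \<eta> D) \<bullet> \<iota> = \<eta> B \<bullet> \<iota>"
    by simp
  then show ?thesis by simp
qed

lemma coinv_incl [simp]:
  assumes "el p" "typ_of p = obj D"
  shows "coinv B (incl B \<bullet> p)"
proof -
  have "(\<rho> B \<cdot> incl B) \<bullet> p = (\<zeta> H B \<cdot> incl B) \<bullet> p"
    by (simp only: incl_coinvariant)
  then show ?thesis
    using assms by (simp add: coinv_def \<zeta>_def)
qed

lemma incl_inj:
  assumes "incl B \<bullet> p = incl B \<bullet> q" "el p" "el q" "typ_of p = obj D" "typ_of q = obj D"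
  shows "p = q"
proof -
  have 1: "fst p = fst q" and 2: "incl B \<cdot> snd p = incl B \<cdot> snd q"
    using assms(1) by (simp_all add: app_def)
  have "snd p = snd q"
    by (rule incl_mono [OF _ _ _ _ _ 2]) (simp_all add: assms(2-) 1)
  with 1 show ?thesis by (simp add: prod_eq_iff)
qed

lemma u_incl: "el p \<Longrightarrow> typ_of p = obj D \<Longrightarrow> gl a \<Longrightarrow>
    incl B \<bullet> p \<star>\<^bsub>B\<^esub> u_map B \<bullet> a = u_map B \<bullet> a \<star>\<^bsub>B\<^esub> incl B \<bullet> p"
  using u_coinv_commute [of B "incl B \<bullet> p" a] by simp

lemma u_incl': "el p \<Longrightarrow> typ_of p = obj D \<Longrightarrow> gl a \<Longrightarrow> el R \<Longrightarrow> typ_of R = obj B \<Longrightarrow>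
    incl B \<bullet> p \<star>\<^bsub>B\<^esub> u_map B \<bullet> a \<star>\<^bsub>B\<^esub> R = u_map B \<bullet> a \<star>\<^bsub>B\<^esub> incl B \<bullet> p \<star>\<^bsub>B\<^esub> R"
  using u_incl [of p a] mul_assoc [of B "incl B \<bullet> p" "u_map B \<bullet> a" R] by simp

end

locale cleft = extension C H D B
  for C :: "('o, 'm) monoidal_data" (structure) and H D B +
  fixes f f' :: 'm
  assumes integral: "is_integral H B f" and inverse: "is_convolution_inverse H B f f'"
begin

lemma f_simps [simp]: "f \<in> Ar C" "source C f = obj H" "target C f = obj B"
  "f' \<in> Ar C" "source C f' = obj H" "target C f' = obj B"
  using integral inverse
  by (auto simp: is_integral_def is_comodule_morphism_def is_convolution_inverse_def Hom_def)

end

locale cleft_stage = cleft C H D B f f' + wha_stage C H X e d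
  for C :: "('o, 'm) monoidal_data" (structure) and H D B f f' X e d
begin

sublocale extension_stage ..

lemma deg_f [simp]:
  assumes "gl a"
  shows "deg B (f \<bullet> a) a"
proof -
  have "\<rho> B \<cdot> f = (f \<otimes> \<H>) \<cdot> \<delta> H"
    using integral by (simp add: is_integral_def is_comodule_morphism_def)
  then have "(\<rho> B \<cdot> f) \<bullet> a = ((f \<otimes> \<H>) \<cdot> \<delta> H) \<bullet> a"
    by simp
  then show ?thesis using assms by (simp add: deg_def)
qed

lemma f_f' [simp]:
  assumes "gl a"
  shows "f \<bullet> a \<star>\<^bsub>B\<^esub> f' \<bullet> a = u_map B \<bullet> a" "f' \<bullet> a \<star>\<^bsub>B\<^esub> f \<bullet> a = u_map B \<bullet> \<Pi>R H \<bullet> a"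
    "u_map B \<bullet> \<Pi>R H \<bullet> a \<star>\<^bsub>B\<^esub> f' \<bullet> a = f' \<bullet> a" "f' \<bullet> a \<star>\<^bsub>B\<^esub> u_map B \<bullet> a = f' \<bullet> a"
proof -
  note [simp] = assms
  have 1: "conv (\<delta> H) B f f' = u_map B" and 2: "conv (\<delta> H) B f' f = e_map H B"
    and 3: "conv (\<delta> H) B (conv (\<delta> H) B f' f) f' = f'"
    using inverse unfolding is_convolution_inverse_def u_map_def by blast+
  have "conv (\<delta> H) B f f' \<bullet> a = u_map B \<bullet> a"
    unfolding 1 ..
  then show ff': "f \<bullet> a \<star>\<^bsub>B\<^esub> f' \<bullet> a = u_map B \<bullet> a" by simp
  have "conv (\<delta> H) B f' f \<bullet> a = e_map H B \<bullet> a"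
    unfolding 2 ..
  then show f'f: "f' \<bullet> a \<star>\<^bsub>B\<^esub> f \<bullet> a = u_map B \<bullet> \<Pi>R H \<bullet> a"
    by (simp add: e_eq_u)
  have "conv (\<delta> H) B (e_map H B) f' \<bullet> a = f' \<bullet> a"
    using 3 unfolding 2 by simp
  then show 4: "u_map B \<bullet> \<Pi>R H \<bullet> a \<star>\<^bsub>B\<^esub> f' \<bullet> a = f' \<bullet> a"
    by (simp add: e_eq_u)
  have "f' \<bullet> a \<star>\<^bsub>B\<^esub> u_map B \<bullet> a = (f' \<bullet> a \<star>\<^bsub>B\<^esub> f \<bullet> a) \<star>\<^bsub>B\<^esub> f' \<bullet> a"
    by (subst mul_assoc) (simp_all add: ff')
  then show "f' \<bullet> a \<star>\<^bsub>B\<^esub> u_map B \<bullet> a = f' \<bullet> a"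
    unfolding f'f 4 .
qed

text \<open>Both \<open>\<rho> (f' a)\<close> and \<open>f' a \<otimes> a\<^sup>-\<^sup>1\<close> are convolution inverses of \<open>f a \<otimes> a = \<rho> (f a)\<close> in \<open>B \<otimes> H\<close>.\<close>

lemma deg_f' [simp]:
  assumes "gl a"
  shows "deg B (f' \<bullet> a) (inv_H a)"
proof -
  note [simp] = assms degD [OF deg_f [OF assms]] degD(3) [OF deg_u]
  have "\<rho> B \<bullet> f' \<bullet> a = \<rho> B \<bullet> (f' \<bullet> a \<star>\<^bsub>B\<^esub> u_map B \<bullet> a)"
    by simp
  also have "\<dots> = mul2 B H (\<rho> B \<bullet> f' \<bullet> a) (mul B (f \<bullet> a) (f' \<bullet> a) \<boxtimes> mul H a (inv_H a))"
    by (subst \<rho>_mul) simp_all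
  also have "\<dots> = mul2 B H (mul2 B H (\<rho> B \<bullet> f' \<bullet> a) (f \<bullet> a \<boxtimes> a)) (f' \<bullet> a \<boxtimes> inv_H a)"
    by (rule mul2_assoc [symmetric]) simp_all
  also have "mul2 B H (\<rho> B \<bullet> f' \<bullet> a) (f \<bullet> a \<boxtimes> a) = \<rho> B \<bullet> (f' \<bullet> a \<star>\<^bsub>B\<^esub> f \<bullet> a)"
    by (subst \<rho>_mul) simp_all
  finally have "\<rho> B \<bullet> f' \<bullet> a = f' \<bullet> a \<boxtimes> inv_H a"
    by simp
  then show ?thesis by (simp add: deg_def)
qed

text \<open>Together with \<open>u_incl\<close>, the following rules eliminate the elements \<open>u a\<close> from a product of values
  of \<open>f\<close>, \<open>f'\<close> and the inclusion.\<close>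

lemma f_words1:
  assumes "gl a" "gl b"
  shows "f \<bullet> a \<star>\<^bsub>B\<^esub> u_map B \<bullet> b = (a \<star> b) \<triangleright> (f \<bullet> a)"
    "f' \<bullet> a \<star>\<^bsub>B\<^esub> u_map B \<bullet> b = (inv_H a \<star> b) \<triangleright> (f' \<bullet> a)"
    "u_map B \<bullet> b \<star>\<^bsub>B\<^esub> f \<bullet> a = (\<Pi>L H \<bullet> b \<star> a) \<triangleright> (f \<bullet> a)"
    "u_map B \<bullet> b \<star>\<^bsub>B\<^esub> f' \<bullet> a = (\<Pi>L H \<bullet> b \<star> inv_H a) \<triangleright> (f' \<bullet> a)"
    "u_map B \<bullet> a \<star>\<^bsub>B\<^esub> u_map B \<bullet> b = (\<Pi>L H \<bullet> a \<star> b) \<triangleright> (u_map B \<bullet> a)"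
  by (rule mul_u u_mul'; simp add: assms)+

lemma mul_tail:
  assumes "mul A P Q = W" "is_algebra A" "el P" "el Q" "el R" "typ_of P = obj A" "typ_of Q = obj A" "typ_of R = obj A"
  shows "mul A P (mul A Q R) = mul A W R"
  using assms by (simp flip: assms(1))

lemma f_words2:
  assumes "gl a" "el R" "typ_of R = obj B"
  shows "f \<bullet> a \<star>\<^bsub>B\<^esub> f' \<bullet> a \<star>\<^bsub>B\<^esub> R = u_map B \<bullet> a \<star>\<^bsub>B\<^esub> R"
    "f' \<bullet> a \<star>\<^bsub>B\<^esub> f \<bullet> a \<star>\<^bsub>B\<^esub> R = u_map B \<bullet> \<Pi>R H \<bullet> a \<star>\<^bsub>B\<^esub> R"
  using mul_tail [OF f_f'(1), of a R] mul_tail [OF f_f'(2), of a R] assms by simp_all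

lemma f_words3:
  assumes "gl a" "gl b" "el R" "typ_of R = obj B"
  shows "f \<bullet> a \<star>\<^bsub>B\<^esub> u_map B \<bullet> b \<star>\<^bsub>B\<^esub> R = (a \<star> b) \<triangleright> (f \<bullet> a \<star>\<^bsub>B\<^esub> R)"
    "f' \<bullet> a \<star>\<^bsub>B\<^esub> u_map B \<bullet> b \<star>\<^bsub>B\<^esub> R = (inv_H a \<star> b) \<triangleright> (f' \<bullet> a \<star>\<^bsub>B\<^esub> R)"
    "u_map B \<bullet> b \<star>\<^bsub>B\<^esub> f \<bullet> a \<star>\<^bsub>B\<^esub> R = (\<Pi>L H \<bullet> b \<star> a) \<triangleright> (f \<bullet> a \<star>\<^bsub>B\<^esub> R)"
    "u_map B \<bullet> b \<star>\<^bsub>B\<^esub> f' \<bullet> a \<star>\<^bsub>B\<^esub> R = (\<Pi>L H \<bullet> b \<star> inv_H a) \<triangleright> (f' \<bullet> a \<star>\<^bsub>B\<^esub> R)"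
    "u_map B \<bullet> a \<star>\<^bsub>B\<^esub> u_map B \<bullet> b \<star>\<^bsub>B\<^esub> R = (\<Pi>L H \<bullet> a \<star> b) \<triangleright> (u_map B \<bullet> a \<star>\<^bsub>B\<^esub> R)"
  using mul_tail [OF f_words1(1), of a b R] mul_tail [OF f_words1(2), of a b R] mul_tail [OF f_words1(3), of a b R]
    mul_tail [OF f_words1(4), of a b R] mul_tail [OF f_words1(5), of a b R] assms by (simp_all del: gl_mul_\<Pi>)

lemmas f_words = f_words1 f_words2 f_words3

lemma gl_scale_mul [simp]:
  assumes "gl a" "is_algebra A" "F \<in> Ar C" "source C F = obj H" "target C F = obj A" "el R" "typ_of R = obj A"
  shows "a \<triangleright> mul A (F \<bullet> a) R = mul A (F \<bullet> a) R"
  using mul_scale(1) [of A a "F \<bullet> a" R] assms by (simp del: mul_scale)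

lemma inv_\<Pi> [simp]:
  assumes "gl a"
  shows "inv_H (\<Pi>L H \<bullet> a) = \<Pi>L H \<bullet> a" "inv_H (\<Pi>R H \<bullet> a) = \<Pi>R H \<bullet> a"
proof -
  have *: "inv_H b = b" if "gl b" "\<Pi>L H \<bullet> b = b" "\<Pi>R H \<bullet> b = b" for b
    using inv_H(2,3) [OF that(1)] that by simp
  show "inv_H (\<Pi>L H \<bullet> a) = \<Pi>L H \<bullet> a" "inv_H (\<Pi>R H \<bullet> a) = \<Pi>R H \<bullet> a"
    using assms by (auto intro!: *)
qed

lemma f_f_scale1:
  assumes "gl a" "gl b"
  shows "(a \<star> b) \<triangleright> (f \<bullet> a \<star>\<^bsub>B\<^esub> f \<bullet> b) = f \<bullet> a \<star>\<^bsub>B\<^esub> f \<bullet> b"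
proof -
  have "deg B (f \<bullet> a \<star>\<^bsub>B\<^esub> f \<bullet> b) (a \<star> b)"
    by (rule deg_mul) (simp_all add: assms)
  then show ?thesis
    by (rule deg_scale [rotated 1]) (simp_all add: assms)
qed

lemma f_f_scale2:
  assumes "gl a" "gl b" "el R" "typ_of R = obj B"
  shows "(a \<star> b) \<triangleright> (f \<bullet> a \<star>\<^bsub>B\<^esub> f \<bullet> b \<star>\<^bsub>B\<^esub> R) = f \<bullet> a \<star>\<^bsub>B\<^esub> f \<bullet> b \<star>\<^bsub>B\<^esub> R"
proof -
  note [simp] = assms
  have "(a \<star> b) \<triangleright> ((f \<bullet> a \<star>\<^bsub>B\<^esub> f \<bullet> b) \<star>\<^bsub>B\<^esub> R) = ((a \<star> b) \<triangleright> (f \<bullet> a \<star>\<^bsub>B\<^esub> f \<bullet> b)) \<star>\<^bsub>B\<^esub> R"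
    by (subst mul_scale) simp_all
  then show ?thesis
    by (simp add: f_f_scale1)
qed

lemmas f_f_scale = f_f_scale1 f_f_scale2

end

locale normal_cleft = cleft C H D B f f'
  for C :: "('o, 'm) monoidal_data" (structure) and H D B f f' +
  assumes normal: "f \<cdot> \<eta> H = \<eta> B"

locale normal_cleft_stage = normal_cleft C H D B f f' + wha_stage C H X e d
  for C :: "('o, 'm) monoidal_data" (structure) and H D B f f' X e d
begin

sublocale cleft_stage ..

lemma f_one [simp]: "f \<bullet> one H = one B"
proof -
  have "(f \<cdot> \<eta> H) \<bullet> \<iota> = \<eta> B \<bullet> \<iota>"
    by (simp only: normal)
  then show ?thesis by simp
qed

text \<open>Colinearity of \<open>f\<close> and \<open>f 1 = 1\<close> give
  \<open>(f \<otimes> H) (\<delta> 1) = \<rho> 1\<close>. Contracting the second leg with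
  \<open>a\<close> turns the left side into \<open>f(\<Pi>\<^sup>L a)\<close> and the right side into
  \<open>u a\<close>.\<close>

lemma f_\<Pi>L [simp]:
  assumes "gl a"
  shows "f \<bullet> \<Pi>L H \<bullet> a = u_map B \<bullet> a" "f' \<bullet> \<Pi>L H \<bullet> a = u_map B \<bullet> a"
proof -
  let ?s = "\<epsilon> H \<cdot> \<mu> H"
  note [simp] = assms
  have 1: "f \<cdot> (\<H> \<otimes> ?s) = (\<langle>obj B\<rangle> \<otimes> ?s) \<cdot> ((f \<otimes> \<H>) \<otimes> \<H>)"
    using interchange [of "\<H>" f ?s "\<langle>\<one>\<rangle>"] interchange [of f "\<langle>obj B\<rangle>" "\<langle>obj H \<odot> obj H\<rangle>" ?s] by simp
  have 2: "((f \<otimes> \<H>) \<otimes> \<H>) \<bullet> ((\<delta> H \<bullet> one H) \<boxtimes> a) = ((f \<otimes> \<H>) \<bullet> \<delta> H \<bullet> one H) \<boxtimes> a"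
    by (subst app_pair) simp_all
  have "\<rho> B \<cdot> f = (f \<otimes> \<H>) \<cdot> \<delta> H"
    using integral by (simp add: is_integral_def is_comodule_morphism_def)
  then have "(\<rho> B \<cdot> f) \<bullet> one H = ((f \<otimes> \<H>) \<cdot> \<delta> H) \<bullet> one H"
    by simp
  then have 3: "(f \<otimes> \<H>) \<bullet> \<delta> H \<bullet> one H = \<rho> B \<bullet> one B"
    by simp
  have "f \<bullet> \<Pi>L H \<bullet> a = (f \<cdot> (\<H> \<otimes> ?s)) \<bullet> ((\<delta> H \<bullet> one H) \<boxtimes> a)"
    by (simp add: \<Pi>L_eq \<pi>l_alt)
  also have "\<dots> = (\<langle>obj B\<rangle> \<otimes> ?s) \<bullet> (((f \<otimes> \<H>) \<otimes> \<H>) \<bullet> ((\<delta> H \<bullet> one H) \<boxtimes> a))"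
    unfolding 1 by (rule app_app) simp_all
  also have "\<dots> = u_map B \<bullet> a"
    unfolding 2 3 by (simp add: app_u)
  finally show f: "f \<bullet> \<Pi>L H \<bullet> a = u_map B \<bullet> a" .
  have "f' \<bullet> \<Pi>L H \<bullet> a \<star>\<^bsub>B\<^esub> f \<bullet> \<Pi>L H \<bullet> a = u_map B \<bullet> a"
    using f_f'(2) [of "\<Pi>L H \<bullet> a"] by simp
  moreover have "f' \<bullet> \<Pi>L H \<bullet> a \<star>\<^bsub>B\<^esub> u_map B \<bullet> a = f' \<bullet> \<Pi>L H \<bullet> a"
    using f_f'(4) [of "\<Pi>L H \<bullet> a"] by simp
  ultimately show "f' \<bullet> \<Pi>L H \<bullet> a = u_map B \<bullet> a"
    unfolding f by simp
qed

end

context cleft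
begin

text \<open>A cleaving becomes unital after division by its values on the unit elements \<open>\<Pi>\<^sup>L a\<close>.\<close>

lemma exists_normal: "\<exists>g g'. normal_cleft C H D B g g'"
proof (intro exI)
  \<comment> \<open>These are \<open>g(a) = f'(\<Pi>\<^sup>L a) f(a)\<close> and \<open>g'(a) = f'(a) f(\<Pi>\<^sup>L a)\<close>.\<close>
  let ?g = "conv (\<delta> H) B (f' \<cdot> \<Pi>L H) f" and ?g' = "conv (\<delta> H) B f' (f \<cdot> \<Pi>L H)"
  have arr: "?g \<in> Ar C" "source C ?g = obj H" "target C ?g = obj B"
    "?g' \<in> Ar C" "source C ?g' = obj H" "target C ?g' = obj B"
    by (simp_all add: conv_def)
  have carr: "conv (\<delta> H) B l l' \<in> Ar C" "source C (conv (\<delta> H) B l l') = obj H" "target C (conv (\<delta> H) B l l') = obj B"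
    if "l \<in> Ar C" "source C l = obj H" "target C l = obj B" "l' \<in> Ar C" "source C l' = obj H" "target C l' = obj B" for l l'
    using that by (simp_all add: conv_def)
  have 1: "\<rho> B \<cdot> ?g = (?g \<otimes> \<H>) \<cdot> \<delta> H"
  proof (rule generic_ext1', goal_cases)
    case (5 X e d a)
    then interpret wha_stage C H X e d by simp
    interpret cleft_stage C H D B f f' X e d ..
    have [simp]: "gl a" using 5 by simp
    have "deg B (mul B (f' \<bullet> \<Pi>L H \<bullet> a) (f \<bullet> a)) (mul H (inv_H (\<Pi>L H \<bullet> a)) a)"
      by (rule deg_mul [OF _ deg_f' deg_f]) simp_all
    then have "deg B (mul B (f' \<bullet> \<Pi>L H \<bullet> a) (f \<bullet> a)) a"
      by simp
    then show ?case by (simp add: degD(3) arr)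
  qed (simp_all add: arr)
  have 2: "conv (\<delta> H) B ?g' ?g = e_map H B"
  proof (rule generic_ext1', goal_cases)
    case (5 X e d a)
    then interpret wha_stage C H X e d by simp
    interpret cleft_stage C H D B f f' X e d ..
    have [simp]: "gl a" using 5 by simp
    show ?case by (simp add: arr e_eq_u f_words)
  qed (simp_all add: arr carr)
  have 3: "conv (\<delta> H) B ?g ?g' = u_map B"
  proof (rule generic_ext1', goal_cases)
    case (5 X e d a)
    then interpret wha_stage C H X e d by simp
    interpret cleft_stage C H D B f f' X e d ..
    have [simp]: "gl a" using 5 by simp
    show ?case by (simp add: arr f_words)
  qed (simp_all add: arr carr)
  have 4: "conv (\<delta> H) B (conv (\<delta> H) B ?g' ?g) ?g' = ?g'"
  proof (rule generic_ext1', goal_cases)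
    case (5 X e d a)
    then interpret wha_stage C H X e d by simp
    interpret cleft_stage C H D B f f' X e d ..
    have [simp]: "gl a" using 5 by simp
    show ?case by (simp add: arr carr f_words)
  qed (simp_all add: arr carr)
  have g_\<Pi>L: "?g \<cdot> \<Pi>L H = u_map B"
  proof (rule generic_ext1', goal_cases)
    case (5 X e d a)
    then interpret wha_stage C H X e d by simp
    interpret cleft_stage C H D B f f' X e d ..
    have [simp]: "gl a" using 5 by simp
    show ?case using f_f'(2) [of "\<Pi>L H \<bullet> a"] by (simp add: arr)
  qed (simp_all add: arr)
  have "?g \<cdot> \<eta> H = \<eta> B"
  proof (rule generic_ext0, goal_cases)
    case (5 X e d)
    then interpret wha_stage C H X e d by simp
    have "?g \<bullet> one H = (?g \<cdot> \<Pi>L H) \<bullet> one H"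
      by (simp add: arr)
    also have "\<dots> = one B"
      unfolding g_\<Pi>L by simp
    finally show ?case by (simp add: arr)
  qed (simp_all add: arr)
  then show "normal_cleft C H D B ?g ?g'"
    using 1 2 3 4 arr
    by unfold_locales
      (simp_all add: is_integral_def is_comodule_morphism_def is_convolution_inverse_def u_map_def Hom_iff)
qed

end

section \<open>The crossed system of a cleft extension\<close>

context cocommutative_wha
begin

lemma generic_ext0_1:
  assumes "F \<in> Ar C" "G \<in> Ar C" "source C F = Y" "source C G = Y" "Y \<in> Ob C"
    and eq: "\<And>X e d P. wha_stage C H X e d \<Longrightarrow> stage.el C X P \<Longrightarrow> typ_of P = Y \<Longrightarrow> F \<bullet> P = G \<bullet> P"
  shows "F = G"
proof -
  interpret stage C \<one> "\<langle>\<one>\<rangle>" "\<langle>\<one>\<rangle>" by (rule stage0)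
  have "F \<bullet> linear Y = G \<bullet> linear Y"
    using assms(5) by (intro eq [OF wha_stageI [OF stage0]]) auto
  then show ?thesis
    using assms by (simp add: linear_def app_def)
qed

lemma generic_ext1_2:
  assumes "F \<in> Ar C" "G \<in> Ar C" "source C F = obj H \<odot> Y \<odot> Z" "source C G = obj H \<odot> Y \<odot> Z" "Y \<in> Ob C" "Z \<in> Ob C"
    and eq: "\<And>X e d a P Q. wha_stage C H X e d \<Longrightarrow> stage.grouplike C X d (obj H) (\<delta> H) a \<Longrightarrow> stage.el C X P
      \<Longrightarrow> typ_of P = Y \<Longrightarrow> stage.el C X Q \<Longrightarrow> typ_of Q = Z
      \<Longrightarrow> F \<bullet> stage.pair C X d a (stage.pair C X d P Q) = G \<bullet> stage.pair C X d a (stage.pair C X d P Q)"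
  shows "F = G"
proof -
  interpret stage C "obj H" "\<epsilon> H" "\<delta> H" by (rule stage1)
  have "F \<bullet> pair generic (pair (linear Y) (linear Z)) = G \<bullet> pair generic (pair (linear Y) (linear Z))"
    using assms(5,6) by (intro eq [OF wha_stageI [OF stage1]] generic_grouplike) auto
  then have "F \<bullet> pair generic (linear (Y \<odot> Z)) = G \<bullet> pair generic (linear (Y \<odot> Z))"
    using assms(5,6) by simp
  then show ?thesis
    using assms by (simp add: app_generic_linear)
qed

lemma \<Omega>L_simps [simp]:
  "\<Omega>L H \<in> Ar C" "source C (\<Omega>L H) = obj H \<odot> obj H" "target C (\<Omega>L H) = obj H \<odot> obj H"
  by (simp_all add: \<Omega>L_def)

definition act :: "('o, 'm) algebra \<Rightarrow> ('o, 'm) algebra_extension \<Rightarrow> 'm \<Rightarrow> 'm \<Rightarrow> 'm"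
  where "act D B f f' = \<mu> B \<cdot> (\<mu> B \<otimes> \<langle>obj B\<rangle>) \<cdot> (f \<otimes> incl B \<otimes> f') \<cdot>
    (\<H> \<otimes> \<gamma> (obj H) (obj D)) \<cdot> (\<delta> H \<otimes> \<langle>obj D\<rangle>)"

definition cocycle :: "('o, 'm) algebra_extension \<Rightarrow> 'm \<Rightarrow> 'm \<Rightarrow> 'm"
  where "cocycle B f f' = conv (\<delta>2 H) B (\<mu> B \<cdot> (f \<otimes> f)) (f' \<cdot> \<mu> H)"

end

context wha_stage
begin

lemma scale_factor [simp]:
  assumes "gl a" "gl b" "F \<in> Ar C" "source C F = obj H"
  shows "a \<triangleright> (F \<bullet> (a \<star> b)) = F \<bullet> (a \<star> b)" "b \<triangleright> (F \<bullet> (a \<star> b)) = F \<bullet> (a \<star> b)"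
    and "is_algebra A \<Longrightarrow> target C F = obj A \<Longrightarrow> el R \<Longrightarrow> typ_of R = obj A \<Longrightarrow>
      a \<triangleright> mul A (F \<bullet> (a \<star> b)) R = mul A (F \<bullet> (a \<star> b)) R"
    and "is_algebra A \<Longrightarrow> target C F = obj A \<Longrightarrow> el R \<Longrightarrow> typ_of R = obj A \<Longrightarrow>
      b \<triangleright> mul A (F \<bullet> (a \<star> b)) R = mul A (F \<bullet> (a \<star> b)) R"
proof -
  have "F \<bullet> (a \<triangleright> (a \<star> b)) = a \<triangleright> (F \<bullet> (a \<star> b))" "F \<bullet> (b \<triangleright> (a \<star> b)) = b \<triangleright> (F \<bullet> (a \<star> b))"
    using assms by (auto intro!: app_scale simp del: app_scale mul_scale_self)
  then show 1: "a \<triangleright> (F \<bullet> (a \<star> b)) = F \<bullet> (a \<star> b)" "b \<triangleright> (F \<bullet> (a \<star> b)) = F \<bullet> (a \<star> b)"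
    using assms by (simp_all del: app_scale)
  have "c \<triangleright> mul A (F \<bullet> (a \<star> b)) R = mul A (F \<bullet> (a \<star> b)) R"
    if "gl c" "c \<triangleright> (F \<bullet> (a \<star> b)) = F \<bullet> (a \<star> b)" "is_algebra A" "target C F = obj A" "el R" "typ_of R = obj A" for c
    using mul_scale(1) [of A c "F \<bullet> (a \<star> b)" R] that assms by simp
  with 1 show "is_algebra A \<Longrightarrow> target C F = obj A \<Longrightarrow> el R \<Longrightarrow> typ_of R = obj A \<Longrightarrow>
      a \<triangleright> mul A (F \<bullet> (a \<star> b)) R = mul A (F \<bullet> (a \<star> b)) R"
    and "is_algebra A \<Longrightarrow> target C F = obj A \<Longrightarrow> el R \<Longrightarrow> typ_of R = obj A \<Longrightarrow>
      b \<triangleright> mul A (F \<bullet> (a \<star> b)) R = mul A (F \<bullet> (a \<star> b)) R"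
    using assms by blast+
qed

lemma app_\<Omega>L [simp]: "gl a \<Longrightarrow> gl b \<Longrightarrow> \<Omega>L H \<bullet> (a \<boxtimes> b) = (a \<star> b) \<triangleright> (a \<boxtimes> b)"
  by (simp add: \<Omega>L_def)

lemma u_product [simp]:
  assumes "right_comodule_algebra H B" "gl a" "gl b"
  shows "u_map B \<bullet> (a \<star> b) = (a \<star> b) \<triangleright> (u_map B \<bullet> a)"
proof -
  have "u_map B \<bullet> \<Pi>L H \<bullet> (a \<star> b) = (a \<star> b) \<triangleright> (u_map B \<bullet> \<Pi>L H \<bullet> a)"
    using assms by (simp del: u_\<Pi>L)
  then show ?thesis using assms by (simp del: \<Pi>_product)
qed

end

text \<open>The extension \<open>B\<close> together with the system \<open>(\<phi>, \<sigma>)\<close> that encodes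
  it by means of the cleaving \<open>f\<close>.\<close>

locale presentation = normal_cleft C H D B f f'
  for C :: "('o, 'm) monoidal_data" (structure) and H D B f f' +
  fixes \<phi> \<sigma> :: 'm
  assumes \<phi>_Hom: "\<phi> \<in> Hom C (obj H \<odot> obj D) (obj D)" and \<sigma>_Hom: "\<sigma> \<in> Hom C (obj H \<odot> obj H) (obj D)"
    and \<phi>_eq: "incl B \<cdot> \<phi> = act D B f f'" and \<sigma>_eq: "incl B \<cdot> \<sigma> = cocycle B f f'"
begin

lemma \<phi>\<sigma>_simps [simp]:
  "\<phi> \<in> Ar C" "source C \<phi> = obj H \<odot> obj D" "target C \<phi> = obj D"
  "\<sigma> \<in> Ar C" "source C \<sigma> = obj H \<odot> obj H" "target C \<sigma> = obj D"
  using \<phi>_Hom \<sigma>_Hom by (simp_all add: Hom_iff)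

end

context cleft
begin

lemma act_simps [simp]: "act D B f f' \<in> Ar C" "source C (act D B f f') = obj H \<odot> obj D" "target C (act D B f f') = obj B"
  by (simp_all add: act_def)

lemma cocycle_simps [simp]: "cocycle B f f' \<in> Ar C" "source C (cocycle B f f') = obj H \<odot> obj H" "target C (cocycle B f f') = obj B"
  by (simp_all add: cocycle_def conv_def)

end

context cleft_stage
begin

lemma app_act:
  assumes "gl a" "el p" "typ_of p = obj D"
  shows "act D B f f' \<bullet> (a \<boxtimes> p) = f \<bullet> a \<star>\<^bsub>B\<^esub> incl B \<bullet> p \<star>\<^bsub>B\<^esub> f' \<bullet> a"
  using assms by (simp add: act_def)

lemma app_cocycle:
  assumes "gl a" "gl b"
  shows "cocycle B f f' \<bullet> (a \<boxtimes> b) = f \<bullet> a \<star>\<^bsub>B\<^esub> f \<bullet> b \<star>\<^bsub>B\<^esub> f' \<bullet> (a \<star> b)"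
  using assms by (simp add: cocycle_def)

lemma coinv_act:
  assumes "gl a" "el p" "typ_of p = obj D"
  shows "coinv B (f \<bullet> a \<star>\<^bsub>B\<^esub> incl B \<bullet> p \<star>\<^bsub>B\<^esub> f' \<bullet> a)"
proof -
  note [simp] = assms
  have "deg B (f \<bullet> a \<star>\<^bsub>B\<^esub> incl B \<bullet> p) a"
    by (rule deg_mul_coinv) simp_all
  then have "deg B ((f \<bullet> a \<star>\<^bsub>B\<^esub> incl B \<bullet> p) \<star>\<^bsub>B\<^esub> f' \<bullet> a) (a \<star> inv_H a)"
    by (rule deg_mul [OF comodule_algebra]) simp_all
  then have "deg B (f \<bullet> a \<star>\<^bsub>B\<^esub> incl B \<bullet> p \<star>\<^bsub>B\<^esub> f' \<bullet> a) (\<Pi>L H \<bullet> a)"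
    by simp
  then show ?thesis
    by (rule deg_coinv [rotated 1]) simp_all
qed

lemma coinv_cocycle:
  assumes "gl a" "gl b"
  shows "coinv B (f \<bullet> a \<star>\<^bsub>B\<^esub> f \<bullet> b \<star>\<^bsub>B\<^esub> f' \<bullet> (a \<star> b))"
    and "coinv B (f \<bullet> (a \<star> b) \<star>\<^bsub>B\<^esub> f' \<bullet> b \<star>\<^bsub>B\<^esub> f' \<bullet> a)"
proof -
  note [simp] = assms
  define g where "g = a \<star> b"
  have [simp]: "gl g" by (simp add: g_def)
  have "deg B (f \<bullet> a \<star>\<^bsub>B\<^esub> f \<bullet> b) g"
    unfolding g_def by (rule deg_mul [OF comodule_algebra]) simp_all
  then have "deg B ((f \<bullet> a \<star>\<^bsub>B\<^esub> f \<bullet> b) \<star>\<^bsub>B\<^esub> f' \<bullet> g) (g \<star> inv_H g)"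
    by (rule deg_mul [OF comodule_algebra]) simp_all
  then have "deg B (f \<bullet> a \<star>\<^bsub>B\<^esub> f \<bullet> b \<star>\<^bsub>B\<^esub> f' \<bullet> g) (\<Pi>L H \<bullet> g)"
    by simp
  then show "coinv B (f \<bullet> a \<star>\<^bsub>B\<^esub> f \<bullet> b \<star>\<^bsub>B\<^esub> f' \<bullet> (a \<star> b))"
    unfolding g_def [symmetric] by (rule deg_coinv [rotated 1]) simp_all
  have "g \<star> inv_H b \<star> inv_H a = a \<star> (b \<star> inv_H b) \<star> inv_H a"
    by (simp add: g_def del: inv_H)
  also have "\<dots> = (a \<star> \<Pi>L H \<bullet> b) \<star> inv_H a"
    by (simp del: gl_mul_\<Pi>)
  also have "\<dots> = \<Pi>L H \<bullet> g"
    by (simp add: g_def)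
  finally have *: "g \<star> inv_H b \<star> inv_H a = \<Pi>L H \<bullet> g" .
  have "deg B (f' \<bullet> b \<star>\<^bsub>B\<^esub> f' \<bullet> a) (inv_H b \<star> inv_H a)"
    by (rule deg_mul [OF comodule_algebra]) simp_all
  then have "deg B (f \<bullet> g \<star>\<^bsub>B\<^esub> f' \<bullet> b \<star>\<^bsub>B\<^esub> f' \<bullet> a) (g \<star> inv_H b \<star> inv_H a)"
    by (intro deg_mul [OF comodule_algebra]) simp_all
  then show "coinv B (f \<bullet> (a \<star> b) \<star>\<^bsub>B\<^esub> f' \<bullet> b \<star>\<^bsub>B\<^esub> f' \<bullet> a)"
    unfolding g_def [symmetric] * by (rule deg_coinv [rotated 1]) simp_all
qed

end

context normal_cleft
begin

lemma exists_lift: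
  assumes "F \<in> Ar C" "target C F = obj B" "\<rho> B \<cdot> F = \<zeta> H B \<cdot> F"
  shows "\<exists>l \<in> Hom C (source C F) (obj D). incl B \<cdot> l = F"
  using incl_lift [OF assms] by blast

lemma exists_presentation: "\<exists>\<phi> \<sigma>. presentation C H D B f f' \<phi> \<sigma>"
proof -
  have "\<rho> B \<cdot> act D B f f' = \<zeta> H B \<cdot> act D B f f'"
  proof (rule generic_ext1 [where Y = "obj D"], goal_cases)
    case (6 X e d a p)
    then interpret wha_stage C H X e d by simp
    interpret cleft_stage C H D B f f' X e d ..
    show ?case using 6 coinv_act [of a p] by (simp add: app_act coinv_def \<zeta>_def)
  qed (simp_all add: \<zeta>_def)
  then obtain \<phi> where \<phi>: "\<phi> \<in> Hom C (obj H \<odot> obj D) (obj D)" "incl B \<cdot> \<phi> = act D B f f'"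
    using exists_lift [of "act D B f f'"] by auto
  have "\<rho> B \<cdot> cocycle B f f' = \<zeta> H B \<cdot> cocycle B f f'"
  proof (rule generic_ext2', goal_cases)
    case (5 X e d a b)
    then interpret wha_stage C H X e d by simp
    interpret cleft_stage C H D B f f' X e d ..
    show ?case using 5 coinv_cocycle(1) [of a b] by (simp add: app_cocycle coinv_def \<zeta>_def)
  qed (simp_all add: \<zeta>_def)
  then obtain \<sigma> where \<sigma>: "\<sigma> \<in> Hom C (obj H \<odot> obj H) (obj D)" "incl B \<cdot> \<sigma> = cocycle B f f'"
    using exists_lift [of "cocycle B f f'"] by auto
  have "presentation C H D B f f' \<phi> \<sigma>"
    using \<phi> \<sigma> by unfold_locales
  then show ?thesis by blast
qed

end

locale presentation_stage = presentation C H D B f f' \<phi> \<sigma> + wha_stage C H X e d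
  for C :: "('o, 'm) monoidal_data" (structure) and H D B f f' \<phi> \<sigma> X e d
begin

sublocale normal_cleft_stage ..

lemma incl_\<phi> [simp]:
  assumes "gl a" "el p" "typ_of p = obj D"
  shows "incl B \<bullet> \<phi> \<bullet> (a \<boxtimes> p) = f \<bullet> a \<star>\<^bsub>B\<^esub> incl B \<bullet> p \<star>\<^bsub>B\<^esub> f' \<bullet> a"
proof -
  have "(incl B \<cdot> \<phi>) \<bullet> (a \<boxtimes> p) = act D B f f' \<bullet> (a \<boxtimes> p)"
    unfolding \<phi>_eq ..
  then show ?thesis using assms by (simp add: app_act)
qed

lemma incl_\<sigma> [simp]:
  assumes "gl a" "gl b"
  shows "incl B \<bullet> \<sigma> \<bullet> (a \<boxtimes> b) = f \<bullet> a \<star>\<^bsub>B\<^esub> f \<bullet> b \<star>\<^bsub>B\<^esub> f' \<bullet> (a \<star> b)"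
proof -
  have "(incl B \<cdot> \<sigma>) \<bullet> (a \<boxtimes> b) = cocycle B f f' \<bullet> (a \<boxtimes> b)"
    unfolding \<sigma>_eq ..
  then show ?thesis using assms by (simp add: app_cocycle)
qed

text \<open>These rules bring a product of values of \<open>f\<close>, \<open>f'\<close> and the inclusion to a
  normal form, with all scalars in front.\<close>

lemmas words = f_words1(1,2,3,5) f_words2 f_words3(1,2,3,5) u_incl u_incl' f_f_scale

end

context presentation
begin

lemma weak_module_algebra: "weak_module_algebra H D \<phi>"
proof -
  have 1: "\<phi> \<cdot> (\<eta> H \<otimes> \<langle>obj D\<rangle>) = \<langle>obj D\<rangle>"
  proof -
    \<comment> \<open>The unit of \<open>H\<close> is replaced by \<open>\<Pi>\<^sup>L z\<close>, which is grouplike for generic \<open>z\<close>.\<close>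
    have *: "incl B \<cdot> \<phi> \<cdot> (\<Pi>L H \<otimes> \<langle>obj D\<rangle>) = \<mu> B \<cdot> (u_map B \<otimes> incl B)"
    proof (rule generic_ext1 [where Y = "obj D"], goal_cases)
      case (6 X e d a p)
      then interpret wha_stage C H X e d by simp
      interpret presentation_stage C H D B f f' \<phi> \<sigma> X e d ..
      show ?case using 6 by (simp add: words)
    qed simp_all
    show ?thesis
    proof (rule generic_ext0_1 [where Y = "obj D"], goal_cases)
      case (6 X e d p)
      then interpret wha_stage C H X e d by simp
      interpret presentation_stage C H D B f f' \<phi> \<sigma> X e d ..
      note [simp] = 6
      have "(incl B \<cdot> \<phi> \<cdot> (\<Pi>L H \<otimes> \<langle>obj D\<rangle>)) \<bullet> pair (one H) p = incl B \<bullet> p"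
        unfolding * by simp
      then show ?case
        using incl_inj [of "(\<phi> \<cdot> (\<eta> H \<otimes> \<langle>obj D\<rangle>)) \<bullet> p" p] by simp
    qed simp_all
  qed
  have 2: "\<phi> \<cdot> (\<H> \<otimes> \<mu> D)
      = \<mu> D \<cdot> (\<phi> \<otimes> \<phi>) \<cdot> (\<H> \<otimes> \<gamma> (obj H) (obj D) \<otimes> \<langle>obj D\<rangle>) \<cdot> (\<delta> H \<otimes> \<langle>obj D\<rangle> \<otimes> \<langle>obj D\<rangle>)"
  proof (rule generic_ext1_2 [where Y = "obj D" and Z = "obj D"], goal_cases)
    case (7 X e d a p q)
    then interpret wha_stage C H X e d by simp
    interpret presentation_stage C H D B f f' \<phi> \<sigma> X e d ..
    note [simp] = 7
    show ?case
      by (rule incl_inj) (simp_all add: words)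
  qed simp_all
  have 3: "\<phi> \<cdot> (\<mu> H \<otimes> \<eta> D) = \<phi> \<cdot> (\<H> \<otimes> (\<phi> \<cdot> (\<H> \<otimes> \<eta> D)))"
  proof (rule generic_ext2', goal_cases)
    case (5 X e d a b)
    then interpret wha_stage C H X e d by simp
    interpret presentation_stage C H D B f f' \<phi> \<sigma> X e d ..
    note [simp] = 5
    show ?case
      by (rule incl_inj) (simp_all add: words)
  qed simp_all
  have 4: "\<phi> \<cdot> (\<Pi>L H \<otimes> \<eta> D) = \<phi> \<cdot> (\<H> \<otimes> \<eta> D)"
  proof (rule generic_ext1', goal_cases)
    case (5 X e d a)
    then interpret wha_stage C H X e d by simp
    interpret presentation_stage C H D B f f' \<phi> \<sigma> X e d ..
    note [simp] = 5
    show ?case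
      by (rule incl_inj) (simp_all add: words)
  qed simp_all
  show ?thesis
    using 1 2 3 4 \<phi>_Hom by (simp add: weak_module_algebra_def)
qed

lemma u2_simps [simp]: "u1 H D \<phi> \<in> Ar C" "source C (u1 H D \<phi>) = obj H" "target C (u1 H D \<phi>) = obj D"
  "u2 H D \<phi> \<in> Ar C" "source C (u2 H D \<phi>) = obj H \<odot> obj H" "target C (u2 H D \<phi>) = obj D"
  by (simp_all add: u1_def u2_def)

end

context presentation_stage
begin

lemma incl_u [simp]:
  assumes "gl a"
  shows "incl B \<bullet> u1 H D \<phi> \<bullet> a = u_map B \<bullet> a"
    and "gl b \<Longrightarrow> incl B \<bullet> u2 H D \<phi> \<bullet> (a \<boxtimes> b) = (a \<star> b) \<triangleright> (u_map B \<bullet> a)"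
  using assms by (simp_all add: u1_def u2_def words)

end

context presentation
begin

text \<open>The inverse of \<open>\<sigma>\<close> is the lift of \<open>f(a b) f'(b) f'(a)\<close>.\<close>

lemma \<sigma>_regular: "\<sigma> \<in> Reg2 H D \<phi>"
proof -
  let ?F = "conv (\<delta>2 H) B (f \<cdot> \<mu> H) (\<mu> B \<cdot> ((f' \<otimes> f') \<cdot> \<gamma> (obj H) (obj H)))"
  have F [simp]: "?F \<in> Ar C" "source C ?F = obj H \<odot> obj H" "target C ?F = obj B"
    by (simp_all add: conv_def)
  have "\<rho> B \<cdot> ?F = \<zeta> H B \<cdot> ?F"
  proof (rule generic_ext2', goal_cases)
    case (5 X e d a b)
    then interpret wha_stage C H X e d by simp
    interpret presentation_stage C H D B f f' \<phi> \<sigma> X e d ..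
    show ?case using 5 coinv_cocycle(2) [of a b] by (simp add: coinv_def \<zeta>_def)
  qed (simp_all add: \<zeta>_def)
  then obtain \<tau> where \<tau>: "\<tau> \<in> Hom C (obj H \<odot> obj H) (obj D)" "incl B \<cdot> \<tau> = ?F"
    using exists_lift [of ?F] by auto
  have [simp]: "\<tau> \<in> Ar C" "source C \<tau> = obj H \<odot> obj H" "target C \<tau> = obj D"
    using \<tau> by (simp_all add: Hom_iff)
  have conv [simp]: "conv (\<delta>2 H) D l l' \<in> Ar C" "source C (conv (\<delta>2 H) D l l') = obj H \<odot> obj H"
      "target C (conv (\<delta>2 H) D l l') = obj D"
    if "l \<in> Ar C" "source C l = obj H \<odot> obj H" "target C l = obj D"
      "l' \<in> Ar C" "source C l' = obj H \<odot> obj H" "target C l' = obj D" for l l'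
    using that by (simp_all add: conv_def)
  have "conv (\<delta>2 H) D \<sigma> \<tau> = u2 H D \<phi>" "conv (\<delta>2 H) D \<tau> \<sigma> = u2 H D \<phi>"
    "conv (\<delta>2 H) D (u2 H D \<phi>) \<sigma> = \<sigma>" "conv (\<delta>2 H) D (u2 H D \<phi>) \<tau> = \<tau>"
  proof -
    have *: "conv (\<delta>2 H) D \<sigma> \<tau> \<bullet> stage.pair C X d a b = u2 H D \<phi> \<bullet> stage.pair C X d a b
      \<and> conv (\<delta>2 H) D \<tau> \<sigma> \<bullet> stage.pair C X d a b = u2 H D \<phi> \<bullet> stage.pair C X d a b
      \<and> conv (\<delta>2 H) D (u2 H D \<phi>) \<sigma> \<bullet> stage.pair C X d a b = \<sigma> \<bullet> stage.pair C X d a b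
      \<and> conv (\<delta>2 H) D (u2 H D \<phi>) \<tau> \<bullet> stage.pair C X d a b = \<tau> \<bullet> stage.pair C X d a b"
      if 5: "wha_stage C H X e d" "stage.grouplike C X d (obj H) (\<delta> H) a" "stage.grouplike C X d (obj H) (\<delta> H) b"
      for X e d a b
    proof -
      interpret wha_stage C H X e d by fact
      interpret presentation_stage C H D B f f' \<phi> \<sigma> X e d ..
      note [simp] = 5
      have "(incl B \<cdot> \<tau>) \<bullet> pair a b = ?F \<bullet> pair a b"
        unfolding \<tau> ..
      then have [simp]: "incl B \<bullet> \<tau> \<bullet> pair a b = mul B (f \<bullet> mul H a b) (mul B (f' \<bullet> b) (f' \<bullet> a))"
        by simp
      show ?thesis
        by (intro conjI; rule incl_inj; simp add: words)
    qed
    show "conv (\<delta>2 H) D \<sigma> \<tau> = u2 H D \<phi>" "conv (\<delta>2 H) D \<tau> \<sigma> = u2 H D \<phi>"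
      "conv (\<delta>2 H) D (u2 H D \<phi>) \<sigma> = \<sigma>" "conv (\<delta>2 H) D (u2 H D \<phi>) \<tau> = \<tau>"
      by (rule generic_ext2'; simp add: *)+
  qed
  then show ?thesis
    using \<tau> \<sigma>_Hom by (auto simp: Reg2_def is_regular_inverse_def)
qed

text \<open>Both sides become \<open>f(a) f(b) p f'(a b)\<close> in \<open>B\<close>.\<close>

lemma twisted:
  "\<mu> D \<cdot> (\<langle>obj D\<rangle> \<otimes> \<phi>) \<cdot> (\<sigma> \<otimes> \<mu> H \<otimes> \<langle>obj D\<rangle>) \<cdot> (\<delta>2 H \<otimes> \<langle>obj D\<rangle>)
    = \<mu> D \<cdot> ((\<phi> \<cdot> (\<H> \<otimes> \<phi>)) \<otimes> \<langle>obj D\<rangle>) \<cdot> (\<H> \<otimes> \<H> \<otimes> \<gamma> (obj D) (obj D)) \<cdot>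
      (\<H> \<otimes> \<H> \<otimes> \<sigma> \<otimes> \<langle>obj D\<rangle>) \<cdot> (\<delta>2 H \<otimes> \<langle>obj D\<rangle>)"
proof (rule generic_ext2 [where Y = "obj D"], goal_cases)
  case (6 X e d a b p)
  then interpret wha_stage C H X e d by simp
  interpret presentation_stage C H D B f f' \<phi> \<sigma> X e d ..
  note [simp] = 6
  show ?case
    by (rule incl_inj) (simp_all add: words)
qed simp_all

text \<open>Both sides become \<open>f(a) f(b) f(c) f'(a b c)\<close> in \<open>B\<close>, up to scalars that
  this word absorbs.\<close>

lemma cocycle_condition:
  "conv (\<delta>3 H) D (\<phi> \<cdot> (\<H> \<otimes> \<sigma>) \<cdot> (\<Omega>L H \<otimes> \<H>)) (\<sigma> \<cdot> (\<H> \<otimes> \<mu> H))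
    = conv (\<delta>3 H) D ((\<sigma> \<otimes> \<epsilon> H) \<cdot> (\<H> \<otimes> \<Omega>L H)) (\<sigma> \<cdot> (\<mu> H \<otimes> \<H>))"
proof (rule generic_ext3', goal_cases)
  case (5 X e d a b c)
  then interpret wha_stage C H X e d by simp
  interpret presentation_stage C H D B f f' \<phi> \<sigma> X e d ..
  note [simp] = 5
  let ?R = "mul B (f \<bullet> a) (mul B (f \<bullet> b) (mul B (f \<bullet> c) (f' \<bullet> mul H a (mul H b c))))"
  have "scale (mul H b c) ?R = ?R"
    using mul_scale(2) [of B "mul H b c" "f \<bullet> a" "mul B (f \<bullet> b) (mul B (f \<bullet> c) (f' \<bullet> mul H a (mul H b c)))"]
    by (simp add: f_f_scale2 del: mul_scale)
  then show ?case
    by - (rule incl_inj, simp_all add: words)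
qed (simp_all add: conv_def)

lemma unital: "\<sigma> \<cdot> (\<H> \<otimes> \<eta> H) = u1 H D \<phi>" "\<sigma> \<cdot> (\<eta> H \<otimes> \<H>) = u1 H D \<phi>"
proof -
  have 1: "incl B \<cdot> \<sigma> \<cdot> (\<H> \<otimes> \<Pi>L H) = u_map B \<cdot> \<mu> H \<cdot> (\<H> \<otimes> \<Pi>L H)"
  proof (rule generic_ext2', goal_cases)
    case (5 X e d a z)
    then interpret wha_stage C H X e d by simp
    interpret presentation_stage C H D B f f' \<phi> \<sigma> X e d ..
    show ?case using 5 by (simp add: words)
  qed simp_all
  have 2: "incl B \<cdot> \<sigma> \<cdot> (\<Pi>L H \<otimes> \<H>) = u_map B \<cdot> \<mu> H \<cdot> (\<Pi>L H \<otimes> \<H>)"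
  proof (rule generic_ext2', goal_cases)
    case (5 X e d z a)
    then interpret wha_stage C H X e d by simp
    interpret presentation_stage C H D B f f' \<phi> \<sigma> X e d ..
    note [simp] = 5
    let ?w = "mul H (\<Pi>L H \<bullet> z) a"
    have w: "?w = scale ?w a"
      using gl_mul_\<Pi>(2) [of "\<Pi>L H \<bullet> z" a] by simp
    have "f' \<bullet> ?w = scale ?w (f' \<bullet> a)" "u_map B \<bullet> ?w = scale ?w (u_map B \<bullet> a)"
      using arg_cong [OF w, of "app f'"] arg_cong [OF w, of "app (u_map B)"] by (simp_all del: u_product)
    moreover have "scale ?w (u_map B \<bullet> z) = scale ?w (u_map B \<bullet> a)"
      using arg_cong [OF \<Pi>L_scale_exchange [of z a], of "app (u_map B)"] by (simp del: gl_mul_\<Pi>)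
    ultimately show ?case by (simp add: words del: u_product gl_mul_\<Pi>)
  qed simp_all
  show "\<sigma> \<cdot> (\<H> \<otimes> \<eta> H) = u1 H D \<phi>"
  proof (rule generic_ext1', goal_cases)
    case (5 X e d a)
    then interpret wha_stage C H X e d by simp
    interpret presentation_stage C H D B f f' \<phi> \<sigma> X e d ..
    note [simp] = 5
    have "(incl B \<cdot> \<sigma> \<cdot> (\<H> \<otimes> \<Pi>L H)) \<bullet> pair a (one H) = u_map B \<bullet> a"
      unfolding 1 by simp
    then show ?case using incl_inj [of "\<sigma> \<bullet> pair a (one H)" "u1 H D \<phi> \<bullet> a"] by simp
  qed simp_all
  show "\<sigma> \<cdot> (\<eta> H \<otimes> \<H>) = u1 H D \<phi>"
  proof (rule generic_ext1', goal_cases)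
    case (5 X e d a)
    then interpret wha_stage C H X e d by simp
    interpret presentation_stage C H D B f f' \<phi> \<sigma> X e d ..
    note [simp] = 5
    have "(incl B \<cdot> \<sigma> \<cdot> (\<Pi>L H \<otimes> \<H>)) \<bullet> pair (one H) a = u_map B \<bullet> a"
      unfolding 2 by simp
    then show ?case using incl_inj [of "\<sigma> \<bullet> pair (one H) a" "u1 H D \<phi> \<bullet> a"] by simp
  qed simp_all
qed

theorem crossed_system: "crossed_system H D \<phi> \<sigma>"
  unfolding crossed_system_def
  by (intro conjI weak_module_algebra \<sigma>_regular twisted cocycle_condition unital)

end

section \<open>Testing arrows on families of elements\<close>

context strict_symmetric_monoidal_category
begin

text \<open>If \<open>P\<close> is split, its arrow is an epimorphism, so that an arrow is determined by its value
  at \<open>P\<close>.\<close>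

definition split :: "('o, 'm) element \<Rightarrow> bool"
  where "split P \<longleftrightarrow> (\<exists>s \<in> Hom C (typ_of P) (source C (snd P)). snd P \<cdot> s = \<langle>typ_of P\<rangle>)"

lemma split_ext:
  assumes "stage.el C X P" "stage C X e d" "split P" "F \<in> Ar C" "G \<in> Ar C" "source C F = typ_of P" "source C G = typ_of P"
    and "F \<bullet> P = G \<bullet> P"
  shows "F = G"
proof -
  interpret stage C X e d by fact
  obtain s where s: "s \<in> Ar C" "source C s = typ_of P" "target C s = source C (snd P)" "snd P \<cdot> s = \<langle>typ_of P\<rangle>"
    using assms by (auto simp: split_def Hom_iff)
  have eq: "F \<cdot> snd P = G \<cdot> snd P"
    using assms(8) by (simp add: app_def)
  have "F = (F \<cdot> snd P) \<cdot> s"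
    using assms s by (subst compose_assoc') simp_all
  also have "\<dots> = G"
    unfolding eq using assms s by (subst compose_assoc') simp_all
  finally show ?thesis .
qed

lemma split_app:
  assumes "stage.el C X P" "stage C X e d" "split P" "Q \<in> Ar C" "source C Q = typ_of P"
    and r: "r \<in> Hom C (target C Q) (typ_of P)" "Q \<cdot> r = \<langle>target C Q\<rangle>"
  shows "split (Q \<bullet> P)"
proof -
  interpret stage C X e d by fact
  obtain s where s: "s \<in> Ar C" "source C s = typ_of P" "target C s = source C (snd P)" "snd P \<cdot> s = \<langle>typ_of P\<rangle>"
    using assms(3) by (auto simp: split_def Hom_iff)
  have r': "r \<in> Ar C" "source C r = target C Q" "target C r = typ_of P"
    using r by (simp_all add: Hom_iff)
  have "(Q \<cdot> snd P) \<cdot> (s \<cdot> r) = Q \<cdot> ((snd P \<cdot> s) \<cdot> r)"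
    using assms(1,4,5) s(1-3) r' by simp
  also have "\<dots> = \<langle>target C Q\<rangle>"
    using s r r' by simp
  finally have "(Q \<cdot> snd P) \<cdot> (s \<cdot> r) = \<langle>target C Q\<rangle>" .
  moreover have "typ_of (Q \<bullet> P) = target C Q" "snd (Q \<bullet> P) = Q \<cdot> snd P"
    using assms(1,4,5) by (simp_all, simp add: app_def)
  ultimately show ?thesis
    unfolding split_def using assms(1,4,5) s(1-3) r'
    by (intro bexI [of _ "s \<cdot> r"]) (simp_all add: Hom_iff)
qed

lemma split_external:
  assumes S: "stage C X e d" and S': "stage C X' e' d'" and P: "stage.el C X P" and Q: "stage.el C X' Q"
    and "split P" "split Q"
  shows "split (stage.pair C (X \<odot> X') (tensor_\<delta> X d X' d') (pull (\<langle>X\<rangle> \<otimes> e') P) (pull (e \<otimes> \<langle>X'\<rangle>) Q))"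
proof -
  interpret S: stage C X e d by fact
  interpret S': stage C X' e' d' by fact
  obtain Y p Z q where PQ: "P = (Y, p)" "Q = (Z, q)" by (metis surj_pair)
  note [simp] = S.el_D(1-3) [OF P, unfolded PQ fst_conv snd_conv] S'.el_D(1-3) [OF Q, unfolded PQ fst_conv snd_conv]
  obtain s t where [simp]: "s \<in> Ar C" "t \<in> Ar C" "source C s = typ_of P" "source C t = typ_of Q"
      "target C s = X \<odot> Y" "target C t = X' \<odot> Z" and st: "p \<cdot> s = \<langle>typ_of P\<rangle>" "q \<cdot> t = \<langle>typ_of Q\<rangle>"
    using assms(5,6) by (auto simp: split_def Hom_iff PQ)
  have [simp]: "typ_of P = target C p" "typ_of Q = target C q"
    unfolding typ_of_def PQ snd_conv by (rule refl)+
  let ?r = "(\<langle>X\<rangle> \<otimes> \<gamma> Y X' \<otimes> \<langle>Z\<rangle>) \<cdot> (s \<otimes> t)"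
  have 1: "(\<langle>X\<rangle> \<otimes> \<gamma> X' Y \<otimes> \<langle>Z\<rangle>) \<cdot> (\<langle>X\<rangle> \<otimes> \<gamma> Y X' \<otimes> \<langle>Z\<rangle>) = \<langle>X \<odot> Y \<odot> X' \<odot> Z\<rangle>"
    by (simp add: interchange)
  have "((p \<otimes> q) \<cdot> (\<langle>X\<rangle> \<otimes> \<gamma> X' Y \<otimes> \<langle>Z\<rangle>)) \<cdot> ?r = (p \<otimes> q) \<cdot> (s \<otimes> t)"
    using compose_tail [OF 1, of "s \<otimes> t"] by simp
  also have "\<dots> = \<langle>target C p \<odot> target C q\<rangle>"
    using st by (simp add: interchange)
  finally show ?thesis
    unfolding external_pair [OF S S' P Q] split_def
    by (intro bexI [of _ ?r]) (simp_all add: PQ typ_of_def Hom_iff)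
qed

end

context cocommutative_wha
begin

context
  fixes Q s :: 'm and Y S :: 'o
  assumes Q: "Q \<in> Ar C" "source C Q = Y \<odot> obj H" "target C Q = S"
    and s: "s \<in> Hom C S (Y \<odot> obj H)" "Q \<cdot> s = \<langle>S\<rangle>" and Y: "Y \<in> Ob C"
begin

text \<open>Values of \<open>Q\<close> at \<open>p \<otimes> a\<close> with \<open>a\<close> grouplike. If
  \<open>Q\<close> has a section, these elements span \<open>S\<close>, and families of them with
  independent parameters span the tensor powers of \<open>S\<close>. This is how an arrow is tested that
  is not defined on powers of \<open>H\<close>.\<close>

definition word :: "'o \<Rightarrow> 'm \<Rightarrow> 'm \<Rightarrow> ('o, 'm) element \<Rightarrow> bool"
  where "word X e d P \<longleftrightarrow> stage C X e d \<and> (\<exists>p a. stage.el C X p \<and> typ_of p = Y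
    \<and> stage.grouplike C X d (obj H) (\<delta> H) a \<and> P = Q \<bullet> stage.pair C X d p a)"

lemma word_el: "word X e d P \<Longrightarrow> stage.el C X P" "word X e d P \<Longrightarrow> typ_of P = S"
proof -
  have "stage.el C X P \<and> typ_of P = S" if "word X e d P"
  proof -
    interpret stage C X e d using that by (simp add: word_def)
    show ?thesis using that Q by (auto simp: word_def grouplike_def)
  qed
  then show "word X e d P \<Longrightarrow> stage.el C X P" "word X e d P \<Longrightarrow> typ_of P = S" by auto
qed

lemma wordE:
  assumes "word X e d P"
  obtains p a where "stage.el C X p" "typ_of p = Y" "stage.grouplike C X d (obj H) (\<delta> H) a"
    "P = Q \<bullet> stage.pair C X d p a"
  using assms unfolding word_def by blast

lemma word_pull:
  assumes w: "word X e d P" and S: "stage C X e d" "stage C X' e' d'"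
    and t: "t \<in> Ar C" "source C t = X'" "target C t = X" "d \<cdot> t = (t \<otimes> t) \<cdot> d'"
  shows "word X' e' d' (pull t P)"
proof -
  interpret S: stage C X e d by fact
  interpret S': stage C X' e' d' by fact
  obtain p a where pa: "S.el p" "typ_of p = Y" "S.grouplike (obj H) (\<delta> H) a" "P = Q \<bullet> S.pair p a"
    using w by (auto simp: word_def)
  have a: "S.el a" "typ_of a = obj H"
    using pa(3) by (auto simp: S.grouplike_def)
  have "pull t P = Q \<bullet> S'.pair (pull t p) (pull t a)"
    using pull_app [OF S t, of "S.pair p a" Q] pull_pair [OF S t pa(1) a(1)] pa a Q by simp
  then show ?thesis
    unfolding word_def using el_pull [OF S t pa(1)] pull_grouplike [OF S t pa(3)] pa(2) S(2)
    by (intro conjI exI [of _ "pull t p"] exI [of _ "pull t a"]) simp_all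
qed

lemma spanning1: "\<exists>P. word (obj H) (\<epsilon> H) (\<delta> H) P \<and> split P"
proof -
  interpret stage C "obj H" "\<epsilon> H" "\<delta> H" by (rule stage1)
  have 1: "pair (linear Y) generic = (Y, \<gamma> (obj H) Y)"
    using swap [of generic "linear Y" "obj H" Y] Y by (simp add: generic_linear app_def)
  then have "split (pair (linear Y) generic)"
    using Y by (auto simp: split_def Hom_iff typ_of_def intro!: bexI [of _ "\<gamma> Y (obj H)"])
  then have "split (Q \<bullet> pair (linear Y) generic)"
    using s Q Y by (intro split_app [OF _ stage1, where r = s]) simp_all
  moreover have "word (obj H) (\<epsilon> H) (\<delta> H) (Q \<bullet> pair (linear Y) generic)"
    unfolding word_def using Y generic_grouplike by (intro conjI stage1 exI [of _ "linear Y"] exI [of _ generic]) simp_all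
  ultimately show ?thesis by blast
qed

text \<open>Two copies of the element of \<open>spanning1\<close>, over the product of its stage with itself.\<close>

lemma spanning2:
  "\<exists>P P'. word (obj H \<odot> obj H) (\<epsilon> H \<otimes> \<epsilon> H) (\<delta>2 H) P \<and> word (obj H \<odot> obj H) (\<epsilon> H \<otimes> \<epsilon> H) (\<delta>2 H) P'
    \<and> split (stage.pair C (obj H \<odot> obj H) (\<delta>2 H) P P')"
proof -
  obtain P where P: "word (obj H) (\<epsilon> H) (\<delta> H) P" "split P"
    using spanning1 by blast
  note pr = product_projections [OF stage1 stage1, folded \<delta>2_def]
  have "word (obj H \<odot> obj H) (\<epsilon> H \<otimes> \<epsilon> H) (\<delta>2 H) (pull (\<H> \<otimes> \<epsilon> H) P)"
    by (rule word_pull [OF P(1) stage1 stage2]) (use pr(2) in simp_all)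
  moreover have "word (obj H \<odot> obj H) (\<epsilon> H \<otimes> \<epsilon> H) (\<delta>2 H) (pull (\<epsilon> H \<otimes> \<H>) P)"
    by (rule word_pull [OF P(1) stage1 stage2]) (use pr(3) in simp_all)
  moreover note split_external [OF stage1 stage1 word_el(1) [OF P(1)] word_el(1) [OF P(1)] P(2) P(2), folded \<delta>2_def]
  ultimately show ?thesis by blast
qed

lemma spanning3:
  "\<exists>P P' P''. word (obj H \<odot> obj H \<odot> obj H) (\<epsilon> H \<otimes> \<epsilon> H \<otimes> \<epsilon> H) (\<delta>3 H) P
    \<and> word (obj H \<odot> obj H \<odot> obj H) (\<epsilon> H \<otimes> \<epsilon> H \<otimes> \<epsilon> H) (\<delta>3 H) P'
    \<and> word (obj H \<odot> obj H \<odot> obj H) (\<epsilon> H \<otimes> \<epsilon> H \<otimes> \<epsilon> H) (\<delta>3 H) P''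
    \<and> split (stage.pair C (obj H \<odot> obj H \<odot> obj H) (\<delta>3 H) P (stage.pair C (obj H \<odot> obj H \<odot> obj H) (\<delta>3 H) P' P''))"
proof -
  interpret T: stage C "obj H \<odot> obj H" "\<epsilon> H \<otimes> \<epsilon> H" "\<delta>2 H" by (rule stage2)
  interpret R: stage C "obj H \<odot> obj H \<odot> obj H" "\<epsilon> H \<otimes> \<epsilon> H \<otimes> \<epsilon> H" "\<delta>3 H" by (rule stage3)
  obtain P where P: "word (obj H) (\<epsilon> H) (\<delta> H) P" "split P"
    using spanning1 by blast
  obtain P1 P2 where P12: "word (obj H \<odot> obj H) (\<epsilon> H \<otimes> \<epsilon> H) (\<delta>2 H) P1" "word (obj H \<odot> obj H) (\<epsilon> H \<otimes> \<epsilon> H) (\<delta>2 H) P2"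
      "split (T.pair P1 P2)"
    using spanning2 by blast
  note pr = product_projections [OF stage2 stage1, folded \<delta>3_def]
  let ?t = "\<langle>obj H \<odot> obj H\<rangle> \<otimes> \<epsilon> H" and ?s = "(\<epsilon> H \<otimes> \<epsilon> H) \<otimes> \<H>"
  have t: "?t \<in> Ar C" "source C ?t = obj H \<odot> obj H \<odot> obj H" "target C ?t = obj H \<odot> obj H"
    "\<delta>2 H \<cdot> ?t = (?t \<otimes> ?t) \<cdot> \<delta>3 H"
    using pr(2) by simp_all
  have s: "?s \<in> Ar C" "source C ?s = obj H \<odot> obj H \<odot> obj H" "target C ?s = obj H"
    "\<delta> H \<cdot> ?s = (?s \<otimes> ?s) \<cdot> \<delta>3 H"
    using pr(3) by simp_all
  have w: "word (obj H \<odot> obj H \<odot> obj H) (\<epsilon> H \<otimes> \<epsilon> H \<otimes> \<epsilon> H) (\<delta>3 H) (pull ?t P1)"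
    "word (obj H \<odot> obj H \<odot> obj H) (\<epsilon> H \<otimes> \<epsilon> H \<otimes> \<epsilon> H) (\<delta>3 H) (pull ?t P2)"
    "word (obj H \<odot> obj H \<odot> obj H) (\<epsilon> H \<otimes> \<epsilon> H \<otimes> \<epsilon> H) (\<delta>3 H) (pull ?s P)"
    by (rule word_pull [OF P12(1) stage2 stage3 t] word_pull [OF P12(2) stage2 stage3 t] word_pull [OF P(1) stage1 stage3 s])+
  have "split (R.pair (pull ?t (T.pair P1 P2)) (pull ?s P))"
    using split_external [OF stage2 stage1 _ word_el(1) [OF P(1)] P12(3) P(2), folded \<delta>3_def]
      word_el(1) [OF P12(1)] word_el(1) [OF P12(2)] by simp
  also have "R.pair (pull ?t (T.pair P1 P2)) (pull ?s P) = R.pair (pull ?t P1) (R.pair (pull ?t P2) (pull ?s P))"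
    unfolding pull_pair [OF stage2 stage3 t word_el(1) [OF P12(1)] word_el(1) [OF P12(2)]]
    using w word_el(1) by simp
  finally show ?thesis
    using w by blast
qed

lemma spanning_ext1:
  assumes "F \<in> Ar C" "G \<in> Ar C" "source C F = S" "source C G = S"
    and eq: "\<And>X e d p a. wha_stage C H X e d \<Longrightarrow> stage.el C X p \<Longrightarrow> typ_of p = Y
      \<Longrightarrow> stage.grouplike C X d (obj H) (\<delta> H) a
      \<Longrightarrow> F \<bullet> Q \<bullet> stage.pair C X d p a = G \<bullet> Q \<bullet> stage.pair C X d p a"
  shows "F = G"
proof -
  obtain P where P: "word (obj H) (\<epsilon> H) (\<delta> H) P" "split P"
    using spanning1 by blast
  have "F \<bullet> P = G \<bullet> P"
    using P(1) by (elim wordE) (simp add: eq [OF wha_stageI [OF stage1]])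
  then show ?thesis
    using assms by (intro split_ext [OF word_el(1) [OF P(1)] stage1 P(2)]) (simp_all add: word_el(2) [OF P(1)])
qed

lemma spanning_ext2:
  assumes "F \<in> Ar C" "G \<in> Ar C" "source C F = S \<odot> S" "source C G = S \<odot> S"
    and eq: "\<And>X e d p a q b. wha_stage C H X e d
      \<Longrightarrow> stage.el C X p \<Longrightarrow> typ_of p = Y \<Longrightarrow> stage.grouplike C X d (obj H) (\<delta> H) a
      \<Longrightarrow> stage.el C X q \<Longrightarrow> typ_of q = Y \<Longrightarrow> stage.grouplike C X d (obj H) (\<delta> H) b
      \<Longrightarrow> F \<bullet> stage.pair C X d (Q \<bullet> stage.pair C X d p a) (Q \<bullet> stage.pair C X d q b)
        = G \<bullet> stage.pair C X d (Q \<bullet> stage.pair C X d p a) (Q \<bullet> stage.pair C X d q b)"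
  shows "F = G"
proof -
  interpret stage C "obj H \<odot> obj H" "\<epsilon> H \<otimes> \<epsilon> H" "\<delta>2 H" by (rule stage2)
  obtain P P' where P: "word (obj H \<odot> obj H) (\<epsilon> H \<otimes> \<epsilon> H) (\<delta>2 H) P" "word (obj H \<odot> obj H) (\<epsilon> H \<otimes> \<epsilon> H) (\<delta>2 H) P'"
      "split (pair P P')"
    using spanning2 by blast
  have "F \<bullet> pair P P' = G \<bullet> pair P P'"
    using P(1,2) by (elim wordE) (simp add: eq [OF wha_stageI [OF stage2]])
  then show ?thesis
    using assms word_el [OF P(1)] word_el [OF P(2)] by (intro split_ext [OF _ stage2 P(3)]) simp_all
qed

lemma spanning_ext3:
  assumes "F \<in> Ar C" "G \<in> Ar C" "source C F = S \<odot> S \<odot> S" "source C G = S \<odot> S \<odot> S"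
    and eq: "\<And>X e d p a q b r c. wha_stage C H X e d
      \<Longrightarrow> stage.el C X p \<Longrightarrow> typ_of p = Y \<Longrightarrow> stage.grouplike C X d (obj H) (\<delta> H) a
      \<Longrightarrow> stage.el C X q \<Longrightarrow> typ_of q = Y \<Longrightarrow> stage.grouplike C X d (obj H) (\<delta> H) b
      \<Longrightarrow> stage.el C X r \<Longrightarrow> typ_of r = Y \<Longrightarrow> stage.grouplike C X d (obj H) (\<delta> H) c
      \<Longrightarrow> F \<bullet> stage.pair C X d (Q \<bullet> stage.pair C X d p a) (stage.pair C X d (Q \<bullet> stage.pair C X d q b) (Q \<bullet> stage.pair C X d r c))
        = G \<bullet> stage.pair C X d (Q \<bullet> stage.pair C X d p a) (stage.pair C X d (Q \<bullet> stage.pair C X d q b) (Q \<bullet> stage.pair C X d r c))"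
  shows "F = G"
proof -
  interpret stage C "obj H \<odot> obj H \<odot> obj H" "\<epsilon> H \<otimes> \<epsilon> H \<otimes> \<epsilon> H" "\<delta>3 H" by (rule stage3)
  obtain P P' P'' where P: "word (obj H \<odot> obj H \<odot> obj H) (\<epsilon> H \<otimes> \<epsilon> H \<otimes> \<epsilon> H) (\<delta>3 H) P"
      "word (obj H \<odot> obj H \<odot> obj H) (\<epsilon> H \<otimes> \<epsilon> H \<otimes> \<epsilon> H) (\<delta>3 H) P'"
      "word (obj H \<odot> obj H \<odot> obj H) (\<epsilon> H \<otimes> \<epsilon> H \<otimes> \<epsilon> H) (\<delta>3 H) P''"
      "split (pair P (pair P' P''))"
    using spanning3 by blast
  have "F \<bullet> pair P (pair P' P'') = G \<bullet> pair P (pair P' P'')"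
    using P(1-3) by (elim wordE) (simp add: eq [OF wha_stageI [OF stage3]])
  then show ?thesis
    using assms word_el [OF P(1)] word_el [OF P(2)] word_el [OF P(3)] by (intro split_ext [OF _ stage3 P(4)]) simp_all
qed

end

lemma generic_ext_right:
  assumes "F \<in> Ar C" "G \<in> Ar C" "source C F = Y \<odot> obj H" "source C G = Y \<odot> obj H" "Y \<in> Ob C"
    and eq: "\<And>X e d p a. wha_stage C H X e d \<Longrightarrow> stage.el C X p \<Longrightarrow> typ_of p = Y
      \<Longrightarrow> stage.grouplike C X d (obj H) (\<delta> H) a \<Longrightarrow> F \<bullet> stage.pair C X d p a = G \<bullet> stage.pair C X d p a"
  shows "F = G"
proof (rule spanning_ext1 [where Q = "\<langle>Y \<odot> obj H\<rangle>" and s = "\<langle>Y \<odot> obj H\<rangle>" and Y = Y and S = "Y \<odot> obj H"], goal_cases)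
  case (11 X e d p a)
  then interpret wha_stage C H X e d by simp
  show ?case using 11 eq [OF 11] by simp
qed (use assms in \<open>simp_all add: Hom_iff\<close>)

end

section \<open>Equivalent extensions\<close>

locale extension_morphism = cocommutative_wha C H + E: extension C H D B + E': extension C H D B'
  for C :: "('o, 'm) monoidal_data" (structure) and H D B B' +
  fixes T :: 'm
  assumes T_algebra: "is_algebra_morphism B B' T"
    and T_comodule: "is_comodule_morphism H (obj B) (\<rho> B) (obj B') (\<rho> B') T"
    and T_incl: "T \<cdot> incl B = incl B'"
begin

lemma T_simps [simp]: "T \<in> Ar C" "source C T = obj B" "target C T = obj B'"
  using T_algebra by (simp_all add: is_algebra_morphism_def Hom_iff)

end

locale extension_morphism_stage = extension_morphism C H D B B' T + wha_stage C H X e d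
  for C :: "('o, 'm) monoidal_data" (structure) and H D B B' T X e d
begin

lemma T_mul [simp]:
  assumes "el P" "el Q" "typ_of P = obj B" "typ_of Q = obj B"
  shows "T \<bullet> (P \<star>\<^bsub>B\<^esub> Q) = (T \<bullet> P) \<star>\<^bsub>B'\<^esub> (T \<bullet> Q)"
proof -
  have "T \<cdot> \<mu> B = \<mu> B' \<cdot> (T \<otimes> T)"
    using T_algebra by (simp add: is_algebra_morphism_def)
  then have "(T \<cdot> \<mu> B) \<bullet> (P \<boxtimes> Q) = (\<mu> B' \<cdot> (T \<otimes> T)) \<bullet> (P \<boxtimes> Q)"
    by simp
  then show ?thesis using assms by simp
qed

lemma T_\<rho>:
  assumes "el P" "typ_of P = obj B"
  shows "\<rho> B' \<bullet> T \<bullet> P = (T \<otimes> \<H>) \<bullet> \<rho> B \<bullet> P"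
proof -
  have "\<rho> B' \<cdot> T = (T \<otimes> \<H>) \<cdot> \<rho> B"
    using T_comodule by (simp add: is_comodule_morphism_def)
  then have "(\<rho> B' \<cdot> T) \<bullet> P = ((T \<otimes> \<H>) \<cdot> \<rho> B) \<bullet> P"
    by simp
  then show ?thesis using assms by simp
qed

lemma T_one [simp]: "T \<bullet> one B = one B'"
proof -
  have "T \<cdot> \<eta> B = \<eta> B'"
    using T_algebra by (simp add: is_algebra_morphism_def)
  then have "(T \<cdot> \<eta> B) \<bullet> \<iota> = \<eta> B' \<bullet> \<iota>"
    by simp
  then show ?thesis by simp
qed

lemma T_incl' [simp]:
  assumes "el p" "typ_of p = obj D"
  shows "T \<bullet> incl B \<bullet> p = incl B' \<bullet> p"
proof -
  have "(T \<cdot> incl B) \<bullet> p = incl B' \<bullet> p"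
    by (simp only: T_incl)
  then show ?thesis using assms by simp
qed

lemma T_u [simp]:
  assumes "el a" "typ_of a = obj H"
  shows "T \<bullet> u_map B \<bullet> a = u_map B' \<bullet> a"
proof -
  let ?s = "\<epsilon> H \<cdot> \<mu> H"
  note [simp] = assms
  have 1: "T \<cdot> (\<langle>obj B\<rangle> \<otimes> ?s) = (\<langle>obj B'\<rangle> \<otimes> ?s) \<cdot> ((T \<otimes> \<H>) \<otimes> \<H>)"
    using interchange [of "\<langle>obj B\<rangle>" T ?s "\<langle>\<one>\<rangle>"] interchange [of T "\<langle>obj B'\<rangle>" "\<langle>obj H \<odot> obj H\<rangle>" ?s] by simp
  have 2: "((T \<otimes> \<H>) \<otimes> \<H>) \<bullet> ((\<rho> B \<bullet> one B) \<boxtimes> a) = ((T \<otimes> \<H>) \<bullet> \<rho> B \<bullet> one B) \<boxtimes> a"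
    by (subst app_pair) simp_all
  have "T \<bullet> u_map B \<bullet> a = (T \<cdot> (\<langle>obj B\<rangle> \<otimes> ?s)) \<bullet> ((\<rho> B \<bullet> one B) \<boxtimes> a)"
    by (simp add: app_u)
  also have "\<dots> = (\<langle>obj B'\<rangle> \<otimes> ?s) \<bullet> (((T \<otimes> \<H>) \<otimes> \<H>) \<bullet> ((\<rho> B \<bullet> one B) \<boxtimes> a))"
    unfolding 1 by (rule app_app) simp_all
  also have "\<dots> = u_map B' \<bullet> a"
    unfolding 2 T_\<rho> [OF el_one(1,2) [OF comodule_algebra_simps(1) [OF E.comodule_algebra]], symmetric]
    by (simp add: app_u)
  finally show ?thesis .
qed

end

context extension_morphism
begin

text \<open>As \<open>T\<close> fixes the coinvariants, it takes the words that define \<open>\<phi>\<close> and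
  \<open>\<sigma>\<close> in \<open>B\<close> to those that define them in \<open>B'\<close>.\<close>

lemma transport_presentation:
  assumes "presentation C H D B f f' \<phi> \<sigma>"
  shows "presentation C H D B' (T \<cdot> f) (T \<cdot> f') \<phi> \<sigma>"
proof -
  interpret P: presentation C H D B f f' \<phi> \<sigma> by fact
  have conv [simp]: "conv (\<delta> H) A l l' \<in> Ar C" "source C (conv (\<delta> H) A l l') = obj H" "target C (conv (\<delta> H) A l l') = obj A"
    if "is_algebra A" "l \<in> Ar C" "source C l = obj H" "target C l = obj A" "l' \<in> Ar C" "source C l' = obj H" "target C l' = obj A"
    for l l' and A :: "('o, 'm) algebra_extension"
    using that by (simp_all add: conv_def)
  have "\<rho> B' \<cdot> (T \<cdot> f) = ((T \<cdot> f) \<otimes> \<H>) \<cdot> \<delta> H \<and> conv (\<delta> H) B' (T \<cdot> f') (T \<cdot> f) = e_map H B'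
    \<and> conv (\<delta> H) B' (T \<cdot> f) (T \<cdot> f') = u_map B'
    \<and> conv (\<delta> H) B' (e_map H B') (T \<cdot> f') = T \<cdot> f'"
  proof -
    have *: "(\<rho> B' \<cdot> (T \<cdot> f)) \<bullet> a = (((T \<cdot> f) \<otimes> \<H>) \<cdot> \<delta> H) \<bullet> a
      \<and> conv (\<delta> H) B' (T \<cdot> f') (T \<cdot> f) \<bullet> a = e_map H B' \<bullet> a
      \<and> conv (\<delta> H) B' (T \<cdot> f) (T \<cdot> f') \<bullet> a = u_map B' \<bullet> a
      \<and> conv (\<delta> H) B' (e_map H B') (T \<cdot> f') \<bullet> a = (T \<cdot> f') \<bullet> a"
      if "wha_stage C H X e d" "stage.grouplike C X d (obj H) (\<delta> H) a" for X e d a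
    proof -
      interpret wha_stage C H X e d by fact
      interpret extension_morphism_stage C H D B B' T X e d ..
      interpret S: presentation_stage C H D B f f' \<phi> \<sigma> X e d ..
      note [simp] = that
      have "mul B' (T \<bullet> f' \<bullet> a) (T \<bullet> f \<bullet> a) = u_map B' \<bullet> \<Pi>R H \<bullet> a"
        "mul B' (T \<bullet> f \<bullet> a) (T \<bullet> f' \<bullet> a) = u_map B' \<bullet> a"
        "mul B' (u_map B' \<bullet> \<Pi>R H \<bullet> a) (T \<bullet> f' \<bullet> a) = T \<bullet> f' \<bullet> a"
        using arg_cong [OF S.f_f'(2), of a "app T"] arg_cong [OF S.f_f'(1), of a "app T"]
          arg_cong [OF S.f_f'(3), of a "app T"] by (simp_all del: S.f_f')
      then show ?thesis
        by (simp add: T_\<rho> e_eq_u degD(3) [OF S.deg_f])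
    qed
    show ?thesis
      by (intro conjI; rule generic_ext1'; simp add: *)
  qed
  moreover have "(T \<cdot> f) \<cdot> \<eta> H = \<eta> B'"
    using T_algebra P.normal by (simp add: is_algebra_morphism_def)
  moreover have "incl B' \<cdot> \<phi> = act D B' (T \<cdot> f) (T \<cdot> f')"
  proof (rule generic_ext1 [where Y = "obj D"], goal_cases)
    case (6 X e d a p)
    then interpret wha_stage C H X e d by simp
    interpret extension_morphism_stage C H D B B' T X e d ..
    interpret S: presentation_stage C H D B f f' \<phi> \<sigma> X e d ..
    note [simp] = 6
    show ?case
      using arg_cong [OF S.incl_\<phi>, of a p "app T"] by (simp add: act_def del: S.incl_\<phi>)
  qed (simp_all add: act_def)
  moreover have "incl B' \<cdot> \<sigma> = cocycle B' (T \<cdot> f) (T \<cdot> f')"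
  proof (rule generic_ext2', goal_cases)
    case (5 X e d a b)
    then interpret wha_stage C H X e d by simp
    interpret extension_morphism_stage C H D B B' T X e d ..
    interpret S: presentation_stage C H D B f f' \<phi> \<sigma> X e d ..
    note [simp] = 5
    show ?case
      using arg_cong [OF S.incl_\<sigma>, of a b "app T"] by (simp add: cocycle_def del: S.incl_\<sigma>)
  qed (simp_all add: cocycle_def conv_def)
  ultimately show ?thesis
    using P.\<phi>_Hom P.\<sigma>_Hom
    by unfold_locales
      (simp_all add: is_integral_def is_comodule_morphism_def is_convolution_inverse_def u_map_def Hom_iff)
qed

end

context presentation
begin

lemmas tensor_B_simps [simp] = stage.tensor_\<mu>_simps [OF stage0 comodule_algebra_simps(1) [OF comodule_algebra] algebra_H]

definition glue :: 'm
  where "glue = \<mu> B \<cdot> (incl B \<otimes> f)"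

lemma glue_simps [simp]: "glue \<in> Ar C" "source C glue = obj D \<odot> obj H" "target C glue = obj B"
  by (simp_all add: glue_def)

text \<open>The element \<open>b\<^sub>0 f'(b\<^sub>1)\<close> is coinvariant: \<open>\<rho>\<close> adds to it the
  factor \<open>b\<^sub>1 \<lambda>(b\<^sub>2) = \<Pi>\<^sup>L(b\<^sub>1)\<close>.\<close>

lemma exists_coordinate: "\<exists>\<kappa> \<in> Hom C (obj B) (obj D). incl B \<cdot> \<kappa> = \<mu> B \<cdot> ((\<langle>obj B\<rangle> \<otimes> f') \<cdot> \<rho> B)"
proof -
  \<comment> \<open>\<open>?M\<close> multiplies by \<open>f'(a) \<otimes> \<lambda> a = \<rho>(f'(a))\<close>, and \<open>?G\<close> sends \<open>p \<otimes> a\<close> to \<open>p f'(a) \<otimes> \<Pi>\<^sup>L a\<close>.\<close>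
  let ?M = "tensor_\<mu> B H \<cdot> (\<langle>obj B \<odot> obj H\<rangle> \<otimes> ((f' \<otimes> antipode H) \<cdot> \<delta> H))"
  let ?G = "?M \<cdot> (\<langle>obj B\<rangle> \<otimes> \<delta> H)"
  let ?c = "\<mu> B \<cdot> ((\<langle>obj B\<rangle> \<otimes> f') \<cdot> \<rho> B)"
  have 1: "\<rho> B \<cdot> (\<mu> B \<cdot> (\<langle>obj B\<rangle> \<otimes> f')) = ?M \<cdot> (\<rho> B \<otimes> \<H>)"
  proof (rule generic_ext_right [where Y = "obj B"], goal_cases)
    case (6 X e d p a)
    then interpret wha_stage C H X e d by simp
    interpret presentation_stage C H D B f f' \<phi> \<sigma> X e d ..
    note [simp] = 6
    show ?case
      by (simp add: \<rho>_mul mul2_def degD(3) [OF deg_f'])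
  qed simp_all
  have 2: "?G = (\<langle>obj B\<rangle> \<otimes> \<Pi>L H) \<cdot> ?G"
  proof (rule generic_ext_right [where Y = "obj B"], goal_cases)
    case (6 X e d p a)
    then interpret wha_stage C H X e d by simp
    interpret presentation_stage C H D B f f' \<phi> \<sigma> X e d ..
    note [simp] = 6
    have "(\<langle>obj B \<odot> obj H\<rangle> \<otimes> ((f' \<otimes> antipode H) \<cdot> \<delta> H)) \<bullet> pair p (pair a a) = pair p (pair a (pair (f' \<bullet> a) (antipode H \<bullet> a)))"
      by (subst app_pair_split) simp_all
    then show ?case by simp
  qed simp_all
  have 3: "(\<rho> B \<otimes> \<H>) \<cdot> \<rho> B = (\<langle>obj B\<rangle> \<otimes> \<delta> H) \<cdot> \<rho> B"
    using comodule_algebra unfolding right_comodule_algebra_def right_comodule_def by blast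
  have 4: "\<rho> B \<cdot> ?c = ?G \<cdot> \<rho> B"
    using compose_tail [OF 1, of "\<rho> B"] 3 by simp
  have "\<zeta> H B \<cdot> ?c = (\<langle>obj B\<rangle> \<otimes> \<Pi>L H) \<cdot> (\<rho> B \<cdot> ?c)"
    by (simp add: \<zeta>_def)
  also have "\<dots> = ((\<langle>obj B\<rangle> \<otimes> \<Pi>L H) \<cdot> ?G) \<cdot> \<rho> B"
    unfolding 4 by simp
  also have "\<dots> = \<rho> B \<cdot> ?c"
    unfolding 4 2 [symmetric] ..
  finally have "\<rho> B \<cdot> ?c = \<zeta> H B \<cdot> ?c" by simp
  then show ?thesis
    using exists_lift [of ?c] by simp
qed

text \<open>Every \<open>b\<close> is equal to \<open>b\<^sub>0 f'(b\<^sub>1) f(b\<^sub>2)\<close>, since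
  \<open>f' \<and> f = e\<close> and \<open>b\<^sub>0 e(b\<^sub>1) = b 1\<close>.\<close>

lemma glue_section:
  assumes \<kappa>: "\<kappa> \<in> Hom C (obj B) (obj D)" "incl B \<cdot> \<kappa> = \<mu> B \<cdot> ((\<langle>obj B\<rangle> \<otimes> f') \<cdot> \<rho> B)"
  shows "glue \<cdot> ((\<kappa> \<otimes> \<H>) \<cdot> \<rho> B) = \<langle>obj B\<rangle>"
proof -
  have [simp]: "\<kappa> \<in> Ar C" "source C \<kappa> = obj B" "target C \<kappa> = obj D"
    using \<kappa> by (simp_all add: Hom_iff)
  let ?N = "\<mu> B \<cdot> (\<langle>obj B\<rangle> \<otimes> f')"
  let ?E = "((\<langle>obj B\<rangle> \<otimes> \<epsilon> H) \<cdot> tensor_\<mu> B H) \<cdot> (\<langle>obj B \<odot> obj H\<rangle> \<otimes> (\<rho> B \<cdot> \<eta> B))"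
  have 1: "\<mu> B \<cdot> ((?N \<otimes> f) \<cdot> (\<langle>obj B\<rangle> \<otimes> \<delta> H)) = ?E"
  proof (rule generic_ext_right [where Y = "obj B"], goal_cases)
    case (6 X e d p a)
    then interpret wha_stage C H X e d by simp
    interpret presentation_stage C H D B f f' \<phi> \<sigma> X e d ..
    note [simp] = 6
    have 1: "(\<langle>obj B \<odot> obj H\<rangle> \<otimes> (\<rho> B \<cdot> \<eta> B)) \<bullet> pair p a = pair p (pair a (\<rho> B \<bullet> one B))"
      by (subst app_pair_unit(2)) simp_all
    have "?E \<bullet> pair p a = mul B p (e_map H B \<bullet> a)"
      unfolding \<epsilon>_tensor_\<mu> [OF comodule_algebra] using 1 by (simp add: e_map_def del: tensor_ident)
    moreover have "(\<mu> B \<cdot> ((?N \<otimes> f) \<cdot> (\<langle>obj B\<rangle> \<otimes> \<delta> H))) \<bullet> pair p a = mul B p (mul B (f' \<bullet> a) (f \<bullet> a))"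
      by simp
    ultimately show ?case by (simp add: e_eq_u)
  qed simp_all
  have 2: "?E \<cdot> \<rho> B = \<langle>obj B\<rangle>"
  proof (rule generic_ext0_1 [where Y = "obj B"], goal_cases)
    case (6 X e d p)
    then interpret wha_stage C H X e d by simp
    interpret presentation_stage C H D B f f' \<phi> \<sigma> X e d ..
    note [simp] = 6
    have "(\<langle>obj B \<odot> obj H\<rangle> \<otimes> (\<rho> B \<cdot> \<eta> B)) \<bullet> (\<rho> B \<bullet> p) = pair (\<rho> B \<bullet> p) (\<rho> B \<bullet> one B)"
      by (subst app_pair_unit(2)) simp_all
    then show ?case
      using \<rho>_counit [of B p] \<rho>_mul [of B p "one B"] by (simp add: mul2_def)
  qed simp_all
  have 3: "(\<rho> B \<otimes> \<H>) \<cdot> \<rho> B = (\<langle>obj B\<rangle> \<otimes> \<delta> H) \<cdot> \<rho> B"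
    using comodule_algebra unfolding right_comodule_algebra_def right_comodule_def by blast
  have "(incl B \<otimes> f) \<cdot> (\<kappa> \<otimes> \<H>) = (?N \<otimes> f) \<cdot> (\<rho> B \<otimes> \<H>)"
    using \<kappa>(2) by (simp add: interchange)
  then have "glue \<cdot> ((\<kappa> \<otimes> \<H>) \<cdot> \<rho> B) = \<mu> B \<cdot> ((?N \<otimes> f) \<cdot> ((\<rho> B \<otimes> \<H>) \<cdot> \<rho> B))"
    using compose_tail [of "incl B \<otimes> f" "\<kappa> \<otimes> \<H>" "(?N \<otimes> f) \<cdot> (\<rho> B \<otimes> \<H>)" "\<rho> B"] by (simp add: glue_def)
  also have "\<dots> = (\<mu> B \<cdot> ((?N \<otimes> f) \<cdot> (\<langle>obj B\<rangle> \<otimes> \<delta> H))) \<cdot> \<rho> B"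
    unfolding 3 by simp
  also have "\<dots> = \<langle>obj B\<rangle>"
    unfolding 1 2 ..
  finally show ?thesis .
qed

end

context presentation_stage
begin

lemma app_glue [simp]: "el p \<Longrightarrow> typ_of p = obj D \<Longrightarrow> gl a \<Longrightarrow> glue \<bullet> (p \<boxtimes> a) = incl B \<bullet> p \<star>\<^bsub>B\<^esub> f \<bullet> a"
  by (simp add: glue_def)

lemma deg_glue:
  assumes "el p" "typ_of p = obj D" "gl a"
  shows "deg B (incl B \<bullet> p \<star>\<^bsub>B\<^esub> f \<bullet> a) a"
  using assms by (intro deg_coinv_mul) simp_all

text \<open>After expansion of \<open>\<phi>\<close> and \<open>\<sigma>\<close> the right side ends with
  \<open>f'(a b) f(a b) = e(a b)\<close>, which acts as a unit on \<open>f(a) f(b)\<close>.\<close>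

lemma glue_mul:
  assumes "el p" "typ_of p = obj D" "gl a" "el q" "typ_of q = obj D" "gl b"
  shows "(incl B \<bullet> p \<star>\<^bsub>B\<^esub> f \<bullet> a) \<star>\<^bsub>B\<^esub> (incl B \<bullet> q \<star>\<^bsub>B\<^esub> f \<bullet> b)
    = incl B \<bullet> (p \<star>\<^bsub>D\<^esub> \<phi> \<bullet> (a \<boxtimes> q) \<star>\<^bsub>D\<^esub> \<sigma> \<bullet> (a \<boxtimes> b)) \<star>\<^bsub>B\<^esub> f \<bullet> (a \<star> b)"
proof -
  note [simp] = assms
  have "deg B (f \<bullet> a \<star>\<^bsub>B\<^esub> f \<bullet> b) (a \<star> b)"
    by (rule deg_mul) simp_all
  then have "(f \<bullet> a \<star>\<^bsub>B\<^esub> f \<bullet> b) \<star>\<^bsub>B\<^esub> (u_map B \<bullet> \<Pi>R H \<bullet> (a \<star> b)) = f \<bullet> a \<star>\<^bsub>B\<^esub> f \<bullet> b"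
    by (rule mul_e [OF comodule_algebra]) simp_all
  then have "f \<bullet> a \<star>\<^bsub>B\<^esub> f \<bullet> b \<star>\<^bsub>B\<^esub> f' \<bullet> (a \<star> b) \<star>\<^bsub>B\<^esub> f \<bullet> (a \<star> b) = f \<bullet> a \<star>\<^bsub>B\<^esub> f \<bullet> b"
    by (simp del: \<Pi>_product)
  moreover have "deg B ((incl B \<bullet> p \<star>\<^bsub>B\<^esub> f \<bullet> a) \<star>\<^bsub>B\<^esub> (incl B \<bullet> q \<star>\<^bsub>B\<^esub> f \<bullet> b)) (a \<star> b)"
    by (intro deg_mul [OF comodule_algebra] deg_glue) simp_all
  then have "(a \<star> b) \<triangleright> ((incl B \<bullet> p \<star>\<^bsub>B\<^esub> f \<bullet> a) \<star>\<^bsub>B\<^esub> (incl B \<bullet> q \<star>\<^bsub>B\<^esub> f \<bullet> b))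
      = (incl B \<bullet> p \<star>\<^bsub>B\<^esub> f \<bullet> a) \<star>\<^bsub>B\<^esub> (incl B \<bullet> q \<star>\<^bsub>B\<^esub> f \<bullet> b)"
    by (rule deg_scale [OF comodule_algebra]) simp_all
  ultimately show ?thesis
    by (simp add: words)
qed

end

locale two_presentations = cocommutative_wha C H + P: presentation C H D B f f' \<phi> \<sigma> + P': presentation C H D B' g g' \<phi> \<sigma>
  for C :: "('o, 'm) monoidal_data" (structure) and H D B f f' B' g g' \<phi> \<sigma>
begin

text \<open>The equivalence \<open>T\<close> sends \<open>d f(a)\<close> to \<open>d g(a)\<close>. It is
  multiplicative because \<open>glue_mul\<close> expresses the products in \<open>B\<close> and in
  \<open>B'\<close> through the same \<open>\<phi>\<close> and \<open>\<sigma>\<close>.\<close>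

theorem exists_equivalence:
  "\<exists>T. is_algebra_morphism B B' T \<and> is_comodule_morphism H (obj B) (\<rho> B) (obj B') (\<rho> B') T \<and> T \<cdot> incl B = incl B'"
proof -
  obtain \<kappa> where \<kappa>: "\<kappa> \<in> Hom C (obj B) (obj D)" "incl B \<cdot> \<kappa> = \<mu> B \<cdot> ((\<langle>obj B\<rangle> \<otimes> f') \<cdot> \<rho> B)"
    using P.exists_coordinate by blast
  then have [simp]: "\<kappa> \<in> Ar C" "source C \<kappa> = obj B" "target C \<kappa> = obj D"
    by (simp_all add: Hom_iff)
  let ?s = "(\<kappa> \<otimes> \<H>) \<cdot> \<rho> B"
  note sec = P.glue_section [OF \<kappa>]
  have s: "?s \<in> Hom C (obj B) (obj D \<odot> obj H)"
    by (simp add: Hom_iff)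
  note ext1 = spanning_ext1 [OF P.glue_simps s sec is_algebra_simps(1) [OF P.algebra_D]]
    and ext2 = spanning_ext2 [OF P.glue_simps s sec is_algebra_simps(1) [OF P.algebra_D]]
  define T where "T = P'.glue \<cdot> ?s"
  have T_simps [simp]: "T \<in> Ar C" "source C T = obj B" "target C T = obj B'"
    by (simp_all add: T_def)
  have T: "T \<cdot> P.glue = P'.glue"
  proof (rule generic_ext_right [where Y = "obj D"], goal_cases)
    case (6 X e d p a)
    then interpret wha_stage C H X e d by simp
    interpret S: presentation_stage C H D B f f' \<phi> \<sigma> X e d ..
    interpret S': presentation_stage C H D B' g g' \<phi> \<sigma> X e d ..
    note [simp] = 6
    let ?b = "mul B (incl B \<bullet> p) (f \<bullet> a)"
    have \<rho>: "\<rho> B \<bullet> ?b = pair ?b a"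
      by (rule degD(3) [OF S.deg_glue]) simp_all
    have "(incl B \<cdot> \<kappa>) \<bullet> ?b = incl B \<bullet> mul D p (u1 H D \<phi> \<bullet> a)"
      unfolding \<kappa>(2) by (simp add: \<rho>)
    then have "\<kappa> \<bullet> ?b = mul D p (u1 H D \<phi> \<bullet> a)"
      by - (rule S.incl_inj, simp_all)
    then have "T \<bullet> ?b = mul B' (incl B' \<bullet> p) (mul B' (u_map B' \<bullet> a) (g \<bullet> a))"
      by (simp add: T_def \<rho>)
    then show ?case
      using u_mul [OF P'.comodule_algebra S'.deg_f, of a] by simp
  qed simp_all
  have app_T: "T \<bullet> stage.mul C X d B (incl B \<bullet> p) (f \<bullet> a) = stage.mul C X d B' (incl B' \<bullet> p) (g \<bullet> a)"
    if "wha_stage C H X e d" "stage.el C X p" "typ_of p = obj D" "stage.grouplike C X d (obj H) (\<delta> H) a"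
    for X e d p a
  proof -
    interpret wha_stage C H X e d by fact
    interpret S: presentation_stage C H D B f f' \<phi> \<sigma> X e d ..
    interpret S': presentation_stage C H D B' g g' \<phi> \<sigma> X e d ..
    have "(T \<cdot> P.glue) \<bullet> pair p a = P'.glue \<bullet> pair p a"
      unfolding T ..
    then show ?thesis using that by simp
  qed
  have T_one: "T \<bullet> incl B \<bullet> p = incl B' \<bullet> p"
    if "wha_stage C H X e d" "stage.el C X p" "typ_of p = obj D" for X e d p
  proof -
    interpret wha_stage C H X e d by fact
    interpret S: presentation_stage C H D B f f' \<phi> \<sigma> X e d ..
    interpret S': presentation_stage C H D B' g g' \<phi> \<sigma> X e d ..
    have "(T \<cdot> P.glue) \<bullet> pair p (one H) = P'.glue \<bullet> pair p (one H)"
      unfolding T ..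
    then show ?thesis using that by (simp add: P.glue_def P'.glue_def)
  qed
  have incl: "T \<cdot> incl B = incl B'"
  proof (rule generic_ext0_1 [where Y = "obj D"], goal_cases)
    case (6 X e d p)
    then interpret wha_stage C H X e d by simp
    show ?case using 6 T_one [OF 6] by simp
  qed simp_all
  have one: "T \<cdot> \<eta> B = \<eta> B'"
  proof (rule generic_ext0, goal_cases)
    case (5 X e d)
    then interpret wha_stage C H X e d by simp
    interpret S: presentation_stage C H D B f f' \<phi> \<sigma> X e d ..
    interpret S': presentation_stage C H D B' g g' \<phi> \<sigma> X e d ..
    show ?case using T_one [OF 5, of "one D"] by simp
  qed simp_all
  have mul: "T \<cdot> \<mu> B = \<mu> B' \<cdot> (T \<otimes> T)"
  proof (rule ext2, goal_cases)
    case (5 X e d p a q b)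
    then interpret wha_stage C H X e d by simp
    interpret S: presentation_stage C H D B f f' \<phi> \<sigma> X e d ..
    interpret S': presentation_stage C H D B' g g' \<phi> \<sigma> X e d ..
    note [simp] = 5
    let ?b = "mul B (incl B \<bullet> p) (f \<bullet> a)" and ?c = "mul B (incl B \<bullet> q) (f \<bullet> b)"
    have "T \<bullet> mul B ?b ?c = mul B' (T \<bullet> ?b) (T \<bullet> ?c)"
      unfolding app_T [OF 5(1-4)] app_T [OF 5(1,5-7)]
      by (subst S.glue_mul, simp_all only: 5, subst S'.glue_mul, simp_all only: 5, rule app_T [OF 5(1)]) simp_all
    then show ?case by (simp del: mul_assoc)
  qed simp_all
  have comodule: "\<rho> B' \<cdot> T = (T \<otimes> \<H>) \<cdot> \<rho> B"
  proof (rule ext1, goal_cases)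
    case (5 X e d p a)
    then interpret wha_stage C H X e d by simp
    interpret S: presentation_stage C H D B f f' \<phi> \<sigma> X e d ..
    interpret S': presentation_stage C H D B' g g' \<phi> \<sigma> X e d ..
    note [simp] = 5
    show ?case
      by (simp add: app_T [OF 5] degD(3) [OF S.deg_glue] degD(3) [OF S'.deg_glue])
  qed simp_all
  show ?thesis
    using incl one mul comodule by (intro exI [of _ T]) (simp add: is_algebra_morphism_def is_comodule_morphism_def Hom_iff)
qed

end

section \<open>Equivalent crossed systems\<close>

lemma (in presentation) incl_u1: "incl B \<cdot> u1 H D \<phi> = u_map B"
proof (rule generic_ext1', goal_cases)
  case (5 X e d a)
  then interpret wha_stage C H X e d by simp
  interpret presentation_stage C H D B f f' \<phi> \<sigma> X e d ..
  show ?case using 5 by simp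
qed simp_all

lemma (in presentation_stage) u1_one [simp]: "u1 H D \<phi> \<bullet> one H = one D"
proof (rule incl_inj)
  have "(incl B \<cdot> u1 H D \<phi>) \<bullet> one H = u_map B \<bullet> one H"
    unfolding incl_u1 ..
  then show "incl B \<bullet> u1 H D \<phi> \<bullet> one H = incl B \<bullet> one D" by simp
qed simp_all

context cocommutative_wha
begin

lemma conv_simps:
  assumes "is_algebra A" "l \<in> Ar C" "source C l = obj H" "target C l = obj A" "l' \<in> Ar C" "source C l' = obj H" "target C l' = obj A"
  shows "conv (\<delta> H) A l l' \<in> Ar C" "source C (conv (\<delta> H) A l l') = obj H" "target C (conv (\<delta> H) A l l') = obj A"
  using assms by (simp_all add: conv_def)

definition twist_act :: "('o, 'm) algebra \<Rightarrow> 'm \<Rightarrow> 'm \<Rightarrow> 'm \<Rightarrow> 'm"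
  where "twist_act D h h' \<psi> = \<mu> D \<cdot> (\<mu> D \<otimes> \<langle>obj D\<rangle>) \<cdot> (h \<otimes> \<psi> \<otimes> h') \<cdot>
    (\<delta> H \<otimes> \<gamma> (obj H) (obj D)) \<cdot> (\<delta> H \<otimes> \<langle>obj D\<rangle>)"

definition twist_cocycle :: "('o, 'm) algebra \<Rightarrow> 'm \<Rightarrow> 'm \<Rightarrow> 'm \<Rightarrow> 'm \<Rightarrow> 'm"
  where "twist_cocycle D h h' \<psi> \<tau> = \<mu> D \<cdot> (\<mu> D \<otimes> h') \<cdot> (\<mu> D \<otimes> \<tau> \<otimes> \<mu> H) \<cdot> (h \<otimes> \<psi> \<otimes> \<delta>2 H) \<cdot>
    (\<delta> H \<otimes> h \<otimes> \<H> \<otimes> \<H>) \<cdot> \<delta>2 H"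

end

context wha_stage
begin

context
  fixes D :: "('o, 'm) algebra" and h h' \<psi> \<tau> :: 'm
  assumes twist [simp]: "is_algebra D" "h \<in> Ar C" "source C h = obj H" "target C h = obj D"
    "h' \<in> Ar C" "source C h' = obj H" "target C h' = obj D"
    "\<psi> \<in> Ar C" "source C \<psi> = obj H \<odot> obj D" "target C \<psi> = obj D"
    "\<tau> \<in> Ar C" "source C \<tau> = obj H \<odot> obj H" "target C \<tau> = obj D"
begin

lemma app_twist_act:
  assumes "gl a" "el p" "typ_of p = obj D"
  shows "twist_act D h h' \<psi> \<bullet> (a \<boxtimes> p) = h \<bullet> a \<star>\<^bsub>D\<^esub> \<psi> \<bullet> (a \<boxtimes> p) \<star>\<^bsub>D\<^esub> h' \<bullet> a"
proof -
  note [simp] = assms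
  have "(h \<otimes> \<psi> \<otimes> h') \<bullet> (a \<boxtimes> a \<boxtimes> p \<boxtimes> a) = h \<bullet> a \<boxtimes> \<psi> \<bullet> (a \<boxtimes> p) \<boxtimes> h' \<bullet> a"
    by simp
  then show ?thesis
    by (simp add: twist_act_def)
qed

lemma app_twist_cocycle:
  assumes "gl a" "gl b"
  shows "twist_cocycle D h h' \<psi> \<tau> \<bullet> (a \<boxtimes> b)
    = h \<bullet> a \<star>\<^bsub>D\<^esub> \<psi> \<bullet> (a \<boxtimes> h \<bullet> b) \<star>\<^bsub>D\<^esub> \<tau> \<bullet> (a \<boxtimes> b) \<star>\<^bsub>D\<^esub> h' \<bullet> (a \<star> b)"
proof -
  note [simp] = assms
  have "(h \<otimes> \<psi> \<otimes> \<delta>2 H) \<bullet> (a \<boxtimes> a \<boxtimes> h \<bullet> b \<boxtimes> a \<boxtimes> b)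
      = h \<bullet> a \<boxtimes> \<psi> \<bullet> (a \<boxtimes> h \<bullet> b) \<boxtimes> a \<boxtimes> b \<boxtimes> a \<boxtimes> b"
    by simp
  moreover have "(\<mu> D \<otimes> \<tau> \<otimes> \<mu> H) \<bullet> (P \<boxtimes> Q \<boxtimes> a \<boxtimes> b \<boxtimes> a \<boxtimes> b) = mul D P Q \<boxtimes> \<tau> \<bullet> (a \<boxtimes> b) \<boxtimes> (a \<star> b)"
    if "el P" "el Q" "typ_of P = obj D" "typ_of Q = obj D" for P Q
    using that by (subst app_pair_split) simp_all
  ultimately show ?thesis
    by (simp add: twist_cocycle_def)
qed

end

end

lemma (in cocommutative_wha) crossed_equivalence_iff:
  "((\<phi>, \<sigma>), (\<psi>, \<tau>)) \<in> crossed_equivalence H D \<longleftrightarrow>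
    crossed_system H D \<phi> \<sigma> \<and> crossed_system H D \<psi> \<tau> \<and> u1 H D \<phi> = u1 H D \<psi> \<and>
    (\<exists>h h'. h \<in> Hom C (obj H) (obj D) \<and> is_regular_inverse (obj H) (\<delta> H) D (u1 H D \<phi>) h h' \<and> h \<cdot> \<eta> H = \<eta> D \<and>
      \<phi> = twist_act D h h' \<psi> \<and> \<sigma> = twist_cocycle D h h' \<psi> \<tau>)"
proof -
  have "h \<in> Reg1 H D \<phi> \<inter> Reg1 H D \<psi>"
    if "h \<in> Hom C (obj H) (obj D)" "is_regular_inverse (obj H) (\<delta> H) D (u1 H D \<phi>) h h'" "u1 H D \<phi> = u1 H D \<psi>" for h h'
    using that by (auto simp: Reg1_def)
  then show ?thesis
    unfolding crossed_equivalence_def crossed_systems_def twist_act_def twist_cocycle_def u1_def [symmetric]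
    by (auto simp: Reg1_def)
qed

locale two_cleavings = cocommutative_wha C H + P: presentation C H D B f f' \<phi> \<sigma> + P': presentation C H D B g g' \<psi> \<tau>
  for C :: "('o, 'm) monoidal_data" (structure) and H D B f f' g g' \<phi> \<sigma> \<psi> \<tau>
begin

text \<open>The equivalence is \<open>h(a) = f(a) g'(a)\<close>, with inverse \<open>g(a) f'(a)\<close>. Both
  are coinvariant, as their degree is \<open>a \<lambda>(a) = \<Pi>\<^sup>L a\<close>.\<close>

theorem equivalent_systems: "((\<phi>, \<sigma>), (\<psi>, \<tau>)) \<in> crossed_equivalence H D"
proof -
  have B [simp]: "is_algebra B" by simp
  have lift: "\<exists>h \<in> Hom C (obj H) (obj D). incl B \<cdot> h = conv (\<delta> H) B k k'"
    if P: "presentation C H D B k l \<phi>1 \<sigma>1" "presentation C H D B l' k' \<phi>2 \<sigma>2" for k l k' l' \<phi>1 \<sigma>1 \<phi>2 \<sigma>2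
  proof -
    interpret K: presentation C H D B k l \<phi>1 \<sigma>1 by fact
    interpret L: presentation C H D B l' k' \<phi>2 \<sigma>2 by fact
    have "\<rho> B \<cdot> conv (\<delta> H) B k k' = \<zeta> H B \<cdot> conv (\<delta> H) B k k'"
    proof (rule generic_ext1', goal_cases)
      case (5 X e d a)
      then interpret wha_stage C H X e d by simp
      interpret K: presentation_stage C H D B k l \<phi>1 \<sigma>1 X e d ..
      interpret L: presentation_stage C H D B l' k' \<phi>2 \<sigma>2 X e d ..
      note [simp] = 5
      have "deg B (mul B (k \<bullet> a) (k' \<bullet> a)) (mul H a (antipode H \<bullet> a))"
        by (intro deg_mul [OF P.comodule_algebra] K.deg_f L.deg_f') simp_all
      then have "coinv B (mul B (k \<bullet> a) (k' \<bullet> a))"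
        by (intro deg_coinv [OF P.comodule_algebra, of _ "\<Pi>L H \<bullet> a"]) simp_all
      then show ?case by (simp add: coinv_def \<zeta>_def conv_simps)
    qed (simp_all add: conv_simps \<zeta>_def)
    then show ?thesis
      using K.exists_lift [of "conv (\<delta> H) B k k'"] by (simp add: conv_simps)
  qed
  obtain h where h: "h \<in> Hom C (obj H) (obj D)" "incl B \<cdot> h = conv (\<delta> H) B f g'"
    using lift P.presentation_axioms P'.presentation_axioms by blast
  obtain h' where h': "h' \<in> Hom C (obj H) (obj D)" "incl B \<cdot> h' = conv (\<delta> H) B g f'"
    using lift P.presentation_axioms P'.presentation_axioms by blast
  have [simp]: "h \<in> Ar C" "source C h = obj H" "target C h = obj D" "h' \<in> Ar C" "source C h' = obj H" "target C h' = obj D"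
    using h h' by (simp_all add: Hom_iff)
  have inclh: "incl B \<bullet> h \<bullet> a = stage.mul C X d B (f \<bullet> a) (g' \<bullet> a)" "incl B \<bullet> h' \<bullet> a = stage.mul C X d B (g \<bullet> a) (f' \<bullet> a)"
    if "wha_stage C H X e d" "stage.grouplike C X d (obj H) (\<delta> H) a" for X e d a
  proof -
    interpret wha_stage C H X e d by fact
    note [simp] = that
    have "(incl B \<cdot> h) \<bullet> a = conv (\<delta> H) B f g' \<bullet> a" "(incl B \<cdot> h') \<bullet> a = conv (\<delta> H) B g f' \<bullet> a"
      unfolding h h' by simp_all
    then show "incl B \<bullet> h \<bullet> a = mul B (f \<bullet> a) (g' \<bullet> a)" "incl B \<bullet> h' \<bullet> a = mul B (g \<bullet> a) (f' \<bullet> a)"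
      by simp_all
  qed
  have u: "u1 H D \<phi> = u1 H D \<psi>"
  proof (rule generic_ext1', goal_cases)
    case (5 X e d a)
    then interpret wha_stage C H X e d by simp
    interpret S: presentation_stage C H D B f f' \<phi> \<sigma> X e d ..
    interpret S': presentation_stage C H D B g g' \<psi> \<tau> X e d ..
    note [simp] = 5
    show ?case by (rule S.incl_inj) simp_all
  qed simp_all
  have regular: "is_regular_inverse (obj H) (\<delta> H) D (u1 H D \<phi>) h h'"
  proof -
    have *: "conv (\<delta> H) D h h' \<bullet> a = u1 H D \<phi> \<bullet> a \<and> conv (\<delta> H) D h' h \<bullet> a = u1 H D \<phi> \<bullet> a
      \<and> conv (\<delta> H) D (u1 H D \<phi>) h \<bullet> a = h \<bullet> a \<and> conv (\<delta> H) D (u1 H D \<phi>) h' \<bullet> a = h' \<bullet> a"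
      if 5: "wha_stage C H X e d" "stage.grouplike C X d (obj H) (\<delta> H) a" for X e d a
    proof -
      interpret wha_stage C H X e d by fact
      interpret S: presentation_stage C H D B f f' \<phi> \<sigma> X e d ..
      interpret S': presentation_stage C H D B g g' \<psi> \<tau> X e d ..
      note [simp] = 5 inclh [OF 5]
      show ?thesis
        by (intro conjI; rule S.incl_inj; simp add: S.words S'.words)
    qed
    have "conv (\<delta> H) D h h' = u1 H D \<phi>" "conv (\<delta> H) D h' h = u1 H D \<phi>"
      "conv (\<delta> H) D (u1 H D \<phi>) h = h" "conv (\<delta> H) D (u1 H D \<phi>) h' = h'"
      by (rule generic_ext1'; simp add: * conv_simps)+
    then show ?thesis
      using h' by (simp add: is_regular_inverse_def)
  qed
  have "h \<cdot> \<eta> H = \<eta> D"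
  proof -
    have *: "h \<cdot> \<Pi>L H = u1 H D \<phi> \<cdot> \<Pi>L H"
    proof (rule generic_ext1', goal_cases)
      case (5 X e d a)
      then interpret wha_stage C H X e d by simp
      interpret S: presentation_stage C H D B f f' \<phi> \<sigma> X e d ..
      interpret S': presentation_stage C H D B g g' \<psi> \<tau> X e d ..
      have "stage.grouplike C X d (obj H) (\<delta> H) (\<Pi>L H \<bullet> a)" using 5 by simp
      note [simp] = 5 inclh [OF 5(1) this]
      show ?case by (rule S.incl_inj) (simp_all add: S.words S'.words)
    qed simp_all
    show ?thesis
    proof (rule generic_ext0, goal_cases)
      case (5 X e d)
      then interpret wha_stage C H X e d by simp
      interpret S: presentation_stage C H D B f f' \<phi> \<sigma> X e d ..
      have "(h \<cdot> \<Pi>L H) \<bullet> one H = (u1 H D \<phi> \<cdot> \<Pi>L H) \<bullet> one H"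
        unfolding * ..
      then show ?case by simp
    qed simp_all
  qed
  moreover have "\<phi> = twist_act D h h' \<psi>"
  proof (rule generic_ext1 [where Y = "obj D"], goal_cases)
    case (6 X e d a p)
    then interpret wha_stage C H X e d by simp
    interpret S: presentation_stage C H D B f f' \<phi> \<sigma> X e d ..
    interpret S': presentation_stage C H D B g g' \<psi> \<tau> X e d ..
    note [simp] = 6 inclh [OF 6(1,2)]
    show ?case by (rule S.incl_inj) (simp_all add: app_twist_act [where \<tau> = \<tau>] S.words S'.words)
  qed (simp_all add: twist_act_def)
  moreover have "\<sigma> = twist_cocycle D h h' \<psi> \<tau>"
  proof (rule generic_ext2', goal_cases)
    case (5 X e d a b)
    then interpret wha_stage C H X e d by simp
    interpret S: presentation_stage C H D B f f' \<phi> \<sigma> X e d ..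
    interpret S': presentation_stage C H D B g g' \<psi> \<tau> X e d ..
    have "stage.grouplike C X d (obj H) (\<delta> H) (mul H a b)" using 5 by simp
    note [simp] = 5 inclh [OF 5(1,2)] inclh [OF 5(1,3)] inclh [OF 5(1) this]
    show ?case by (rule S.incl_inj) (simp_all add: app_twist_cocycle S.words S'.words)
  qed (simp_all add: twist_cocycle_def)
  ultimately show ?thesis
    unfolding crossed_equivalence_iff
    using P.crossed_system P'.crossed_system u regular h by blast
qed

end

text \<open>The system \<open>(\<phi>, \<sigma>)\<close> arises from the system of the cleaving \<open>g\<close> by
  the equivalence \<open>h\<close>. It will turn out to be the system of the cleaving
  \<open>h(a) g(a)\<close>.\<close>

locale recleaving = cocommutative_wha C H + P: presentation C H D B g g' \<psi> \<tau>
  for C :: "('o, 'm) monoidal_data" (structure) and H D B g g' \<psi> \<tau> +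
  fixes h h' \<phi> \<sigma> :: 'm
  assumes h: "h \<in> Hom C (obj H) (obj D)" and h': "h' \<in> Hom C (obj H) (obj D)"
    and regular: "conv (\<delta> H) D h h' = u1 H D \<psi>" "conv (\<delta> H) D h' h = u1 H D \<psi>" "conv (\<delta> H) D h (u1 H D \<psi>) = h"
    and unital: "h \<cdot> \<eta> H = \<eta> D"
    and twist: "\<phi> = twist_act D h h' \<psi>" "\<sigma> = twist_cocycle D h h' \<psi> \<tau>"
begin

lemma h_simps [simp]: "h \<in> Ar C" "source C h = obj H" "target C h = obj D"
    "h' \<in> Ar C" "source C h' = obj H" "target C h' = obj D"
  using h h' by (simp_all add: Hom_iff)

lemma \<phi>\<sigma>_simps [simp]:
  "\<phi> \<in> Ar C" "source C \<phi> = obj H \<odot> obj D" "target C \<phi> = obj D"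
  "\<sigma> \<in> Ar C" "source C \<sigma> = obj H \<odot> obj H" "target C \<sigma> = obj D"
  by (simp_all add: twist twist_act_def twist_cocycle_def)

definition f :: 'm
  where "f = conv (\<delta> H) B (incl B \<cdot> h) g"

definition f' :: 'm
  where "f' = conv (\<delta> H) B g' (incl B \<cdot> h')"

lemma f_simps [simp]: "f \<in> Ar C" "source C f = obj H" "target C f = obj B"
  "f' \<in> Ar C" "source C f' = obj H" "target C f' = obj B"
  by (simp_all add: f_def f'_def conv_simps)

end

locale recleaving_stage = recleaving C H D B g g' \<psi> \<tau> h h' \<phi> \<sigma> + wha_stage C H X e d
  for C :: "('o, 'm) monoidal_data" (structure) and H D B g g' \<psi> \<tau> h h' \<phi> \<sigma> X e d
begin

sublocale S: presentation_stage C H D B g g' \<psi> \<tau> X e d ..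

lemma h_h':
  assumes "gl a"
  shows "incl B \<bullet> h \<bullet> a \<star>\<^bsub>B\<^esub> incl B \<bullet> h' \<bullet> a = u_map B \<bullet> a" "incl B \<bullet> h' \<bullet> a \<star>\<^bsub>B\<^esub> incl B \<bullet> h \<bullet> a = u_map B \<bullet> a"
    "incl B \<bullet> h \<bullet> a \<star>\<^bsub>B\<^esub> u_map B \<bullet> a = incl B \<bullet> h \<bullet> a"
proof -
  note [simp] = assms
  have "conv (\<delta> H) D h h' \<bullet> a = u1 H D \<psi> \<bullet> a" "conv (\<delta> H) D h' h \<bullet> a = u1 H D \<psi> \<bullet> a"
    "conv (\<delta> H) D h (u1 H D \<psi>) \<bullet> a = h \<bullet> a"
    unfolding regular by simp_all
  then have "incl B \<bullet> (h \<bullet> a \<star>\<^bsub>D\<^esub> h' \<bullet> a) = incl B \<bullet> u1 H D \<psi> \<bullet> a" "incl B \<bullet> (h' \<bullet> a \<star>\<^bsub>D\<^esub> h \<bullet> a) = incl B \<bullet> u1 H D \<psi> \<bullet> a"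
    "incl B \<bullet> (h \<bullet> a \<star>\<^bsub>D\<^esub> u1 H D \<psi> \<bullet> a) = incl B \<bullet> h \<bullet> a"
    by (simp_all del: S.incl_mul)
  then show "incl B \<bullet> h \<bullet> a \<star>\<^bsub>B\<^esub> incl B \<bullet> h' \<bullet> a = u_map B \<bullet> a" "incl B \<bullet> h' \<bullet> a \<star>\<^bsub>B\<^esub> incl B \<bullet> h \<bullet> a = u_map B \<bullet> a"
    "incl B \<bullet> h \<bullet> a \<star>\<^bsub>B\<^esub> u_map B \<bullet> a = incl B \<bullet> h \<bullet> a"
    by simp_all
qed

lemma h_h'_tail:
  assumes "gl a" "el R" "typ_of R = obj B"
  shows "incl B \<bullet> h \<bullet> a \<star>\<^bsub>B\<^esub> incl B \<bullet> h' \<bullet> a \<star>\<^bsub>B\<^esub> R = u_map B \<bullet> a \<star>\<^bsub>B\<^esub> R"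
    "incl B \<bullet> h' \<bullet> a \<star>\<^bsub>B\<^esub> incl B \<bullet> h \<bullet> a \<star>\<^bsub>B\<^esub> R = u_map B \<bullet> a \<star>\<^bsub>B\<^esub> R"
  using S.mul_tail [OF h_h'(1), of a R] S.mul_tail [OF h_h'(2), of a R] assms by simp_all

lemma app_twisted [simp]:
  assumes "gl a"
  shows "el p \<Longrightarrow> typ_of p = obj D \<Longrightarrow> \<phi> \<bullet> (a \<boxtimes> p) = h \<bullet> a \<star>\<^bsub>D\<^esub> \<psi> \<bullet> (a \<boxtimes> p) \<star>\<^bsub>D\<^esub> h' \<bullet> a"
    and "gl b \<Longrightarrow> \<sigma> \<bullet> (a \<boxtimes> b)
      = h \<bullet> a \<star>\<^bsub>D\<^esub> \<psi> \<bullet> (a \<boxtimes> h \<bullet> b) \<star>\<^bsub>D\<^esub> \<tau> \<bullet> (a \<boxtimes> b) \<star>\<^bsub>D\<^esub> h' \<bullet> (a \<star> b)"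
  using assms by (simp_all add: twist app_twist_act [where \<tau> = \<tau>] app_twist_cocycle)

lemma app_f [simp]: "gl a \<Longrightarrow> f \<bullet> a = incl B \<bullet> h \<bullet> a \<star>\<^bsub>B\<^esub> g \<bullet> a"
  and app_f' [simp]: "gl a \<Longrightarrow> f' \<bullet> a = g' \<bullet> a \<star>\<^bsub>B\<^esub> incl B \<bullet> h' \<bullet> a"
  by (simp_all add: f_def f'_def)

end

context recleaving
begin

theorem presentation: "presentation C H D B f f' \<phi> \<sigma>"
proof -
  have *: "(\<rho> B \<cdot> f) \<bullet> a = ((f \<otimes> \<H>) \<cdot> \<delta> H) \<bullet> a
      \<and> conv (\<delta> H) B f' f \<bullet> a = e_map H B \<bullet> a
      \<and> conv (\<delta> H) B f f' \<bullet> a = u_map B \<bullet> a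
      \<and> conv (\<delta> H) B (e_map H B) f' \<bullet> a = f' \<bullet> a
      \<and> (f \<cdot> \<Pi>L H) \<bullet> a = (incl B \<cdot> (h \<cdot> \<Pi>L H)) \<bullet> a"
    if "wha_stage C H X e d" "stage.grouplike C X d (obj H) (\<delta> H) a" for X e d a
  proof -
    interpret wha_stage C H X e d by fact
    interpret recleaving_stage C H D B g g' \<psi> \<tau> h h' \<phi> \<sigma> X e d ..
    note [simp] = that
    have "deg B (mul B (incl B \<bullet> h \<bullet> a) (g \<bullet> a)) a"
      by (intro deg_coinv_mul) simp_all
    moreover have "mul B (incl B \<bullet> h \<bullet> \<Pi>L H \<bullet> a) (u_map B \<bullet> a) = incl B \<bullet> h \<bullet> \<Pi>L H \<bullet> a"
      using h_h'(3) [of "\<Pi>L H \<bullet> a"] by simp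
    moreover have "mul B (u_map B \<bullet> \<Pi>R H \<bullet> a) (mul B (g' \<bullet> a) (incl B \<bullet> h' \<bullet> a)) = mul B (g' \<bullet> a) (incl B \<bullet> h' \<bullet> a)"
      by (rule S.mul_tail [OF S.f_f'(3)]) simp_all
    ultimately show ?thesis
      by (simp add: degD(3) S.words h_h' h_h'_tail e_eq_u)
  qed
  have "\<rho> B \<cdot> f = (f \<otimes> \<H>) \<cdot> \<delta> H" "conv (\<delta> H) B f' f = e_map H B" "conv (\<delta> H) B f f' = u_map B"
    "conv (\<delta> H) B (e_map H B) f' = f'"
    by (rule generic_ext1'; simp add: * conv_simps)+
  moreover have "f \<cdot> \<eta> H = \<eta> B"
  proof -
    have **: "f \<cdot> \<Pi>L H = incl B \<cdot> (h \<cdot> \<Pi>L H)"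
      by (rule generic_ext1'; simp add: *)
    show ?thesis
    proof (rule generic_ext0, goal_cases)
      case (5 X e d)
      then interpret wha_stage C H X e d by simp
      interpret recleaving_stage C H D B g g' \<psi> \<tau> h h' \<phi> \<sigma> X e d ..
      have "(f \<cdot> \<Pi>L H) \<bullet> one H = (incl B \<cdot> (h \<cdot> \<Pi>L H)) \<bullet> one H"
        unfolding ** ..
      moreover have "(h \<cdot> \<eta> H) \<bullet> unit_el = \<eta> D \<bullet> unit_el"
        unfolding unital ..
      ultimately show ?case by simp
    qed simp_all
  qed
  moreover have "incl B \<cdot> \<phi> = act D B f f'"
  proof (rule generic_ext1 [where Y = "obj D"], goal_cases)
    case (6 X e d a p)
    then interpret wha_stage C H X e d by simp
    interpret recleaving_stage C H D B g g' \<psi> \<tau> h h' \<phi> \<sigma> X e d ..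
    note [simp] = 6
    show ?case by (simp add: act_def S.words h_h' h_h'_tail)
  qed (simp_all add: act_def)
  moreover have "incl B \<cdot> \<sigma> = cocycle B f f'"
  proof (rule generic_ext2', goal_cases)
    case (5 X e d a b)
    then interpret wha_stage C H X e d by simp
    interpret recleaving_stage C H D B g g' \<psi> \<tau> h h' \<phi> \<sigma> X e d ..
    note [simp] = 5
    let ?g = "mul H a b"
    let ?K = "\<lambda>R. mul B (incl B \<bullet> h \<bullet> a) (mul B (g \<bullet> a) (mul B (incl B \<bullet> h \<bullet> b) (mul B (g \<bullet> b) R)))"
    let ?R = "mul B (g' \<bullet> ?g) (incl B \<bullet> h' \<bullet> ?g)"
    have K: "scale ?g (?K R) = ?K (scale ?g R)" if "el R" "typ_of R = obj B" for R
      using that by simp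
    have "scale ?g (?K ?R) = ?K (scale ?g ?R)"
      by (rule K) simp_all
    also have "scale ?g ?R = ?R"
      by (rule S.gl_scale_mul) simp_all
    finally have eq: "scale ?g (?K ?R) = ?K ?R" .
    moreover have "(incl B \<cdot> \<sigma>) \<bullet> pair a b = scale ?g (?K ?R)"
      by (simp add: S.words h_h' h_h'_tail)
    moreover have "cocycle B f f' \<bullet> pair a b = ?K ?R"
      by (simp add: cocycle_def S.words h_h' h_h'_tail)
    ultimately show ?case unfolding eq by (simp only:)
  qed (simp_all add: cocycle_def conv_def)
  moreover have "\<phi> \<in> Hom C (obj H \<odot> obj D) (obj D)" "\<sigma> \<in> Hom C (obj H \<odot> obj H) (obj D)"
    by (simp_all add: Hom_iff)
  ultimately show ?thesis
    by unfold_locales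
      (simp_all add: is_integral_def is_comodule_morphism_def is_convolution_inverse_def u_map_def Hom_iff)
qed

end

context cocommutative_wha
begin

lemma transport_along_equivalence:
  assumes P: "presentation C H D B g g' \<psi> \<tau>" and eq: "((\<phi>, \<sigma>), (\<psi>, \<tau>)) \<in> crossed_equivalence H D"
  shows "\<exists>f f'. presentation C H D B f f' \<phi> \<sigma>"
proof -
  interpret P: presentation C H D B g g' \<psi> \<tau> by fact
  obtain h h' where h: "h \<in> Hom C (obj H) (obj D)" "is_regular_inverse (obj H) (\<delta> H) D (u1 H D \<psi>) h h'"
      "h \<cdot> \<eta> H = \<eta> D" "\<phi> = twist_act D h h' \<psi>" "\<sigma> = twist_cocycle D h h' \<psi> \<tau>"
    using eq unfolding crossed_equivalence_iff by auto
  have reg: "h' \<in> Hom C (obj H) (obj D)" "conv (\<delta> H) D h h' = u1 H D \<psi>" "conv (\<delta> H) D h' h = u1 H D \<psi>"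
    "conv (\<delta> H) D (conv (\<delta> H) D h h') h = h"
    using h(2) unfolding is_regular_inverse_def by blast+
  have simps [simp]: "h \<in> Ar C" "source C h = obj H" "target C h = obj D" "h' \<in> Ar C" "source C h' = obj H" "target C h' = obj D"
    using h(1) reg(1) by (simp_all add: Hom_iff)
  have "conv (\<delta> H) D h (conv (\<delta> H) D h' h) = conv (\<delta> H) D (conv (\<delta> H) D h h') h"
  proof (rule generic_ext1', goal_cases)
    case (5 X e d a)
    then interpret wha_stage C H X e d by simp
    show ?case using 5 by (simp add: conv_simps)
  qed (simp_all add: conv_simps)
  then have "conv (\<delta> H) D h (u1 H D \<psi>) = h"
    unfolding reg(4) unfolding reg .
  then interpret R: recleaving C H D B g g' \<psi> \<tau> h h' \<phi> \<sigma>
    using h reg by unfold_locales simp_all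
  show ?thesis using R.presentation by blast
qed

end

section \<open>Calculus of a crossed system\<close>

locale crossed = cocommutative_wha C H
  for C :: "('o, 'm) monoidal_data" (structure) and H :: "('o, 'm) weak_hopf" +
  fixes D :: "('o, 'm) algebra" and \<phi> \<sigma> \<sigma>' :: 'm
  assumes crossed_system: "crossed_system H D \<phi> \<sigma>"
    and \<sigma>'_inverse: "is_regular_inverse (obj H \<odot> obj H) (\<delta>2 H) D (u2 H D \<phi>) \<sigma> \<sigma>'"
begin

lemma weak_module: "weak_module_algebra H D \<phi>"
  using crossed_system by (simp add: crossed_system_def)

lemma algebra_D [simp]: "is_algebra D"
  using weak_module by (simp add: weak_module_algebra_def)

lemma crossed_simps [simp]:
  "\<phi> \<in> Ar C" "source C \<phi> = obj H \<odot> obj D" "target C \<phi> = obj D"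
  "\<sigma> \<in> Ar C" "source C \<sigma> = obj H \<odot> obj H" "target C \<sigma> = obj D"
  "\<sigma>' \<in> Ar C" "source C \<sigma>' = obj H \<odot> obj H" "target C \<sigma>' = obj D"
  using weak_module crossed_system \<sigma>'_inverse
  by (simp_all add: weak_module_algebra_def crossed_system_def Reg2_def is_regular_inverse_def Hom_iff)

lemma unit_simps [simp]:
  "u1 H D \<phi> \<in> Ar C" "source C (u1 H D \<phi>) = obj H" "target C (u1 H D \<phi>) = obj D"
  by (simp_all add: u1_def)

end

locale crossed_stage = crossed C H D \<phi> \<sigma> \<sigma>' + wha_stage C H X e d
  for C :: "('o, 'm) monoidal_data" (structure) and H D \<phi> \<sigma> \<sigma>' X e d
begin

abbreviation u :: "('o, 'm) element \<Rightarrow> ('o, 'm) element"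
  where "u a \<equiv> u1 H D \<phi> \<bullet> a"

lemma act_one [simp]:
  assumes "el a" "typ_of a = obj H"
  shows "\<phi> \<bullet> (a \<boxtimes> one D) = u a"
  using assms by (simp add: u1_def)

lemma act_mul [simp]:
  assumes "gl a" "el p" "typ_of p = obj D" "el q" "typ_of q = obj D"
  shows "\<phi> \<bullet> (a \<boxtimes> (p \<star>\<^bsub>D\<^esub> q)) = \<phi> \<bullet> (a \<boxtimes> p) \<star>\<^bsub>D\<^esub> \<phi> \<bullet> (a \<boxtimes> q)"
proof -
  have "\<phi> \<cdot> (\<H> \<otimes> \<mu> D)
      = \<mu> D \<cdot> (\<phi> \<otimes> \<phi>) \<cdot> (\<H> \<otimes> \<gamma> (obj H) (obj D) \<otimes> \<langle>obj D\<rangle>) \<cdot> (\<delta> H \<otimes> \<langle>obj D\<rangle> \<otimes> \<langle>obj D\<rangle>)"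
    using weak_module unfolding weak_module_algebra_def by blast
  then have "(\<phi> \<cdot> (\<H> \<otimes> \<mu> D)) \<bullet> (a \<boxtimes> p \<boxtimes> q)
      = (\<mu> D \<cdot> (\<phi> \<otimes> \<phi>) \<cdot> (\<H> \<otimes> \<gamma> (obj H) (obj D) \<otimes> \<langle>obj D\<rangle>) \<cdot> (\<delta> H \<otimes> \<langle>obj D\<rangle> \<otimes> \<langle>obj D\<rangle>)) \<bullet> (a \<boxtimes> p \<boxtimes> q)"
    by (simp only:)
  then show ?thesis using assms by simp
qed

lemma one_act [simp]:
  assumes "el p" "typ_of p = obj D"
  shows "\<phi> \<bullet> (one H \<boxtimes> p) = p"
proof -
  have "\<phi> \<cdot> (\<eta> H \<otimes> \<langle>obj D\<rangle>) = \<langle>obj D\<rangle>"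
    using weak_module unfolding weak_module_algebra_def by blast
  then have "(\<phi> \<cdot> (\<eta> H \<otimes> \<langle>obj D\<rangle>)) \<bullet> p = \<langle>obj D\<rangle> \<bullet> p"
    by (simp only:)
  then show ?thesis using assms by simp
qed

lemma unit_one [simp]: "u (one H) = one D"
  using one_act [of "one D"] by simp

lemma unit_\<Pi>L [simp]:
  assumes "el a" "typ_of a = obj H"
  shows "u (\<Pi>L H \<bullet> a) = u a"
proof -
  have "\<phi> \<cdot> (\<Pi>L H \<otimes> \<eta> D) = \<phi> \<cdot> (\<H> \<otimes> \<eta> D)"
    using weak_module unfolding weak_module_algebra_def by blast
  then have "(\<phi> \<cdot> (\<Pi>L H \<otimes> \<eta> D)) \<bullet> a = (\<phi> \<cdot> (\<H> \<otimes> \<eta> D)) \<bullet> a"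
    by (simp only:)
  then show ?thesis using assms by simp
qed

lemma unit_product [simp]:
  assumes "gl a" "gl b"
  shows "u (a \<star> b) = (a \<star> b) \<triangleright> u a"
proof -
  have "u (\<Pi>L H \<bullet> (a \<star> b)) = (a \<star> b) \<triangleright> u (\<Pi>L H \<bullet> a)"
    using assms by (simp del: unit_\<Pi>L)
  then show ?thesis using assms by (simp del: \<Pi>_product)
qed

lemma act_unit [simp]:
  assumes "gl a" "gl b"
  shows "\<phi> \<bullet> (a \<boxtimes> u b) = (a \<star> b) \<triangleright> u a"
proof -
  have "\<phi> \<cdot> (\<mu> H \<otimes> \<eta> D) = \<phi> \<cdot> (\<H> \<otimes> (\<phi> \<cdot> (\<H> \<otimes> \<eta> D)))"
    using weak_module unfolding weak_module_algebra_def by blast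
  then have "(\<phi> \<cdot> (\<mu> H \<otimes> \<eta> D)) \<bullet> (a \<boxtimes> b) = (\<phi> \<cdot> (\<H> \<otimes> (\<phi> \<cdot> (\<H> \<otimes> \<eta> D)))) \<bullet> (a \<boxtimes> b)"
    by (simp only:)
  moreover have "(\<mu> H \<otimes> \<eta> D) \<bullet> (a \<boxtimes> b) = (a \<star> b) \<boxtimes> one D"
    using assms by (subst app_pair_unit(2)) simp_all
  moreover have "(\<H> \<otimes> (\<phi> \<cdot> (\<H> \<otimes> \<eta> D))) \<bullet> (a \<boxtimes> b) = a \<boxtimes> u b"
    using assms by (subst app_pair) simp_all
  ultimately show ?thesis using assms by simp
qed

lemma act_mul_unit [simp]:
  assumes "gl a" "el p" "typ_of p = obj D"
  shows "\<phi> \<bullet> (a \<boxtimes> p) \<star>\<^bsub>D\<^esub> u a = \<phi> \<bullet> (a \<boxtimes> p)" "u a \<star>\<^bsub>D\<^esub> \<phi> \<bullet> (a \<boxtimes> p) = \<phi> \<bullet> (a \<boxtimes> p)"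
  using act_mul [of a p "one D"] act_mul [of a "one D" p] assms by simp_all

lemma unit_unit [simp]: "gl a \<Longrightarrow> u a \<star>\<^bsub>D\<^esub> u a = u a"
  using act_mul_unit(1) [of a "one D"] by simp

end

context crossed
begin

text \<open>Either side sends \<open>z \<otimes> a \<otimes> p\<close> to
  \<open>\<epsilon>(z a) \<phi>\<^sub>z(p)\<close>, since
  \<open>\<phi>\<^sub>z(u(a)) = \<epsilon>(z a) u(z)\<close>. At \<open>z = 1\<close> this computes
  the products \<open>u(a) p\<close> and \<open>p u(a)\<close>.\<close>

lemma act_unit_mul:
  "\<phi> \<cdot> (\<H> \<otimes> (\<mu> D \<cdot> (u1 H D \<phi> \<otimes> \<langle>obj D\<rangle>))) = \<phi> \<cdot> (\<pi>l \<otimes> \<langle>obj D\<rangle>)"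
  "\<phi> \<cdot> (\<H> \<otimes> (\<mu> D \<cdot> (\<gamma> (obj D) (obj D) \<cdot> (u1 H D \<phi> \<otimes> \<langle>obj D\<rangle>)))) = \<phi> \<cdot> (\<pi>l \<otimes> \<langle>obj D\<rangle>)"
proof -
  have *: "(\<phi> \<cdot> (\<H> \<otimes> (\<mu> D \<cdot> (u1 H D \<phi> \<otimes> \<langle>obj D\<rangle>)))) \<bullet> stage.pair C X d z (stage.pair C X d a p)
      = (\<phi> \<cdot> (\<pi>l \<otimes> \<langle>obj D\<rangle>)) \<bullet> stage.pair C X d z (stage.pair C X d a p)
    \<and> (\<phi> \<cdot> (\<H> \<otimes> (\<mu> D \<cdot> (\<gamma> (obj D) (obj D) \<cdot> (u1 H D \<phi> \<otimes> \<langle>obj D\<rangle>))))) \<bullet> stage.pair C X d z (stage.pair C X d a p)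
      = (\<phi> \<cdot> (\<pi>l \<otimes> \<langle>obj D\<rangle>)) \<bullet> stage.pair C X d z (stage.pair C X d a p)"
    if "wha_stage C H X e d" "stage.grouplike C X d (obj H) (\<delta> H) z" "stage.grouplike C X d (obj H) (\<delta> H) a"
      "stage.el C X p" "typ_of p = obj D" for X e d z a p
  proof -
    interpret wha_stage C H X e d by fact
    interpret crossed_stage C H D \<phi> \<sigma> \<sigma>' X e d ..
    note [simp] = that
    have "(\<pi>l \<otimes> \<langle>obj D\<rangle>) \<bullet> pair z (pair a p) = pair (scale (mul H z a) z) p"
      by (subst app_pair_split) simp_all
    then show ?thesis by simp
  qed
  show "\<phi> \<cdot> (\<H> \<otimes> (\<mu> D \<cdot> (u1 H D \<phi> \<otimes> \<langle>obj D\<rangle>))) = \<phi> \<cdot> (\<pi>l \<otimes> \<langle>obj D\<rangle>)"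
    "\<phi> \<cdot> (\<H> \<otimes> (\<mu> D \<cdot> (\<gamma> (obj D) (obj D) \<cdot> (u1 H D \<phi> \<otimes> \<langle>obj D\<rangle>)))) = \<phi> \<cdot> (\<pi>l \<otimes> \<langle>obj D\<rangle>)"
    by (rule generic_ext2 [where Y = "obj D"]; simp add: *)+
qed

end

context crossed_stage
begin

lemma unit_mul:
  assumes "gl a" "el p" "typ_of p = obj D"
  shows "u a \<star>\<^bsub>D\<^esub> p = \<phi> \<bullet> ((\<Pi>L H \<bullet> a) \<boxtimes> p)" "p \<star>\<^bsub>D\<^esub> u a = \<phi> \<bullet> ((\<Pi>L H \<bullet> a) \<boxtimes> p)"
proof -
  note [simp] = assms
  have 1: "(\<pi>l \<otimes> \<langle>obj D\<rangle>) \<bullet> (one H \<boxtimes> a \<boxtimes> p) = (\<Pi>L H \<bullet> a) \<boxtimes> p"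
    by (subst app_pair_split) (simp_all add: \<Pi>L_eq)
  have "(\<phi> \<cdot> (\<H> \<otimes> (\<mu> D \<cdot> (u1 H D \<phi> \<otimes> \<langle>obj D\<rangle>)))) \<bullet> (one H \<boxtimes> a \<boxtimes> p) = (\<phi> \<cdot> (\<pi>l \<otimes> \<langle>obj D\<rangle>)) \<bullet> (one H \<boxtimes> a \<boxtimes> p)"
    "(\<phi> \<cdot> (\<H> \<otimes> (\<mu> D \<cdot> (\<gamma> (obj D) (obj D) \<cdot> (u1 H D \<phi> \<otimes> \<langle>obj D\<rangle>))))) \<bullet> (one H \<boxtimes> a \<boxtimes> p)
      = (\<phi> \<cdot> (\<pi>l \<otimes> \<langle>obj D\<rangle>)) \<bullet> (one H \<boxtimes> a \<boxtimes> p)"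
    unfolding act_unit_mul by (rule refl)+
  then show "u a \<star>\<^bsub>D\<^esub> p = \<phi> \<bullet> ((\<Pi>L H \<bullet> a) \<boxtimes> p)" "p \<star>\<^bsub>D\<^esub> u a = \<phi> \<bullet> ((\<Pi>L H \<bullet> a) \<boxtimes> p)"
    using 1 by simp_all
qed

lemma unit_commute:
  assumes "gl a" "el p" "typ_of p = obj D"
  shows "p \<star>\<^bsub>D\<^esub> u a = u a \<star>\<^bsub>D\<^esub> p"
  using unit_mul [OF assms] by simp

lemma unit_mul_unit:
  assumes "gl a" "gl b"
  shows "u a \<star>\<^bsub>D\<^esub> u b = (\<Pi>L H \<bullet> a \<star> b) \<triangleright> u a"
  using assms by (subst unit_mul) (simp_all del: gl_mul_\<Pi>)

lemma cocycle_inverse: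
  assumes "gl a" "gl b"
  shows "\<sigma> \<bullet> (a \<boxtimes> b) \<star>\<^bsub>D\<^esub> \<sigma>' \<bullet> (a \<boxtimes> b) = (a \<star> b) \<triangleright> u a" "\<sigma>' \<bullet> (a \<boxtimes> b) \<star>\<^bsub>D\<^esub> \<sigma> \<bullet> (a \<boxtimes> b) = (a \<star> b) \<triangleright> u a"
    "((a \<star> b) \<triangleright> u a) \<star>\<^bsub>D\<^esub> \<sigma> \<bullet> (a \<boxtimes> b) = \<sigma> \<bullet> (a \<boxtimes> b)" "((a \<star> b) \<triangleright> u a) \<star>\<^bsub>D\<^esub> \<sigma>' \<bullet> (a \<boxtimes> b) = \<sigma>' \<bullet> (a \<boxtimes> b)"
proof -
  note [simp] = assms
  have eq: "conv (\<delta>2 H) D \<sigma> \<sigma>' = u2 H D \<phi>" "conv (\<delta>2 H) D \<sigma>' \<sigma> = u2 H D \<phi>"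
      "conv (\<delta>2 H) D (conv (\<delta>2 H) D \<sigma> \<sigma>') \<sigma> = \<sigma>" "conv (\<delta>2 H) D (conv (\<delta>2 H) D \<sigma>' \<sigma>) \<sigma>' = \<sigma>'"
    using \<sigma>'_inverse unfolding is_regular_inverse_def by blast+
  have [simp]: "u2 H D \<phi> \<in> Ar C" "source C (u2 H D \<phi>) = obj H \<odot> obj H" "target C (u2 H D \<phi>) = obj D"
    by (simp_all add: u2_def)
  have u: "u2 H D \<phi> \<bullet> (a \<boxtimes> b) = (a \<star> b) \<triangleright> u a"
    by (simp add: u2_def)
  have "conv (\<delta>2 H) D \<sigma> \<sigma>' \<bullet> (a \<boxtimes> b) = u2 H D \<phi> \<bullet> (a \<boxtimes> b)" "conv (\<delta>2 H) D \<sigma>' \<sigma> \<bullet> (a \<boxtimes> b) = u2 H D \<phi> \<bullet> (a \<boxtimes> b)"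
    "conv (\<delta>2 H) D (u2 H D \<phi>) \<sigma> \<bullet> (a \<boxtimes> b) = \<sigma> \<bullet> (a \<boxtimes> b)" "conv (\<delta>2 H) D (u2 H D \<phi>) \<sigma>' \<bullet> (a \<boxtimes> b) = \<sigma>' \<bullet> (a \<boxtimes> b)"
    using eq(3,4) unfolding eq(1,2) by simp_all
  then show "\<sigma> \<bullet> (a \<boxtimes> b) \<star>\<^bsub>D\<^esub> \<sigma>' \<bullet> (a \<boxtimes> b) = (a \<star> b) \<triangleright> u a" "\<sigma>' \<bullet> (a \<boxtimes> b) \<star>\<^bsub>D\<^esub> \<sigma> \<bullet> (a \<boxtimes> b) = (a \<star> b) \<triangleright> u a"
    "((a \<star> b) \<triangleright> u a) \<star>\<^bsub>D\<^esub> \<sigma> \<bullet> (a \<boxtimes> b) = \<sigma> \<bullet> (a \<boxtimes> b)" "((a \<star> b) \<triangleright> u a) \<star>\<^bsub>D\<^esub> \<sigma>' \<bullet> (a \<boxtimes> b) = \<sigma>' \<bullet> (a \<boxtimes> b)"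
    using u by (simp_all del: mul_scale)
qed

lemma cocycle_scale [simp]:
  assumes "gl a" "gl b"
  shows "(a \<star> b) \<triangleright> \<sigma> \<bullet> (a \<boxtimes> b) = \<sigma> \<bullet> (a \<boxtimes> b)" "(a \<star> b) \<triangleright> \<sigma>' \<bullet> (a \<boxtimes> b) = \<sigma>' \<bullet> (a \<boxtimes> b)"
proof -
  note [simp] = assms
  have "(a \<star> b) \<triangleright> (((a \<star> b) \<triangleright> u a) \<star>\<^bsub>D\<^esub> \<sigma> \<bullet> (a \<boxtimes> b)) = ((a \<star> b) \<triangleright> u a) \<star>\<^bsub>D\<^esub> \<sigma> \<bullet> (a \<boxtimes> b)"
    "(a \<star> b) \<triangleright> (((a \<star> b) \<triangleright> u a) \<star>\<^bsub>D\<^esub> \<sigma>' \<bullet> (a \<boxtimes> b)) = ((a \<star> b) \<triangleright> u a) \<star>\<^bsub>D\<^esub> \<sigma>' \<bullet> (a \<boxtimes> b)"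
    by simp_all
  then show "(a \<star> b) \<triangleright> \<sigma> \<bullet> (a \<boxtimes> b) = \<sigma> \<bullet> (a \<boxtimes> b)" "(a \<star> b) \<triangleright> \<sigma>' \<bullet> (a \<boxtimes> b) = \<sigma>' \<bullet> (a \<boxtimes> b)"
    unfolding cocycle_inverse(3,4) [OF assms] .
qed

lemma unit_mul_cocycle [simp]:
  assumes "gl a" "gl b"
  shows "u a \<star>\<^bsub>D\<^esub> \<sigma> \<bullet> (a \<boxtimes> b) = \<sigma> \<bullet> (a \<boxtimes> b)" "u a \<star>\<^bsub>D\<^esub> \<sigma>' \<bullet> (a \<boxtimes> b) = \<sigma>' \<bullet> (a \<boxtimes> b)"
proof -
  note [simp] = assms
  have K: "(a \<star> b) \<triangleright> (u a \<star>\<^bsub>D\<^esub> R) = u a \<star>\<^bsub>D\<^esub> ((a \<star> b) \<triangleright> R)" if "el R" "typ_of R = obj D" for R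
    using that by simp
  show "u a \<star>\<^bsub>D\<^esub> \<sigma> \<bullet> (a \<boxtimes> b) = \<sigma> \<bullet> (a \<boxtimes> b)" "u a \<star>\<^bsub>D\<^esub> \<sigma>' \<bullet> (a \<boxtimes> b) = \<sigma>' \<bullet> (a \<boxtimes> b)"
    using cocycle_inverse(3,4) [OF assms] K [of "\<sigma> \<bullet> (a \<boxtimes> b)"] K [of "\<sigma>' \<bullet> (a \<boxtimes> b)"] by simp_all
qed

lemma cocycle_mul_unit [simp]:
  assumes "gl a" "gl b"
  shows "\<sigma> \<bullet> (a \<boxtimes> b) \<star>\<^bsub>D\<^esub> u a = \<sigma> \<bullet> (a \<boxtimes> b)" "\<sigma>' \<bullet> (a \<boxtimes> b) \<star>\<^bsub>D\<^esub> u a = \<sigma>' \<bullet> (a \<boxtimes> b)"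
  using assms by (simp_all add: unit_commute)

lemma twisted_action:
  assumes "gl a" "gl b" "el p" "typ_of p = obj D"
  shows "\<sigma> \<bullet> (a \<boxtimes> b) \<star>\<^bsub>D\<^esub> \<phi> \<bullet> ((a \<star> b) \<boxtimes> p) = \<phi> \<bullet> (a \<boxtimes> \<phi> \<bullet> (b \<boxtimes> p)) \<star>\<^bsub>D\<^esub> \<sigma> \<bullet> (a \<boxtimes> b)"
proof -
  have "\<mu> D \<cdot> (\<langle>obj D\<rangle> \<otimes> \<phi>) \<cdot> (\<sigma> \<otimes> \<mu> H \<otimes> \<langle>obj D\<rangle>) \<cdot> (\<delta>2 H \<otimes> \<langle>obj D\<rangle>)
      = \<mu> D \<cdot> ((\<phi> \<cdot> (\<H> \<otimes> \<phi>)) \<otimes> \<langle>obj D\<rangle>) \<cdot> (\<H> \<otimes> \<H> \<otimes> \<gamma> (obj D) (obj D)) \<cdot>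
        (\<H> \<otimes> \<H> \<otimes> \<sigma> \<otimes> \<langle>obj D\<rangle>) \<cdot> (\<delta>2 H \<otimes> \<langle>obj D\<rangle>)"
    using crossed_system unfolding crossed_system_def by blast
  then have "(\<mu> D \<cdot> (\<langle>obj D\<rangle> \<otimes> \<phi>) \<cdot> (\<sigma> \<otimes> \<mu> H \<otimes> \<langle>obj D\<rangle>) \<cdot> (\<delta>2 H \<otimes> \<langle>obj D\<rangle>)) \<bullet> (a \<boxtimes> b \<boxtimes> p)
      = (\<mu> D \<cdot> ((\<phi> \<cdot> (\<H> \<otimes> \<phi>)) \<otimes> \<langle>obj D\<rangle>) \<cdot> (\<H> \<otimes> \<H> \<otimes> \<gamma> (obj D) (obj D)) \<cdot>
        (\<H> \<otimes> \<H> \<otimes> \<sigma> \<otimes> \<langle>obj D\<rangle>) \<cdot> (\<delta>2 H \<otimes> \<langle>obj D\<rangle>)) \<bullet> (a \<boxtimes> b \<boxtimes> p)"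
    by (simp only:)
  then show ?thesis using assms by simp
qed

text \<open>The scalars in the cocycle condition say that \<open>a, b\<close> and \<open>b, c\<close> are
  composable; they are absorbed by \<open>\<sigma>(a, b c)\<close> and
  \<open>\<sigma>(a b, c)\<close>.\<close>

lemma cocycle_identity:
  assumes "gl a" "gl b" "gl c"
  shows "\<phi> \<bullet> (a \<boxtimes> \<sigma> \<bullet> (b \<boxtimes> c)) \<star>\<^bsub>D\<^esub> \<sigma> \<bullet> (a \<boxtimes> (b \<star> c)) = \<sigma> \<bullet> (a \<boxtimes> b) \<star>\<^bsub>D\<^esub> \<sigma> \<bullet> ((a \<star> b) \<boxtimes> c)"
proof -
  note [simp] = assms
  have "conv (\<delta>3 H) D (\<phi> \<cdot> (\<H> \<otimes> \<sigma>) \<cdot> (\<Omega>L H \<otimes> \<H>)) (\<sigma> \<cdot> (\<H> \<otimes> \<mu> H))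
      = conv (\<delta>3 H) D ((\<sigma> \<otimes> \<epsilon> H) \<cdot> (\<H> \<otimes> \<Omega>L H)) (\<sigma> \<cdot> (\<mu> H \<otimes> \<H>))"
    using crossed_system unfolding crossed_system_def by blast
  then have 1: "conv (\<delta>3 H) D (\<phi> \<cdot> (\<H> \<otimes> \<sigma>) \<cdot> (\<Omega>L H \<otimes> \<H>)) (\<sigma> \<cdot> (\<H> \<otimes> \<mu> H)) \<bullet> (a \<boxtimes> b \<boxtimes> c)
      = conv (\<delta>3 H) D ((\<sigma> \<otimes> \<epsilon> H) \<cdot> (\<H> \<otimes> \<Omega>L H)) (\<sigma> \<cdot> (\<mu> H \<otimes> \<H>)) \<bullet> (a \<boxtimes> b \<boxtimes> c)"
    by (simp only:)
  let ?s = "\<sigma> \<bullet> (a \<boxtimes> (b \<star> c))" and ?t = "\<sigma> \<bullet> ((a \<star> b) \<boxtimes> c)"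
  have s: "(a \<star> b) \<triangleright> ?s = ?s"
  proof -
    have "(a \<star> b) \<triangleright> (a \<star> (b \<star> c)) \<triangleright> ?s = (a \<star> (b \<star> c)) \<triangleright> ?s"
      by (simp del: cocycle_scale)
    then show ?thesis by (simp only: cocycle_scale assms gl_mul)
  qed
  have t: "(b \<star> c) \<triangleright> ?t = ?t"
  proof -
    have "(b \<star> c) \<triangleright> ((a \<star> b) \<star> c) \<triangleright> ?t = ((a \<star> b) \<star> c) \<triangleright> ?t"
      by (simp del: cocycle_scale)
    then show ?thesis by (simp only: cocycle_scale assms gl_mul)
  qed
  have c: "c \<triangleright> ?t = ?t"
  proof -
    have "c \<triangleright> ((a \<star> b) \<star> c) \<triangleright> ?t = ((a \<star> b) \<star> c) \<triangleright> ?t"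
      by (simp del: cocycle_scale mul_assoc)
    then show ?thesis by (simp only: cocycle_scale assms gl_mul)
  qed
  have "((a \<star> b) \<triangleright> \<phi> \<bullet> (a \<boxtimes> \<sigma> \<bullet> (b \<boxtimes> c))) \<star>\<^bsub>D\<^esub> ?s = \<phi> \<bullet> (a \<boxtimes> \<sigma> \<bullet> (b \<boxtimes> c)) \<star>\<^bsub>D\<^esub> ((a \<star> b) \<triangleright> ?s)"
    by simp
  moreover have "((b \<star> c) \<triangleright> c \<triangleright> \<sigma> \<bullet> (a \<boxtimes> b)) \<star>\<^bsub>D\<^esub> ?t = \<sigma> \<bullet> (a \<boxtimes> b) \<star>\<^bsub>D\<^esub> ((b \<star> c) \<triangleright> c \<triangleright> ?t)"
    by simp
  moreover have "((a \<star> b) \<triangleright> \<phi> \<bullet> (a \<boxtimes> \<sigma> \<bullet> (b \<boxtimes> c))) \<star>\<^bsub>D\<^esub> ?s = ((b \<star> c) \<triangleright> c \<triangleright> \<sigma> \<bullet> (a \<boxtimes> b)) \<star>\<^bsub>D\<^esub> ?t"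
    using 1 by simp
  ultimately show ?thesis
    unfolding s t c by simp
qed

end

context crossed
begin

text \<open>Units \<open>x\<close> and \<open>y\<close> that are composable agree, whence
  \<open>\<sigma>(x, y) = \<epsilon>(x y) \<sigma>(x, x)\<close>.\<close>

lemma cocycle_idempotents:
  "\<sigma> \<cdot> (\<Pi>L H \<otimes> \<Pi>L H)
    = ((\<epsilon> H \<cdot> \<mu> H) \<otimes> (\<sigma> \<cdot> \<delta> H)) \<cdot> (\<H> \<otimes> \<gamma> (obj H) (obj H)) \<cdot> (\<delta> H \<otimes> \<H>) \<cdot> (\<Pi>L H \<otimes> \<Pi>L H)"
proof (rule generic_ext2', goal_cases)
  case (5 X e d z w)
  then interpret wha_stage C H X e d by simp
  interpret crossed_stage C H D \<phi> \<sigma> \<sigma>' X e d ..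
  define x y where "x = \<Pi>L H \<bullet> z" and "y = \<Pi>L H \<bullet> w"
  have [simp]: "gl x" "gl y"
    using 5 by (simp_all add: x_def y_def)
  have "scale (mul H x y) y = mul H x y"
    using gl_mul_\<Pi>(2) [of x y] 5 by (simp add: x_def y_def del: gl_mul_\<Pi>)
  moreover have "mul H x y = scale (mul H x y) x"
    using gl_mul_\<Pi>(1) [of x y] 5 by (simp add: x_def y_def del: gl_mul_\<Pi>)
  ultimately have xy: "scale (mul H x y) y = scale (mul H x y) x"
    by simp
  have "\<sigma> \<bullet> pair x y = scale (mul H x y) (\<sigma> \<bullet> pair x y)"
    by simp
  also have "\<dots> = \<sigma> \<bullet> pair x (scale (mul H x y) y)"
    by (simp del: cocycle_scale)
  also have "\<dots> = scale (mul H x y) (\<sigma> \<bullet> pair x x)"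
    unfolding xy by (simp del: cocycle_scale)
  finally show ?case
    using 5 by (simp add: x_def [symmetric] y_def [symmetric] del: gl_mul_\<Pi> cocycle_scale)
qed simp_all

end

context crossed_stage
begin

text \<open>At \<open>w = 1\<close> the left side of \<open>cocycle_idempotents\<close> is \<open>u(z)\<close>,
  because \<open>\<sigma>\<close> is unital.\<close>

lemma cocycle_idempotent:
  assumes "gl z"
  shows "\<sigma> \<bullet> (\<Pi>L H \<bullet> z \<boxtimes> \<Pi>L H \<bullet> z) = u z"
proof -
  note [simp] = assms
  have "\<sigma> \<cdot> (\<H> \<otimes> \<eta> H) = u1 H D \<phi>"
    using crossed_system unfolding crossed_system_def by blast
  then have "(\<sigma> \<cdot> (\<H> \<otimes> \<eta> H)) \<bullet> \<Pi>L H \<bullet> z = u1 H D \<phi> \<bullet> \<Pi>L H \<bullet> z"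
    by (simp only:)
  then have "u z = (\<sigma> \<cdot> (\<Pi>L H \<otimes> \<Pi>L H)) \<bullet> (z \<boxtimes> one H)"
    by simp
  also have "\<dots> = \<sigma> \<bullet> (\<Pi>L H \<bullet> z \<boxtimes> \<Pi>L H \<bullet> z)"
  proof -
    have "(\<Pi>L H \<bullet> z) \<triangleright> \<sigma> \<bullet> (\<Pi>L H \<bullet> z \<boxtimes> \<Pi>L H \<bullet> z) = \<sigma> \<bullet> (((\<Pi>L H \<bullet> z) \<triangleright> (\<Pi>L H \<bullet> z)) \<boxtimes> \<Pi>L H \<bullet> z)"
      by (simp del: gl_scale)
    then show ?thesis
      unfolding cocycle_idempotents by simp
  qed
  finally show ?thesis ..
qed

text \<open>An invertible idempotent is the unit.\<close>

lemma cocycle_cancel: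
  assumes [simp]: "gl a" "gl b" and "\<sigma> \<bullet> (a \<boxtimes> b) \<star>\<^bsub>D\<^esub> \<sigma> \<bullet> (a \<boxtimes> b) = \<sigma> \<bullet> (a \<boxtimes> b)"
  shows "\<sigma> \<bullet> (a \<boxtimes> b) = (a \<star> b) \<triangleright> u a"
proof -
  have "\<sigma> \<bullet> (a \<boxtimes> b) = \<sigma> \<bullet> (a \<boxtimes> b) \<star>\<^bsub>D\<^esub> (\<sigma> \<bullet> (a \<boxtimes> b) \<star>\<^bsub>D\<^esub> \<sigma>' \<bullet> (a \<boxtimes> b))"
    by (simp add: cocycle_inverse)
  also have "\<dots> = (\<sigma> \<bullet> (a \<boxtimes> b) \<star>\<^bsub>D\<^esub> \<sigma> \<bullet> (a \<boxtimes> b)) \<star>\<^bsub>D\<^esub> \<sigma>' \<bullet> (a \<boxtimes> b)"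
    by (subst mul_assoc) simp_all
  also have "\<dots> = (a \<star> b) \<triangleright> u a"
    unfolding assms(3) by (simp add: cocycle_inverse)
  finally show ?thesis .
qed

text \<open>With \<open>x = \<Pi>\<^sup>L z\<close>, the cocycle identities for \<open>a, x, x\<close> and for
  \<open>x, x, a\<close> say that \<open>\<sigma>(a, x)\<close> and \<open>\<sigma>(x, a)\<close> are
  idempotent.\<close>

lemma cocycle_\<Pi>L:
  assumes a: "gl a" and z: "gl z"
  shows "\<sigma> \<bullet> (a \<boxtimes> \<Pi>L H \<bullet> z) = (a \<star> \<Pi>L H \<bullet> z) \<triangleright> u a"
    and "\<sigma> \<bullet> (\<Pi>L H \<bullet> z \<boxtimes> a) = (\<Pi>L H \<bullet> z \<star> a) \<triangleright> u (\<Pi>L H \<bullet> z)"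
proof -
  define x where "x = \<Pi>L H \<bullet> z"
  have x [simp]: "gl x" "\<Pi>L H \<bullet> x = x" "\<Pi>R H \<bullet> x = x" and [simp]: "gl a"
    using a z by (simp_all add: x_def)
  have xx: "x \<star> x = x"
    using \<Pi>_mul(1) [of x] by simp
  have \<sigma>x: "\<sigma> \<bullet> (x \<boxtimes> x) = u x"
    using cocycle_idempotent [OF z] z by (simp add: x_def)
  have ax: "a \<star> x = (a \<star> x) \<triangleright> a" "x \<star> a = (x \<star> a) \<triangleright> a"
    using gl_mul_\<Pi>(1) [of a x] gl_mul_\<Pi>(2) [of x a] by simp_all
  have 1: "\<sigma> \<bullet> ((a \<star> x) \<boxtimes> x) = \<sigma> \<bullet> (a \<boxtimes> x)"
    by (subst ax) simp
  have 2: "\<sigma> \<bullet> (x \<boxtimes> (x \<star> a)) = \<sigma> \<bullet> (x \<boxtimes> a)"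
    by (subst ax) simp
  have "\<phi> \<bullet> (a \<boxtimes> u x) \<star>\<^bsub>D\<^esub> \<sigma> \<bullet> (a \<boxtimes> x) = \<sigma> \<bullet> (a \<boxtimes> x) \<star>\<^bsub>D\<^esub> \<sigma> \<bullet> (a \<boxtimes> x)"
    using cocycle_identity [of a x x] by (simp only: xx \<sigma>x 1 x(1) \<open>gl a\<close>)
  then have "\<sigma> \<bullet> (a \<boxtimes> x) \<star>\<^bsub>D\<^esub> \<sigma> \<bullet> (a \<boxtimes> x) = \<sigma> \<bullet> (a \<boxtimes> x)"
    by (simp add: cocycle_inverse del: mul_scale)
  then show "\<sigma> \<bullet> (a \<boxtimes> \<Pi>L H \<bullet> z) = (a \<star> \<Pi>L H \<bullet> z) \<triangleright> u a"
    unfolding x_def [symmetric] by (intro cocycle_cancel) simp_all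
  have "\<phi> \<bullet> (x \<boxtimes> \<sigma> \<bullet> (x \<boxtimes> a)) = u x \<star>\<^bsub>D\<^esub> \<sigma> \<bullet> (x \<boxtimes> a)"
    by (subst unit_mul) simp_all
  then have "\<sigma> \<bullet> (x \<boxtimes> a) \<star>\<^bsub>D\<^esub> \<sigma> \<bullet> (x \<boxtimes> a) = u x \<star>\<^bsub>D\<^esub> \<sigma> \<bullet> (x \<boxtimes> a)"
    using cocycle_identity [of x x a] unfolding xx \<sigma>x 2 by simp
  then show "\<sigma> \<bullet> (\<Pi>L H \<bullet> z \<boxtimes> a) = (\<Pi>L H \<bullet> z \<star> a) \<triangleright> u (\<Pi>L H \<bullet> z)"
    unfolding x_def [symmetric] by (intro cocycle_cancel) simp_all
qed

text \<open>The cocycle identity for \<open>a, \<lambda> a, a\<close> reduces to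
  \<open>\<phi>\<^sub>a(\<sigma>(\<lambda> a, a)) = \<sigma>(a, \<lambda> a)\<close>. The result
  shows that \<open>a \<mapsto> \<sigma>'(\<lambda> a, a) \<otimes> \<lambda> a\<close> inverts the
  cleaving \<open>a \<mapsto> 1 \<otimes> a\<close> of the crossed product.\<close>

lemma act_cocycle_inverse:
  assumes "gl a"
  shows "\<phi> \<bullet> (a \<boxtimes> \<sigma>' \<bullet> (inv_H a \<boxtimes> a)) \<star>\<^bsub>D\<^esub> \<sigma> \<bullet> (a \<boxtimes> inv_H a) = u a"
proof -
  note [simp] = assms
  have 1: "\<sigma> \<bullet> (a \<boxtimes> \<Pi>R H \<bullet> a) = u a"
    using cocycle_\<Pi>L(1) [of a "inv_H a"] by simp
  have 2: "\<sigma> \<bullet> (\<Pi>L H \<bullet> a \<boxtimes> a) = u a"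
    using cocycle_\<Pi>L(2) [of a a] by simp
  have "\<phi> \<bullet> (a \<boxtimes> \<sigma> \<bullet> (inv_H a \<boxtimes> a)) = \<sigma> \<bullet> (a \<boxtimes> inv_H a)"
    using cocycle_identity [of a "inv_H a" a] by (simp add: 1 2)
  then have "\<phi> \<bullet> (a \<boxtimes> \<sigma>' \<bullet> (inv_H a \<boxtimes> a)) \<star>\<^bsub>D\<^esub> \<sigma> \<bullet> (a \<boxtimes> inv_H a)
      = \<phi> \<bullet> (a \<boxtimes> (\<sigma>' \<bullet> (inv_H a \<boxtimes> a) \<star>\<^bsub>D\<^esub> \<sigma> \<bullet> (inv_H a \<boxtimes> a)))"
    by simp
  also have "\<dots> = u a"
    by (subst cocycle_inverse) simp_all
  finally show ?thesis .
qed

end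

section \<open>The crossed product\<close>

context crossed
begin

text \<open>The idempotent \<open>p \<otimes> a \<mapsto> p u(a) \<otimes> a\<close>, whose image is the
  crossed product: a word \<open>p f(a)\<close> in an extension does not change if \<open>p\<close> is
  multiplied by \<open>u(a)\<close>.\<close>

definition nabla :: 'm
  where "nabla = (\<mu> D \<otimes> \<H>) \<cdot> ((\<langle>obj D\<rangle> \<otimes> u1 H D \<phi> \<otimes> \<H>) \<cdot> (\<langle>obj D\<rangle> \<otimes> \<delta> H))"

text \<open>The product
  \<open>(p \<otimes> a) (q \<otimes> b) = p \<phi>\<^sub>a(q) \<sigma>(a, b) \<otimes> a b\<close>.\<close>

definition raw_mult :: 'm
  where "raw_mult = (\<mu> D \<otimes> \<H>) \<cdot> ((\<mu> D \<otimes> ((\<sigma> \<otimes> \<mu> H) \<cdot> \<delta>2 H)) \<cdot> ((\<langle>obj D\<rangle> \<otimes> \<phi> \<otimes> \<langle>obj H \<odot> obj H\<rangle>) \<cdot>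
    ((\<langle>obj D\<rangle> \<otimes> \<H> \<otimes> \<gamma> (obj H) (obj D) \<otimes> \<H>) \<cdot> (\<langle>obj D\<rangle> \<otimes> \<delta> H \<otimes> \<langle>obj D \<odot> obj H\<rangle>))))"

lemma nabla_simps [simp]:
  "nabla \<in> Ar C" "source C nabla = obj D \<odot> obj H" "target C nabla = obj D \<odot> obj H"
  "raw_mult \<in> Ar C" "source C raw_mult = obj D \<odot> obj H \<odot> obj D \<odot> obj H" "target C raw_mult = obj D \<odot> obj H"
  by (simp_all add: nabla_def raw_mult_def)

end

context crossed_stage
begin

lemma app_nabla [simp]:
  assumes "el p" "typ_of p = obj D" "gl a"
  shows "nabla \<bullet> (p \<boxtimes> a) = (p \<star>\<^bsub>D\<^esub> u a) \<boxtimes> a"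
  using assms by (simp add: nabla_def)

lemma app_raw_mult:
  assumes "el p" "typ_of p = obj D" "gl a" "el q" "typ_of q = obj D" "gl b"
  shows "raw_mult \<bullet> (p \<boxtimes> a \<boxtimes> q \<boxtimes> b) = (p \<star>\<^bsub>D\<^esub> \<phi> \<bullet> (a \<boxtimes> q) \<star>\<^bsub>D\<^esub> \<sigma> \<bullet> (a \<boxtimes> b)) \<boxtimes> (a \<star> b)"
proof -
  note [simp] = assms
  have "(\<langle>obj D\<rangle> \<otimes> \<phi> \<otimes> \<langle>obj H \<odot> obj H\<rangle>) \<bullet> (p \<boxtimes> a \<boxtimes> q \<boxtimes> a \<boxtimes> b) = p \<boxtimes> \<phi> \<bullet> (a \<boxtimes> q) \<boxtimes> a \<boxtimes> b"
    by simp
  moreover have "(\<mu> D \<otimes> ((\<sigma> \<otimes> \<mu> H) \<cdot> \<delta>2 H)) \<bullet> (p \<boxtimes> r \<boxtimes> a \<boxtimes> b) = (p \<star>\<^bsub>D\<^esub> r) \<boxtimes> \<sigma> \<bullet> (a \<boxtimes> b) \<boxtimes> (a \<star> b)"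
    if "el r" "typ_of r = obj D" for r
    using that by (subst app_pair_split) simp_all
  ultimately show ?thesis
    by (simp add: raw_mult_def)
qed

lemma pair_gl_scale:
  assumes "gl g" "el p" "F \<in> Ar C" "source C F = typ_of p \<odot> obj H"
  shows "g \<triangleright> F \<bullet> (p \<boxtimes> g) = F \<bullet> (p \<boxtimes> g)"
proof -
  have "g \<triangleright> F \<bullet> (p \<boxtimes> r) = F \<bullet> (p \<boxtimes> (g \<triangleright> r))" if "el r" "typ_of r = obj H" for r
    using that assms by simp
  from this [of g] show ?thesis
    using assms by simp
qed

lemma idempotent_exchange:
  assumes "gl z" "gl w"
  shows "(\<Pi>L H \<bullet> z \<star> \<Pi>L H \<bullet> w) \<triangleright> (\<Pi>L H \<bullet> z) = \<Pi>L H \<bullet> z \<star> \<Pi>L H \<bullet> w"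
    and "(\<Pi>L H \<bullet> z \<star> \<Pi>L H \<bullet> w) \<triangleright> (\<Pi>L H \<bullet> w) = \<Pi>L H \<bullet> z \<star> \<Pi>L H \<bullet> w"
  using gl_mul_\<Pi>(1) [of "\<Pi>L H \<bullet> z" "\<Pi>L H \<bullet> w"] gl_mul_\<Pi>(2) [of "\<Pi>L H \<bullet> z" "\<Pi>L H \<bullet> w"] assms
  by (simp_all del: gl_mul_\<Pi>)

end

text \<open>The object \<open>S\<close> is the image of \<open>nabla\<close>, with inclusion \<open>j\<close> and
  projection \<open>\<pi>\<close>. Its elements \<open>\<pi> \<bullet> (p \<boxtimes> a)\<close> stand
  for the words \<open>p f(a)\<close>.\<close>

locale crossed_product = crossed C H D \<phi> \<sigma> \<sigma>'
  for C :: "('o, 'm) monoidal_data" (structure) and H D \<phi> \<sigma> \<sigma>' +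
  fixes S :: 'o and j \<pi> :: 'm
  assumes j_Hom: "j \<in> Hom C S (obj D \<odot> obj H)" and \<pi>_Hom: "\<pi> \<in> Hom C (obj D \<odot> obj H) S"
    and \<pi>_j: "\<pi> \<cdot> j = \<langle>S\<rangle>" and j_\<pi>: "j \<cdot> \<pi> = nabla"
begin

lemma split_simps [simp]:
  "j \<in> Ar C" "source C j = S" "target C j = obj D \<odot> obj H"
  "\<pi> \<in> Ar C" "source C \<pi> = obj D \<odot> obj H" "target C \<pi> = S"
  using j_Hom \<pi>_Hom by (simp_all add: Hom_iff)

lemma S_simps [simp]: "S \<in> Ob C"
  using target_closed [of \<pi>] by simp

definition product :: "('o, 'm) algebra_extension"
  where "product = \<lparr>obj = S, \<eta> = \<pi> \<cdot> (\<eta> D \<otimes> \<eta> H), \<mu> = \<pi> \<cdot> (raw_mult \<cdot> (j \<otimes> j)),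
    \<rho> = (\<pi> \<otimes> \<H>) \<cdot> ((\<langle>obj D\<rangle> \<otimes> \<delta> H) \<cdot> j), incl = \<pi> \<cdot> (\<langle>obj D\<rangle> \<otimes> \<eta> H)\<rparr>"

lemma product_obj [simp]: "obj product = S"
  by (simp add: product_def)

lemma product_simps [simp]:
  "\<eta> product \<in> Ar C" "source C (\<eta> product) = \<one>" "target C (\<eta> product) = S"
  "\<mu> product \<in> Ar C" "source C (\<mu> product) = S \<odot> S" "target C (\<mu> product) = S"
  "\<rho> product \<in> Ar C" "source C (\<rho> product) = S" "target C (\<rho> product) = S \<odot> obj H"
  "incl product \<in> Ar C" "source C (incl product) = obj D" "target C (incl product) = S"
  by (simp_all add: product_def)

lemma \<pi>_nabla: "\<pi> \<cdot> nabla = \<pi>"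
  unfolding j_\<pi> [symmetric] using compose_tail [OF \<pi>_j, of \<pi>] by simp

lemmas word_ext1 = spanning_ext1 [OF split_simps(4-6) j_Hom \<pi>_j is_algebra_simps(1) [OF algebra_D]]
  and word_ext2 = spanning_ext2 [OF split_simps(4-6) j_Hom \<pi>_j is_algebra_simps(1) [OF algebra_D]]
  and word_ext3 = spanning_ext3 [OF split_simps(4-6) j_Hom \<pi>_j is_algebra_simps(1) [OF algebra_D]]

end

locale crossed_product_stage = crossed_product C H D \<phi> \<sigma> \<sigma>' S j \<pi> + wha_stage C H X e d
  for C :: "('o, 'm) monoidal_data" (structure) and H D \<phi> \<sigma> \<sigma>' S j \<pi> X e d
begin

sublocale crossed_stage ..

lemma el_product_mul [simp]:
  assumes "el P" "el Q" "typ_of P = S" "typ_of Q = S"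
  shows "el (P \<star>\<^bsub>product\<^esub> Q)" "typ_of (P \<star>\<^bsub>product\<^esub> Q) = S"
  using assms by (simp_all add: mul_def del: app_\<mu>)

lemma el_product_one [simp]: "el (one product)" "typ_of (one product) = S" "fst (one product) = \<one>"
  by (simp_all add: one_def del: app_\<eta>)

lemma j_word [simp]:
  assumes "el p" "typ_of p = obj D" "el a" "typ_of a = obj H"
  shows "j \<bullet> \<pi> \<bullet> (p \<boxtimes> a) = nabla \<bullet> (p \<boxtimes> a)"
proof -
  have "(j \<cdot> \<pi>) \<bullet> (p \<boxtimes> a) = nabla \<bullet> (p \<boxtimes> a)"
    unfolding j_\<pi> ..
  then show ?thesis using assms by simp
qed

lemma word_unit:
  assumes "el p" "typ_of p = obj D" "gl a"
  shows "\<pi> \<bullet> ((p \<star>\<^bsub>D\<^esub> u a) \<boxtimes> a) = \<pi> \<bullet> (p \<boxtimes> a)"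
proof -
  have "(\<pi> \<cdot> nabla) \<bullet> (p \<boxtimes> a) = \<pi> \<bullet> (p \<boxtimes> a)"
    unfolding \<pi>_nabla ..
  then show ?thesis using assms by simp
qed

lemma word_scale:
  assumes "el p" "typ_of p = obj D" "gl a"
  shows "a \<triangleright> \<pi> \<bullet> (p \<boxtimes> a) = \<pi> \<bullet> (p \<boxtimes> a)"
  using assms by (intro pair_gl_scale) simp_all

lemma word_mul:
  assumes "el p" "typ_of p = obj D" "gl a" "el q" "typ_of q = obj D" "gl b"
  shows "\<pi> \<bullet> (p \<boxtimes> a) \<star>\<^bsub>product\<^esub> \<pi> \<bullet> (q \<boxtimes> b) = \<pi> \<bullet> ((p \<star>\<^bsub>D\<^esub> \<phi> \<bullet> (a \<boxtimes> q) \<star>\<^bsub>D\<^esub> \<sigma> \<bullet> (a \<boxtimes> b)) \<boxtimes> (a \<star> b))"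
proof -
  note [simp] = assms
  let ?r = "p \<star>\<^bsub>D\<^esub> \<phi> \<bullet> (a \<boxtimes> q) \<star>\<^bsub>D\<^esub> \<sigma> \<bullet> (a \<boxtimes> b)"
  have 1: "u a \<star>\<^bsub>D\<^esub> \<phi> \<bullet> (a \<boxtimes> q) \<star>\<^bsub>D\<^esub> R = \<phi> \<bullet> (a \<boxtimes> q) \<star>\<^bsub>D\<^esub> R" if "el R" "typ_of R = obj D" for R
    using mul_assoc [of D "u a" "\<phi> \<bullet> (a \<boxtimes> q)" R] that by simp
  have "\<pi> \<bullet> (p \<boxtimes> a) \<star>\<^bsub>product\<^esub> \<pi> \<bullet> (q \<boxtimes> b) = (\<pi> \<cdot> (raw_mult \<cdot> (j \<otimes> j))) \<bullet> (\<pi> \<bullet> (p \<boxtimes> a) \<boxtimes> \<pi> \<bullet> (q \<boxtimes> b))"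
    by (simp add: mul_def product_def del: app_\<mu> app_app)
  also have "\<dots> = \<pi> \<bullet> (((p \<star>\<^bsub>D\<^esub> u a) \<star>\<^bsub>D\<^esub> \<phi> \<bullet> (a \<boxtimes> (q \<star>\<^bsub>D\<^esub> u b)) \<star>\<^bsub>D\<^esub> \<sigma> \<bullet> (a \<boxtimes> b)) \<boxtimes> (a \<star> b))"
    by (simp add: app_raw_mult)
  also have "\<dots> = (a \<star> b) \<triangleright> \<pi> \<bullet> (?r \<boxtimes> (a \<star> b))"
    by (simp add: 1)
  also have "\<dots> = \<pi> \<bullet> (?r \<boxtimes> (a \<star> b))"
    by (rule word_scale) simp_all
  finally show ?thesis .
qed

lemma \<rho>_word:
  assumes "el p" "typ_of p = obj D" "gl a"
  shows "\<rho> product \<bullet> \<pi> \<bullet> (p \<boxtimes> a) = \<pi> \<bullet> (p \<boxtimes> a) \<boxtimes> a"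
proof -
  note [simp] = assms
  have "(\<pi> \<otimes> \<H>) \<bullet> ((p \<star>\<^bsub>D\<^esub> u a) \<boxtimes> a \<boxtimes> a) = \<pi> \<bullet> (p \<boxtimes> a) \<boxtimes> a"
    by (subst app_pair_split) (simp_all add: word_unit)
  then show ?thesis
    by (simp add: product_def)
qed

lemma incl_eq: "el p \<Longrightarrow> typ_of p = obj D \<Longrightarrow> incl product \<bullet> p = \<pi> \<bullet> (p \<boxtimes> one H)"
  by (simp add: product_def)

lemma one_eq: "one product = \<pi> \<bullet> (one D \<boxtimes> one H)"
proof -
  have "(\<eta> D \<otimes> \<eta> H) \<bullet> \<iota> = one D \<boxtimes> one H"
    by (subst app_pair_unit(1)) simp_all
  then show ?thesis
    by (simp add: one_def product_def del: app_\<eta>)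
qed

text \<open>The products with \<open>p \<otimes> \<Pi>\<^sup>L z\<close>, from which those with
  \<open>p \<otimes> 1\<close>, the elements of the image of \<open>D\<close>, are obtained at
  \<open>z = 1\<close>. The formula \<open>word_mul\<close> does not cover them, as \<open>1\<close> is
  not grouplike.\<close>

lemma word_idempotent:
  assumes "el p" "typ_of p = obj D" "gl a" "el q" "typ_of q = obj D" "gl z"
  shows "\<pi> \<bullet> (p \<boxtimes> \<Pi>L H \<bullet> z) \<star>\<^bsub>product\<^esub> \<pi> \<bullet> (q \<boxtimes> a) = \<pi> \<bullet> ((p \<star>\<^bsub>D\<^esub> q) \<boxtimes> (\<Pi>L H \<bullet> z \<star> a))"
    and "\<pi> \<bullet> (p \<boxtimes> a) \<star>\<^bsub>product\<^esub> \<pi> \<bullet> (q \<boxtimes> \<Pi>L H \<bullet> z) = \<pi> \<bullet> ((p \<star>\<^bsub>D\<^esub> \<phi> \<bullet> (a \<boxtimes> q)) \<boxtimes> (a \<star> \<Pi>L H \<bullet> z))"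
proof -
  define x where "x = \<Pi>L H \<bullet> z"
  define g where "g = x \<star> a"
  define k where "k = a \<star> x"
  have [simp]: "gl x" "gl g" "gl k" "\<Pi>L H \<bullet> x = x" and [simp]: "el p" "typ_of p = obj D" "gl a" "el q" "typ_of q = obj D"
    using assms by (simp_all add: x_def g_def k_def del: gl_mul_\<Pi>)
  have u: "u g = g \<triangleright> u x" "u k = k \<triangleright> u a"
    unfolding g_def k_def by (rule unit_product; simp)+
  have \<sigma>: "\<sigma> \<bullet> (a \<boxtimes> x) = k \<triangleright> u a" "\<sigma> \<bullet> (x \<boxtimes> a) = g \<triangleright> u x"
    using cocycle_\<Pi>L [OF \<open>gl a\<close> \<open>gl x\<close>] by (simp_all add: g_def k_def del: gl_mul_\<Pi>)
  have \<phi>: "\<phi> \<bullet> (x \<boxtimes> q) = q \<star>\<^bsub>D\<^esub> u x"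
    using unit_mul(2) [of x q] by simp
  have scale: "\<pi> \<bullet> ((r \<star>\<^bsub>D\<^esub> (h \<triangleright> v)) \<boxtimes> h) = \<pi> \<bullet> ((r \<star>\<^bsub>D\<^esub> v) \<boxtimes> h)"
    if "gl h" "el r" "typ_of r = obj D" "el v" "typ_of v = obj D" for h r v
    using word_scale [of "r \<star>\<^bsub>D\<^esub> v" h] that by simp
  have "\<pi> \<bullet> (p \<boxtimes> x) \<star>\<^bsub>product\<^esub> \<pi> \<bullet> (q \<boxtimes> a) = \<pi> \<bullet> (((p \<star>\<^bsub>D\<^esub> q \<star>\<^bsub>D\<^esub> u x) \<star>\<^bsub>D\<^esub> (g \<triangleright> u x)) \<boxtimes> g)"
    by (subst word_mul) (simp_all add: \<phi> \<sigma> g_def [symmetric] del: mul_scale)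
  also have "\<dots> = \<pi> \<bullet> (((p \<star>\<^bsub>D\<^esub> q) \<star>\<^bsub>D\<^esub> u x) \<boxtimes> g)"
    by (subst scale) simp_all
  also have "\<dots> = \<pi> \<bullet> (((p \<star>\<^bsub>D\<^esub> q) \<star>\<^bsub>D\<^esub> u g) \<boxtimes> g)"
    unfolding u by (rule scale [symmetric]) simp_all
  also have "\<dots> = \<pi> \<bullet> ((p \<star>\<^bsub>D\<^esub> q) \<boxtimes> g)"
    by (rule word_unit) simp_all
  finally show "\<pi> \<bullet> (p \<boxtimes> \<Pi>L H \<bullet> z) \<star>\<^bsub>product\<^esub> \<pi> \<bullet> (q \<boxtimes> a) = \<pi> \<bullet> ((p \<star>\<^bsub>D\<^esub> q) \<boxtimes> (\<Pi>L H \<bullet> z \<star> a))"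
    unfolding g_def x_def .
  have "\<pi> \<bullet> (p \<boxtimes> a) \<star>\<^bsub>product\<^esub> \<pi> \<bullet> (q \<boxtimes> x) = \<pi> \<bullet> (((p \<star>\<^bsub>D\<^esub> \<phi> \<bullet> (a \<boxtimes> q)) \<star>\<^bsub>D\<^esub> (k \<triangleright> u a)) \<boxtimes> k)"
    by (subst word_mul) (simp_all add: \<sigma> k_def [symmetric] del: mul_scale)
  also have "\<dots> = \<pi> \<bullet> ((p \<star>\<^bsub>D\<^esub> \<phi> \<bullet> (a \<boxtimes> q)) \<boxtimes> k)"
    by (subst scale) simp_all
  finally show "\<pi> \<bullet> (p \<boxtimes> a) \<star>\<^bsub>product\<^esub> \<pi> \<bullet> (q \<boxtimes> \<Pi>L H \<bullet> z) = \<pi> \<bullet> ((p \<star>\<^bsub>D\<^esub> \<phi> \<bullet> (a \<boxtimes> q)) \<boxtimes> (a \<star> \<Pi>L H \<bullet> z))"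
    unfolding k_def x_def .
qed

text \<open>Both elements are multiples of \<open>u(z) \<otimes> \<Pi>\<^sup>L z\<close> by the same scalar.\<close>

lemma word_unit_idempotents:
  assumes "gl z" "gl w"
  shows "\<pi> \<bullet> (u z \<boxtimes> \<Pi>L H \<bullet> w) = \<pi> \<bullet> (one D \<boxtimes> (\<Pi>L H \<bullet> z \<star> \<Pi>L H \<bullet> w))"
proof -
  define x y g where "x = \<Pi>L H \<bullet> z" and "y = \<Pi>L H \<bullet> w" and "g = x \<star> y"
  have [simp]: "gl x" "gl y" "gl g" "\<Pi>L H \<bullet> x = x" "u z = u x"
    using assms by (simp_all add: x_def y_def g_def del: gl_mul_\<Pi>)
  have g: "g \<triangleright> x = g" "g \<triangleright> y = g"
    using idempotent_exchange [OF assms] by (simp_all add: x_def y_def g_def)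
  have scale: "\<pi> \<bullet> (p \<boxtimes> (g \<triangleright> v)) = g \<triangleright> \<pi> \<bullet> (p \<boxtimes> v)" if "el p" "typ_of p = obj D" "el v" "typ_of v = obj H" for p v
    using that by simp
  have "\<pi> \<bullet> (u x \<boxtimes> y) = \<pi> \<bullet> ((u x \<star>\<^bsub>D\<^esub> u y) \<boxtimes> y)"
    by (rule word_unit [symmetric]) simp_all
  also have "\<dots> = g \<triangleright> \<pi> \<bullet> (u x \<boxtimes> y)"
    using unit_mul_unit [of x y] by (simp add: g_def [symmetric])
  also have "\<dots> = g \<triangleright> \<pi> \<bullet> (u x \<boxtimes> x)"
    using scale [of "u x" x] scale [of "u x" y] unfolding g by simp
  also have "\<pi> \<bullet> (u x \<boxtimes> x) = \<pi> \<bullet> (one D \<boxtimes> x)"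
    using word_unit [of "one D" x] by simp
  also have "g \<triangleright> \<dots> = \<pi> \<bullet> (one D \<boxtimes> g)"
    using scale [of "one D" x] unfolding g by simp
  finally show ?thesis
    by (simp add: x_def [symmetric] y_def [symmetric] g_def [symmetric])
qed

end

context crossed_product
begin

text \<open>The formulas of \<open>word_idempotent\<close> as equations of arrows, in which \<open>z = 1\<close>
  can be substituted.\<close>

lemma product_idempotent:
  "\<mu> product \<cdot> ((\<pi> \<cdot> (\<langle>obj D\<rangle> \<otimes> \<Pi>L H)) \<otimes> \<pi>)
    = \<pi> \<cdot> ((\<mu> D \<otimes> (\<mu> H \<cdot> (\<Pi>L H \<otimes> \<H>))) \<cdot> (\<langle>obj D\<rangle> \<otimes> \<gamma> (obj H) (obj D) \<otimes> \<H>))"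
  "\<mu> product \<cdot> (\<pi> \<otimes> (\<pi> \<cdot> (\<langle>obj D\<rangle> \<otimes> \<Pi>L H)))
    = \<pi> \<cdot> (((\<mu> D \<cdot> (\<langle>obj D\<rangle> \<otimes> \<phi>)) \<otimes> (\<mu> H \<cdot> (\<H> \<otimes> \<Pi>L H)))
      \<cdot> ((\<langle>obj D\<rangle> \<otimes> \<H> \<otimes> \<gamma> (obj H) (obj D) \<otimes> \<H>) \<cdot> (\<langle>obj D\<rangle> \<otimes> \<delta> H \<otimes> \<langle>obj D \<odot> obj H\<rangle>)))"
    (is "?L = ?R")
proof -
  have s: "\<langle>obj D \<odot> obj H\<rangle> \<in> Hom C (obj D \<odot> obj H) (obj D \<odot> obj H)"
    by (simp add: Hom_iff)
  note ext2 = spanning_ext2 [OF _ _ _ s _ is_algebra_simps(1) [OF algebra_D], of "\<langle>obj D \<odot> obj H\<rangle>"]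
  show "\<mu> product \<cdot> ((\<pi> \<cdot> (\<langle>obj D\<rangle> \<otimes> \<Pi>L H)) \<otimes> \<pi>)
    = \<pi> \<cdot> ((\<mu> D \<otimes> (\<mu> H \<cdot> (\<Pi>L H \<otimes> \<H>))) \<cdot> (\<langle>obj D\<rangle> \<otimes> \<gamma> (obj H) (obj D) \<otimes> \<H>))"
  proof (rule ext2, goal_cases)
    case (9 X e d p z q a)
    then interpret wha_stage C H X e d by simp
    interpret crossed_product_stage C H D \<phi> \<sigma> \<sigma>' S j \<pi> X e d ..
    note [simp] = 9
    have "((\<pi> \<cdot> (\<langle>obj D\<rangle> \<otimes> \<Pi>L H)) \<otimes> \<pi>) \<bullet> pair p (pair z (pair q a)) = pair (\<pi> \<bullet> pair p (\<Pi>L H \<bullet> z)) (\<pi> \<bullet> pair q a)"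
      by (subst app_pair_split) simp_all
    moreover have "(\<mu> D \<otimes> (\<mu> H \<cdot> (\<Pi>L H \<otimes> \<H>))) \<bullet> pair p (pair q (pair z a)) = pair (mul D p q) (mul H (\<Pi>L H \<bullet> z) a)"
      by (subst app_pair_split) (simp_all del: gl_mul_\<Pi>)
    ultimately show ?case
      by (simp add: word_idempotent(1) del: gl_mul_\<Pi>)
  qed simp_all
  show "?L = ?R"
  proof (rule ext2, goal_cases)
    case (9 X e d p a q z)
    then interpret wha_stage C H X e d by simp
    interpret crossed_product_stage C H D \<phi> \<sigma> \<sigma>' S j \<pi> X e d ..
    note [simp] = 9
    have "(\<pi> \<otimes> (\<pi> \<cdot> (\<langle>obj D\<rangle> \<otimes> \<Pi>L H))) \<bullet> pair p (pair a (pair q z)) = pair (\<pi> \<bullet> pair p a) (\<pi> \<bullet> pair q (\<Pi>L H \<bullet> z))"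
      by (subst app_pair_split) simp_all
    moreover have "((\<mu> D \<cdot> (\<langle>obj D\<rangle> \<otimes> \<phi>)) \<otimes> (\<mu> H \<cdot> (\<H> \<otimes> \<Pi>L H))) \<bullet> pair p (pair a (pair q (pair a z)))
        = pair (mul D p (\<phi> \<bullet> pair a q)) (mul H a (\<Pi>L H \<bullet> z))"
      by (subst app_pair_split3) (simp_all del: gl_mul_\<Pi>)
    ultimately show ?case
      by (simp add: word_idempotent(2) del: gl_mul_\<Pi>)
  qed simp_all
qed

lemma product_unit_idempotents: "\<pi> \<cdot> (u1 H D \<phi> \<otimes> \<Pi>L H) = \<pi> \<cdot> (\<eta> D \<otimes> (\<mu> H \<cdot> (\<Pi>L H \<otimes> \<Pi>L H)))"
proof (rule generic_ext2', goal_cases)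
  case (5 X e d z w)
  then interpret wha_stage C H X e d by simp
  interpret crossed_product_stage C H D \<phi> \<sigma> \<sigma>' S j \<pi> X e d ..
  note [simp] = 5
  have "(\<eta> D \<otimes> (\<mu> H \<cdot> (\<Pi>L H \<otimes> \<Pi>L H))) \<bullet> pair z w = pair (one D) (mul H (\<Pi>L H \<bullet> z) (\<Pi>L H \<bullet> w))"
    by (subst app_pair_unit(1)) (simp_all del: gl_mul_\<Pi>)
  then show ?case
    using word_unit_idempotents [of z w] by (simp del: gl_mul_\<Pi>)
qed simp_all

lemma \<rho>_\<pi>: "\<rho> product \<cdot> \<pi> = (\<pi> \<otimes> \<H>) \<cdot> (\<langle>obj D\<rangle> \<otimes> \<delta> H)"
proof (rule generic_ext_right [where Y = "obj D"], goal_cases)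
  case (6 X e d p a)
  then interpret wha_stage C H X e d by simp
  interpret crossed_product_stage C H D \<phi> \<sigma> \<sigma>' S j \<pi> X e d ..
  note [simp] = 6
  have "(\<pi> \<otimes> \<H>) \<bullet> pair p (pair a a) = pair (\<pi> \<bullet> pair p a) a"
    by (subst app_pair_split) simp_all
  then show ?case by (simp add: \<rho>_word)
qed simp_all

end

context crossed_product_stage
begin

lemma incl_mul_word:
  assumes "el p" "typ_of p = obj D" "el q" "typ_of q = obj D" "el a" "typ_of a = obj H"
  shows "incl product \<bullet> p \<star>\<^bsub>product\<^esub> \<pi> \<bullet> (q \<boxtimes> a) = \<pi> \<bullet> ((p \<star>\<^bsub>D\<^esub> q) \<boxtimes> a)"
proof -
  note [simp] = assms
  have 1: "((\<pi> \<cdot> (\<langle>obj D\<rangle> \<otimes> \<Pi>L H)) \<otimes> \<pi>) \<bullet> (p \<boxtimes> one H \<boxtimes> q \<boxtimes> a) = incl product \<bullet> p \<boxtimes> \<pi> \<bullet> (q \<boxtimes> a)"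
    by (subst app_pair_split) (simp_all add: incl_eq)
  have 2: "(\<mu> D \<otimes> (\<mu> H \<cdot> (\<Pi>L H \<otimes> \<H>))) \<bullet> (p \<boxtimes> q \<boxtimes> one H \<boxtimes> a) = (p \<star>\<^bsub>D\<^esub> q) \<boxtimes> a"
    by (subst app_pair_split) simp_all
  have "(\<mu> product \<cdot> ((\<pi> \<cdot> (\<langle>obj D\<rangle> \<otimes> \<Pi>L H)) \<otimes> \<pi>)) \<bullet> (p \<boxtimes> one H \<boxtimes> q \<boxtimes> a)
    = (\<pi> \<cdot> ((\<mu> D \<otimes> (\<mu> H \<cdot> (\<Pi>L H \<otimes> \<H>))) \<cdot> (\<langle>obj D\<rangle> \<otimes> \<gamma> (obj H) (obj D) \<otimes> \<H>))) \<bullet> (p \<boxtimes> one H \<boxtimes> q \<boxtimes> a)"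
    unfolding product_idempotent(1) ..
  then show ?thesis
    using 1 2 by simp
qed

lemma word_mul_incl:
  assumes "el p" "typ_of p = obj D" "el q" "typ_of q = obj D" "gl a"
  shows "\<pi> \<bullet> (p \<boxtimes> a) \<star>\<^bsub>product\<^esub> incl product \<bullet> q = \<pi> \<bullet> ((p \<star>\<^bsub>D\<^esub> \<phi> \<bullet> (a \<boxtimes> q)) \<boxtimes> a)"
proof -
  note [simp] = assms
  have 1: "(\<pi> \<otimes> (\<pi> \<cdot> (\<langle>obj D\<rangle> \<otimes> \<Pi>L H))) \<bullet> (p \<boxtimes> a \<boxtimes> q \<boxtimes> one H) = \<pi> \<bullet> (p \<boxtimes> a) \<boxtimes> incl product \<bullet> q"
    by (subst app_pair_split) (simp_all add: incl_eq)
  have 2: "((\<mu> D \<cdot> (\<langle>obj D\<rangle> \<otimes> \<phi>)) \<otimes> (\<mu> H \<cdot> (\<H> \<otimes> \<Pi>L H))) \<bullet> (p \<boxtimes> a \<boxtimes> q \<boxtimes> a \<boxtimes> one H) = (p \<star>\<^bsub>D\<^esub> \<phi> \<bullet> (a \<boxtimes> q)) \<boxtimes> a"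
    by (subst app_pair_split3) simp_all
  have "(\<mu> product \<cdot> (\<pi> \<otimes> (\<pi> \<cdot> (\<langle>obj D\<rangle> \<otimes> \<Pi>L H)))) \<bullet> (p \<boxtimes> a \<boxtimes> q \<boxtimes> one H)
    = (\<pi> \<cdot> (((\<mu> D \<cdot> (\<langle>obj D\<rangle> \<otimes> \<phi>)) \<otimes> (\<mu> H \<cdot> (\<H> \<otimes> \<Pi>L H)))
      \<cdot> ((\<langle>obj D\<rangle> \<otimes> \<H> \<otimes> \<gamma> (obj H) (obj D) \<otimes> \<H>) \<cdot> (\<langle>obj D\<rangle> \<otimes> \<delta> H \<otimes> \<langle>obj D \<odot> obj H\<rangle>)))) \<bullet> (p \<boxtimes> a \<boxtimes> q \<boxtimes> one H)"
    unfolding product_idempotent(2) ..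
  then show ?thesis
    using 1 2 by simp
qed

lemma incl_unit:
  assumes "gl a"
  shows "incl product \<bullet> u a = \<pi> \<bullet> (one D \<boxtimes> \<Pi>L H \<bullet> a)"
proof -
  note [simp] = assms
  have "(\<eta> D \<otimes> (\<mu> H \<cdot> (\<Pi>L H \<otimes> \<Pi>L H))) \<bullet> (a \<boxtimes> one H) = one D \<boxtimes> \<Pi>L H \<bullet> a"
    by (subst app_pair_unit(1)) simp_all
  moreover have "(\<pi> \<cdot> (u1 H D \<phi> \<otimes> \<Pi>L H)) \<bullet> (a \<boxtimes> one H) = (\<pi> \<cdot> (\<eta> D \<otimes> (\<mu> H \<cdot> (\<Pi>L H \<otimes> \<Pi>L H)))) \<bullet> (a \<boxtimes> one H)"
    unfolding product_unit_idempotents ..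
  ultimately show ?thesis
    by (simp add: incl_eq)
qed

lemma \<rho>_incl:
  assumes "el p" "typ_of p = obj D"
  shows "\<rho> product \<bullet> incl product \<bullet> p = (\<pi> \<otimes> \<H>) \<bullet> (p \<boxtimes> \<delta> H \<bullet> one H)"
proof -
  have "(\<rho> product \<cdot> \<pi>) \<bullet> (p \<boxtimes> one H) = ((\<pi> \<otimes> \<H>) \<cdot> (\<langle>obj D\<rangle> \<otimes> \<delta> H)) \<bullet> (p \<boxtimes> one H)"
    unfolding \<rho>_\<pi> ..
  then show ?thesis using assms by (simp add: incl_eq)
qed

lemma incl_coinvariant:
  assumes "el p" "typ_of p = obj D"
  shows "(\<langle>S\<rangle> \<otimes> \<Pi>L H) \<bullet> \<rho> product \<bullet> incl product \<bullet> p = \<rho> product \<bullet> incl product \<bullet> p"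
proof -
  note [simp] = assms
  have "(\<langle>S\<rangle> \<otimes> \<Pi>L H) \<cdot> (\<pi> \<otimes> \<H>) = (\<pi> \<otimes> \<H>) \<cdot> (\<langle>obj D\<rangle> \<otimes> \<H> \<otimes> \<Pi>L H)"
    using interchange [of "\<langle>obj D \<odot> obj H\<rangle>" \<pi> "\<Pi>L H" "\<H>"] by (simp add: interchange ident_merge)
  then have "((\<langle>S\<rangle> \<otimes> \<Pi>L H) \<cdot> (\<pi> \<otimes> \<H>)) \<bullet> (p \<boxtimes> \<delta> H \<bullet> one H)
      = ((\<pi> \<otimes> \<H>) \<cdot> (\<langle>obj D\<rangle> \<otimes> \<H> \<otimes> \<Pi>L H)) \<bullet> (p \<boxtimes> \<delta> H \<bullet> one H)"
    by (simp only:)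
  then show ?thesis
    by (simp add: \<rho>_incl \<Pi>_\<delta>_one')
qed

lemma one_incl: "one product = incl product \<bullet> one D"
  by (simp add: one_eq incl_eq)

end

context crossed_product
begin

lemma product_algebra [simp]: "is_algebra product"
proof -
  have 1: "\<mu> product \<cdot> (\<langle>S\<rangle> \<otimes> \<eta> product) = \<langle>S\<rangle>" "\<mu> product \<cdot> (\<eta> product \<otimes> \<langle>S\<rangle>) = \<langle>S\<rangle>"
  proof -
    have *: "(\<mu> product \<cdot> (\<langle>S\<rangle> \<otimes> \<eta> product)) \<bullet> \<pi> \<bullet> stage.pair C X d p a = \<langle>S\<rangle> \<bullet> \<pi> \<bullet> stage.pair C X d p a
      \<and> (\<mu> product \<cdot> (\<eta> product \<otimes> \<langle>S\<rangle>)) \<bullet> \<pi> \<bullet> stage.pair C X d p a = \<langle>S\<rangle> \<bullet> \<pi> \<bullet> stage.pair C X d p a"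
      if "wha_stage C H X e d" "stage.el C X p" "typ_of p = obj D" "stage.grouplike C X d (obj H) (\<delta> H) a" for X e d p a
    proof -
      interpret wha_stage C H X e d by fact
      interpret crossed_product_stage C H D \<phi> \<sigma> \<sigma>' S j \<pi> X e d ..
      note [simp] = that
      show ?thesis
        using word_mul_incl [of p "one D" a] incl_mul_word [of "one D" p a] by (simp add: one_incl word_unit)
    qed
    show "\<mu> product \<cdot> (\<langle>S\<rangle> \<otimes> \<eta> product) = \<langle>S\<rangle>" "\<mu> product \<cdot> (\<eta> product \<otimes> \<langle>S\<rangle>) = \<langle>S\<rangle>"
      by (rule word_ext1; simp add: *)+
  qed
  have 2: "\<mu> product \<cdot> (\<langle>S\<rangle> \<otimes> \<mu> product) = \<mu> product \<cdot> (\<mu> product \<otimes> \<langle>S\<rangle>)"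
  proof (rule word_ext3, goal_cases)
    case (5 X e d p a q b r c)
    then interpret wha_stage C H X e d by simp
    interpret crossed_product_stage C H D \<phi> \<sigma> \<sigma>' S j \<pi> X e d ..
    note [simp] = 5
    have "mul D (\<sigma> \<bullet> pair a b) (mul D (\<phi> \<bullet> pair (mul H a b) r) R) = mul D (\<phi> \<bullet> pair a (\<phi> \<bullet> pair b r)) (mul D (\<sigma> \<bullet> pair a b) R)"
      if "el R" "typ_of R = obj D" for R
    proof -
      have "mul D (mul D (\<sigma> \<bullet> pair a b) (\<phi> \<bullet> pair (mul H a b) r)) R = mul D (mul D (\<phi> \<bullet> pair a (\<phi> \<bullet> pair b r)) (\<sigma> \<bullet> pair a b)) R"
        by (subst twisted_action) simp_all
      then show ?thesis using that by simp
    qed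
    then have "mul product (mul product (\<pi> \<bullet> pair p a) (\<pi> \<bullet> pair q b)) (\<pi> \<bullet> pair r c)
        = mul product (\<pi> \<bullet> pair p a) (mul product (\<pi> \<bullet> pair q b) (\<pi> \<bullet> pair r c))"
      by (simp add: word_mul cocycle_identity)
    moreover have "(\<mu> product \<otimes> \<langle>S\<rangle>) \<bullet> pair (\<pi> \<bullet> pair p a) (pair (\<pi> \<bullet> pair q b) (\<pi> \<bullet> pair r c))
        = pair (mul product (\<pi> \<bullet> pair p a) (\<pi> \<bullet> pair q b)) (\<pi> \<bullet> pair r c)"
      by (subst app_pair_split) simp_all
    ultimately show ?case by simp
  qed simp_all
  show ?thesis
    using 1 2 unfolding is_algebra_def product_obj by (simp add: Hom_iff)
qed

lemma product_comodule_algebra: "right_comodule_algebra H product"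
proof -
  have 1: "(\<langle>S\<rangle> \<otimes> \<epsilon> H) \<cdot> \<rho> product = \<langle>S\<rangle>"
    "(\<rho> product \<otimes> \<H>) \<cdot> \<rho> product = (\<langle>S\<rangle> \<otimes> \<delta> H) \<cdot> \<rho> product"
  proof -
    have *: "((\<langle>S\<rangle> \<otimes> \<epsilon> H) \<cdot> \<rho> product) \<bullet> \<pi> \<bullet> stage.pair C X d p a = \<langle>S\<rangle> \<bullet> \<pi> \<bullet> stage.pair C X d p a
      \<and> ((\<rho> product \<otimes> \<H>) \<cdot> \<rho> product) \<bullet> \<pi> \<bullet> stage.pair C X d p a
        = ((\<langle>S\<rangle> \<otimes> \<delta> H) \<cdot> \<rho> product) \<bullet> \<pi> \<bullet> stage.pair C X d p a"
      if "wha_stage C H X e d" "stage.el C X p" "typ_of p = obj D" "stage.grouplike C X d (obj H) (\<delta> H) a" for X e d p a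
    proof -
      interpret wha_stage C H X e d by fact
      interpret crossed_product_stage C H D \<phi> \<sigma> \<sigma>' S j \<pi> X e d ..
      note [simp] = that
      show ?thesis
        by (simp add: \<rho>_word word_scale)
    qed
    show "(\<langle>S\<rangle> \<otimes> \<epsilon> H) \<cdot> \<rho> product = \<langle>S\<rangle>"
      "(\<rho> product \<otimes> \<H>) \<cdot> \<rho> product = (\<langle>S\<rangle> \<otimes> \<delta> H) \<cdot> \<rho> product"
      by (rule word_ext1; simp add: *)+
  qed
  note [simp] = stage.tensor_\<mu>_simps [OF stage0 product_algebra algebra_H]
  have 2: "\<rho> product \<cdot> \<mu> product = tensor_\<mu> product H \<cdot> (\<rho> product \<otimes> \<rho> product)"
  proof (rule word_ext2, goal_cases)
    case (5 X e d p a q b)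
    then interpret wha_stage C H X e d by simp
    interpret crossed_product_stage C H D \<phi> \<sigma> \<sigma>' S j \<pi> X e d ..
    note [simp] = 5
    show ?case
      by (simp add: \<rho>_word word_mul)
  qed simp_all
  have 3: "(\<langle>S\<rangle> \<otimes> \<Pi>L H) \<cdot> \<rho> product \<cdot> \<eta> product = \<rho> product \<cdot> \<eta> product"
  proof (rule generic_ext0, goal_cases)
    case (5 X e d)
    then interpret wha_stage C H X e d by simp
    interpret crossed_product_stage C H D \<phi> \<sigma> \<sigma>' S j \<pi> X e d ..
    show ?case by (simp add: one_incl incl_coinvariant)
  qed simp_all
  show ?thesis
    using 1 2 3 unfolding right_comodule_algebra_def right_comodule_def product_obj by (simp add: Hom_iff)
qed

definition retraction :: 'm
  where "retraction = (\<langle>obj D\<rangle> \<otimes> \<epsilon> H) \<cdot> j"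

lemma retraction_simps [simp]:
  "retraction \<in> Ar C" "source C retraction = S" "target C retraction = obj D"
  by (simp_all add: retraction_def)

lemma \<epsilon>_nabla: "(\<langle>obj D\<rangle> \<otimes> \<epsilon> H) \<cdot> nabla = \<mu> D \<cdot> (\<langle>obj D\<rangle> \<otimes> u1 H D \<phi>)"
proof (rule generic_ext_right [where Y = "obj D"], goal_cases)
  case (6 X e d p a)
  then interpret wha_stage C H X e d by simp
  interpret crossed_product_stage C H D \<phi> \<sigma> \<sigma>' S j \<pi> X e d ..
  note [simp] = 6
  have "scale a (mul D p r) = mul D p (scale a r)" if "el r" "typ_of r = obj D" for r
    using that by simp
  from this [of "u1 H D \<phi> \<bullet> a"] show ?case by simp
qed simp_all

lemma retraction_\<pi>: "retraction \<cdot> \<pi> = \<mu> D \<cdot> (\<langle>obj D\<rangle> \<otimes> u1 H D \<phi>)"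
  using \<epsilon>_nabla j_\<pi> by (simp add: retraction_def)

lemma retraction_incl: "retraction \<cdot> incl product = \<langle>obj D\<rangle>"
proof (rule generic_ext0_1 [where Y = "obj D"], goal_cases)
  case (6 X e d p)
  then interpret wha_stage C H X e d by simp
  interpret crossed_product_stage C H D \<phi> \<sigma> \<sigma>' S j \<pi> X e d ..
  note [simp] = 6
  have "(retraction \<cdot> \<pi>) \<bullet> pair p (one H) = (\<mu> D \<cdot> (\<langle>obj D\<rangle> \<otimes> u1 H D \<phi>)) \<bullet> pair p (one H)"
    unfolding retraction_\<pi> ..
  then show ?case by (simp add: incl_eq)
qed simp_all

text \<open>With \<open>r\<close> for the retraction, every \<open>b\<close> is the word
  \<open>r(b\<^sub>0) \<otimes> b\<^sub>1\<close>. If \<open>b\<close> is coinvariant,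
  \<open>b\<^sub>1\<close> may be replaced by \<open>\<Pi>\<^sup>L(b\<^sub>1)\<close>, and then the second
  formula identifies \<open>b\<close> with the image of \<open>r(b)\<close>.\<close>

lemma retraction_words:
  "\<pi> \<cdot> ((retraction \<otimes> \<H>) \<cdot> \<rho> product) = \<langle>S\<rangle>"
  "\<pi> \<cdot> ((retraction \<otimes> \<Pi>L H) \<cdot> \<rho> product) = incl product \<cdot> retraction"
proof -
  have *: "(\<pi> \<cdot> ((retraction \<otimes> \<H>) \<cdot> \<rho> product)) \<bullet> \<pi> \<bullet> stage.pair C X d p a = \<langle>S\<rangle> \<bullet> \<pi> \<bullet> stage.pair C X d p a
    \<and> (\<pi> \<cdot> ((retraction \<otimes> \<Pi>L H) \<cdot> \<rho> product)) \<bullet> \<pi> \<bullet> stage.pair C X d p a = (incl product \<cdot> retraction) \<bullet> \<pi> \<bullet> stage.pair C X d p a"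
    if "wha_stage C H X e d" "stage.el C X p" "typ_of p = obj D" "stage.grouplike C X d (obj H) (\<delta> H) a" for X e d p a
  proof -
    interpret wha_stage C H X e d by fact
    interpret crossed_product_stage C H D \<phi> \<sigma> \<sigma>' S j \<pi> X e d ..
    note [simp] = that
    have "(retraction \<cdot> \<pi>) \<bullet> pair p a = (\<mu> D \<cdot> (\<langle>obj D\<rangle> \<otimes> u1 H D \<phi>)) \<bullet> pair p a"
      unfolding retraction_\<pi> ..
    then have r: "retraction \<bullet> \<pi> \<bullet> pair p a = mul D p (u1 H D \<phi> \<bullet> a)"
      by simp
    have "\<pi> \<bullet> pair (mul D p (u1 H D \<phi> \<bullet> a)) (\<Pi>L H \<bullet> a) = \<pi> \<bullet> pair p (\<Pi>L H \<bullet> a)"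
      using word_unit [of p "\<Pi>L H \<bullet> a"] by simp
    moreover have "incl product \<bullet> mul D p (u1 H D \<phi> \<bullet> a) = \<pi> \<bullet> pair p (\<Pi>L H \<bullet> a)"
    proof -
      have "incl product \<bullet> mul D p (u1 H D \<phi> \<bullet> a) = mul product (incl product \<bullet> p) (incl product \<bullet> u1 H D \<phi> \<bullet> a)"
        using incl_mul_word [of p "u1 H D \<phi> \<bullet> a" "one H"] by (simp add: incl_eq)
      also have "\<dots> = \<pi> \<bullet> pair p (\<Pi>L H \<bullet> a)"
        by (simp add: incl_unit incl_mul_word)
      finally show ?thesis .
    qed
    ultimately show ?thesis
      by (simp add: \<rho>_word r word_unit)
  qed
  show "\<pi> \<cdot> ((retraction \<otimes> \<H>) \<cdot> \<rho> product) = \<langle>S\<rangle>"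
    "\<pi> \<cdot> ((retraction \<otimes> \<Pi>L H) \<cdot> \<rho> product) = incl product \<cdot> retraction"
    by (rule word_ext1; simp add: *)+
qed

lemma product_coinvariants: "coinvariant_subalgebra H product D (incl product)"
proof -
  have mul: "incl product \<cdot> \<mu> D = \<mu> product \<cdot> (incl product \<otimes> incl product)"
  proof -
    have "F = G" if "F \<in> Ar C" "G \<in> Ar C" "source C F = obj D \<odot> obj D" "source C G = obj D \<odot> obj D"
      and "\<And>X e d p q. wha_stage C H X e d \<Longrightarrow> stage.el C X p \<Longrightarrow> typ_of p = obj D \<Longrightarrow> stage.el C X q \<Longrightarrow> typ_of q = obj D
        \<Longrightarrow> F \<bullet> stage.pair C X d p q = G \<bullet> stage.pair C X d p q" for F G
    proof -
      interpret stage C \<one> "\<langle>\<one>\<rangle>" "\<langle>\<one>\<rangle>" by (rule stage0)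
      have "F \<bullet> pair (linear (obj D)) (linear (obj D)) = G \<bullet> pair (linear (obj D)) (linear (obj D))"
        by (rule that(5) [OF wha_stageI [OF stage0]]) simp_all
      then have "F \<bullet> linear (obj D \<odot> obj D) = G \<bullet> linear (obj D \<odot> obj D)"
        by simp
      then show ?thesis
        using that(1-4) by (simp add: linear_def app_def)
    qed
    then show ?thesis
    proof (rule, goal_cases)
      case (5 X e d p q)
      then interpret wha_stage C H X e d by simp
      interpret crossed_product_stage C H D \<phi> \<sigma> \<sigma>' S j \<pi> X e d ..
      show ?case
        using 5 incl_mul_word [of p q "one H"] by (simp add: incl_eq)
    qed simp_all
  qed
  have one: "incl product \<cdot> \<eta> D = \<eta> product"
  proof (rule generic_ext0, goal_cases)
    case (5 X e d)
    then interpret wha_stage C H X e d by simp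
    interpret crossed_product_stage C H D \<phi> \<sigma> \<sigma>' S j \<pi> X e d ..
    show ?case by (simp add: one_incl)
  qed simp_all
  have coinv: "\<rho> product \<cdot> incl product = \<zeta> H product \<cdot> incl product"
  proof (rule generic_ext0_1 [where Y = "obj D"], goal_cases)
    case (6 X e d p)
    then interpret wha_stage C H X e d by simp
    interpret crossed_product_stage C H D \<phi> \<sigma> \<sigma>' S j \<pi> X e d ..
    show ?case using 6 incl_coinvariant [of p] by (simp add: \<zeta>_def)
  qed (simp_all add: \<zeta>_def)
  have lift: "\<exists>!l. l \<in> Hom C x (obj D) \<and> incl product \<cdot> l = k"
    if k: "k \<in> Hom C x S" "\<rho> product \<cdot> k = \<zeta> H product \<cdot> k" for x k
  proof -
    have [simp]: "k \<in> Ar C" "source C k = x" "target C k = S"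
      using k by (simp_all add: Hom_iff)
    have "k = (\<pi> \<cdot> ((retraction \<otimes> \<H>) \<cdot> \<rho> product)) \<cdot> k"
      unfolding retraction_words by simp
    also have "\<dots> = \<pi> \<cdot> ((retraction \<otimes> \<H>) \<cdot> (\<zeta> H product \<cdot> k))"
      using k(2) by simp
    also have "\<dots> = \<pi> \<cdot> (((retraction \<otimes> \<H>) \<cdot> (\<langle>S\<rangle> \<otimes> \<Pi>L H)) \<cdot> (\<rho> product \<cdot> k))"
      by (simp add: \<zeta>_def)
    also have "\<dots> = (\<pi> \<cdot> ((retraction \<otimes> \<Pi>L H) \<cdot> \<rho> product)) \<cdot> k"
      by (simp add: interchange)
    also have "\<dots> = incl product \<cdot> (retraction \<cdot> k)"
      unfolding retraction_words by simp
    finally have 1: "incl product \<cdot> (retraction \<cdot> k) = k" ..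
    have 2: "l = retraction \<cdot> k" if "l \<in> Hom C x (obj D)" "incl product \<cdot> l = k" for l
    proof -
      have [simp]: "l \<in> Ar C" "source C l = x" "target C l = obj D"
        using that by (simp_all add: Hom_iff)
      have "retraction \<cdot> k = (retraction \<cdot> incl product) \<cdot> l"
        unfolding that(2) [symmetric] by simp
      then show ?thesis
        unfolding retraction_incl by simp
    qed
    show ?thesis
      using 1 2 by (intro ex1I [of _ "retraction \<cdot> k"]) (simp_all add: Hom_iff)
  qed
  have "is_equalizer (\<rho> product) (\<zeta> H product) (obj D) (incl product)"
    unfolding is_equalizer_def
  proof (rule exI [of _ S], rule exI [of _ "S \<odot> obj H"], intro conjI coinv)
    show "\<forall>x. \<forall>k \<in> Hom C x S. \<rho> product \<cdot> k = \<zeta> H product \<cdot> k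
        \<longrightarrow> (\<exists>!l. l \<in> Hom C x (obj D) \<and> incl product \<cdot> l = k)"
      using lift by blast
  qed (simp_all add: Hom_iff \<zeta>_def)
  then show ?thesis
    using mul one unfolding coinvariant_subalgebra_def is_algebra_morphism_def by (simp add: Hom_iff)
qed

sublocale ext: extension C H D product
  by unfold_locales (rule product_comodule_algebra product_coinvariants)+

definition cleaving :: 'm
  where "cleaving = \<pi> \<cdot> (\<eta> D \<otimes> \<H>)"

text \<open>The arrow \<open>a \<mapsto> \<sigma>'(\<lambda> a, a) \<otimes> \<lambda> a\<close>.\<close>

definition cleaving_inverse :: 'm
  where "cleaving_inverse = \<pi> \<cdot> ((\<sigma>' \<otimes> antipode H) \<cdot> ((antipode H \<otimes> \<langle>obj H \<odot> obj H\<rangle>) \<cdot> ((\<delta> H \<otimes> \<H>) \<cdot> \<delta> H)))"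

lemma cleaving_simps [simp]:
  "cleaving \<in> Ar C" "source C cleaving = obj H" "target C cleaving = S"
  "cleaving_inverse \<in> Ar C" "source C cleaving_inverse = obj H" "target C cleaving_inverse = S"
  by (simp_all add: cleaving_def cleaving_inverse_def)

end

context crossed_product_stage
begin

sublocale ext: extension_stage C H D product X e d ..

lemma app_cleaving: "el a \<Longrightarrow> typ_of a = obj H \<Longrightarrow> cleaving \<bullet> a = \<pi> \<bullet> (one D \<boxtimes> a)"
  by (simp add: cleaving_def)

lemma app_cleaving_inverse: "gl a \<Longrightarrow> cleaving_inverse \<bullet> a = \<pi> \<bullet> (\<sigma>' \<bullet> (inv_H a \<boxtimes> a) \<boxtimes> inv_H a)"
  by (simp add: cleaving_inverse_def)

lemma u_product_map:
  assumes "gl a"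
  shows "u_map product \<bullet> a = incl product \<bullet> u a"
proof -
  let ?s = "\<epsilon> H \<cdot> \<mu> H"
  note [simp] = assms
  have 1: "(\<langle>S\<rangle> \<otimes> ?s) \<cdot> ((\<pi> \<otimes> \<H>) \<otimes> \<H>) = \<pi> \<cdot> (\<langle>obj D\<rangle> \<otimes> \<H> \<otimes> ?s)"
    using interchange [of "\<langle>obj D \<odot> obj H\<rangle>" \<pi> ?s "\<langle>\<one>\<rangle>"] interchange [of \<pi> "\<langle>S\<rangle>" "\<langle>obj H \<odot> obj H\<rangle>" ?s] by (simp add: ident_merge)
  have 2: "((\<pi> \<otimes> \<H>) \<otimes> \<H>) \<bullet> ((one D \<boxtimes> \<delta> H \<bullet> one H) \<boxtimes> a) = ((\<pi> \<otimes> \<H>) \<bullet> (one D \<boxtimes> \<delta> H \<bullet> one H)) \<boxtimes> a"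
    by (subst app_pair) simp_all
  have 3: "(\<H> \<otimes> ?s) \<bullet> (\<delta> H \<bullet> one H \<boxtimes> a) = \<Pi>L H \<bullet> a"
    by (simp add: \<Pi>L_eq \<pi>l_alt)
  have \<rho>: "\<rho> product \<bullet> one product = (\<pi> \<otimes> \<H>) \<bullet> (one D \<boxtimes> \<delta> H \<bullet> one H)"
    unfolding one_incl by (rule \<rho>_incl) simp_all
  have "u_map product \<bullet> a = (\<langle>S\<rangle> \<otimes> ?s) \<bullet> (((\<pi> \<otimes> \<H>) \<bullet> (one D \<boxtimes> \<delta> H \<bullet> one H)) \<boxtimes> a)"
    using app_u [OF product_comodule_algebra gl_simps(1) [OF assms] gl_simps(3) [OF assms]] unfolding \<rho> product_obj .
  also have "\<dots> = ((\<langle>S\<rangle> \<otimes> ?s) \<cdot> ((\<pi> \<otimes> \<H>) \<otimes> \<H>)) \<bullet> ((one D \<boxtimes> \<delta> H \<bullet> one H) \<boxtimes> a)"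
    unfolding 2 [symmetric] by (rule app_app [symmetric]) simp_all
  also have "\<dots> = \<pi> \<bullet> (\<langle>obj D\<rangle> \<otimes> \<H> \<otimes> ?s) \<bullet> (one D \<boxtimes> \<delta> H \<bullet> one H \<boxtimes> a)"
    unfolding 1 by simp
  also have "(\<langle>obj D\<rangle> \<otimes> \<H> \<otimes> ?s) \<bullet> (one D \<boxtimes> \<delta> H \<bullet> one H \<boxtimes> a) = one D \<boxtimes> (\<H> \<otimes> ?s) \<bullet> (\<delta> H \<bullet> one H \<boxtimes> a)"
    by (subst app_pair) simp_all
  finally show ?thesis
    unfolding 3 by (simp add: incl_unit)
qed

lemma cleaving_mul:
  assumes "gl a"
  shows "cleaving \<bullet> a \<star>\<^bsub>product\<^esub> cleaving_inverse \<bullet> a = incl product \<bullet> u a"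
    and "cleaving_inverse \<bullet> a \<star>\<^bsub>product\<^esub> cleaving \<bullet> a = incl product \<bullet> u (\<Pi>R H \<bullet> a)"
    and "incl product \<bullet> u (\<Pi>R H \<bullet> a) \<star>\<^bsub>product\<^esub> cleaving_inverse \<bullet> a = cleaving_inverse \<bullet> a"
proof -
  note [simp] = assms
  have inv: "u (inv_H a) = u (\<Pi>R H \<bullet> a)"
    using unit_\<Pi>L [of "inv_H a"] by simp
  let ?s = "\<sigma>' \<bullet> (inv_H a \<boxtimes> a)"
  have "cleaving \<bullet> a \<star>\<^bsub>product\<^esub> cleaving_inverse \<bullet> a = \<pi> \<bullet> (u a \<boxtimes> \<Pi>L H \<bullet> a)"
    by (simp add: app_cleaving app_cleaving_inverse word_mul act_cocycle_inverse)
  also have "\<dots> = incl product \<bullet> u a"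
    using word_unit [of "one D" "\<Pi>L H \<bullet> a"] by (simp add: incl_unit)
  finally show "cleaving \<bullet> a \<star>\<^bsub>product\<^esub> cleaving_inverse \<bullet> a = incl product \<bullet> u a" .
  have "cleaving_inverse \<bullet> a \<star>\<^bsub>product\<^esub> cleaving \<bullet> a = \<pi> \<bullet> (u (\<Pi>R H \<bullet> a) \<boxtimes> \<Pi>R H \<bullet> a)"
    unfolding inv [symmetric]
    by (simp add: app_cleaving app_cleaving_inverse word_mul cocycle_inverse)
  also have "\<dots> = incl product \<bullet> u (\<Pi>R H \<bullet> a)"
    using word_unit [of "one D" "\<Pi>R H \<bullet> a"] by (simp add: incl_unit)
  finally show "cleaving_inverse \<bullet> a \<star>\<^bsub>product\<^esub> cleaving \<bullet> a = incl product \<bullet> u (\<Pi>R H \<bullet> a)" .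
  show "incl product \<bullet> u (\<Pi>R H \<bullet> a) \<star>\<^bsub>product\<^esub> cleaving_inverse \<bullet> a = cleaving_inverse \<bullet> a"
    unfolding inv [symmetric] by (simp add: app_cleaving_inverse incl_mul_word)
qed

lemma cleaving_mul_tail:
  assumes "gl a" "el p" "typ_of p = obj D"
  shows "\<pi> \<bullet> (p \<boxtimes> a) \<star>\<^bsub>product\<^esub> cleaving_inverse \<bullet> a = incl product \<bullet> (p \<star>\<^bsub>D\<^esub> u a)"
proof -
  note [simp] = assms
  have "\<pi> \<bullet> (p \<boxtimes> a) = incl product \<bullet> p \<star>\<^bsub>product\<^esub> cleaving \<bullet> a"
    by (simp add: app_cleaving incl_mul_word)
  then have "\<pi> \<bullet> (p \<boxtimes> a) \<star>\<^bsub>product\<^esub> cleaving_inverse \<bullet> a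
      = incl product \<bullet> p \<star>\<^bsub>product\<^esub> (cleaving \<bullet> a \<star>\<^bsub>product\<^esub> cleaving_inverse \<bullet> a)"
    by (simp only:) (rule mul_assoc, simp_all)
  then show ?thesis
    by (simp add: cleaving_mul)
qed

end

context crossed_product
begin

theorem product_presentation: "presentation C H D product cleaving cleaving_inverse \<phi> \<sigma>"
proof -
  have *: "(\<rho> product \<cdot> cleaving) \<bullet> a = ((cleaving \<otimes> \<H>) \<cdot> \<delta> H) \<bullet> a
      \<and> conv (\<delta> H) product cleaving_inverse cleaving \<bullet> a = e_map H product \<bullet> a
      \<and> conv (\<delta> H) product cleaving cleaving_inverse \<bullet> a = u_map product \<bullet> a
      \<and> conv (\<delta> H) product (e_map H product) cleaving_inverse \<bullet> a = cleaving_inverse \<bullet> a"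
    if "wha_stage C H X e d" "stage.grouplike C X d (obj H) (\<delta> H) a" for X e d a
  proof -
    interpret wha_stage C H X e d by fact
    interpret crossed_product_stage C H D \<phi> \<sigma> \<sigma>' S j \<pi> X e d ..
    note [simp] = that
    have "\<rho> product \<bullet> cleaving \<bullet> a = pair (cleaving \<bullet> a) a"
      by (simp add: app_cleaving \<rho>_word)
    then show ?thesis
      by (simp add: e_eq_u u_product_map cleaving_mul)
  qed
  have "\<rho> product \<cdot> cleaving = (cleaving \<otimes> \<H>) \<cdot> \<delta> H" "conv (\<delta> H) product cleaving_inverse cleaving = e_map H product"
    "conv (\<delta> H) product cleaving cleaving_inverse = u_map product"
    "conv (\<delta> H) product (e_map H product) cleaving_inverse = cleaving_inverse"
    by (rule generic_ext1'; simp add: * conv_simps)+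
  moreover have "cleaving \<cdot> \<eta> H = \<eta> product"
  proof (rule generic_ext0, goal_cases)
    case (5 X e d)
    then interpret wha_stage C H X e d by simp
    interpret crossed_product_stage C H D \<phi> \<sigma> \<sigma>' S j \<pi> X e d ..
    show ?case by (simp add: app_cleaving one_eq)
  qed simp_all
  moreover have "incl product \<cdot> \<phi> = act D product cleaving cleaving_inverse"
  proof (rule generic_ext1 [where Y = "obj D"], goal_cases)
    case (6 X e d a p)
    then interpret wha_stage C H X e d by simp
    interpret crossed_product_stage C H D \<phi> \<sigma> \<sigma>' S j \<pi> X e d ..
    note [simp] = 6
    have "mul product (mul product (cleaving \<bullet> a) (incl product \<bullet> p)) (cleaving_inverse \<bullet> a) = incl product \<bullet> \<phi> \<bullet> pair a p"
      by (simp add: app_cleaving word_mul_incl cleaving_mul_tail del: mul_assoc ext.incl_mul)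
    then show ?case by (simp add: act_def)
  qed (simp_all add: act_def)
  moreover have "incl product \<cdot> \<sigma> = cocycle product cleaving cleaving_inverse"
  proof (rule generic_ext2', goal_cases)
    case (5 X e d a b)
    then interpret wha_stage C H X e d by simp
    interpret crossed_product_stage C H D \<phi> \<sigma> \<sigma>' S j \<pi> X e d ..
    note [simp] = 5
    have "mul D (\<sigma> \<bullet> pair a b) (scale (mul H a b) (u1 H D \<phi> \<bullet> a)) = \<sigma> \<bullet> pair a b"
      by simp
    then have "mul product (mul product (cleaving \<bullet> a) (cleaving \<bullet> b)) (cleaving_inverse \<bullet> mul H a b) = incl product \<bullet> \<sigma> \<bullet> pair a b"
      by (simp add: app_cleaving word_mul cleaving_mul_tail del: mul_assoc ext.incl_mul mul_scale)
    then show ?case by (simp add: cocycle_def)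
  qed (simp_all add: cocycle_def conv_def)
  ultimately show ?thesis
    by unfold_locales
      (simp_all add: is_integral_def is_comodule_morphism_def is_convolution_inverse_def u_map_def Hom_iff)
qed

end

section \<open>The bijective correspondence\<close>

context crossed
begin

lemma nabla_idempotent: "nabla \<cdot> nabla = nabla"
proof (rule generic_ext_right [where Y = "obj D"], goal_cases)
  case (6 X e d p a)
  then interpret wha_stage C H X e d by simp
  interpret crossed_stage C H D \<phi> \<sigma> \<sigma>' X e d ..
  show ?case using 6 by simp
qed simp_all

text \<open>The equalizer of an idempotent and the identity splits the idempotent.\<close>

lemma exists_crossed_product:
  assumes "strict_symmetric_monoidal_category_with_equalizers C"
  shows "\<exists>S j \<pi>. crossed_product C H D \<phi> \<sigma> \<sigma>' S j \<pi>"
proof -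
  interpret E: strict_symmetric_monoidal_category_with_equalizers C by fact
  let ?T = "obj D \<odot> obj H"
  have "\<exists>S j. is_equalizer nabla \<langle>?T\<rangle> S j"
    by (rule E.has_equalizers [of _ ?T ?T]) (simp_all add: Hom_iff)
  then obtain S j a b where eq: "nabla \<in> Hom C a b" "j \<in> Hom C S a" "nabla \<cdot> j = \<langle>?T\<rangle> \<cdot> j"
      "\<forall>x. \<forall>k \<in> Hom C x a. nabla \<cdot> k = \<langle>?T\<rangle> \<cdot> k \<longrightarrow> (\<exists>!l. l \<in> Hom C x S \<and> j \<cdot> l = k)"
    unfolding is_equalizer_def by blast
  have [simp]: "a = ?T" "j \<in> Ar C" "source C j = S" "target C j = ?T"
    using eq(1,2) by (auto simp: Hom_iff)
  have S [simp]: "S \<in> Ob C"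
    using source_closed [of j] by simp
  have "\<exists>!l. l \<in> Hom C ?T S \<and> j \<cdot> l = nabla"
    using eq(4) nabla_idempotent by (simp add: Hom_iff)
  then obtain \<pi> where \<pi>: "\<pi> \<in> Hom C ?T S" "j \<cdot> \<pi> = nabla"
    by blast
  have [simp]: "\<pi> \<in> Ar C" "source C \<pi> = ?T" "target C \<pi> = S"
    using \<pi> by (simp_all add: Hom_iff)
  have nj: "nabla \<cdot> j = j"
    using eq(3) by simp
  then have "\<exists>!l. l \<in> Hom C S S \<and> j \<cdot> l = j"
    using eq(4) by (simp add: Hom_iff)
  moreover have "j \<cdot> (\<pi> \<cdot> j) = j"
    using compose_tail [OF \<pi>(2), of j] nj by simp
  moreover have "\<pi> \<cdot> j \<in> Hom C S S" "\<langle>S\<rangle> \<in> Hom C S S" "j \<cdot> \<langle>S\<rangle> = j"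
    by (simp_all add: Hom_iff)
  ultimately have "\<pi> \<cdot> j = \<langle>S\<rangle>"
    by blast
  then have "crossed_product C H D \<phi> \<sigma> \<sigma>' S j \<pi>"
    using \<pi> eq(2) by unfold_locales simp_all
  then show ?thesis by blast
qed

end

context cocommutative_wha
begin

text \<open>The relation that induces the correspondence of equivalence classes.\<close>

definition presented_by :: "('o, 'm) algebra \<Rightarrow> ('o, 'm) algebra_extension \<Rightarrow> 'm \<times> 'm \<Rightarrow> bool"
  where "presented_by D B s \<longleftrightarrow> (\<exists>f f'. presentation C H D B f f' (fst s) (snd s))"

lemma cleft_extension_presented:
  assumes "B \<in> cleft_extensions H D"
  shows "\<exists>s. presented_by D B s"
proof -
  obtain f f' where "right_comodule_algebra H B" "coinvariant_subalgebra H B D (incl B)"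
      "is_integral H B f" "is_convolution_inverse H B f f'"
    using assms by (auto simp: cleft_extensions_def cleft_extension_def)
  then interpret cleft C H D B f f'
    by unfold_locales
  obtain g g' where g: "normal_cleft C H D B g g'"
    using exists_normal by blast
  then obtain \<phi> \<sigma> where "presentation C H D B g g' \<phi> \<sigma>"
    using normal_cleft.exists_presentation [OF g] by blast
  then have "presented_by D B (\<phi>, \<sigma>)"
    by (auto simp: presented_by_def)
  then show ?thesis ..
qed

lemma presented_by_members:
  assumes "presented_by D B s"
  shows "B \<in> cleft_extensions H D" "s \<in> crossed_systems H D"
proof -
  obtain f f' where "presentation C H D B f f' (fst s) (snd s)"
    using assms by (auto simp: presented_by_def)
  then interpret presentation C H D B f f' "fst s" "snd s" .
  have "conv (\<delta> H) B f f' = u_map B"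
    using inverse by (simp add: is_convolution_inverse_def u_map_def)
  then have "\<exists>g \<in> Hom C (obj H) (obj D). conv (\<delta> H) B f f' = incl B \<cdot> g"
    using incl_u1 by (intro bexI [of _ "u1 H D (fst s)"]) (simp_all add: Hom_iff)
  then show "B \<in> cleft_extensions H D"
    using comodule_algebra coinvariants integral inverse unfolding cleft_extensions_def cleft_extension_def by blast
  show "s \<in> crossed_systems H D"
    using crossed_system by (simp add: crossed_systems_def split_beta)
qed

lemma crossed_system_presents:
  assumes "strict_symmetric_monoidal_category_with_equalizers C" "s \<in> crossed_systems H D"
  shows "\<exists>B. presented_by D B s"
proof -
  have s: "crossed_system H D (fst s) (snd s)"
    using assms(2) by (simp add: crossed_systems_def split_beta)
  then obtain \<sigma>' where "is_regular_inverse (obj H \<odot> obj H) (\<delta>2 H) D (u2 H D (fst s)) (snd s) \<sigma>'"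
    by (auto simp: crossed_system_def Reg2_def)
  with s interpret crossed C H D "fst s" "snd s" \<sigma>'
    by unfold_locales
  obtain S j \<pi> where "crossed_product C H D (fst s) (snd s) \<sigma>' S j \<pi>"
    using exists_crossed_product [OF assms(1)] by blast
  then interpret crossed_product C H D "fst s" "snd s" \<sigma>' S j \<pi> .
  show ?thesis
    using product_presentation by (auto simp: presented_by_def)
qed

lemma presented_by_equivalence:
  assumes "presented_by D B s"
  shows "presented_by D B' s \<Longrightarrow> (B, B') \<in> cleft_equivalence H D"
    and "(B, B') \<in> cleft_equivalence H D \<Longrightarrow> presented_by D B' s"
    and "presented_by D B s' \<Longrightarrow> (s, s') \<in> crossed_equivalence H D"
    and "(s', s) \<in> crossed_equivalence H D \<Longrightarrow> presented_by D B s'"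
proof -
  obtain f f' where P: "presentation C H D B f f' (fst s) (snd s)"
    using assms by (auto simp: presented_by_def)
  show "(B, B') \<in> cleft_equivalence H D" if B': "presented_by D B' s"
  proof -
    obtain g g' where "presentation C H D B' g g' (fst s) (snd s)"
      using B' by (auto simp: presented_by_def)
    then have two: "two_presentations C H D B f f' B' g g' (fst s) (snd s)"
      using P by (intro two_presentations.intro cocommutative_wha_axioms)
    then show ?thesis
      using two_presentations.exists_equivalence [OF two] presented_by_members(1) [OF assms] presented_by_members(1) [OF B']
      unfolding cleft_equivalence_def by blast
  qed
  show "presented_by D B' s" if eq: "(B, B') \<in> cleft_equivalence H D"
  proof -
    interpret P: presentation C H D B f f' "fst s" "snd s" by (rule P)
    obtain T where T: "is_algebra_morphism B B' T" "is_comodule_morphism H (obj B) (\<rho> B) (obj B') (\<rho> B') T"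
        "T \<cdot> incl B = incl B'" and B': "right_comodule_algebra H B'" "coinvariant_subalgebra H B' D (incl B')"
      using eq by (auto simp: cleft_equivalence_def cleft_extensions_def cleft_extension_def)
    interpret extension_morphism C H D B B' T
      using T B' by unfold_locales
    show ?thesis
      using transport_presentation [OF P] by (auto simp: presented_by_def)
  qed
  show "(s, s') \<in> crossed_equivalence H D" if s': "presented_by D B s'"
  proof -
    obtain g g' where "presentation C H D B g g' (fst s') (snd s')"
      using s' by (auto simp: presented_by_def)
    then have two: "two_cleavings C H D B f f' g g' (fst s) (snd s) (fst s') (snd s')"
      using P by (intro two_cleavings.intro cocommutative_wha_axioms)
    then show ?thesis
      using two_cleavings.equivalent_systems [OF two] by simp
  qed
  show "presented_by D B s'" if "(s', s) \<in> crossed_equivalence H D"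
    using transport_along_equivalence [OF P, of "fst s'" "snd s'"] that by (simp add: presented_by_def)
qed

end

text \<open>The bijection sends a class \<open>K\<close> to the set of all \<open>y\<close> that are related to a
  member of \<open>K\<close>. By assumption the class of \<open>x\<close> consists of all \<open>z\<close>
  with \<open>R z y\<close>, for any \<open>y\<close> that is related to \<open>x\<close>.\<close>

lemma quotient_correspondence:
  assumes total: "\<And>x. x \<in> X \<Longrightarrow> \<exists>y. R x y" "\<And>y. y \<in> Y \<Longrightarrow> \<exists>x. R x y"
    and dom: "\<And>x y. R x y \<Longrightarrow> x \<in> X \<and> y \<in> Y"
    and r: "\<And>x x' y. R x y \<Longrightarrow> (x, x') \<in> r \<longleftrightarrow> R x' y"
    and q: "\<And>x y y'. R x y \<Longrightarrow> (y, y') \<in> q \<Longrightarrow> (y', y) \<in> q"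
      "\<And>x y y'. R x y \<Longrightarrow> R x y' \<Longrightarrow> (y, y') \<in> q"
      "\<And>x y y'. R x y \<Longrightarrow> (y', y) \<in> q \<Longrightarrow> R x y'"
  shows "\<exists>\<Phi>. bij_betw \<Phi> (X // r) (Y // q)"
proof
  let ?\<Phi> = "\<lambda>K. {y. \<exists>x \<in> K. R x y}"
  have cls: "r `` {x} = {z. R z y}" if "R x y" for x y
    using r [OF that] by blast
  have img: "?\<Phi> (r `` {x}) = q `` {y}" if xy: "R x y" for x y
  proof (intro set_eqI iffI)
    fix y' assume "y' \<in> ?\<Phi> (r `` {x})"
    then obtain x' where "R x' y" "R x' y'"
      unfolding cls [OF xy] by blast
    then show "y' \<in> q `` {y}"
      using q(2) by blast
  next
    fix y' assume "y' \<in> q `` {y}"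
    then have "R x y'"
      using q(1,3) xy by blast
    then show "y' \<in> ?\<Phi> (r `` {x})"
      unfolding cls [OF xy] using xy by blast
  qed
  show "bij_betw ?\<Phi> (X // r) (Y // q)"
    unfolding bij_betw_def
  proof
    show "inj_on ?\<Phi> (X // r)"
    proof (rule inj_onI)
      fix K K' assume "K \<in> X // r" "K' \<in> X // r" and eq: "?\<Phi> K = ?\<Phi> K'"
      then obtain x x' where K: "K = r `` {x}" "K' = r `` {x'}" "x \<in> X" "x' \<in> X"
        by (auto elim!: quotientE)
      obtain y y' where xy: "R x y" "R x' y'"
        using K total by blast
      have "q `` {y} = q `` {y'}"
        using eq unfolding K img [OF xy(1)] img [OF xy(2)] .
      then have "(y, y') \<in> q"
        using q(2) [OF xy(2) xy(2)] by blast
      then have "R x' y"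
        using q(3) xy(2) by blast
      then show "K = K'"
        unfolding K using cls xy(1) by blast
    qed
    show "?\<Phi> ` (X // r) = Y // q"
    proof (intro set_eqI iffI)
      fix L assume "L \<in> ?\<Phi> ` (X // r)"
      then obtain x where x: "x \<in> X" "L = ?\<Phi> (r `` {x})"
        by (auto elim!: quotientE)
      then obtain y where xy: "R x y"
        using total by blast
      show "L \<in> Y // q"
        unfolding x(2) img [OF xy] using dom [OF xy] by (auto intro: quotientI)
    next
      fix L assume "L \<in> Y // q"
      then obtain y where y: "y \<in> Y" "L = q `` {y}"
        by (auto elim!: quotientE)
      then obtain x where xy: "R x y"
        using total by blast
      have "r `` {x} \<in> X // r"
        using dom [OF xy] by (auto intro: quotientI)
      moreover have "L = ?\<Phi> (r `` {x})"
        unfolding y(2) img [OF xy] ..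
      ultimately show "L \<in> ?\<Phi> ` (X // r)" by blast
    qed
  qed
qed

theorem theorem3p22:
  fixes C :: "('o, 'm) monoidal_data"
    and H :: "('o, 'm) weak_hopf"
    and A :: "('o, 'm) comodule_algebra"
    and AH :: "('o, 'm) algebra"
    and iA :: 'm
  assumes "strict_symmetric_monoidal_category_with_equalizers C"
    and "strict_symmetric_monoidal_category.weak_hopf_algebra C H"
    and "strict_symmetric_monoidal_category.cocommutative C H"
    and "strict_symmetric_monoidal_category.right_comodule_algebra C H A"
    and "strict_symmetric_monoidal_category.coinvariant_subalgebra C H A AH iA"
  shows "\<exists>\<Phi>. bij_betw \<Phi>
    (strict_symmetric_monoidal_category.cleft_extensions C H AH //
      strict_symmetric_monoidal_category.cleft_equivalence C H AH)
    (strict_symmetric_monoidal_category.crossed_systems C H AH //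
      strict_symmetric_monoidal_category.crossed_equivalence C H AH)"
proof -
  interpret strict_symmetric_monoidal_category_with_equalizers C by fact
  interpret cocommutative_wha C H
    using assms(2,3) by unfold_locales
  show ?thesis
  proof (rule quotient_correspondence [where R = "presented_by AH"], goal_cases)
    case (1 B)
    then show ?case by (rule cleft_extension_presented)
  next
    case (2 s)
    then show ?case by (rule crossed_system_presents [OF assms(1)])
  next
    case (3 B s)
    then show ?case using presented_by_members [OF 3] by simp
  next
    case (4 B B' s)
    then show ?case using presented_by_equivalence(1,2) [OF 4] by blast
  next
    case (5 B s s')
    then have "s' \<in> crossed_systems H AH"
      by (auto simp: crossed_equivalence_def)
    then obtain B' where B': "presented_by AH B' s'"
      using crossed_system_presents [OF assms(1)] by blast
    then have "presented_by AH B' s"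
      using 5(2) by (rule presented_by_equivalence(4))
    then show ?case
      by (rule presented_by_equivalence(3) [OF B'])
  next
    case (6 B s s')
    then show ?case by (rule presented_by_equivalence(3))
  next
    case (7 B s s')
    then show ?case by (rule presented_by_equivalence(4))
  qed
qed

end
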